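(* Let $p,r\in(0,1)$ and let $\mathcal S,\mathcal T\in\mathrm{TDC}\cap\mathrm{OSC}^{\mathrm E}_1(p,r)$. If $\mathbb Z[p]$ is a principal ideal domain, then $E_{\mathcal S}$ and $E_{\mathcal T}$ are Lipschitz equivalent.
   Context: Two metric spaces are Lipschitz equivalent if there is a bijection $f$ between them and $L\ge 1$ with $L^{-1}d_1(x,y)\le d_2(f(x),f(y))\le L\,d_1(x,y)$ for all $x,y$. An IFS is a finite family $\mathcal S=\{S_1,\dots,S_N\}$, $N\ge2$, of contracting similarities of a Euclidean space $\mathbb R^d$ ($d$ may depend on the IFS), where $S_i$ has ratio $r_i\in(0,1)$, i.e. $|S_i(x)-S_i(y)|=r_i|x-y|$. $E_{\mathcal S}$ is the unique nonempty compact set with $E_{\mathcal S}=\bigcup_i S_i(E_{\mathcal S})$. $\mathcal S$ satisfies the open set condition (OSC) if there is a nonempty bounded open set $O$ such that the sets $S_i(O)$ are pairwise disjoint and contained in $O$. The ratios are commensurable if there is $r_{\mathcal S}\in(0,1)$ (the ratio root) with $r_i=r_{\mathcal S}^{\lambda_i}$ for positive integers $\lambda_i$ with $\gcd(\lambda_1,\dots,\lambda_N)=1$. $\mathrm{TDC}\cap\mathrm{OSC}^{\mathrm E}_1$ denotes the set of IFSs on Euclidean spaces that satisfy the OSC, have commensurable ratios, and whose $E_{\mathcal S}$ is totally disconnected. For such $\mathcal S$, with $s=\dim_H E_{\mathcal S}$ (equivalently $\sum_i r_i^s=1$), the measure root is $p_{\mathcal S}=r_{\mathcal S}^s$. $\mathrm{TDC}\cap\mathrm{OSC}^{\mathrm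 E}_1(p,r)$ is the set of $\mathcal S\in\mathrm{TDC}\cap\mathrm{OSC}^{\mathrm E}_1$ with $p_{\mathcal S}=p$ and $r_{\mathcal S}=r$. $\mathbb Z[p]\subset\mathbb R$ is the ring generated by $p$ over $\mathbb Z$. *)

theory Defs
  imports
    "HOL-Analysis.Analysis"
    "HOL-Algebra.Generated_Rings"
    "HOL-Algebra.Ring_Divisibility"
    "HOL-Algebra.Algebraic_Closure_Type"
begin

definition lipschitz_equivalent :: "'a::metric_space set \<Rightarrow> 'b::metric_space set \<Rightarrow> bool" where
  "lipschitz_equivalent A B \<longleftrightarrow>
     (\<exists>f L. 1 \<le> L \<and> bij_betw f A B \<and>
        (\<forall>x\<in>A. \<forall>y\<in>A. inverse L * dist x y \<le> dist (f x) (f y) \<and>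
                        dist (f x) (f y) \<le> L * dist x y))"

definition totally_disconnected :: "'a::topological_space set \<Rightarrow> bool" where
  "totally_disconnected A \<longleftrightarrow> (\<forall>C. C \<subseteq> A \<and> connected C \<longrightarrow> (\<exists>a. C \<subseteq> {a}))"

text \<open>The members of a covering must be bounded because the library's \<open>diameter\<close> is
  unspecified on unbounded sets.  Empty members contribute \<open>0\<close>, so finite coverings
  are included.\<close>

definition hausdorff_premeasure :: "real \<Rightarrow> real \<Rightarrow> 'a::metric_space set \<Rightarrow> ennreal" where
  "hausdorff_premeasure s \<delta> A =
     (INF U \<in> {U :: nat \<Rightarrow> 'a set. A \<subseteq> (\<Union>n. U n) \<and> (\<forall>n. bounded (U n) \<and> diameter (U n) \<le> \<delta>)}.
        (\<Sum>n. ennreal (diameter (U n) powr s)))"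

definition hausdorff_measure :: "real \<Rightarrow> 'a::metric_space set \<Rightarrow> ennreal" where
  "hausdorff_measure s A = (SUP \<delta> \<in> {0<..}. hausdorff_premeasure s \<delta> A)"

text \<open>Exponent \<open>0\<close> is left out, since \<open>0 powr 0 = 0\<close> would give the wrong
  \<open>0\<close>-dimensional measure; this does not affect the infimum.  In a Euclidean space the set
  below is nonempty, as it contains every \<open>s > DIM('a)\<close>.\<close>

definition hausdorff_dim :: "'a::euclidean_space set \<Rightarrow> real" where
  "hausdorff_dim A = Inf {s. 0 < s \<and> hausdorff_measure s A = 0}"

definition similarity_with_ratio :: "real \<Rightarrow> ('a::metric_space \<Rightarrow> 'a) \<Rightarrow> bool" where
  "similarity_with_ratio c f \<longleftrightarrow> (\<forall>x y. dist (f x) (f y) = c * dist x y)"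

text \<open>The family \<open>S\<^sub>1, \<dots>, S\<^sub>N\<close> is the list \<open>S\<close>, indexed from \<open>0\<close>.\<close>

definition is_ifs :: "('a::euclidean_space \<Rightarrow> 'a) list \<Rightarrow> bool" where
  "is_ifs S \<longleftrightarrow> 2 \<le> length S \<and>
     (\<forall>i<length S. \<exists>c. 0 < c \<and> c < 1 \<and> similarity_with_ratio c (S ! i))"

definition attractor :: "('a::euclidean_space \<Rightarrow> 'a) list \<Rightarrow> 'a set" where
  "attractor S = (THE E. E \<noteq> {} \<and> compact E \<and> E = (\<Union>i<length S. (S ! i) ` E))"

definition open_set_condition :: "('a::euclidean_space \<Rightarrow> 'a) list \<Rightarrow> bool" where
  "open_set_condition S \<longleftrightarrow>
     (\<exists>V. V \<noteq> {} \<and> bounded V \<and> open V \<and>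
        (\<forall>i<length S. (S ! i) ` V \<subseteq> V) \<and>
        (\<forall>i<length S. \<forall>j<length S. i \<noteq> j \<longrightarrow> (S ! i) ` V \<inter> (S ! j) ` V = {}))"

definition is_ratio_root :: "('a::euclidean_space \<Rightarrow> 'a) list \<Rightarrow> real \<Rightarrow> bool" where
  "is_ratio_root S r \<longleftrightarrow> 0 < r \<and> r < 1 \<and>
     (\<exists>l :: nat \<Rightarrow> nat. (\<forall>i<length S. 0 < l i \<and> similarity_with_ratio (r ^ l i) (S ! i)) \<and>
        Gcd (l ` {..<length S}) = 1)"

definition commensurable_ratios :: "('a::euclidean_space \<Rightarrow> 'a) list \<Rightarrow> bool" where
  "commensurable_ratios S \<longleftrightarrow> (\<exists>r. is_ratio_root S r)"

definition ratio_root :: "('a::euclidean_space \<Rightarrow> 'a) list \<Rightarrow> real" where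
  "ratio_root S = (THE r. is_ratio_root S r)"

definition measure_root :: "('a::euclidean_space \<Rightarrow> 'a) list \<Rightarrow> real" where
  "measure_root S = ratio_root S powr hausdorff_dim (attractor S)"

definition TDC_OSC1 :: "('a::euclidean_space \<Rightarrow> 'a) list set" where
  "TDC_OSC1 = {S. is_ifs S \<and> open_set_condition S \<and> commensurable_ratios S \<and>
                  totally_disconnected (attractor S)}"

definition TDC_OSC1_roots :: "real \<Rightarrow> real \<Rightarrow> ('a::euclidean_space \<Rightarrow> 'a) list set" where
  "TDC_OSC1_roots p r = {S \<in> TDC_OSC1. measure_root S = p \<and> ratio_root S = r}"

definition Z_adjoin :: "real \<Rightarrow> real ring" where
  "Z_adjoin p = ring_of_type_algebra \<lparr> carrier := generate_ring ring_of_type_algebra {p} \<rparr>"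

end

theory Submission
  imports Defs "HOL-Library.Sublist"
begin

text \<open>
  Total disconnectedness makes the attractor \<open>E\<close> uniformly disconnected at the scales \<open>r\<^sup>k\<close>, so \<open>E\<close> is a tree of
  clopen pieces with diameters and gaps comparable to \<open>r\<^sup>k\<close>. By the open set condition the self-similar
  measure takes only finitely many values on them after division by \<open>p\<^sup>k\<close>, all in \<open>\<int>[p]\<close>. Certain clopen sets
  keep their measure up to a power of \<open>p\<close> under all words of the system; these measures are the positive
  part of an ideal, up to powers of \<open>p\<close>. A generator of this ideal is the measure of such a set \<open>G\<close>, and
  by the renewal theorem for the word lengths \<open>G\<close> has clopen subsets of every relative measure in \<open>\<int>[p] \<inter> (0,1)\<close>.
  The self-similar measure is then replaced by an additive weight on the tree with prescribed total in \<open>\<int>[p]\<close>,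
  which is proportional to the self-similar measure on a copy of \<open>G\<close> inside each piece, so that subsets of any
  admissible weight can be carved out at bounded depth. Two trees with equal total are matched piece by piece:
  a union of pieces is split into parts of the same weights as the pieces of the other side, parts are grouped into
  clusters of bounded size with equal weights on both sides, and the limit of the matchings is bi-Lipschitz.
\<close>

subsection \<open>Gluing matched pieces\<close>

text \<open>Under the open set condition distinct cylinders may meet, so a cylinder need not be
  clopen. Only sets whose copies keep a proportional distance from all incomparable cylinders
  (\<open>insul\<close>) can be moved by words with control of gap and measure; every exact
  subdivision is made of them. Their measures generate an ideal that depends on the attractor.
  Division by the measure of \<open>G\<close> brings them into Z[p] and gives \<open>G\<close> mass
  1, but the whole attractor then has mass \<open>1 / mu G\<close>, which differs between attractors
  and may lie outside Z[p]. So the self-similar measures of two attractors cannot be matched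
  directly, and the weights are rounded values of \<open>kap\<close> times the measure instead. A
  reserved region can only absorb a positive error that is small against its own size. Positivity
  forces \<open>kap\<close> to be large, smallness forces \<open>ee\<close> to be large in terms of
  \<open>kap\<close>, rounding forces \<open>eps\<close> to be small, and the reserved regions are
  unions of pieces of the next level only if \<open>m\<close> is large. Each bound depends on the
  attractor, so the choices must be made for both attractors together, in this order. Since the
  powers \<open>p ^ l i\<close> add up to 1, \<open>p\<close> is a unit of Z[p]; powers of
  \<open>p\<close> are harmless throughout.\<close>

lemma gluing:
  fixes M :: "nat \<Rightarrow> 'a::heine_borel set \<Rightarrow> 'b::heine_borel set \<Rightarrow> bool"
  assumes rho: "0 < rho" "rho < 1" and C: "1 \<le> C"
    and cptU: "\<And>t U V. M t U V \<Longrightarrow> compact U \<and> U \<noteq> {}"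
    and cptV: "\<And>t U V. M t U V \<Longrightarrow> compact V \<and> V \<noteq> {}"
    and diamU: "\<And>t U V x y. M t U V \<Longrightarrow> x \<in> U \<Longrightarrow> y \<in> U \<Longrightarrow> dist x y \<le> C * rho ^ t"
    and diamV: "\<And>t U V x y. M t U V \<Longrightarrow> x \<in> V \<Longrightarrow> y \<in> V \<Longrightarrow> dist x y \<le> C * rho ^ t"
    and step: "\<And>t U V. M t U V \<Longrightarrow>
        \<exists>S. (\<forall>s\<in>S. M (fst s) (fst (snd s)) (snd (snd s)) \<and> t < fst s) \<and>
            (\<Union>s\<in>S. fst (snd s)) = U \<and> (\<Union>s\<in>S. snd (snd s)) = V \<and>
            (\<forall>s\<in>S. \<forall>s'\<in>S. s \<noteq> s' \<longrightarrow>
               (\<forall>x\<in>fst (snd s). \<forall>y\<in>fst (snd s'). rho ^ t \<le> C * dist x y) \<and>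
               (\<forall>x\<in>snd (snd s). \<forall>y\<in>snd (snd s'). rho ^ t \<le> C * dist x y))"
    and start: "M t0 U0 V0"
  shows "\<exists>f. bij_betw f U0 V0 \<and>
    (\<forall>x\<in>U0. \<forall>y\<in>U0. dist x y \<le> C\<^sup>2 * dist (f x) (f y) \<and> dist (f x) (f y) \<le> C\<^sup>2 * dist x y)"
proof -
  define pu where "pu s = fst (snd s)" for s :: "nat \<times> 'a set \<times> 'b set"
  define pv where "pv s = snd (snd s)" for s :: "nat \<times> 'a set \<times> 'b set"
  define MM where "MM s = M (fst s) (pu s) (pv s)" for s
  define good where "good s S \<longleftrightarrow> (\<forall>s'\<in>S. MM s' \<and> fst s < fst s') \<and>
            (\<Union>s'\<in>S. pu s') = pu s \<and> (\<Union>s'\<in>S. pv s') = pv s \<and>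
            (\<forall>s1\<in>S. \<forall>s2\<in>S. s1 \<noteq> s2 \<longrightarrow>
               (\<forall>x\<in>pu s1. \<forall>y\<in>pu s2. rho ^ fst s \<le> C * dist x y) \<and>
               (\<forall>x\<in>pv s1. \<forall>y\<in>pv s2. rho ^ fst s \<le> C * dist x y))" for s S
  define ch where "ch s = (SOME S. good s S)" for s
  \<comment> \<open>\<open>L n\<close> is the n-th generation of matched pairs. Its members may have
    different levels, but levels increase strictly from parent to child, so all of them are at least
    \<open>n\<close>.\<close>
  define L where "L = rec_nat {(t0, U0, V0)} (\<lambda>i Y. \<Union> (ch ` Y))"
  have L0: "L 0 = {(t0, U0, V0)}" and LS: "L (Suc n) = \<Union> (ch ` L n)" for n
    by (simp_all add: L_def)
  have good': "good s (ch s)" if "MM s" for s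
    unfolding ch_def by (rule someI_ex) (use step[OF that[unfolded MM_def]] in \<open>simp add: good_def MM_def pu_def pv_def\<close>)
  note goodD = good'[unfolded good_def]
  have g1: "MM s' \<and> fst s < fst s'" if "MM s" "s' \<in> ch s" for s s'
    by (rule bspec[OF conjunct1[OF goodD[OF that(1)]] that(2)])
  have g2: "(\<Union>s'\<in>ch s. pu s') = pu s" "(\<Union>s'\<in>ch s. pv s') = pv s" if "MM s" for s
    by (rule conjunct1[OF conjunct2[OF goodD[OF that]]],
        rule conjunct1[OF conjunct2[OF conjunct2[OF goodD[OF that]]]])
  have g34: "(\<forall>x\<in>pu s1. \<forall>y\<in>pu s2. rho ^ fst s \<le> C * dist x y) \<and>
             (\<forall>x\<in>pv s1. \<forall>y\<in>pv s2. rho ^ fst s \<le> C * dist x y)"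
    if "MM s" "s1 \<in> ch s" "s2 \<in> ch s" "s1 \<noteq> s2" for s s1 s2
    by (rule mp[OF bspec[OF bspec[OF conjunct2[OF conjunct2[OF conjunct2[OF goodD[OF that(1)]]]]
          that(2)] that(3)] that(4)])
  have g3: "rho ^ fst s \<le> C * dist x y" if "MM s" "s1 \<in> ch s" "s2 \<in> ch s" "s1 \<noteq> s2" "x \<in> pu s1" "y \<in> pu s2"
    for s s1 s2 x y
    using g34[OF that(1-4)] that(5,6) by blast
  have g4: "rho ^ fst s \<le> C * dist x y" if "MM s" "s1 \<in> ch s" "s2 \<in> ch s" "s1 \<noteq> s2" "x \<in> pv s1" "y \<in> pv s2"
    for s s1 s2 x y
    using g34[OF that(1-4)] that(5,6) by blast
  have Mlev: "MM s \<and> n \<le> fst s" if "s \<in> L n" for s n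
    using that
  proof (induction n arbitrary: s)
    case 0 then show ?case using start by (auto simp: L0 MM_def pu_def pv_def)
  next
    case (Suc n)
    then obtain s0 where "s0 \<in> L n" "s \<in> ch s0" by (auto simp: LS)
    with Suc.IH[of s0] g1[of s0 s] show ?case by auto
  qed
  have dU: "dist x y \<le> C * rho ^ n" if "s \<in> L n" "x \<in> pu s" "y \<in> pu s" for s n x y
  proof -
    have "dist x y \<le> C * rho ^ fst s" using Mlev[OF that(1)] that(2,3) diamU unfolding MM_def by blast
    also have "\<dots> \<le> C * rho ^ n" using Mlev[OF that(1)] rho C by (intro mult_left_mono power_decreasing) auto
    finally show ?thesis .
  qed
  have dV: "dist x y \<le> C * rho ^ n" if "s \<in> L n" "x \<in> pv s" "y \<in> pv s" for s n x y
  proof -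
    have "dist x y \<le> C * rho ^ fst s" using Mlev[OF that(1)] that(2,3) diamV unfolding MM_def by blast
    also have "\<dots> \<le> C * rho ^ n" using Mlev[OF that(1)] rho C by (intro mult_left_mono power_decreasing) auto
    finally show ?thesis .
  qed
  \<comment> \<open>If two points part below a common pair of level \<open>t\<close>, both distances
    lie between \<open>rho ^ t / C\<close> and \<open>C * rho ^ t\<close>; hence the factor
    \<open>C\<close> squared. The positivity part makes the members of one generation disjoint on
    both sides.\<close>
  have cmp: "dist x y \<le> C\<^sup>2 * dist x' y' \<and> dist x' y' \<le> C\<^sup>2 * dist x y \<and> 0 < dist x y \<and> 0 < dist x' y'"
    if "s \<in> L n" "s' \<in> L n" "s \<noteq> s'" "x \<in> pu s" "y \<in> pu s'" "x' \<in> pv s" "y' \<in> pv s'" for n s s' x y x' y'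
    using that
  proof (induction n arbitrary: s s')
    case 0 then show ?case by (auto simp: L0)
  next
    case (Suc n)
    obtain a where a: "a \<in> L n" "s \<in> ch a" using Suc.prems by (auto simp: LS)
    obtain b where b: "b \<in> L n" "s' \<in> ch b" using Suc.prems by (auto simp: LS)
    note Ma = Mlev[OF a(1)] and Mb = Mlev[OF b(1)]
    have inU: "x \<in> pu a" "y \<in> pu b" and inV: "x' \<in> pv a" "y' \<in> pv b"
      using g2[of a] g2[of b] Ma Mb a(2) b(2) Suc.prems by blast+
    show ?case
    proof (cases "a = b")
      case False
      then show ?thesis using Suc.IH[of a b] a b inU inV Suc.prems by blast
    next
      case True
      let ?q = "rho ^ fst a"
      have q: "?q > 0" using rho by simp
      have 1: "?q \<le> C * dist x y" "?q \<le> C * dist x' y'"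
        using g3[of a s s' x y] g4[of a s s' x' y'] Ma a b True Suc.prems by blast+
      have 2: "dist x y \<le> C * ?q" "dist x' y' \<le> C * ?q"
        using diamU[of "fst a" "pu a" "pv a" x y] diamV[of "fst a" "pu a" "pv a" x' y'] Ma True inU inV
        unfolding MM_def by blast+
      have "dist x y \<le> C * (C * dist x' y')" using 2(1) mult_left_mono[OF 1(2), of C] C by linarith
      moreover have "dist x' y' \<le> C * (C * dist x y)" using 2(2) mult_left_mono[OF 1(1), of C] C by linarith
      moreover have "0 < dist x y" "0 < dist x' y'" using 1 q by (smt (verit) C mult_nonneg_nonpos zero_le_dist mult_zero_right)+
      ultimately show ?thesis by (simp add: power2_eq_square mult.assoc)
    qed
  qed
  have covU: "\<exists>s\<in>L n. x \<in> pu s" if "x \<in> U0" for x n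
  proof (induction n)
    case 0 then show ?case using that by (auto simp: L0 pu_def)
  next
    case (Suc n)
    then obtain s where s: "s \<in> L n" "x \<in> pu s" by blast
    then have "x \<in> (\<Union>s'\<in>ch s. pu s')" using g2(1)[of s] Mlev[OF s(1)] by simp
    then show ?case using s(1) by (auto simp: LS)
  qed
  have covV: "\<exists>s\<in>L n. x \<in> pv s" if "x \<in> V0" for x n
  proof (induction n)
    case 0 then show ?case using that by (auto simp: L0 pv_def)
  next
    case (Suc n)
    then obtain s where s: "s \<in> L n" "x \<in> pv s" by blast
    then have "x \<in> (\<Union>s'\<in>ch s. pv s')" using g2(2)[of s] Mlev[OF s(1)] by simp
    then show ?case using s(1) by (auto simp: LS)
  qed
  have neU: "pu s \<noteq> {}" "compact (pu s)" if "s \<in> L n" for s n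
    using Mlev[OF that] cptU unfolding MM_def by blast+
  have neV: "pv s \<noteq> {}" "compact (pv s)" if "s \<in> L n" for s n
    using Mlev[OF that] cptV unfolding MM_def by blast+
  have uniU: "s = s'" if "s \<in> L n" "s' \<in> L n" "x \<in> pu s" "x \<in> pu s'" for s s' n x
    using cmp[OF that(1,2) _ that(3,4)] neV[OF that(1)] neV[OF that(2)] by fastforce
  have uniV: "s = s'" if "s \<in> L n" "s' \<in> L n" "x \<in> pv s" "x \<in> pv s'" for s s' n x
    using cmp[OF that(1,2) _ _ _ that(3,4)] neU[OF that(1)] neU[OF that(2)] by fastforce
  \<comment> \<open>The bijection is obtained from its graph, which is symmetric in the two sides:
    existence of partners follows by compactness on either side, uniqueness from the shrinking
    diameters.\<close>
  define R where "R x y \<longleftrightarrow> (\<forall>n. \<exists>s\<in>L n. x \<in> pu s \<and> y \<in> pv s)" for x y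
  have exV: "\<exists>y. R x y" if x: "x \<in> U0" for x
  proof -
    obtain c where c: "\<And>n. c n \<in> L n" "\<And>n. x \<in> pu (c n)" using covU[OF x] by metis
    have sub: "pv (c (Suc n)) \<subseteq> pv (c n)" for n
    proof -
      obtain a where a: "a \<in> L n" "c (Suc n) \<in> ch a" using c(1)[of "Suc n"] by (auto simp: LS)
      have "x \<in> pu a" using g2(1)[of a] Mlev[OF a(1)] a(2) c(2)[of "Suc n"] by blast
      then have "a = c n" using uniU[OF a(1) c(1)] c(2) by blast
      then show ?thesis using g2(2)[of a] Mlev[OF a(1)] a(2) by blast
    qed
    have "\<Inter> (range (\<lambda>n. pv (c n))) \<noteq> {}"
    proof (rule compact_nest)
      show "compact (pv (c n))" "pv (c n) \<noteq> {}" for n using neV[OF c(1)] by auto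
      show "pv (c n) \<subseteq> pv (c m)" if "m \<le> n" for m n using lift_Suc_antimono_le[of "\<lambda>n. pv (c n)", OF sub that] .
    qed
    then obtain y where "\<And>n. y \<in> pv (c n)" by auto
    then have "R x y" unfolding R_def using c by blast
    then show ?thesis ..
  qed
  have exU: "\<exists>x. R x y" if y: "y \<in> V0" for y
  proof -
    obtain c where c: "\<And>n. c n \<in> L n" "\<And>n. y \<in> pv (c n)" using covV[OF y] by metis
    have sub: "pu (c (Suc n)) \<subseteq> pu (c n)" for n
    proof -
      obtain a where a: "a \<in> L n" "c (Suc n) \<in> ch a" using c(1)[of "Suc n"] by (auto simp: LS)
      have "y \<in> pv a" using g2(2)[of a] Mlev[OF a(1)] a(2) c(2)[of "Suc n"] by blast
      then have "a = c n" using uniV[OF a(1) c(1)] c(2) by blast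
      then show ?thesis using g2(1)[of a] Mlev[OF a(1)] a(2) by blast
    qed
    have "\<Inter> (range (\<lambda>n. pu (c n))) \<noteq> {}"
    proof (rule compact_nest)
      show "compact (pu (c n))" "pu (c n) \<noteq> {}" for n using neU[OF c(1)] by auto
      show "pu (c n) \<subseteq> pu (c m)" if "m \<le> n" for m n using lift_Suc_antimono_le[of "\<lambda>n. pu (c n)", OF sub that] .
    qed
    then obtain x where "\<And>n. x \<in> pu (c n)" by auto
    then have "R x y" unfolding R_def using c by blast
    then show ?thesis ..
  qed
  have small: "d \<le> 0" if "\<And>n. d \<le> C * rho ^ n" for d
  proof (rule ccontr)
    assume "\<not> d \<le> 0"
    then have "d / C > 0" using C by simp
    then obtain n where "rho ^ n < d / C" using real_arch_pow_inv rho by blast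
    then have "C * rho ^ n < d" using C by (simp add: field_simps)
    then show False using that[of n] by simp
  qed
  have Req: "x = x' \<longleftrightarrow> y = y'" if R: "R x y" "R x' y'" for x x' y y'
  proof
    assume "x = x'"
    have "dist y y' \<le> C * rho ^ n" for n
    proof -
      obtain s where s: "s \<in> L n" "x \<in> pu s" "y \<in> pv s" using R unfolding R_def by blast
      obtain s' where s': "s' \<in> L n" "x \<in> pu s'" "y' \<in> pv s'" using R \<open>x = x'\<close> unfolding R_def by blast
      show ?thesis using dV uniU[of s n s' x] s s' by metis
    qed
    from small[OF this] show "y = y'" by simp
  next
    assume "y = y'"
    have "dist x x' \<le> C * rho ^ n" for n
    proof -
      obtain s where s: "s \<in> L n" "x \<in> pu s" "y \<in> pv s" using R unfolding R_def by blast
      obtain s' where s': "s' \<in> L n" "x' \<in> pu s'" "y \<in> pv s'" using R \<open>y = y'\<close> unfolding R_def by blast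
      show ?thesis using dU uniV[of s n s' y] s s' by metis
    qed
    from small[OF this] show "x = x'" by simp
  qed
  have Rdist: "dist x x' \<le> C\<^sup>2 * dist y y' \<and> dist y y' \<le> C\<^sup>2 * dist x x'" if R: "R x y" "R x' y'" for x x' y y'
  proof (cases "x = x'")
    case True
    then show ?thesis using Req[OF R] by simp
  next
    case False
    then obtain n where n: "\<not> dist x x' \<le> C * rho ^ n" using small[of "dist x x'"] by fastforce
    obtain s where s: "s \<in> L n" "x \<in> pu s" "y \<in> pv s" using R unfolding R_def by blast
    obtain s' where s': "s' \<in> L n" "x' \<in> pu s'" "y' \<in> pv s'" using R unfolding R_def by blast
    have "s \<noteq> s'" using n dU s s' by blast
    then show ?thesis using cmp[of s n s' x x' y y'] s s' by blast
  qed
  define f where "f x = (SOME y. R x y)" for x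
  have Rf: "R x (f x)" if "x \<in> U0" for x unfolding f_def by (rule someI_ex[OF exV[OF that]])
  have RV: "y \<in> V0" "x \<in> U0" if "R x y" for x y
    using that unfolding R_def by (auto simp: L0 pu_def pv_def dest: spec[of _ 0])
  have "bij_betw f U0 V0"
    unfolding bij_betw_def
  proof
    show "inj_on f U0" by (rule inj_onI) (metis Req Rf)
    show "f ` U0 = V0"
    proof
      show "f ` U0 \<subseteq> V0" using Rf RV by blast
      show "V0 \<subseteq> f ` U0"
      proof
        fix y assume "y \<in> V0"
        then obtain x where "R x y" using exU by blast
        then have "y = f x" "x \<in> U0" using RV Rf Req by blast+
        then show "y \<in> f ` U0" by blast
      qed
    qed
  qed
  then show ?thesis using Rdist Rf by blast
qed


section \<open>Finite combinatorics: families of equal sum broken into bounded clusters\<close>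

lemma incseq_subseq_all_coordinates:
  fixes v :: "nat \<Rightarrow> 'i \<Rightarrow> nat"
  assumes "finite I"
  shows "\<exists>f. strict_mono f \<and> (\<forall>i\<in>I. incseq (\<lambda>n. v (f n) i))"
  using assms
proof (induction I)
  case empty
  show ?case by (intro exI[of _ id]) (auto simp: strict_mono_def)
next
  case (insert x I)
  then obtain f where f: "strict_mono f" "\<And>i. i \<in> I \<Longrightarrow> incseq (\<lambda>n. v (f n) i)" by auto
  obtain g where g: "strict_mono g" "monoseq (\<lambda>n. v (f (g n)) x)"
    using seq_monosub[of "\<lambda>n. v (f n) x"] by blast
  \<comment> \<open>A monotone sequence of natural numbers is increasing, or decreasing and then
    constant from the index \<open>k\<close> at which its minimum is attained.\<close>
  obtain k where k: "incseq (\<lambda>n. v (f (g (n + k))) x)"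
  proof (cases "incseq (\<lambda>n. v (f (g n)) x)")
    case True
    then show ?thesis using that[of 0] by simp
  next
    case False
    then have dec: "decseq (\<lambda>n. v (f (g n)) x)" using g(2) by (simp add: monoseq_iff)
    define m where "m = (LEAST y. y \<in> range (\<lambda>n. v (f (g n)) x))"
    have "m \<in> range (\<lambda>n. v (f (g n)) x)" unfolding m_def by (rule LeastI) blast
    then obtain k where k: "m = v (f (g k)) x" by blast
    have "v (f (g (n + k))) x = m" for n
      using decseqD[OF dec, of k "n + k"] k Least_le[of "\<lambda>y. y \<in> range (\<lambda>n. v (f (g n)) x)" "v (f (g (n + k))) x"]
      unfolding m_def[symmetric] by simp
    then show ?thesis using that[of k] by (simp add: incseq_def)
  qed
  have sm: "strict_mono (\<lambda>n. f (g (n + k)))"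
    using f(1) g(1) by (auto simp: strict_mono_def)
  have "incseq (\<lambda>n. v (f (g (n + k))) i)" if "i \<in> I" for i
    using f(2)[OF that] g(1) by (auto simp: incseq_def strict_mono_less_eq)
  with k sm show ?case by (intro exI[of _ "\<lambda>n. f (g (n + k))"]) auto
qed

lemma sum_fibres:
  fixes a :: "'i \<Rightarrow> real"
  assumes "finite I" "finite K" "a ` I \<subseteq> K"
  shows "sum a I = (\<Sum>y\<in>K. real (card {i\<in>I. a i = y}) * y)"
proof -
  have "(\<Sum>y\<in>K. sum a {i\<in>I. a i = y}) = sum a I"
    by (rule sum.group[OF assms])
  moreover have "sum a {i\<in>I. a i = y} = real (card {i\<in>I. a i = y}) * y" for y
    by simp
  ultimately show ?thesis by simp
qed

text \<open>A sum depends only on the multiplicities of its values, and every vector of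
  multiplicities below that of \<open>I\<close> is realised by a subfamily. This turns the search
  for clusters into a question about vectors of natural numbers.\<close>

lemma subset_with_fibre_cards:
  fixes a :: "'i \<Rightarrow> real"
  assumes fin: "finite I" "finite K" and aK: "a ` I \<subseteq> K"
    and w: "\<And>y. y \<in> K \<Longrightarrow> w y \<le> card {i\<in>I. a i = y}"
  shows "\<exists>I0\<subseteq>I. sum a I0 = (\<Sum>y\<in>K. real (w y) * y) \<and> card I0 = (\<Sum>y\<in>K. w y)"
proof -
  have "\<exists>T. T \<subseteq> {i\<in>I. a i = y} \<and> card T = w y" if "y \<in> K" for y
    by (rule obtain_subset_with_card_n[OF w[OF that]]) auto
  then obtain T where T: "\<And>y. y \<in> K \<Longrightarrow> T y \<subseteq> {i\<in>I. a i = y} \<and> card (T y) = w y" by metis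
  let ?I = "\<Union>y\<in>K. T y"
  have sub: "?I \<subseteq> I" using T by blast
  have f: "finite ?I" using sub fin(1) by (rule finite_subset)
  have Ta: "i \<in> I" "a i = y" if "i \<in> T y" "y \<in> K" for i y using T that by auto
  have eq: "{i\<in>?I. a i = y} = T y" if "y \<in> K" for y using that by (auto dest: Ta)
  have "sum a ?I = (\<Sum>y\<in>K. real (card {i\<in>?I. a i = y}) * y)"
    using sub aK by (intro sum_fibres f fin) blast
  also have "\<dots> = (\<Sum>y\<in>K. real (w y) * y)" using eq T by (intro sum.cong) auto
  finally have 1: "sum a ?I = \<dots>" .
  have "card ?I = (\<Sum>y\<in>K. card (T y))"
  proof (rule card_UN_disjoint[OF fin(2)])
    show "\<forall>y\<in>K. finite (T y)" using T fin(1) by (metis (no_types, lifting) finite_subset mem_Collect_eq subsetI)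
    show "\<forall>y\<in>K. \<forall>y'\<in>K. y \<noteq> y' \<longrightarrow> T y \<inter> T y' = {}"
    proof (intro ballI impI)
      fix y y' assume "y \<in> K" "y' \<in> K" and ne: "y \<noteq> y'"
      then have "T y \<subseteq> {i\<in>I. a i = y}" "T y' \<subseteq> {i\<in>I. a i = y'}" using T by simp_all
      then show "T y \<inter> T y' = {}" using ne by auto
    qed
  qed
  also have "\<dots> = (\<Sum>y\<in>K. w y)" using T by simp
  finally show ?thesis using 1 sub by blast
qed

text \<open>Dickson's lemma: the minimal solutions in natural numbers of one linear equation are finite
  in number, and their sizes bound the size of a cluster.\<close>

lemma bounded_equal_sum_cluster:
  fixes K :: "real set"
  assumes fin: "finite K" and pos: "\<And>y. y \<in> K \<Longrightarrow> 0 < y"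
  shows "\<exists>B. \<forall>(I::'i set) (J::'j set) a b. finite I \<longrightarrow> finite J \<longrightarrow> I \<noteq> {} \<longrightarrow> a ` I \<subseteq> K \<longrightarrow> b ` J \<subseteq> K \<longrightarrow>
      sum a I = sum b J \<longrightarrow>
      (\<exists>I0\<subseteq>I. \<exists>J0\<subseteq>J. I0 \<noteq> {} \<and> J0 \<noteq> {} \<and> sum a I0 = sum b J0 \<and> card J0 \<le> B)"
proof -
  \<comment> \<open>Coordinates are pairs of a side and a value: \<open>True\<close> counts members
    of \<open>I\<close>, \<open>False\<close> members of \<open>J\<close>. The support condition
    leaves only finitely many coordinates to compare.\<close>
  define S where "S v \<longleftrightarrow> (\<Sum>y\<in>K. real (v (True, y)) * y) = (\<Sum>y\<in>K. real (v (False, y)) * y) \<and>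
      (\<exists>z. v z \<noteq> 0) \<and> (\<forall>z. snd z \<notin> K \<longrightarrow> v z = 0)" for v :: "bool \<times> real \<Rightarrow> nat"
  define Mn where "Mn = {v. S v \<and> (\<forall>w. S w \<longrightarrow> w \<le> v \<longrightarrow> w = v)}"
  have "finite Mn"
  proof (rule ccontr)
    assume "infinite Mn"
    from infinite_countable_subset[OF this]
    obtain e :: "nat \<Rightarrow> bool \<times> real \<Rightarrow> nat" where e: "inj e" "range e \<subseteq> Mn" by auto
    obtain f where f: "strict_mono f" "\<And>i. i \<in> UNIV \<times> K \<Longrightarrow> incseq (\<lambda>n. e (f n) i)"
      using incseq_subseq_all_coordinates[of "(UNIV :: bool set) \<times> K" e] fin by auto
    have "e (f 0) z \<le> e (f 1) z" for z
    proof (cases "snd z \<in> K")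
      case True
      then have "z \<in> UNIV \<times> K" by (cases z) auto
      then show ?thesis using f(2)[of z] by (simp add: incseq_def)
    next
      case False
      have "S (e (f 0))" using e(2) by (auto simp: Mn_def)
      then show ?thesis using False by (cases z) (simp add: S_def)
    qed
    then have le: "e (f 0) \<le> e (f 1)" by (simp add: le_fun_def)
    have "S (e (f 0))" "\<forall>w. S w \<longrightarrow> w \<le> e (f 1) \<longrightarrow> w = e (f 1)" using e(2) by (auto simp: Mn_def image_subset_iff)
    then have "e (f 0) = e (f 1)" using le by blast
    then have "f 0 = f 1" using e(1) by (simp add: inj_eq)
    then show False using f(1) strict_mono_eq by fastforce
  qed
  define tot where "tot v = (\<Sum>z\<in>UNIV \<times> K. v z)" for v :: "bool \<times> real \<Rightarrow> nat"
  obtain B where B: "\<And>v. v \<in> Mn \<Longrightarrow> tot v \<le> B"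
    using \<open>finite Mn\<close> by (metis Max_ge finite_imageI imageI)
  \<comment> \<open>Among the solutions below \<open>v\<close>, one of least total size is minimal
    for the pointwise order.\<close>
  have below: "\<exists>w\<in>Mn. w \<le> v" if "S v" for v
  proof -
    have "\<exists>w. (S w \<and> w \<le> v) \<and> (\<forall>w'. S w' \<and> w' \<le> v \<longrightarrow> tot w \<le> tot w')"
      by (rule ex_has_least_nat[of _ v]) (use that in simp)
    then obtain w where w: "S w \<and> w \<le> v" and wm: "\<And>w'. S w' \<and> w' \<le> v \<Longrightarrow> tot w \<le> tot w'"
      by blast
    have "w' = w" if w': "S w'" "w' \<le> w" for w'
    proof -
      have "tot w \<le> tot w'" using wm w' w order_trans by blast
      have "w' z = w z" for z
      proof (rule ccontr)
        assume ne: "w' z \<noteq> w z"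
        then have "w' z < w z" using le_funD[OF w'(2), of z] by simp
        moreover have "snd z \<in> K" using ne w w' unfolding S_def by fastforce
        ultimately have "\<exists>z\<in>UNIV \<times> K. w' z < w z" by (intro bexI[of _ z]) (simp_all add: mem_Times_iff)
        then have "tot w' < tot w"
          unfolding tot_def using fin le_funD[OF w'(2)]
          by (intro sum_strict_mono_ex1) auto
        then show False using \<open>tot w \<le> tot w'\<close> by simp
      qed
      then show ?thesis by blast
    qed
    then show ?thesis using w by (auto simp: Mn_def)
  qed
  show ?thesis
  proof (intro exI[of _ B] allI impI)
    fix I :: "'i set" and J :: "'j set" and a b
    assume I: "finite I" "finite J" "I \<noteq> {}" and ab: "a ` I \<subseteq> K" "b ` J \<subseteq> K" and eq: "sum a I = sum b J"
    define v where "v z = (if snd z \<in> K then if fst z then card {i\<in>I. a i = snd z} else card {j\<in>J. b j = snd z} else 0)"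
      for z
    have "S v"
      unfolding S_def
    proof (intro conjI)
      show "(\<Sum>y\<in>K. real (v (True, y)) * y) = (\<Sum>y\<in>K. real (v (False, y)) * y)"
        using eq sum_fibres[OF I(1) fin ab(1)] sum_fibres[OF I(2) fin ab(2)] by (simp add: v_def)
      obtain i where i: "i \<in> I" using I(3) by blast
      then have "i \<in> {j\<in>I. a j = a i}" "a i \<in> K" using ab by auto
      then have "v (True, a i) \<noteq> 0" using I(1) by (auto simp: v_def card_eq_0_iff)
      then show "\<exists>z. v z \<noteq> 0" by blast
      show "\<forall>z. snd z \<notin> K \<longrightarrow> v z = 0" by (simp add: v_def)
    qed
    then obtain w where w: "w \<in> Mn" "w \<le> v" using below by blast
    then have Sw: "S w" by (simp add: Mn_def)
    have wv: "w z \<le> v z" for z using le_funD[OF w(2)] .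
    have vw: "w (True, y) \<le> card {i\<in>I. a i = y}" "w (False, y) \<le> card {j\<in>J. b j = y}" if "y \<in> K" for y
      using wv[of "(True, y)"] wv[of "(False, y)"] that by (simp_all add: v_def)
    obtain I0 where I0: "I0 \<subseteq> I" "sum a I0 = (\<Sum>y\<in>K. real (w (True, y)) * y)" "card I0 = (\<Sum>y\<in>K. w (True, y))"
      using subset_with_fibre_cards[OF I(1) fin ab(1), of "\<lambda>y. w (True, y)"] vw by auto
    obtain J0 where J0: "J0 \<subseteq> J" "sum b J0 = (\<Sum>y\<in>K. real (w (False, y)) * y)" "card J0 = (\<Sum>y\<in>K. w (False, y))"
      using subset_with_fibre_cards[OF I(2) fin ab(2), of "\<lambda>y. w (False, y)"] vw by auto
    have eq0: "sum a I0 = sum b J0" using I0 J0 Sw by (simp add: S_def)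
    have fI0: "finite I0" "finite J0" using I0 J0 I finite_subset by blast+
    \<comment> \<open>All values are positive, so an empty side has sum 0 and forces the other side
      to be empty.\<close>
    have iff: "I0 = {} \<longleftrightarrow> J0 = {}"
    proof -
      have "0 < a i" if "i \<in> I0" for i using I0(1) ab(1) pos that by blast
      then have "0 < sum a I0" if "I0 \<noteq> {}" using that fI0 by (intro sum_pos) auto
      moreover have "0 < b i" if "i \<in> J0" for i using J0(1) ab(2) pos that by blast
      then have "0 < sum b J0" if "J0 \<noteq> {}" using that fI0 by (intro sum_pos) auto
      ultimately show ?thesis using eq0 by fastforce
    qed
    have "tot w = (\<Sum>x\<in>UNIV. \<Sum>y\<in>K. w (x, y))"
      unfolding tot_def by (simp add: sum.cartesian_product)
    then have tw: "tot w = card I0 + card J0" using I0 J0 by (simp add: UNIV_bool)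
    have "I0 \<noteq> {} \<or> J0 \<noteq> {}"
    proof (rule ccontr)
      assume "\<not> ?thesis"
      then have "tot w = 0" using tw by simp
      then have "\<And>z. z \<in> UNIV \<times> K \<Longrightarrow> w z = 0" using fin by (auto simp: tot_def)
      then show False using Sw unfolding S_def by (metis UNIV_I mem_Times_iff)
    qed
    then show "\<exists>I0\<subseteq>I. \<exists>J0\<subseteq>J. I0 \<noteq> {} \<and> J0 \<noteq> {} \<and> sum a I0 = sum b J0 \<and> card J0 \<le> B"
      using I0 J0 eq0 iff B[OF w(1)] tw by (intro exI[of _ I0] conjI exI[of _ J0]) auto
  qed
qed

text \<open>Clusters are peeled off one at a time; removing equal sums leaves equal sums. The size
  bound is on the \<open>G\<close> side because the members of \<open>G k\<close> prescribe the
  parts that will have to be carved out.\<close>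

lemma equal_sum_cluster_partition:
  fixes K :: "real set"
  assumes fin: "finite K" and pos: "\<And>y. y \<in> K \<Longrightarrow> 0 < y"
  shows "\<exists>B. \<forall>(I::'i set) (J::'j set) a b. finite I \<longrightarrow> finite J \<longrightarrow> a ` I \<subseteq> K \<longrightarrow> b ` J \<subseteq> K \<longrightarrow>
      sum a I = sum b J \<longrightarrow>
      (\<exists>n F G. disjoint_family_on F {..<n::nat} \<and> disjoint_family_on G {..<n} \<and>
         (\<Union>k<n. F k) = I \<and> (\<Union>k<n. G k) = J \<and>
         (\<forall>k<n. G k \<noteq> {} \<and> card (G k) \<le> B \<and> sum a (F k) = sum b (G k)))"
proof -
  obtain B where B: "\<And>(I::'i set) (J::'j set) a b. finite I \<Longrightarrow> finite J \<Longrightarrow> I \<noteq> {} \<Longrightarrow> a ` I \<subseteq> K \<Longrightarrow> b ` J \<subseteq> K \<Longrightarrow>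
      sum a I = sum b J \<Longrightarrow>
      (\<exists>I0\<subseteq>I. \<exists>J0\<subseteq>J. I0 \<noteq> {} \<and> J0 \<noteq> {} \<and> sum a I0 = sum b J0 \<and> card J0 \<le> B)"
    using bounded_equal_sum_cluster[OF fin pos] by metis
  show ?thesis
  proof (rule exI[of _ B], intro allI impI)
    fix I :: "'i set" and J :: "'j set" and a b
    assume "finite I" "finite J" "a ` I \<subseteq> K" "b ` J \<subseteq> K" "sum a I = sum b J"
    then show "\<exists>n F G. disjoint_family_on F {..<n::nat} \<and> disjoint_family_on G {..<n} \<and>
         (\<Union>k<n. F k) = I \<and> (\<Union>k<n. G k) = J \<and>
         (\<forall>k<n. G k \<noteq> {} \<and> card (G k) \<le> B \<and> sum a (F k) = sum b (G k))"
    proof (induction "card I" arbitrary: I J rule: less_induct)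
      case less
      show ?case
      proof (cases "I = {}")
        case True
        have "J = {}"
        proof (rule ccontr)
          assume "J \<noteq> {}"
          then have "0 < sum b J" using less.prems pos by (intro sum_pos) auto
          then show False using less.prems True by simp
        qed
        with True show ?thesis by (intro exI[of _ 0]) (auto simp: disjoint_family_on_def)
      next
        case False
        then obtain I0 J0 where 0: "I0 \<subseteq> I" "J0 \<subseteq> J" "I0 \<noteq> {}" "J0 \<noteq> {}" "sum a I0 = sum b J0" "card J0 \<le> B"
          using B[OF less.prems(1,2) False less.prems(3-5)] by blast
        have "card (I - I0) < card I" using 0 less.prems(1) by (intro psubset_card_mono) auto
        moreover have "sum a (I - I0) = sum b (J - J0)"
          using 0 less.prems by (simp add: sum_diff)
        ultimately have "\<exists>n F G. disjoint_family_on F {..<n::nat} \<and> disjoint_family_on G {..<n} \<and>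
         (\<Union>k<n. F k) = I - I0 \<and> (\<Union>k<n. G k) = J - J0 \<and>
         (\<forall>k<n. G k \<noteq> {} \<and> card (G k) \<le> B \<and> sum a (F k) = sum b (G k))"
          by (intro less.hyps) (use less.prems in auto)
        then obtain n F G where ih: "disjoint_family_on F {..<n::nat}" "disjoint_family_on G {..<n}"
         "(\<Union>k<n. F k) = I - I0" "(\<Union>k<n. G k) = J - J0"
         "\<And>k. k < n \<Longrightarrow> G k \<noteq> {} \<and> card (G k) \<le> B \<and> sum a (F k) = sum b (G k)"
          by (elim exE conjE) simp
        define F' where "F' = F(n := I0)"
        define G' where "G' = G(n := J0)"
        have "disjoint_family_on F' {..<Suc n}" "disjoint_family_on G' {..<Suc n}"
          using ih(1-4) unfolding disjoint_family_on_def F'_def G'_def by (fastforce simp: less_Suc_eq)+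
        moreover have "(\<Union>k<Suc n. F' k) = I" "(\<Union>k<Suc n. G' k) = J"
          using ih(3,4) 0 by (auto simp: F'_def G'_def lessThan_Suc)
        moreover have "\<forall>k<Suc n. G' k \<noteq> {} \<and> card (G' k) \<le> B \<and> sum a (F' k) = sum b (G' k)"
          using ih(5) 0 by (auto simp: F'_def G'_def less_Suc_eq)
        ultimately show ?thesis by blast
      qed
    qed
  qed
qed

text \<open>Sums of at most \<open>n\<close> members of \<open>K\<close>, repetitions allowed. Its
  purpose is to be a finite set that contains a given sum, wherever a quantity must be shown to take
  finitely many values over all scales.\<close>

fun bounded_sums :: "real set \<Rightarrow> nat \<Rightarrow> real set" where
  "bounded_sums K 0 = {0}"
| "bounded_sums K (Suc n) = bounded_sums K n \<union> (\<lambda>(x, y). x + y) ` (K \<times> bounded_sums K n)"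

lemma finite_bounded_sums: "finite K \<Longrightarrow> finite (bounded_sums K n)"
  by (induction n) auto

lemma sum_in_bounded_sums:
  "finite J \<Longrightarrow> card J \<le> n \<Longrightarrow> b ` J \<subseteq> K \<Longrightarrow> sum b J \<in> bounded_sums K n"
proof (induction n arbitrary: J)
  case 0
  then show ?case by simp
next
  case (Suc n)
  show ?case
  proof (cases "J = {}")
    case True
    then show ?thesis using Suc.IH[of "{}"] by simp
  next
    case False
    then obtain j where j: "j \<in> J" by blast
    have "sum b (J - {j}) \<in> bounded_sums K n" using Suc.prems j by (intro Suc.IH) auto
    then have "b j + sum b (J - {j}) \<in> (\<lambda>(x, y). x + y) ` (K \<times> bounded_sums K n)"
      using Suc.prems(3) j by (intro image_eqI[of _ _ "(b j, sum b (J - {j}))"]) auto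
    then show ?thesis using sum.remove[OF Suc.prems(1) j, of b] by simp
  qed
qed

subsection \<open>Weighted trees of pieces\<close>

text \<open>The pieces of level \<open>t\<close> live at scale \<open>rho\<^sup>t\<close>, and \<open>u\<^sup>t\<close> is the corresponding scale of weights. Below, \<open>PS t\<close> consists of
  the unions of pieces of level \<open>t\<close>, and \<open>vs t\<close> extends the weight \<open>nu t\<close> to them.\<close>

locale piece_tree =
  fixes Om :: "'a::heine_borel set" and P :: "nat \<Rightarrow> 'a set set" and nu :: "nat \<Rightarrow> 'a set \<Rightarrow> real"
    and rho u C :: real and Z :: "real set" and Phi :: "real set"
  assumes rho: "0 < rho" "rho < 1" and u: "0 < u" "u < 1" and C: "1 \<le> C"
    and Z_add: "\<And>x y. x \<in> Z \<Longrightarrow> y \<in> Z \<Longrightarrow> x + y \<in> Z"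
    and Z_mult: "\<And>x y. x \<in> Z \<Longrightarrow> y \<in> Z \<Longrightarrow> x * y \<in> Z"
    and Z_0: "0 \<in> Z" and Z_1: "1 \<in> Z" and Z_u: "u \<in> Z" and Z_inv: "1 / u \<in> Z"
    and compact_X: "compact Om" and X_ne: "Om \<noteq> {}"
    and P_0: "P 0 = {Om}"
    and fin_P: "\<And>t. finite (P t)"
    and cov_P: "\<And>t. \<Union>(P t) = Om"
    and ne_P: "\<And>t A. A \<in> P t \<Longrightarrow> A \<noteq> {}"
    and gap_P: "\<And>t A B x y. A \<in> P t \<Longrightarrow> B \<in> P t \<Longrightarrow> A \<noteq> B \<Longrightarrow> x \<in> A \<Longrightarrow> y \<in> B \<Longrightarrow> rho ^ t \<le> C * dist x y"
    and refine_P: "\<And>t B. B \<in> P (Suc t) \<Longrightarrow> \<exists>A\<in>P t. B \<subseteq> A"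
    and diam_P: "\<And>t A x y. A \<in> P t \<Longrightarrow> x \<in> A \<Longrightarrow> y \<in> A \<Longrightarrow> dist x y \<le> C * rho ^ t"
    and nu_split: "\<And>t A. A \<in> P t \<Longrightarrow> nu t A = (\<Sum>B\<in>{B\<in>P (Suc t). B \<subseteq> A}. nu (Suc t) B)"
    and fin_Phi: "finite Phi" and Phi_Z: "Phi \<subseteq> Z" and Phi_pos: "\<And>y. y \<in> Phi \<Longrightarrow> 0 < y"
    and nu_Phi: "\<And>t A. A \<in> P t \<Longrightarrow> nu t A / u ^ t \<in> Phi"
begin

definition PS :: "nat \<Rightarrow> 'a set set" where
  "PS t = {U. U \<subseteq> Om \<and> (\<forall>A\<in>P t. A \<subseteq> U \<or> A \<inter> U = {})}"

definition vs :: "nat \<Rightarrow> 'a set \<Rightarrow> real" where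
  "vs t U = (\<Sum>A\<in>{A\<in>P t. A \<subseteq> U}. nu t A)"

lemma disjoint_P: "A \<in> P t \<Longrightarrow> B \<in> P t \<Longrightarrow> A \<noteq> B \<Longrightarrow> A \<inter> B = {}"
  using gap_P[of A t B] rho by (metis dist_self disjoint_iff mult_zero_right not_le zero_less_power)

lemma P_eqI: "A \<in> P t \<Longrightarrow> B \<in> P t \<Longrightarrow> x \<in> A \<Longrightarrow> x \<in> B \<Longrightarrow> A = B"
  using disjoint_P by blast

lemma P_sub_X: "A \<in> P t \<Longrightarrow> A \<subseteq> Om"
  using cov_P by blast

lemma P_in_PS: "A \<in> P t \<Longrightarrow> A \<in> PS t"
  unfolding PS_def mem_Collect_eq
proof (intro conjI ballI)
  show "A \<subseteq> Om" if "A \<in> P t" using P_sub_X that .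
  show "B \<subseteq> A \<or> B \<inter> A = {}" if "A \<in> P t" "B \<in> P t" for B
    using disjoint_P[of B t A] that by (cases "B = A") auto
qed

lemma X_in_PS: "Om \<in> PS t"
  unfolding PS_def using P_sub_X by blast

lemma PS_Suc: "U \<in> PS t \<Longrightarrow> U \<in> PS (Suc t)"
  unfolding PS_def mem_Collect_eq
proof (intro conjI ballI; elim conjE)
  fix B assume U: "\<forall>A\<in>P t. A \<subseteq> U \<or> A \<inter> U = {}" and "B \<in> P (Suc t)"
  then obtain A where "A \<in> P t" "B \<subseteq> A" using refine_P[of B t] by blast
  then show "B \<subseteq> U \<or> B \<inter> U = {}" using U by blast
qed

lemma PS_mono: "U \<in> PS t \<Longrightarrow> t \<le> s \<Longrightarrow> U \<in> PS s"
  by (rule lift_Suc_mono_le[of PS, THEN subsetD]) (use PS_Suc in auto)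

lemma PS_Diff: "U \<in> PS t \<Longrightarrow> W \<in> PS t \<Longrightarrow> U - W \<in> PS t"
  unfolding PS_def by blast

lemma PS_Un: "U \<in> PS t \<Longrightarrow> W \<in> PS t \<Longrightarrow> U \<union> W \<in> PS t"
  unfolding PS_def by blast

lemma PS_UN: "(\<And>j. j \<in> J \<Longrightarrow> W j \<in> PS t) \<Longrightarrow> (\<Union>j\<in>J. W j) \<in> PS t"
  unfolding PS_def by blast

lemma PS_eq_Union: "U \<in> PS t \<Longrightarrow> \<Union>{A\<in>P t. A \<subseteq> U} = U"
  unfolding PS_def using cov_P[of t] by blast

lemma PS_Union: "Q \<subseteq> P t \<Longrightarrow> \<Union>Q \<in> PS t"
  using PS_UN[of Q "\<lambda>A. A" t] P_in_PS by auto

lemma pieces_Union: "Q \<subseteq> P t \<Longrightarrow> {A\<in>P t. A \<subseteq> \<Union>Q} = Q"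
proof (intro equalityI subsetI)
  fix A assume Q: "Q \<subseteq> P t" and A: "A \<in> {A\<in>P t. A \<subseteq> \<Union>Q}"
  then obtain x where "x \<in> A" using ne_P by blast
  then obtain B where "B \<in> Q" "x \<in> B" using A by blast
  then show "A \<in> Q" using P_eqI[of A t B x] A Q \<open>x \<in> A\<close> by blast
qed blast

lemma PS_gap:
  assumes "U \<in> PS t" "W \<in> PS t" "U \<inter> W = {}" "x \<in> U" "y \<in> W"
  shows "rho ^ t \<le> C * dist x y"
proof -
  obtain A B where "A \<in> P t" "x \<in> A" "A \<subseteq> U" "B \<in> P t" "y \<in> B" "B \<subseteq> W"
    using PS_eq_Union[OF assms(1)] PS_eq_Union[OF assms(2)] assms(4,5) by blast
  then show ?thesis using gap_P[of A t B x y] assms(3) by blast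
qed

text \<open>The pieces are not assumed closed: a union of pieces is closed because it has a positive
  gap to the remaining pieces of the same level and \<open>Om\<close> is compact.\<close>

lemma PS_compact:
  assumes U: "U \<in> PS t"
  shows "compact U"
proof -
  have UX: "U \<subseteq> Om" using U by (simp add: PS_def)
  have "closed U"
    unfolding closed_sequential_limits
  proof (intro allI impI, elim conjE)
    fix s l assume s: "\<forall>n. s n \<in> U" and l: "s \<longlonglongrightarrow> l"
    have "closed Om" using compact_X by (rule compact_imp_closed)
    then have lX: "l \<in> Om" using s l UX unfolding closed_sequential_limits by blast
    show "l \<in> U"
    proof (rule ccontr)
      assume "l \<notin> U"
      then have *: "rho ^ t \<le> C * dist (s n) l" for n
        using PS_gap[OF U PS_Diff[OF X_in_PS U]] s lX by blast
      have "0 < rho ^ t / C" using rho C by simp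
      then obtain n where "dist (s n) l < rho ^ t / C" using l unfolding lim_sequentially by blast
      then have "C * dist (s n) l < rho ^ t" using C by (simp add: field_simps)
      then show False using *[of n] by simp
    qed
  qed
  then show ?thesis using compact_X UX by (metis compact_Int_closed inf.absorb_iff2)
qed

lemma nu_pos: "A \<in> P t \<Longrightarrow> 0 < nu t A"
  using Phi_pos[OF nu_Phi] u by (metis zero_less_divide_iff zero_less_power not_less_iff_gr_or_eq)

lemma vs_Suc:
  assumes U: "U \<in> PS t"
  shows "vs (Suc t) U = vs t U"
proof -
  let ?Q = "{A\<in>P t. A \<subseteq> U}"
  have "{B\<in>P (Suc t). B \<subseteq> U} = (\<Union>A\<in>?Q. {B\<in>P (Suc t). B \<subseteq> A})"
  proof (intro equalityI subsetI)
    fix B assume B: "B \<in> {B\<in>P (Suc t). B \<subseteq> U}"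
    then obtain A where A: "A \<in> P t" "B \<subseteq> A" using refine_P by blast
    have "B \<noteq> {}" using B ne_P by blast
    then have "A \<subseteq> U" using U A B unfolding PS_def by blast
    then show "B \<in> (\<Union>A\<in>?Q. {B\<in>P (Suc t). B \<subseteq> A})" using A B by blast
  qed blast
  then have "vs (Suc t) U = sum (nu (Suc t)) (\<Union>A\<in>?Q. {B\<in>P (Suc t). B \<subseteq> A})"
    by (simp add: vs_def)
  also have "\<dots> = (\<Sum>A\<in>?Q. sum (nu (Suc t)) {B\<in>P (Suc t). B \<subseteq> A})"
  proof (rule sum.UNION_disjoint)
    show "\<forall>A\<in>?Q. \<forall>A'\<in>?Q. A \<noteq> A' \<longrightarrow> {B\<in>P (Suc t). B \<subseteq> A} \<inter> {B\<in>P (Suc t). B \<subseteq> A'} = {}"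
    proof (intro ballI impI)
      fix A A' assume "A \<in> ?Q" "A' \<in> ?Q" "A \<noteq> A'"
      then have "A \<inter> A' = {}" using disjoint_P[of A t A'] by simp
      then show "{B\<in>P (Suc t). B \<subseteq> A} \<inter> {B\<in>P (Suc t). B \<subseteq> A'} = {}" using ne_P by blast
    qed
  qed (use fin_P in auto)
  also have "\<dots> = vs t U" using nu_split by (auto simp: vs_def intro: sum.cong)
  finally show ?thesis .
qed

lemma vs_mono_level: "U \<in> PS t \<Longrightarrow> t \<le> s \<Longrightarrow> vs s U = vs t U"
proof (induction s)
  case (Suc s)
  show ?case
  proof (cases "t \<le> s")
    case True
    then show ?thesis using Suc vs_Suc[OF PS_mono[OF Suc.prems(1) True]] by simp
  next
    case False
    then have "t = Suc s" using Suc.prems by simp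
    then show ?thesis by simp
  qed
qed simp

lemma vs_Un:
  assumes "U \<in> PS t" "W \<in> PS t" "U \<inter> W = {}"
  shows "vs t (U \<union> W) = vs t U + vs t W"
proof -
  have "{A\<in>P t. A \<subseteq> U \<union> W} = {A\<in>P t. A \<subseteq> U} \<union> {A\<in>P t. A \<subseteq> W}"
    using assms unfolding PS_def by blast
  moreover have "{A\<in>P t. A \<subseteq> U} \<inter> {A\<in>P t. A \<subseteq> W} = {}" using assms(3) ne_P by blast
  ultimately show ?thesis unfolding vs_def by (simp add: sum.union_disjoint fin_P)
qed

lemma vs_Diff: "U \<in> PS t \<Longrightarrow> W \<in> PS t \<Longrightarrow> W \<subseteq> U \<Longrightarrow> vs t (U - W) = vs t U - vs t W"
  using vs_Un[of "U - W" t W] PS_Diff by (simp add: Un_absorb2 Int_commute)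

lemma vs_piece: "A \<in> P t \<Longrightarrow> vs t A = nu t A"
proof -
  assume A: "A \<in> P t"
  have "{B\<in>P t. B \<subseteq> A} = {A}" using pieces_Union[of "{A}" t] A by simp
  then show ?thesis by (simp add: vs_def)
qed

lemma vs_Union: "Q \<subseteq> P t \<Longrightarrow> vs t (\<Union>Q) = sum (nu t) Q"
  by (simp add: vs_def pieces_Union)

lemma Z_power: "x \<in> Z \<Longrightarrow> x ^ n \<in> Z"
  by (induction n) (auto simp: Z_1 Z_mult)

lemma Z_scale: "x \<in> Z \<Longrightarrow> x * u ^ n \<in> Z" "x \<in> Z \<Longrightarrow> x / u ^ n \<in> Z"
proof -
  assume x: "x \<in> Z"
  show "x * u ^ n \<in> Z" using Z_mult[OF x Z_power[OF Z_u]] .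
  have "x * (1 / u) ^ n \<in> Z" using Z_mult[OF x Z_power[OF Z_inv]] .
  then show "x / u ^ n \<in> Z" by (simp add: power_one_over)
qed

lemma Z_sum: "(\<And>i. i \<in> I \<Longrightarrow> f i \<in> Z) \<Longrightarrow> sum f I \<in> Z"
  by (induction I rule: infinite_finite_induct) (auto simp: Z_0 Z_add)

end

text \<open>The depth \<open>m\<close> may depend on the normalised weights \<open>b\<close> and
  \<open>b'\<close>, but neither on \<open>t\<close> nor on \<open>U\<close>. This uniformity turns
  the limit of the matchings into a bi-Lipschitz map instead of a mere homeomorphism.\<close>

locale rich_piece_tree = piece_tree +
  assumes carve: "\<And>b b'. b \<in> Z \<Longrightarrow> b' \<in> Z \<Longrightarrow> 0 < b \<Longrightarrow> 0 < b' \<Longrightarrow>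
      \<exists>m. \<forall>t U. U \<in> PS t \<longrightarrow> vs t U = u ^ t * (b + b') \<longrightarrow>
        (\<exists>W\<in>PS (t + m). W \<subseteq> U \<and> vs (t + m) W = u ^ t * b)"
begin

lemma carve_uniform:
  assumes "finite S" "S \<subseteq> (Z \<inter> {0<..}) \<times> (Z \<inter> {0<..})"
  shows "\<exists>m. \<forall>(b, b')\<in>S. \<forall>t U. U \<in> PS t \<longrightarrow> vs t U = u ^ t * (b + b') \<longrightarrow>
        (\<exists>W\<in>PS (t + m). W \<subseteq> U \<and> vs (t + m) W = u ^ t * b)"
  using assms
proof (induction S)
  case empty
  then show ?case by blast
next
  case (insert z S)
  obtain b b' where z: "z = (b, b')" by (cases z)
  obtain m1 where m1: "\<And>c c' t U. (c, c') \<in> S \<Longrightarrow> U \<in> PS t \<Longrightarrow> vs t U = u ^ t * (c + c') \<Longrightarrow>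
        (\<exists>W\<in>PS (t + m1). W \<subseteq> U \<and> vs (t + m1) W = u ^ t * c)"
    using insert by fastforce
  obtain m2 where m2: "\<And>t U. U \<in> PS t \<Longrightarrow> vs t U = u ^ t * (b + b') \<Longrightarrow>
        (\<exists>W\<in>PS (t + m2). W \<subseteq> U \<and> vs (t + m2) W = u ^ t * b)"
    using carve[of b b'] insert.prems z by auto
  have lift: "\<exists>W\<in>PS (t + n). W \<subseteq> U \<and> vs (t + n) W = y" if ex: "\<exists>W\<in>PS (t + m). W \<subseteq> U \<and> vs (t + m) W = y" and mn: "m \<le> n"
    for t U m n y
  proof -
    obtain W where "W \<in> PS (t + m)" "W \<subseteq> U" "vs (t + m) W = y" using ex by blast
    then show ?thesis using PS_mono[of W "t + m" "t + n"] vs_mono_level[of W "t + m" "t + n"] mn by auto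
  qed
  show ?case
  proof (rule exI[of _ "max m1 m2"], intro ballI)
    fix c assume c: "c \<in> insert z S"
    show "case c of (b, b') \<Rightarrow> \<forall>t U. U \<in> PS t \<longrightarrow> vs t U = u ^ t * (b + b') \<longrightarrow>
        (\<exists>W\<in>PS (t + max m1 m2). W \<subseteq> U \<and> vs (t + max m1 m2) W = u ^ t * b)"
    proof (cases "c = z")
      case True
      then show ?thesis using z by (auto intro!: lift[OF m2])
    next
      case False
      obtain d d' where d: "c = (d, d')" by (cases c)
      then have "(d, d') \<in> S" using c False by simp
      then show ?thesis using d by (auto intro!: lift[OF m1])
    qed
  qed
qed

text \<open>Parts are split off one at a time. The remainders that can occur form the finite set
  \<open>K'\<close>, so one depth \<open>m1\<close> serves every first cut. Relative to level
  \<open>t + m1\<close> the remaining weights are divided by \<open>u ^ m1\<close>, which is why the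
  induction is over all \<open>K\<close> and continues with \<open>K2\<close>.\<close>

lemma carve_family:
  fixes K :: "real set"
  assumes "finite K" "K \<subseteq> Z" "\<And>y. y \<in> K \<Longrightarrow> 0 < y"
  shows "\<exists>m. \<forall>t U (J::'j set) b. U \<in> PS t \<longrightarrow> finite J \<longrightarrow> J \<noteq> {} \<longrightarrow> card J \<le> Suc n \<longrightarrow> b ` J \<subseteq> K \<longrightarrow>
    vs t U = u ^ t * sum b J \<longrightarrow>
    (\<exists>W. (\<forall>j\<in>J. W j \<in> PS (t + m) \<and> vs (t + m) (W j) = u ^ t * b j) \<and> disjoint_family_on W J \<and> (\<Union>j\<in>J. W j) = U)"
  using assms
proof (induction n arbitrary: K)
  case 0
  show ?case
  proof (rule exI[of _ 0], intro allI impI)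
    fix t U and J :: "'j set" and b
    assume a: "U \<in> PS t" "finite J" "J \<noteq> {}" "card J \<le> Suc 0" "b ` J \<subseteq> K" "vs t U = u ^ t * sum b J"
    then have "card J = 1" by (simp add: card_gt_0_iff le_antisym Suc_le_eq)
    then obtain j where "J = {j}" by (rule card_1_singletonE)
    then show "\<exists>W. (\<forall>j\<in>J. W j \<in> PS (t + 0) \<and> vs (t + 0) (W j) = u ^ t * b j) \<and> disjoint_family_on W J \<and> (\<Union>j\<in>J. W j) = U"
      using a by (intro exI[of _ "\<lambda>_. U"]) (auto simp: disjoint_family_on_def)
  qed
next
  case (Suc n)
  define K' where "K' = {y\<in>bounded_sums K (Suc n). y \<in> Z \<and> 0 < y}"
  have "finite K'" unfolding K'_def by (rule finite_subset[OF _ finite_bounded_sums[OF Suc.prems(1), of "Suc n"]]) blast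
  then have "finite (K \<times> K')" "K \<times> K' \<subseteq> (Z \<inter> {0<..}) \<times> (Z \<inter> {0<..})"
    using Suc.prems by (auto simp: K'_def)
  from carve_uniform[OF this] obtain m1 where m1': "\<forall>(b, b')\<in>K \<times> K'. \<forall>t U. U \<in> PS t \<longrightarrow> vs t U = u ^ t * (b + b') \<longrightarrow>
        (\<exists>W\<in>PS (t + m1). W \<subseteq> U \<and> vs (t + m1) W = u ^ t * b)" by (elim exE) (rule that)
  have m1: "\<exists>W\<in>PS (t + m1). W \<subseteq> U \<and> vs (t + m1) W = u ^ t * b"
    if "b \<in> K" "b' \<in> K'" "U \<in> PS t" "vs t U = u ^ t * (b + b')" for b b' t U
    using bspec[OF m1', of "(b, b')"] that by simp
  define K2 where "K2 = (\<lambda>y. y / u ^ m1) ` K"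
  have K2: "finite K2" "K2 \<subseteq> Z" "\<And>y. y \<in> K2 \<Longrightarrow> 0 < y"
    using Suc.prems u Z_scale(2) by (auto simp: K2_def)
  obtain m2 where m2: "\<And>t U (J::'j set) b. U \<in> PS t \<Longrightarrow> finite J \<Longrightarrow> J \<noteq> {} \<Longrightarrow> card J \<le> Suc n \<Longrightarrow> b ` J \<subseteq> K2 \<Longrightarrow>
    vs t U = u ^ t * sum b J \<Longrightarrow>
    (\<exists>W. (\<forall>j\<in>J. W j \<in> PS (t + m2) \<and> vs (t + m2) (W j) = u ^ t * b j) \<and> disjoint_family_on W J \<and> (\<Union>j\<in>J. W j) = U)"
    using Suc.IH[OF K2] by metis
  show ?case
  proof (rule exI[of _ "m1 + m2"], intro allI impI)
    fix t U and J :: "'j set" and b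
    assume U: "U \<in> PS t" and J: "finite J" "J \<noteq> {}" "card J \<le> Suc (Suc n)" and b: "b ` J \<subseteq> K"
      and eq: "vs t U = u ^ t * sum b J"
    obtain j where j: "j \<in> J" using J by blast
    show "\<exists>W. (\<forall>j\<in>J. W j \<in> PS (t + (m1 + m2)) \<and> vs (t + (m1 + m2)) (W j) = u ^ t * b j) \<and>
            disjoint_family_on W J \<and> (\<Union>j\<in>J. W j) = U"
    proof (cases "J = {j}")
      case True
      then show ?thesis
        using U eq PS_mono[OF U, of "t + (m1 + m2)"] vs_mono_level[OF U, of "t + (m1 + m2)"]
        by (intro exI[of _ "\<lambda>_. U"]) (auto simp: disjoint_family_on_def)
    next
      case False
      let ?J = "J - {j}"
      have J': "finite ?J" "?J \<noteq> {}" "card ?J \<le> Suc n" "b ` ?J \<subseteq> K" using J j b False by auto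
      have bj: "b j \<in> K" using b j by blast
      have "0 < sum b ?J" using J' Suc.prems(3) by (intro sum_pos) auto
      moreover have "sum b ?J \<in> Z" using J' Suc.prems(2) by (intro Z_sum) auto
      ultimately have K': "sum b ?J \<in> K'" using sum_in_bounded_sums[OF J'(1,3,4)] by (simp add: K'_def)
      have sp: "sum b J = b j + sum b ?J" using sum.remove[OF J(1) j] .
      obtain W1 where W1: "W1 \<in> PS (t + m1)" "W1 \<subseteq> U" "vs (t + m1) W1 = u ^ t * b j"
        using m1[OF bj K' U] eq sp by auto
      have U1: "U \<in> PS (t + m1)" using PS_mono[OF U] by simp
      have D: "U - W1 \<in> PS (t + m1)" using PS_Diff[OF U1 W1(1)] .
      have "vs (t + m1) (U - W1) = u ^ t * sum b ?J"
        using vs_Diff[OF U1 W1(1,2)] vs_mono_level[OF U, of "t + m1"] W1(3) eq sp by (simp add: algebra_simps)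
      also have "\<dots> = u ^ (t + m1) * (\<Sum>i\<in>?J. b i / u ^ m1)"
        using u by (simp add: power_add sum_divide_distrib[symmetric])
      finally have eq2: "vs (t + m1) (U - W1) = u ^ (t + m1) * (\<Sum>i\<in>?J. b i / u ^ m1)" .
      have "(\<lambda>i. b i / u ^ m1) ` ?J \<subseteq> K2" using J'(4) by (auto simp: K2_def)
      from m2[OF D J'(1-3) this eq2] obtain W where
        W: "\<And>i. i \<in> ?J \<Longrightarrow> W i \<in> PS (t + m1 + m2) \<and> vs (t + m1 + m2) (W i) = u ^ (t + m1) * (b i / u ^ m1)"
           "disjoint_family_on W ?J" "(\<Union>i\<in>?J. W i) = U - W1" by blast
      have eqi: "u ^ (t + m1) * (b i / u ^ m1) = u ^ t * b i" for i using u by (simp add: power_add)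
      let ?W = "W(j := W1)"
      have "?W i \<in> PS (t + (m1 + m2)) \<and> vs (t + (m1 + m2)) (?W i) = u ^ t * b i" if "i \<in> J" for i
      proof (cases "i = j")
        case True
        then show ?thesis using W1 PS_mono[OF W1(1), of "t + (m1 + m2)"] vs_mono_level[OF W1(1), of "t + (m1 + m2)"] by simp
      next
        case False
        then have "?W i = W i" by simp
        then show ?thesis using W(1)[of i] that False unfolding eqi by (simp add: add.assoc)
      qed
      moreover have "disjoint_family_on ?W J"
        unfolding disjoint_family_on_def
      proof (intro ballI impI)
        fix i k assume ik: "i \<in> J" "k \<in> J" "i \<noteq> k"
        have *: "W i \<subseteq> U - W1" if "i \<in> ?J" for i using W(3) that by blast
        show "?W i \<inter> ?W k = {}"
          using ik W(2) *[of i] *[of k] unfolding disjoint_family_on_def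
          by (cases "i = j"; cases "k = j") auto
      qed
      moreover have "(\<Union>i\<in>J. ?W i) = U"
      proof -
        have "(\<Union>i\<in>J. ?W i) = W1 \<union> (\<Union>i\<in>?J. W i)" using j by auto
        then show ?thesis unfolding W(3) using W1(2) by blast
      qed
      ultimately show ?thesis by blast
    qed
  qed
qed

end


section \<open>Matching two rich trees with the same total weight\<close>

locale piece_tree_pair =
  A: rich_piece_tree Om P nu rho u C Z Phi + B: rich_piece_tree Om' P' nu' rho u C Z Phi'
  for Om :: "'a::heine_borel set" and Om' :: "'b::heine_borel set" and P nu P' nu' rho u C Z Phi Phi' +
  assumes total: "nu 0 Om = nu' 0 Om'"
begin

text \<open>\<open>U\<close> and \<open>V\<close> may consist of any number of pieces, while the
  depth of \<open>carve_family\<close> depends on a bound for the number of parts. Grouping both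
  sides into clusters of bounded size and equal weight first makes \<open>m\<close> independent of
  \<open>t\<close>, \<open>U\<close> and \<open>V\<close>.\<close>

lemma transfer_pieces:
  "\<exists>m. \<forall>t U V. U \<in> A.PS t \<longrightarrow> V \<in> B.PS t \<longrightarrow> A.vs t U = B.vs t V \<longrightarrow>
     (\<exists>W. (\<forall>D\<in>{D\<in>P' t. D \<subseteq> V}. W D \<in> A.PS (t + m) \<and> A.vs (t + m) (W D) = nu' t D) \<and>
        disjoint_family_on W {D\<in>P' t. D \<subseteq> V} \<and> (\<Union>D\<in>{D\<in>P' t. D \<subseteq> V}. W D) = U)"
proof -
  let ?K = "Phi \<union> Phi'"
  have K: "finite ?K" "\<And>y. y \<in> ?K \<Longrightarrow> 0 < y" using A.fin_Phi B.fin_Phi A.Phi_pos B.Phi_pos by auto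
  obtain N where N: "\<And>(I::'a set set) (J::'b set set) a b. finite I \<Longrightarrow> finite J \<Longrightarrow> a ` I \<subseteq> ?K \<Longrightarrow> b ` J \<subseteq> ?K \<Longrightarrow>
      sum a I = sum b J \<Longrightarrow>
      (\<exists>n F G. disjoint_family_on F {..<n::nat} \<and> disjoint_family_on G {..<n} \<and>
         (\<Union>k<n. F k) = I \<and> (\<Union>k<n. G k) = J \<and>
         (\<forall>k<n. G k \<noteq> {} \<and> card (G k) \<le> N \<and> sum a (F k) = sum b (G k)))"
    using equal_sum_cluster_partition[OF K, where 'i = "'a set" and 'j = "'b set"] by metis
  obtain m where m: "\<And>t U (J::'b set set) b. U \<in> A.PS t \<Longrightarrow> finite J \<Longrightarrow> J \<noteq> {} \<Longrightarrow> card J \<le> Suc N \<Longrightarrow> b ` J \<subseteq> Phi' \<Longrightarrow>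
    A.vs t U = u ^ t * sum b J \<Longrightarrow>
    (\<exists>W. (\<forall>j\<in>J. W j \<in> A.PS (t + m) \<and> A.vs (t + m) (W j) = u ^ t * b j) \<and> disjoint_family_on W J \<and> (\<Union>j\<in>J. W j) = U)"
    using A.carve_family[OF B.fin_Phi B.Phi_Z B.Phi_pos, where 'j = "'b set" and n = N] by metis
  show ?thesis
  proof (rule exI[of _ m], intro allI impI)
    fix t U V assume U: "U \<in> A.PS t" and V: "V \<in> B.PS t" and eq: "A.vs t U = B.vs t V"
    let ?I = "{D\<in>P t. D \<subseteq> U}" and ?J = "{D\<in>P' t. D \<subseteq> V}"
    have ut: "u ^ t > 0" using A.u by simp
    have fin: "finite ?I" "finite ?J" using A.fin_P B.fin_P by auto
    have sub: "(\<lambda>D. nu t D / u ^ t) ` ?I \<subseteq> ?K" "(\<lambda>D. nu' t D / u ^ t) ` ?J \<subseteq> ?K"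
      using A.nu_Phi B.nu_Phi by auto
    have s: "(\<Sum>D\<in>?I. nu t D / u ^ t) = (\<Sum>D\<in>?J. nu' t D / u ^ t)"
      using eq by (simp add: A.vs_def B.vs_def sum_divide_distrib[symmetric])
    from N[OF fin sub s] obtain n F G where
      F: "disjoint_family_on F {..<n::nat}" and G: "disjoint_family_on G {..<n}" and
      UF: "(\<Union>k<n. F k) = ?I" and UG: "(\<Union>k<n. G k) = ?J" and
      cl: "\<And>k. k < n \<Longrightarrow> G k \<noteq> {}" "\<And>k. k < n \<Longrightarrow> card (G k) \<le> N"
        "\<And>k. k < n \<Longrightarrow> (\<Sum>D\<in>F k. nu t D / u ^ t) = (\<Sum>D\<in>G k. nu' t D / u ^ t)"
      by (elim exE conjE) simp
    have FP: "F k \<subseteq> P t" "F k \<subseteq> ?I" if "k < n" for k using UF that by blast+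
    have GP: "G k \<subseteq> ?J" if "k < n" for k using UG that by blast
    have "\<exists>W. (\<forall>D\<in>G k. W D \<in> A.PS (t + m) \<and> A.vs (t + m) (W D) = u ^ t * (nu' t D / u ^ t)) \<and>
        disjoint_family_on W (G k) \<and> (\<Union>D\<in>G k. W D) = \<Union>(F k)" if k: "k < n" for k
    proof (rule m)
      show "\<Union>(F k) \<in> A.PS t" using A.PS_Union FP(1)[OF k] .
      show "finite (G k)" using GP[OF k] fin(2) by (rule finite_subset)
      show "G k \<noteq> {}" "card (G k) \<le> Suc N" using cl(1,2)[OF k] by auto
      show "(\<lambda>D. nu' t D / u ^ t) ` G k \<subseteq> Phi'" using GP[OF k] B.nu_Phi by auto
      have "A.vs t (\<Union>(F k)) = u ^ t * (\<Sum>D\<in>F k. nu t D / u ^ t)"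
        using A.vs_Union[OF FP(1)[OF k]] A.u by (simp add: sum_divide_distrib[symmetric])
      then show "A.vs t (\<Union>(F k)) = u ^ t * (\<Sum>D\<in>G k. nu' t D / u ^ t)" using cl(3)[OF k] by simp
    qed
    then have "\<forall>k. \<exists>W. k < n \<longrightarrow> (\<forall>D\<in>G k. W D \<in> A.PS (t + m) \<and> A.vs (t + m) (W D) = nu' t D) \<and>
        disjoint_family_on W (G k) \<and> (\<Union>D\<in>G k. W D) = \<Union>(F k)" using A.u by auto
    then obtain W where W: "\<And>k D. k < n \<Longrightarrow> D \<in> G k \<Longrightarrow> W k D \<in> A.PS (t + m) \<and> A.vs (t + m) (W k D) = nu' t D"
      "\<And>k. k < n \<Longrightarrow> disjoint_family_on (W k) (G k)" "\<And>k. k < n \<Longrightarrow> (\<Union>D\<in>G k. W k D) = \<Union>(F k)"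
      by metis
    define idx where "idx D = (THE k. k < n \<and> D \<in> G k)" for D
    have idx: "idx D = k" if "k < n" "D \<in> G k" for k D
      unfolding idx_def
    proof (rule the_equality)
      fix k' assume "k' < n \<and> D \<in> G k'"
      then show "k' = k" using G that unfolding disjoint_family_on_def by blast
    qed (use that in blast)
    define WW where "WW D = W (idx D) D" for D
    have 1: "\<forall>D\<in>?J. WW D \<in> A.PS (t + m) \<and> A.vs (t + m) (WW D) = nu' t D"
    proof
      fix D assume "D \<in> ?J"
      then obtain k where "k < n" "D \<in> G k" using UG by blast
      then show "WW D \<in> A.PS (t + m) \<and> A.vs (t + m) (WW D) = nu' t D" using W(1) idx by (simp add: WW_def)
    qed
    have sub: "WW D \<subseteq> \<Union>(F k)" if "k < n" "D \<in> G k" for k D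
      using W(3)[OF that(1)] that idx[OF that] unfolding WW_def by blast
    have disF: "\<Union>(F k) \<inter> \<Union>(F k') = {}" if "k < n" "k' < n" "k \<noteq> k'" for k k'
    proof (rule ccontr)
      assume "\<Union>(F k) \<inter> \<Union>(F k') \<noteq> {}"
      then obtain D D' x where D: "D \<in> F k" "D' \<in> F k'" "x \<in> D" "x \<in> D'" by blast
      then have "D = D'" using A.P_eqI[of D t D' x] FP(1) that by blast
      then show False using D F that unfolding disjoint_family_on_def by blast
    qed
    have 2: "disjoint_family_on WW ?J"
      unfolding disjoint_family_on_def
    proof (intro ballI impI)
      fix D D' assume "D \<in> ?J" "D' \<in> ?J" and ne: "D \<noteq> D'"
      obtain k where k1: "k < n" "D \<in> G k" using \<open>D \<in> ?J\<close> unfolding UG[symmetric] by blast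
      obtain k' where k2: "k' < n" "D' \<in> G k'" using \<open>D' \<in> ?J\<close> unfolding UG[symmetric] by blast
      note k = k1 k2
      show "WW D \<inter> WW D' = {}"
      proof (cases "k = k'")
        case True
        have "W k D \<inter> W k D' = {}"
          using W(2)[OF k(1)] k(2,4) ne True unfolding disjoint_family_on_def by simp
        then show ?thesis using True idx[OF k(1,2)] idx[OF k(3,4)] by (simp add: WW_def)
      next
        case False
        then show ?thesis using sub[OF k(1,2)] sub[OF k(3,4)] disF[OF k(1,3)] by blast
      qed
    qed
    have "(\<Union>D\<in>?J. WW D) = (\<Union>k<n. \<Union>D\<in>G k. WW D)" unfolding UG[symmetric] by blast
    also have "\<dots> = (\<Union>k<n. \<Union>D\<in>G k. W k D)" using idx by (simp add: WW_def)
    also have "\<dots> = (\<Union>k<n. \<Union>(F k))" using W(3) by simp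
    also have "\<dots> = \<Union>?I" unfolding UF[symmetric] by blast
    also have "\<dots> = U" using A.PS_eq_Union[OF U] .
    finally show "\<exists>W. (\<forall>D\<in>?J. W D \<in> A.PS (t + m) \<and> A.vs (t + m) (W D) = nu' t D) \<and>
        disjoint_family_on W ?J \<and> (\<Union>D\<in>?J. W D) = U" using 1 2 by blast
  qed
qed

lemma bilipschitz_bijection:
  "\<exists>f L. 1 \<le> L \<and> bij_betw f Om Om' \<and>
    (\<forall>x\<in>Om. \<forall>y\<in>Om. dist x y \<le> L * dist (f x) (f y) \<and> dist (f x) (f y) \<le> L * dist x y)"
proof -
  obtain m1 where m1': "\<forall>t U V. U \<in> A.PS t \<longrightarrow> V \<in> B.PS t \<longrightarrow> A.vs t U = B.vs t V \<longrightarrow>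
     (\<exists>W. (\<forall>D\<in>{D\<in>P' t. D \<subseteq> V}. W D \<in> A.PS (t + m1) \<and> A.vs (t + m1) (W D) = nu' t D) \<and>
        disjoint_family_on W {D\<in>P' t. D \<subseteq> V} \<and> (\<Union>D\<in>{D\<in>P' t. D \<subseteq> V}. W D) = U)"
    using transfer_pieces by (elim exE) (rule that)
  note m1 = m1'[rule_format]
  have ph: "\<exists>x. x \<in> Phi" "\<exists>x. x \<in> Phi'" using A.nu_Phi[of Om 0] B.nu_Phi[of Om' 0] A.P_0 B.P_0 by auto
  define pmin where "pmin = Min Phi"
  define pmax where "pmax = Max Phi'"
  have pmin: "0 < pmin" "\<And>x. x \<in> Phi \<Longrightarrow> pmin \<le> x"
  proof -
    have "Min Phi \<in> Phi" using A.fin_Phi ph(1) by (intro Min_in) auto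
    then show "0 < pmin" unfolding pmin_def by (rule A.Phi_pos)
    show "pmin \<le> x" if "x \<in> Phi" for x unfolding pmin_def using A.fin_Phi that by simp
  qed
  have pmax: "\<And>x. x \<in> Phi' \<Longrightarrow> x \<le> pmax" using B.fin_Phi unfolding pmax_def by auto
  \<comment> \<open>Bounds the number of pieces of level \<open>t + m1\<close> in a \<open>U\<close>
    matched with one piece of level \<open>t\<close>: each weighs at least
    \<open>pmin * u ^ (t + m1)\<close>, all together at most \<open>pmax * u ^ t\<close>.\<close>
  define N where "N = nat \<lceil>pmax / (pmin * u ^ m1)\<rceil>"
  define K where "K = (\<lambda>x. x * u ^ m1) ` Phi"
  have K: "finite K" "K \<subseteq> Z" "\<And>y. y \<in> K \<Longrightarrow> 0 < y"
    using A.fin_Phi A.Phi_Z A.Z_scale(1) A.Phi_pos A.u by (auto simp: K_def)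
  obtain m0 where m0: "\<And>t V (J::'a set set) b. V \<in> B.PS t \<Longrightarrow> finite J \<Longrightarrow> J \<noteq> {} \<Longrightarrow> card J \<le> Suc N \<Longrightarrow> b ` J \<subseteq> K \<Longrightarrow>
    B.vs t V = u ^ t * sum b J \<Longrightarrow>
    (\<exists>W. (\<forall>j\<in>J. W j \<in> B.PS (t + m0) \<and> B.vs (t + m0) (W j) = u ^ t * b j) \<and> disjoint_family_on W J \<and> (\<Union>j\<in>J. W j) = V)"
    using B.carve_family[OF K, where 'j = "'a set" and n = N] by metis
  \<comment> \<open>Level \<open>t + m2\<close> is below both the parts carved from \<open>V\<close>
    (depth \<open>m0\<close>) and the pieces of \<open>U\<close> (depth \<open>m1\<close>);
    \<open>Suc\<close> makes the level increase strictly. The children on the first side are unions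
    of pieces of level \<open>t + m2 + m1\<close>, and \<open>C1\<close> is the cost of comparing
    their gaps with \<open>rho ^ t\<close>.\<close>
  define m2 where "m2 = Suc (m0 + m1)"
  define C1 where "C1 = C / rho ^ (m1 + m2)"
  have rp: "0 < rho ^ n" "rho ^ n \<le> 1" for n using A.rho by (auto intro: power_le_one)
  have C1: "C \<le> C1" unfolding C1_def using rp[of "m1 + m2"] A.C by (simp add: field_simps)
  \<comment> \<open>\<open>V\<close> is a single piece, but \<open>U\<close> is only a union of
    finer pieces of the same total weight, so its diameter has to be carried along as an
    invariant.\<close>
  define M where "M t U V \<longleftrightarrow> V \<in> P' t \<and> U \<in> A.PS (t + m1) \<and> U \<noteq> {} \<and> A.vs (t + m1) U = nu' t V \<and>
     (\<forall>x\<in>U. \<forall>y\<in>U. dist x y \<le> C1 * rho ^ t)" for t U V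
  have step: "\<exists>S. (\<forall>s\<in>S. M (fst s) (fst (snd s)) (snd (snd s)) \<and> t < fst s) \<and>
            (\<Union>s\<in>S. fst (snd s)) = U \<and> (\<Union>s\<in>S. snd (snd s)) = V \<and>
            (\<forall>s\<in>S. \<forall>s'\<in>S. s \<noteq> s' \<longrightarrow>
               (\<forall>x\<in>fst (snd s). \<forall>y\<in>fst (snd s'). rho ^ t \<le> C1 * dist x y) \<and>
               (\<forall>x\<in>snd (snd s). \<forall>y\<in>snd (snd s'). rho ^ t \<le> C1 * dist x y))"
    if MM: "M t U V" for t U V
  proof -
    have V: "V \<in> P' t" and U: "U \<in> A.PS (t + m1)" "U \<noteq> {}" and eq: "A.vs (t + m1) U = nu' t V"
      using MM by (auto simp: M_def)
    let ?J = "{A\<in>P (t + m1). A \<subseteq> U}"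
    have finJ: "finite ?J" using A.fin_P by simp
    have neJ: "?J \<noteq> {}" using A.PS_eq_Union[OF U(1)] U(2) by (metis Union_empty)
    have ut: "0 < u ^ t" "0 < u ^ (t + m1)" "0 < u ^ m1" using A.u by auto
    have lo: "pmin * u ^ (t + m1) \<le> nu (t + m1) A" if "A \<in> ?J" for A
      using pmin(2)[OF A.nu_Phi[of A "t + m1"]] that ut(2) by (simp add: field_simps)
    have "real (card ?J) * (pmin * u ^ (t + m1)) \<le> (\<Sum>A\<in>?J. nu (t + m1) A)"
      using sum_mono[of ?J "\<lambda>_. pmin * u ^ (t + m1)" "nu (t + m1)"] lo by simp
    also have "\<dots> = nu' t V" using eq by (simp add: A.vs_def)
    also have "\<dots> \<le> pmax * u ^ t" using pmax[OF B.nu_Phi[OF V]] ut by (simp add: field_simps)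
    finally have "real (card ?J) * (pmin * u ^ m1) * u ^ t \<le> pmax * u ^ t" by (simp add: power_add algebra_simps)
    then have "real (card ?J) * (pmin * u ^ m1) \<le> pmax" using ut by simp
    then have "real (card ?J) \<le> pmax / (pmin * u ^ m1)" using pmin(1) ut(3) by (simp add: field_simps)
    then have cardJ: "card ?J \<le> Suc N" unfolding N_def by linarith
    have bK: "(\<lambda>A. nu (t + m1) A / u ^ t) ` ?J \<subseteq> K"
    proof
      fix y assume "y \<in> (\<lambda>A. nu (t + m1) A / u ^ t) ` ?J"
      then obtain A where A: "A \<in> P (t + m1)" "y = nu (t + m1) A / u ^ t" by blast
      then have "y = nu (t + m1) A / u ^ (t + m1) * u ^ m1" using A.u by (simp add: power_add)
      then show "y \<in> K" unfolding K_def by (rule image_eqI[OF _ A.nu_Phi[OF A(1)]])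
    qed
    have "B.vs t V = u ^ t * (\<Sum>A\<in>?J. nu (t + m1) A / u ^ t)"
      using eq B.vs_piece[OF V] A.u by (simp add: A.vs_def sum_divide_distrib[symmetric])
    \<comment> \<open>First \<open>V\<close> is cut to match the pieces \<open>A\<close> of
      \<open>U\<close>; afterwards each \<open>A\<close> is cut to match the pieces of its part
      \<open>Y A\<close>. The first cut confines every new set on the left to one piece
      \<open>A\<close>; without it the diameter constant would grow with each generation.\<close>
    from m0[OF B.P_in_PS[OF V] finJ neJ cardJ bK this]
    obtain Y where Y0: "\<And>A. A \<in> ?J \<Longrightarrow> Y A \<in> B.PS (t + m0) \<and> B.vs (t + m0) (Y A) = u ^ t * (nu (t + m1) A / u ^ t)"
      and Yd: "disjoint_family_on Y ?J" and YU: "(\<Union>A\<in>?J. Y A) = V" by blast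
    define s where "s = t + m2"
    have s: "t + m0 \<le> s" "t + m1 \<le> s" "t < s" by (auto simp: s_def m2_def)
    have Y: "Y A \<in> B.PS s" "B.vs s (Y A) = nu (t + m1) A" if "A \<in> ?J" for A
      using Y0[OF that] B.PS_mono[OF _ s(1)] B.vs_mono_level[OF _ s(1), of "Y A"] A.u by auto
    have AS: "A \<in> A.PS s" "A.vs s A = nu (t + m1) A" if "A \<in> ?J" for A
      using that A.PS_mono[OF A.P_in_PS s(2), of A] A.vs_mono_level[OF A.P_in_PS s(2), of A] A.vs_piece by auto
    have "\<forall>A\<in>?J. \<exists>W. (\<forall>D\<in>{D\<in>P' s. D \<subseteq> Y A}. W D \<in> A.PS (s + m1) \<and> A.vs (s + m1) (W D) = nu' s D) \<and>
        disjoint_family_on W {D\<in>P' s. D \<subseteq> Y A} \<and> (\<Union>D\<in>{D\<in>P' s. D \<subseteq> Y A}. W D) = A"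
    proof
      fix A assume A: "A \<in> ?J"
      show "\<exists>W. (\<forall>D\<in>{D\<in>P' s. D \<subseteq> Y A}. W D \<in> A.PS (s + m1) \<and> A.vs (s + m1) (W D) = nu' s D) \<and>
        disjoint_family_on W {D\<in>P' s. D \<subseteq> Y A} \<and> (\<Union>D\<in>{D\<in>P' s. D \<subseteq> Y A}. W D) = A"
        by (rule m1[OF AS(1)[OF A] Y(1)[OF A]]) (simp only: AS(2)[OF A] Y(2)[OF A])
    qed
    from bchoice[OF this] obtain W where
      WW: "\<forall>A\<in>?J. (\<forall>D\<in>{D\<in>P' s. D \<subseteq> Y A}. W A D \<in> A.PS (s + m1) \<and> A.vs (s + m1) (W A D) = nu' s D) \<and>
        disjoint_family_on (W A) {D\<in>P' s. D \<subseteq> Y A} \<and> (\<Union>D\<in>{D\<in>P' s. D \<subseteq> Y A}. W A D) = A"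
      by (elim exE) (rule that)
    have W1: "W A D \<in> A.PS (s + m1) \<and> A.vs (s + m1) (W A D) = nu' s D"
      if "A \<in> ?J" "D \<in> P' s" "D \<subseteq> Y A" for A D
      using conjunct1[OF bspec[OF WW that(1)]] that(2,3) by simp
    have W2: "disjoint_family_on (W A) {D\<in>P' s. D \<subseteq> Y A}" if "A \<in> ?J" for A
      using conjunct1[OF conjunct2[OF bspec[OF WW that]]] .
    have W3: "(\<Union>D\<in>{D\<in>P' s. D \<subseteq> Y A}. W A D) = A" if "A \<in> ?J" for A
      using conjunct2[OF conjunct2[OF bspec[OF WW that]]] .
    define S where "S = (\<Union>A\<in>?J. (\<lambda>D. (s, W A D, D)) ` {D\<in>P' s. D \<subseteq> Y A})"
    have WA: "W A D \<subseteq> A" if "A \<in> ?J" "D \<in> P' s" "D \<subseteq> Y A" for A D using W3[OF that(1)] that by blast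
    have MS: "M s (W A D) D" if A: "A \<in> ?J" "D \<in> P' s" "D \<subseteq> Y A" for A D
      unfolding M_def
    proof (intro conjI ballI)
      show "D \<in> P' s" "W A D \<in> A.PS (s + m1)" "A.vs (s + m1) (W A D) = nu' s D" using W1[OF A] A by auto
      have "0 < A.vs (s + m1) (W A D)" using W1[OF A] B.nu_pos[OF A(2)] by simp
      moreover have "A.vs (s + m1) {} = 0" using A.ne_P by (force simp: A.vs_def intro: sum.neutral)
      ultimately show "W A D \<noteq> {}" by force
      fix x y assume "x \<in> W A D" "y \<in> W A D"
      then have "dist x y \<le> C * rho ^ (t + m1)" using WA[OF A] A(1) A.diam_P[of A "t + m1" x y] by blast
      also have "\<dots> \<le> C1 * rho ^ s"
      proof -
        have "C1 * rho ^ s = C * (rho ^ t / rho ^ m1)"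
          using A.rho by (simp add: C1_def s_def power_add)
        moreover have "rho ^ (t + m1) \<le> rho ^ t / rho ^ m1"
        proof -
          have "rho ^ t * (rho ^ m1 * rho ^ m1) \<le> rho ^ t * 1"
            using rp[of m1] rp[of t] by (intro mult_left_mono mult_le_one) auto
          then show ?thesis using rp[of m1] by (simp add: power_add field_simps)
        qed
        ultimately show ?thesis using mult_left_mono[of "rho ^ (t + m1)" "rho ^ t / rho ^ m1" C] A.C by linarith
      qed
      finally show "dist x y \<le> C1 * rho ^ s" .
    qed
    have gapU: "rho ^ t \<le> C1 * dist x y" if "rho ^ (s + m1) \<le> C * dist x y" for x y :: 'a
    proof -
      have "rho ^ t * rho ^ (m1 + m2) \<le> C * dist x y" using that by (simp add: s_def power_add algebra_simps)
      then show ?thesis using rp[of "m1 + m2"] by (simp add: C1_def field_simps)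
    qed
    have gapV: "rho ^ t \<le> C1 * dist x y" if "rho ^ s \<le> C * dist x y" for x y :: 'b
    proof -
      have "rho ^ (s + m1) \<le> rho ^ s" using A.rho by (intro power_decreasing) auto
      then have "rho ^ t * rho ^ (m1 + m2) \<le> C * dist x y" using that by (simp add: s_def power_add algebra_simps)
      then show ?thesis using rp[of "m1 + m2"] by (simp add: C1_def field_simps)
    qed
    have gaps: "(\<forall>x\<in>W A D. \<forall>y\<in>W A' D'. rho ^ t \<le> C1 * dist x y) \<and> (\<forall>x\<in>D. \<forall>y\<in>D'. rho ^ t \<le> C1 * dist x y)"
      if A: "A \<in> ?J" "D \<in> P' s" "D \<subseteq> Y A" and A': "A' \<in> ?J" "D' \<in> P' s" "D' \<subseteq> Y A'"
        and ne: "(s, W A D, D) \<noteq> (s, W A' D', D')" for A D A' D'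
    proof -
      have AA: "A = A'" if "D = D'"
      proof (rule ccontr)
        assume "A \<noteq> A'"
        then have "Y A \<inter> Y A' = {}" using Yd A A' unfolding disjoint_family_on_def by blast
        moreover have "D \<noteq> {}" using B.ne_P A by blast
        ultimately show False using A A' that by blast
      qed
      then have DD: "D \<noteq> D'" using ne by blast
      have "W A D \<inter> W A' D' = {}"
      proof (cases "A = A'")
        case True
        then show ?thesis using W2[OF A(1)] A A' DD unfolding disjoint_family_on_def by blast
      next
        case False
        then have "A \<inter> A' = {}" using A.disjoint_P[of A "t + m1" A'] A A' by blast
        then show ?thesis using WA[OF A] WA[OF A'] by blast
      qed
      then have "rho ^ (s + m1) \<le> C * dist x y" if "x \<in> W A D" "y \<in> W A' D'" for x y
        using A.PS_gap[of "W A D" "s + m1" "W A' D'" x y] W1[OF A] W1[OF A'] that by blast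
      moreover have "rho ^ s \<le> C * dist x y" if "x \<in> D" "y \<in> D'" for x y
        using B.gap_P[OF A(2) A'(2) DD that] .
      ultimately show ?thesis using gapU gapV by blast
    qed
    show ?thesis
    proof (intro exI[of _ S] conjI ballI impI)
      show "M (fst z) (fst (snd z)) (snd (snd z))" "t < fst z" if "z \<in> S" for z
        using that MS s(3) unfolding S_def by auto
      have "(\<Union>z\<in>S. fst (snd z)) = (\<Union>A\<in>?J. \<Union>D\<in>{D\<in>P' s. D \<subseteq> Y A}. W A D)" unfolding S_def by force
      also have "\<dots> = (\<Union>A\<in>?J. A)" using W3 by simp
      also have "\<dots> = U" using A.PS_eq_Union[OF U(1)] by simp
      finally show "(\<Union>z\<in>S. fst (snd z)) = U" .
      have "(\<Union>z\<in>S. snd (snd z)) = (\<Union>A\<in>?J. \<Union>{D\<in>P' s. D \<subseteq> Y A})" unfolding S_def by force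
      also have "\<dots> = (\<Union>A\<in>?J. Y A)" using B.PS_eq_Union[OF Y(1)] by simp
      finally show "(\<Union>z\<in>S. snd (snd z)) = V" using YU by simp
      fix z z' assume "z \<in> S" "z' \<in> S" "z \<noteq> z'"
      then obtain A D A' D' where *: "A \<in> ?J" "D \<in> P' s" "D \<subseteq> Y A" "A' \<in> ?J" "D' \<in> P' s" "D' \<subseteq> Y A'"
        and z: "z = (s, W A D, D)" "z' = (s, W A' D', D')" unfolding S_def by auto
      show "rho ^ t \<le> C1 * dist x y" if "x \<in> fst (snd z)" "y \<in> fst (snd z')" for x y
        using gaps[OF *] z \<open>z \<noteq> z'\<close> that by auto
      show "rho ^ t \<le> C1 * dist x y" if "x \<in> snd (snd z)" "y \<in> snd (snd z')" for x y
        using gaps[OF *] z \<open>z \<noteq> z'\<close> that by auto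
    qed
  qed
  have start: "M 0 Om Om'"
    unfolding M_def
  proof (intro conjI ballI)
    show "Om' \<in> P' 0" "Om \<in> A.PS (0 + m1)" "Om \<noteq> {}" using B.P_0 A.X_in_PS A.X_ne by auto
    show "A.vs (0 + m1) Om = nu' 0 Om'"
      using A.vs_mono_level[OF A.X_in_PS, of 0 m1] A.vs_piece[of Om 0] A.P_0 total by simp
    fix x y assume "x \<in> Om" "y \<in> Om"
    then show "dist x y \<le> C1 * rho ^ 0" using A.diam_P[of Om 0 x y] A.P_0 C1 by simp
  qed
  have "\<exists>f. bij_betw f Om Om' \<and>
    (\<forall>x\<in>Om. \<forall>y\<in>Om. dist x y \<le> C1\<^sup>2 * dist (f x) (f y) \<and> dist (f x) (f y) \<le> C1\<^sup>2 * dist x y)"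
  proof (rule gluing[of rho C1 M, OF A.rho _ _ _ _ _ step start])
    show "1 \<le> C1" using A.C C1 by simp
    show "compact U \<and> U \<noteq> {}" if "M t U V" for t U V using that A.PS_compact unfolding M_def by blast
    show "compact V \<and> V \<noteq> {}" if "M t U V" for t U V
      using that B.PS_compact[OF B.P_in_PS] B.ne_P unfolding M_def by blast
    show "dist x y \<le> C1 * rho ^ t" if "M t U V" "x \<in> U" "y \<in> U" for t U V x y using that unfolding M_def by blast
    show "dist x y \<le> C1 * rho ^ t" if "M t U V" "x \<in> V" "y \<in> V" for t U V x y
    proof -
      have "dist x y \<le> C * rho ^ t" using that B.diam_P unfolding M_def by blast
      also have "\<dots> \<le> C1 * rho ^ t" using C1 rp by simp
      finally show ?thesis .
    qed
  qed
  then obtain f where "bij_betw f Om Om'"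
    "\<forall>x\<in>Om. \<forall>y\<in>Om. dist x y \<le> C1\<^sup>2 * dist (f x) (f y) \<and> dist (f x) (f y) \<le> C1\<^sup>2 * dist x y" by blast
  moreover have "1 \<le> C1\<^sup>2" using A.C C1 by (simp add: one_le_power)
  ultimately show ?thesis by blast
qed

end

subsection \<open>Words and renewal\<close>

text \<open>The differences of semigroup elements are closed under taking remainders by the least
  positive one. So this one divides every \<open>l i\<close> and equals 1, and two consecutive
  elements \<open>b\<close> and \<open>b + 1\<close> produce the whole window from
  \<open>M * b\<close> to \<open>M * b + M\<close>.\<close>

lemma numerical_semigroup:
  fixes l :: "nat \<Rightarrow> nat"
  assumes g: "Gcd (l ` {..<N}) = 1"
  shows "\<exists>a. \<forall>k\<le>M. \<exists>c. a + k = (\<Sum>i<N. c i * l i)"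
proof -
  define S where "S a \<longleftrightarrow> (\<exists>c. a = (\<Sum>i<N. c i * l i))" for a
  have S_add: "S (a + b)" if ab: "S a" "S b" for a b
  proof -
    obtain c d where "a = (\<Sum>i<N. c i * l i)" "b = (\<Sum>i<N. d i * l i)" using ab unfolding S_def by blast
    then show ?thesis unfolding S_def
      by (intro exI[of _ "\<lambda>i. c i + d i"]) (simp add: sum.distrib algebra_simps)
  qed
  have S_0: "S 0" unfolding S_def by (intro exI[of _ "\<lambda>_. 0"]) simp
  have S_mult: "S (k * a)" if "S a" for k a
    using that by (induction k) (auto simp: S_0 S_add)
  have S_l: "S (l i)" if "i < N" for i
    unfolding S_def using that
    by (intro exI[of _ "\<lambda>j. if j = i then 1 else 0"]) (simp add: if_distrib[of "\<lambda>x. x * _"] cong: if_cong)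
  define D where "D x \<longleftrightarrow> (\<exists>b. S b \<and> S (b + x))" for x
  have D_l: "D (l i)" if "i < N" for i unfolding D_def using S_0 S_l[OF that] by auto
  have "\<exists>i<N. l i \<noteq> 0"
  proof (rule ccontr)
    assume "\<not> ?thesis"
    then have "Gcd (l ` {..<N}) = 0" by (simp add: Gcd_0_iff image_subset_iff)
    then show False using g by simp
  qed
  then obtain i0 where "i0 < N" "l i0 \<noteq> 0" by blast
  then have ex: "\<exists>x. D x \<and> 0 < x" using D_l by auto
  define d where "d = (LEAST x. D x \<and> 0 < x)"
  have d: "D d" "0 < d" using LeastI_ex[OF ex] unfolding d_def by auto
  have least: "d \<le> x" if "D x" "0 < x" for x unfolding d_def using that by (intro Least_le) auto
  have dm: "D (x mod d)" if Dx: "D x" for x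
  proof -
    obtain b where b: "S b" "S (b + d)" using d by (auto simp: D_def)
    obtain a where a: "S a" "S (a + x)" using Dx by (auto simp: D_def)
    let ?k = "x div d"
    have "S (a + ?k * (b + d))" using S_add a b S_mult by blast
    moreover have "S (a + x + ?k * b)" using S_add a b S_mult by blast
    moreover have "a + x + ?k * b = a + ?k * (b + d) + x mod d"
    proof -
      have "x = ?k * d + x mod d" by simp
      then have "a + x + ?k * b = a + (?k * d + x mod d) + ?k * b" by presburger
      then show ?thesis by (simp add: algebra_simps)
    qed
    ultimately show ?thesis unfolding D_def by metis
  qed
  have "d dvd x" if "x \<in> l ` {..<N}" for x
  proof -
    have "D (x mod d)" using that D_l dm by auto
    moreover have "x mod d < d" using d by simp
    ultimately have "x mod d = 0" using least[of "x mod d"] by (meson not_le neq0_conv)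
    then show ?thesis by auto
  qed
  then have "d dvd Gcd (l ` {..<N})" by (rule Gcd_greatest)
  then have "d = 1" using g by simp
  then obtain b where b: "S b" "S (b + 1)" using d by (auto simp: D_def)
  have "S (M * b + k)" if "k \<le> M" for k
  proof -
    have "S (k * (b + 1) + (M - k) * b)" using S_add S_mult b by blast
    moreover have "k * (b + 1) + (M - k) * b = M * b + k"
    proof -
      have "k * b + (M - k) * b = M * b" using that by (simp add: add_mult_distrib[symmetric])
      then show ?thesis by (simp add: algebra_simps)
    qed
    ultimately show ?thesis by metis
  qed
  then show ?thesis unfolding S_def by blast
qed

text \<open>In the paper's notation \<open>l i\<close> is \<open>\<lambda>\<^sub>i\<close> and \<open>p\<close> is the measure root.\<close>

locale weighted_alphabet =
  fixes N :: nat and l :: "nat \<Rightarrow> nat" and p :: real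
  assumes N: "2 \<le> N" and l_pos: "\<And>i. i < N \<Longrightarrow> 0 < l i" and p: "0 < p" "p < 1"
    and gcd_l: "Gcd (l ` {..<N}) = 1" and sum_p: "(\<Sum>i<N. p ^ l i) = 1"
begin

definition M :: nat where "M = Max (l ` {..<N})"

lemma l_le_M: "i < N \<Longrightarrow> l i \<le> M"
  unfolding M_def by simp

lemma M_attained: "\<exists>i<N. l i = M"
proof -
  have "M \<in> l ` {..<N}" unfolding M_def using N by (intro Max_in) (auto simp: lessThan_empty_iff)
  then show ?thesis by auto
qed

lemma M_pos: "0 < M"
  using M_attained l_pos by force

text \<open>The tail of the step distribution that gives \<open>l i\<close> the probability
  \<open>p ^ l i\<close>. These are the coefficients of the linear form in \<open>M\<close>
  consecutive values that the renewal recursion conserves.\<close>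

definition theta :: "nat \<Rightarrow> real" where
  "theta k = (\<Sum>i<N. if k < l i then p ^ l i else 0)"

lemma theta_nonneg: "0 \<le> theta k"
  unfolding theta_def using p by (intro sum_nonneg) auto

lemma theta_0: "theta 0 = 1"
  unfolding theta_def using sum_p l_pos by simp

text \<open>Feller's argument: along a subsequence approaching the lower limit, all shifts by elements of
  the numerical semigroup approach it as well, hence so does a whole window of length \<open>M\<close>.\<close>

lemma renewal_lower_bound:
  fixes f :: "nat \<Rightarrow> real"
  assumes rec: "\<And>n. M \<le> n \<Longrightarrow> f n = (\<Sum>i<N. p ^ l i * f (n - l i))"
    and win: "\<And>n. M \<le> n \<Longrightarrow> (\<Sum>k<M. theta k * f (n - k)) = c"
    and bdd: "\<And>n. \<bar>f n\<bar> \<le> B"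
    and eps: "0 < eps"
  shows "\<exists>n0. \<forall>n\<ge>n0. c / (\<Sum>k<M. theta k) - eps < f n"
proof -
  define Th where "Th = (\<Sum>k<M. theta k)"
  have Th: "Th \<ge> 1"
  proof -
    have "theta 0 \<le> Th" unfolding Th_def using M_pos theta_nonneg by (intro member_le_sum) auto
    then show ?thesis by (simp add: theta_0)
  qed
  \<comment> \<open>\<open>T\<close> consists of the eventual lower bounds of \<open>f\<close>, so
    its supremum \<open>L\<close> is the lower limit; \<open>low\<close> and \<open>freq\<close> are
    the two properties that characterise it.\<close>
  define T where "T = {x. \<exists>n. \<forall>k\<ge>n. x \<le> f k}"
  have ne: "- B \<in> T" unfolding T_def using bdd by (auto simp: abs_le_iff minus_le_iff intro!: exI[of _ 0])
  have up: "x \<le> B" if xT: "x \<in> T" for x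
  proof -
    obtain n where "x \<le> f n" using xT unfolding T_def by blast
    then show ?thesis using bdd[of n] by (simp add: abs_le_iff)
  qed
  have bdd_T: "bdd_above T" using up by (auto simp: bdd_above_def)
  define L where "L = Sup T"
  have low: "\<exists>n. \<forall>k\<ge>n. L - e < f k" if e0: "0 < e" for e
  proof -
    obtain x where "x \<in> T" "L - e < x" using less_cSupD[of T "L - e"] ne e0 unfolding L_def by auto
    then show ?thesis unfolding T_def by force
  qed
  have freq: "\<exists>k\<ge>n. f k < L + e" if "0 < e" for e n
  proof (rule ccontr)
    assume "\<not> ?thesis"
    then have "L + e \<in> T" unfolding T_def by (auto simp: not_less)
    then show False using cSup_upper[OF _ bdd_T] that unfolding L_def by fastforce
  qed
  define Q where "Q a \<longleftrightarrow> (\<forall>e>0. \<exists>d>0. \<exists>n0. \<forall>n\<ge>n0. f n < L + d \<longrightarrow> f (n - a) < L + e)" for a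
  have Q0: "Q 0" unfolding Q_def by auto
  have Q_add: "Q (a + b)" if qa: "Q a" and qb: "Q b" for a b
    unfolding Q_def
  proof (intro allI impI)
    fix e :: real assume "0 < e"
    then obtain d n0 where d: "0 < d" "\<And>n. n0 \<le> n \<Longrightarrow> f n < L + d \<Longrightarrow> f (n - b) < L + e"
      using qb unfolding Q_def by metis
    obtain d' n0' where d': "0 < d'" "\<And>n. n0' \<le> n \<Longrightarrow> f n < L + d' \<Longrightarrow> f (n - a) < L + d"
      using qa d(1) unfolding Q_def by metis
    have "f (n - (a + b)) < L + e" if "n \<ge> n0' + n0 + a" "f n < L + d'" for n
      using d(2)[of "n - a"] d'(2)[of n] that by simp
    then show "\<exists>d>0. \<exists>n0. \<forall>n\<ge>n0. f n < L + d \<longrightarrow> f (n - (a + b)) < L + e"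
      using d'(1) by blast
  qed
  \<comment> \<open>\<open>f n\<close> is a weighted mean of the shifted values, all eventually
    above \<open>L - d\<close>. If the mean is below \<open>L + d\<close>, the value of weight
    \<open>?q = p ^ l i\<close> exceeds \<open>L\<close> by less than \<open>2 * d / ?q\<close>, and
    \<open>d\<close> is chosen to make this \<open>e\<close>.\<close>
  have Q_l: "Q (l i)" if i: "i < N" for i
    unfolding Q_def
  proof (intro allI impI)
    fix e :: real assume e: "0 < e"
    let ?q = "p ^ l i"
    have q: "0 < ?q" "?q \<le> 1" using p by (auto intro: power_le_one)
    define d where "d = ?q * e / 2"
    have d: "0 < d" using q e by (simp add: d_def)
    obtain n1 where n1: "\<And>k. n1 \<le> k \<Longrightarrow> L - d < f k" using low[OF d] by blast
    have "f (n - l i) < L + e" if n: "n \<ge> n1 + M" "f n < L + d" for n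
    proof -
      have "(\<Sum>j\<in>{..<N} - {i}. p ^ l j * (L - d)) \<le> (\<Sum>j\<in>{..<N} - {i}. p ^ l j * f (n - l j))"
      proof (rule sum_mono)
        fix j assume "j \<in> {..<N} - {i}"
        then have "n1 \<le> n - l j" using n l_le_M[of j] by auto
        then show "p ^ l j * (L - d) \<le> p ^ l j * f (n - l j)" using n1 p by (intro mult_left_mono) (auto intro: less_imp_le)
      qed
      moreover have "(\<Sum>j\<in>{..<N} - {i}. p ^ l j * (L - d)) = (1 - ?q) * (L - d)"
        using sum.remove[of "{..<N}" i "\<lambda>j. p ^ l j"] i sum_p by (simp add: sum_distrib_right[symmetric])
      moreover have "f n = ?q * f (n - l i) + (\<Sum>j\<in>{..<N} - {i}. p ^ l j * f (n - l j))"
        using rec[of n] n i sum.remove[of "{..<N}" i "\<lambda>j. p ^ l j * f (n - l j)"] by simp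
      ultimately have "?q * f (n - l i) + (1 - ?q) * (L - d) < L + d" using n by linarith
      then have "?q * f (n - l i) < ?q * L + 2 * d - ?q * d" by (simp add: algebra_simps)
      also have "\<dots> < ?q * L + 2 * d" using q d by simp
      also have "\<dots> = ?q * (L + e)" by (simp add: d_def algebra_simps)
      finally show ?thesis using q by simp
    qed
    then show "\<exists>d>0. \<exists>n0. \<forall>n\<ge>n0. f n < L + d \<longrightarrow> f (n - l i) < L + e" using d by blast
  qed
  have Q_mult: "Q (k * a)" if "Q a" for k a
    using that by (induction k) (auto simp: Q0 Q_add)
  have Q_sum: "Q (\<Sum>i<n. c i * l i)" if "n \<le> N" for n and c :: "nat \<Rightarrow> nat"
    using that by (induction n) (auto simp: Q0 intro!: Q_add Q_mult Q_l)
  obtain a where a': "\<forall>k\<le>M. \<exists>c. a + k = (\<Sum>i<N. c i * l i)"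
    using numerical_semigroup[OF gcd_l, of M] by blast
  have a: "Q (a + k)" if k: "k \<le> M" for k
  proof -
    obtain c where "a + k = (\<Sum>i<N. c i * l i)" using a' k by blast
    then show ?thesis using Q_sum[of N c] by simp
  qed
  have "c / Th \<le> L + e" if e: "0 < e" for e
  proof -
    have "\<exists>d>0. \<exists>n0. \<forall>n\<ge>n0. f n < L + d \<longrightarrow> (\<forall>k<m. f (n - (a + k)) < L + e)" if "m \<le> M" for m
      using that
    proof (induction m)
      case 0
      then show ?case by (auto intro: exI[of _ 1])
    next
      case (Suc m)
      then obtain d n0 where d: "0 < d" "\<forall>n\<ge>n0. f n < L + d \<longrightarrow> (\<forall>k<m. f (n - (a + k)) < L + e)" by auto
      obtain d' n0' where d': "0 < d'" "\<forall>n\<ge>n0'. f n < L + d' \<longrightarrow> f (n - (a + m)) < L + e"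
        using a[of m] Suc.prems e unfolding Q_def by auto
      show ?case
        using d d' by (intro exI[of _ "min d d'"] conjI exI[of _ "max n0 n0'"]) (auto simp: less_Suc_eq)
    qed
    from this[of M] obtain d n0 where d: "0 < d" "\<And>n k. n0 \<le> n \<Longrightarrow> f n < L + d \<Longrightarrow> k < M \<Longrightarrow> f (n - (a + k)) < L + e"
      by auto
    \<comment> \<open>Near such an \<open>n\<close> a full window of \<open>M\<close> values lies
      below \<open>L + e\<close>; inserted into the conserved sum it bounds \<open>c\<close> by
      \<open>Th * (L + e)\<close>.\<close>
    obtain n where n: "n \<ge> n0 + a + M" "f n < L + d" using freq[OF d(1)] by blast
    have "c = (\<Sum>k<M. theta k * f (n - a - k))" using win[of "n - a"] n by simp
    also have "\<dots> \<le> (\<Sum>k<M. theta k * (L + e))"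
      using d(2)[of n] n theta_nonneg by (intro sum_mono mult_left_mono) (auto intro: less_imp_le)
    also have "\<dots> = Th * (L + e)" by (simp add: Th_def sum_distrib_right)
    finally show ?thesis using Th by (simp add: field_simps)
  qed
  then have "c / Th \<le> L" by (rule field_le_epsilon)
  moreover obtain n0 where "\<And>k. n0 \<le> k \<Longrightarrow> L - eps < f k" using low[OF eps] by blast
  ultimately show ?thesis unfolding Th_def by (meson diff_right_mono order_le_less_trans)
qed

text \<open>\<open>v n\<close> is the probability that the renewal process visits \<open>n\<close>.
  The identity \<open>id\<close> conserves the \<open>theta\<close>-weighted sum, and the lower
  bound applied to \<open>v\<close> and to \<open>- v\<close>, with constants 1 and -1, squeezes
  \<open>v\<close> to \<open>1 / Th\<close>.\<close>

lemma renewal_limit: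
  fixes v :: "nat \<Rightarrow> real"
  assumes v0: "v 0 = 1" and rec: "\<And>n. 0 < n \<Longrightarrow> v n = (\<Sum>i<N. if l i \<le> n then p ^ l i * v (n - l i) else 0)"
  shows "\<exists>L>0. v \<longlonglongrightarrow> L"
proof -
  have bnd: "0 \<le> v n \<and> v n \<le> 1" for n
  proof (induction n rule: less_induct)
    case (less n)
    show ?case
    proof (cases "n = 0")
      case False
      have *: "0 \<le> (if l i \<le> n then p ^ l i * v (n - l i) else 0) \<and>
          (if l i \<le> n then p ^ l i * v (n - l i) else 0) \<le> p ^ l i" if "i < N" for i
        using less[of "n - l i"] l_pos[OF that] p False by (auto intro!: mult_left_le)
      have "v n \<le> (\<Sum>i<N. p ^ l i)" using rec[of n] False * by (auto intro!: sum_mono)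
      moreover have "0 \<le> v n" using rec[of n] False * by (auto intro!: sum_nonneg)
      ultimately show ?thesis using sum_p by simp
    qed (simp add: v0)
  qed
  have id: "(\<Sum>k\<le>n. theta k * v (n - k)) = 1" for n
  proof (induction n)
    case 0
    then show ?case by (simp add: theta_0 v0)
  next
    case (Suc n)
    have th: "theta (Suc k) = theta k - (\<Sum>i<N. if l i = Suc k then p ^ l i else 0)" for k
      unfolding theta_def by (auto simp: sum_subtractf[symmetric] intro!: sum.cong)
    have "(\<Sum>k\<le>Suc n. theta k * v (Suc n - k)) = v (Suc n) + (\<Sum>k\<le>n. theta (Suc k) * v (n - k))"
      by (subst sum.atMost_Suc_shift) (simp add: theta_0)
    also have "(\<Sum>k\<le>n. theta (Suc k) * v (n - k)) =
        1 - (\<Sum>k\<le>n. (\<Sum>i<N. if l i = Suc k then p ^ l i else 0) * v (n - k))"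
      using Suc by (simp add: th left_diff_distrib sum_subtractf)
    also have "(\<Sum>k\<le>n. (\<Sum>i<N. if l i = Suc k then p ^ l i else 0) * v (n - k)) =
        (\<Sum>i<N. \<Sum>k\<le>n. if l i = Suc k then p ^ l i * v (n - k) else 0)"
      by (subst sum.swap) (auto simp: sum_distrib_right intro!: sum.cong)
    also have "\<dots> = (\<Sum>i<N. if l i \<le> Suc n then p ^ l i * v (Suc n - l i) else 0)"
    proof (rule sum.cong[OF refl])
      fix i assume "i \<in> {..<N}"
      then obtain m where m: "l i = Suc m" using l_pos[of i] gr0_conv_Suc by auto
      have "(\<Sum>k\<le>n. if l i = Suc k then p ^ l i * v (n - k) else 0) = (\<Sum>k\<le>n. if m = k then p ^ l i * v (n - k) else 0)"
        by (simp add: m)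
      also have "\<dots> = (if m \<in> {..n} then p ^ l i * v (n - m) else 0)" by (rule sum.delta') simp
      finally show "(\<Sum>k\<le>n. if l i = Suc k then p ^ l i * v (n - k) else 0) = (if l i \<le> Suc n then p ^ l i * v (Suc n - l i) else 0)"
        by (simp add: m)
    qed
    also have "\<dots> = v (Suc n)" using rec[of "Suc n"] by simp
    finally show ?case by simp
  qed
  have th0: "theta k = 0" if "M \<le> k" for k
  proof -
    have "\<not> k < l i" if "i < N" for i using l_le_M[OF that] \<open>M \<le> k\<close> by simp
    then show ?thesis unfolding theta_def by (intro sum.neutral) auto
  qed
  have win: "(\<Sum>k<M. theta k * v (n - k)) = 1" if "M \<le> n" for n
  proof -
    have "(\<Sum>k<M. theta k * v (n - k)) = (\<Sum>k\<le>n. theta k * v (n - k))"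
      using that th0 by (intro sum.mono_neutral_left) auto
    then show ?thesis using id by simp
  qed
  have rec': "v n = (\<Sum>i<N. p ^ l i * v (n - l i))" if "M \<le> n" for n
  proof -
    have "l i \<le> n" if "i < N" for i using l_le_M[OF that] \<open>M \<le> n\<close> by simp
    then show ?thesis using rec[of n] that M_pos by simp
  qed
  define Th where "Th = (\<Sum>k<M. theta k)"
  have "theta 0 \<le> Th" unfolding Th_def using M_pos theta_nonneg by (intro member_le_sum) auto
  then have Th: "Th > 0" by (simp add: theta_0)
  have "v \<longlonglongrightarrow> 1 / Th"
    unfolding lim_sequentially
  proof (intro allI impI)
    fix e :: real assume e: "0 < e"
    have "\<exists>n0. \<forall>n\<ge>n0. 1 / (\<Sum>k<M. theta k) - e < v n"
    proof (rule renewal_lower_bound[OF rec' win _ e])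
      show "\<bar>v n\<bar> \<le> 1" for n using bnd[of n] by simp
    qed
    moreover have "\<exists>n0. \<forall>n\<ge>n0. (- 1) / (\<Sum>k<M. theta k) - e < - v n"
    proof (rule renewal_lower_bound[of "\<lambda>n. - v n" "- 1" 1, OF _ _ _ e])
      show "- v n = (\<Sum>i<N. p ^ l i * - v (n - l i))" if "M \<le> n" for n using rec'[OF that] by (simp add: sum_negf)
      show "(\<Sum>k<M. theta k * - v (n - k)) = - 1" if "M \<le> n" for n using win[OF that] by (simp add: sum_negf)
      show "\<bar>- v n\<bar> \<le> 1" for n using bnd[of n] by simp
    qed
    ultimately obtain n0 n1 where "\<And>n. n0 \<le> n \<Longrightarrow> 1 / Th - e < v n" "\<And>n. n1 \<le> n \<Longrightarrow> - 1 / Th - e < - v n"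
      unfolding Th_def by blast
    then have "dist (v n) (1 / Th) < e" if "n \<ge> max n0 n1" for n
      using that by (force simp: dist_real_def abs_less_iff)
    then show "\<exists>no. \<forall>n\<ge>no. dist (v n) (1 / Th) < e" by blast
  qed
  then show ?thesis using Th by (intro exI[of _ "1 / Th"]) simp
qed

section \<open>Cut sets of words and the growth of their counts\<close>

definition valid :: "nat list \<Rightarrow> bool" where "valid w \<longleftrightarrow> set w \<subseteq> {..<N}"

definition lv :: "nat list \<Rightarrow> nat" where "lv w = sum_list (map l w)"

text \<open>\<open>W k\<close> is the cut set of the words whose ratio \<open>r ^ lv w\<close> has just dropped to \<open>r ^ k\<close> or below.\<close>

definition W :: "nat \<Rightarrow> nat list set" where
  "W k = {w. valid w \<and> k \<le> lv w \<and> (w = [] \<or> lv (butlast w) < k)}"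

lemma valid_simps [simp]: "valid []" "valid (i # w) \<longleftrightarrow> i < N \<and> valid w" "valid (v @ w) \<longleftrightarrow> valid v \<and> valid w"
  by (auto simp: valid_def)

lemma lv_simps [simp]: "lv [] = 0" "lv (i # w) = l i + lv w" "lv (v @ w) = lv v + lv w"
  by (auto simp: lv_def)

lemma length_le_lv: "valid w \<Longrightarrow> length w \<le> lv w"
proof (induction w)
  case (Cons i w)
  then show ?case using l_pos[of i] by simp
qed simp

lemma finite_valid_lv: "finite {w. valid w \<and> lv w \<le> n}"
proof (rule finite_subset)
  show "{w. valid w \<and> lv w \<le> n} \<subseteq> {w. set w \<subseteq> {..<N} \<and> length w \<le> n}"
    using length_le_lv by (auto simp: valid_def intro: order_trans)
  show "finite {w. set w \<subseteq> {..<N} \<and> length w \<le> n}" by (rule finite_lists_length_le) simp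
qed

lemma W_lv_less: "w \<in> W k \<Longrightarrow> lv w < k + M"
proof (cases w rule: rev_cases)
  case Nil
  then show ?thesis using M_pos by simp
next
  case (snoc v i)
  assume "w \<in> W k"
  then show ?thesis using snoc l_le_M[of i] by (auto simp: W_def)
qed

lemma W_lv_ge: "w \<in> W k \<Longrightarrow> k \<le> lv w"
  by (simp add: W_def)

lemma W_valid: "w \<in> W k \<Longrightarrow> valid w"
  by (simp add: W_def)

lemma finite_W [simp]: "finite (W k)"
  by (rule finite_subset[OF _ finite_valid_lv[of "k + M"]]) (auto simp: W_valid dest: W_lv_less)

lemma W_0: "W 0 = {[]}"
  by (auto simp: W_def)

lemma lv_prefix: "prefix v w \<Longrightarrow> lv v \<le> lv w"
  by (auto simp: prefix_def)

lemma W_prefix_ex: "valid w \<Longrightarrow> k \<le> lv w \<Longrightarrow> \<exists>v\<in>W k. prefix v w"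
proof (induction w rule: rev_induct)
  case Nil
  then show ?case by (auto simp: W_def)
next
  case (snoc i w)
  show ?case
  proof (cases "k \<le> lv w")
    case True
    then obtain v where "v \<in> W k" "prefix v w" using snoc by auto
    then show ?thesis by (meson prefix_prefix)
  next
    case False
    then have "w @ [i] \<in> W k" using snoc.prems by (auto simp: W_def)
    then show ?thesis by blast
  qed
qed

lemma W_prefix_eq: "v \<in> W k \<Longrightarrow> w \<in> W k \<Longrightarrow> prefix v w \<Longrightarrow> v = w"
proof (rule ccontr)
  assume v: "v \<in> W k" and w: "w \<in> W k" and pr: "prefix v w" and ne: "v \<noteq> w"
  then obtain z where z: "w = v @ z" "z \<noteq> []" by (auto simp: prefix_def)
  then have "prefix v (butlast w)" by (simp add: butlast_append)
  then have "lv v \<le> lv (butlast w)" by (rule lv_prefix)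
  moreover have "w \<noteq> []" using z by simp
  ultimately show False using v w by (auto simp: W_def)
qed

lemma W_append: "valid u \<Longrightarrow> u @ v \<in> W (lv u + n) \<longleftrightarrow> v \<in> W n"
proof (cases "v = []")
  case True
  assume u: "valid u"
  show ?thesis
  proof (cases u rule: rev_cases)
    case Nil
    then show ?thesis using True by simp
  next
    case (snoc u' i)
    then show ?thesis using u True l_pos[of i] by (auto simp: W_def)
  qed
next
  case False
  assume "valid u"
  then show ?thesis using False by (auto simp: W_def butlast_append)
qed

lemma W_extensions: "valid u \<Longrightarrow> {w\<in>W (lv u + n). prefix u w} = (@) u ` W n"
  using W_append by (auto simp: prefix_def image_iff)

lemma W_Suc: "W (Suc k) = {w\<in>W k. k < lv w} \<union> (\<Union>w\<in>{w\<in>W k. lv w = k}. (\<lambda>i. w @ [i]) ` {..<N})"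
  (is "_ = ?A \<union> ?B")
proof (intro equalityI subsetI)
  fix w assume w: "w \<in> W (Suc k)"
  show "w \<in> ?A \<union> ?B"
  proof (cases w rule: rev_cases)
    case Nil
    then show ?thesis using w by (simp add: W_def)
  next
    case (snoc v i)
    have v: "valid v" "i < N" "lv v \<le> k" "Suc k \<le> lv w" using w snoc by (auto simp: W_def)
    show ?thesis
    proof (cases "lv v = k")
      case True
      have "lv (butlast v) < k" if vne: "v \<noteq> []"
      proof -
        obtain v' j where vj: "v = v' @ [j]" using vne by (cases v rule: rev_cases) auto
        then show ?thesis using True v l_pos[of j] by auto
      qed
      then have "v \<in> W k" using v True by (auto simp: W_def)
      then show ?thesis using True snoc v by auto
    next
      case False
      then have "w \<in> W k" using w snoc v by (auto simp: W_def)
      then show ?thesis using v by auto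
    qed
  qed
next
  fix w assume "w \<in> ?A \<union> ?B"
  then show "w \<in> W (Suc k)"
  proof
    assume "w \<in> ?A"
    then show ?thesis by (auto simp: W_def)
  next
    assume "w \<in> ?B"
    then obtain v i where v: "v \<in> W k" "lv v = k" "i < N" "w = v @ [i]" by auto
    then show ?thesis using l_pos[of i] by (auto simp: W_def)
  qed
qed

text \<open>Going from \<open>W k\<close> to \<open>W (Suc k)\<close> replaces each word of length
  exactly \<open>k\<close> by its \<open>N\<close> one-letter extensions and keeps all others.
  Inductions over cut sets rest on this.\<close>

lemma sum_W_Suc:
  fixes phi :: "nat list \<Rightarrow> 'c::comm_monoid_add"
  shows "sum phi (W (Suc k)) = sum phi {w\<in>W k. k < lv w} + (\<Sum>w\<in>{w\<in>W k. lv w = k}. \<Sum>i<N. phi (w @ [i]))"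
proof -
  let ?A = "{w\<in>W k. k < lv w}" and ?Q = "{w\<in>W k. lv w = k}"
  have dis: "?A \<inter> (\<Union>w\<in>?Q. (\<lambda>i. w @ [i]) ` {..<N}) = {}"
  proof (rule ccontr)
    assume "\<not> ?thesis"
    then obtain v i where v: "v \<in> W k" "v @ [i] \<in> W k" by auto
    then show False using W_prefix_eq[OF v] by simp
  qed
  have "sum phi (W (Suc k)) = sum phi ?A + sum phi (\<Union>w\<in>?Q. (\<lambda>i. w @ [i]) ` {..<N})"
    unfolding W_Suc by (rule sum.union_disjoint) (use dis in auto)
  also have "sum phi (\<Union>w\<in>?Q. (\<lambda>i. w @ [i]) ` {..<N}) = (\<Sum>w\<in>?Q. sum phi ((\<lambda>i. w @ [i]) ` {..<N}))"
    by (rule sum.UNION_disjoint) auto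
  also have "\<dots> = (\<Sum>w\<in>?Q. \<Sum>i<N. phi (w @ [i]))"
    by (intro sum.cong refl) (subst sum.reindex, auto simp: inj_on_def)
  finally show ?thesis .
qed

lemma sum_W_split:
  fixes phi :: "nat list \<Rightarrow> 'c::comm_monoid_add"
  shows "sum phi (W k) = sum phi {w\<in>W k. k < lv w} + sum phi {w\<in>W k. lv w = k}"
proof -
  have "W k = {w\<in>W k. k < lv w} \<union> {w\<in>W k. lv w = k}" using W_lv_ge by fastforce
  then have "sum phi (W k) = sum phi ({w\<in>W k. k < lv w} \<union> {w\<in>W k. lv w = k})" by simp
  also have "\<dots> = sum phi {w\<in>W k. k < lv w} + sum phi {w\<in>W k. lv w = k}" by (rule sum.union_disjoint) auto
  finally show ?thesis .
qed

lemma sum_weights_W: "(\<Sum>w\<in>W k. p ^ lv w) = 1"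
proof (induction k)
  case 0
  then show ?case by (simp add: W_0)
next
  case (Suc k)
  have "(\<Sum>i<N. p ^ lv (w @ [i])) = p ^ lv w" for w
    using sum_p by (simp add: power_add sum_distrib_left[symmetric])
  then have "(\<Sum>w\<in>{w\<in>W k. lv w = k}. \<Sum>i<N. p ^ lv (w @ [i])) = (\<Sum>w\<in>{w\<in>W k. lv w = k}. p ^ lv w)"
    by (intro sum.cong refl)
  then have "(\<Sum>w\<in>W (Suc k). p ^ lv w) = (\<Sum>w\<in>W k. p ^ lv w)"
    unfolding sum_W_Suc sum_W_split[of _ k] by (rule arg_cong)
  then show ?case using Suc by simp
qed

definition words_at :: "nat \<Rightarrow> nat list set" where "words_at n = {w. valid w \<and> lv w = n}"

text \<open>\<open>j\<close> is the overshoot of a word over the level \<open>k\<close>; by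
  \<open>W_lv_less\<close> only values \<open>j < M\<close> occur.\<close>

definition cnt :: "nat \<Rightarrow> nat \<Rightarrow> nat" where "cnt k j = card {w\<in>W k. lv w = k + j}"

lemma finite_words_at [simp]: "finite (words_at n)"
  unfolding words_at_def by (rule finite_subset[OF _ finite_valid_lv[of n]]) auto

text \<open>Splitting off the first letter gives the renewal recursion for the normalised
  counts.\<close>

lemma card_words_at_limit: "\<exists>L>0. (\<lambda>n. real (card (words_at n)) * p ^ n) \<longlonglongrightarrow> L"
proof (rule renewal_limit)
  have "words_at 0 = {[]}"
    using length_le_lv by (force simp: words_at_def)
  then show "real (card (words_at 0)) * p ^ 0 = 1" by simp
  fix n :: nat assume n: "0 < n"
  let ?I = "{i. i < N \<and> l i \<le> n}"
  have "words_at n = (\<Union>i\<in>?I. (\<lambda>w. i # w) ` words_at (n - l i))"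
  proof (intro equalityI subsetI)
    fix w assume w: "w \<in> words_at n"
    then obtain i v where "w = i # v" using n by (cases w) (auto simp: words_at_def)
    then show "w \<in> (\<Union>i\<in>?I. (\<lambda>w. i # w) ` words_at (n - l i))" using w by (auto simp: words_at_def)
  qed (auto simp: words_at_def)
  then have "card (words_at n) = card (\<Union>i\<in>?I. (\<lambda>w. i # w) ` words_at (n - l i))" by simp
  also have "\<dots> = (\<Sum>i\<in>?I. card ((\<lambda>w. i # w) ` words_at (n - l i)))"
    by (rule card_UN_disjoint) auto
  also have "\<dots> = (\<Sum>i\<in>?I. card (words_at (n - l i)))"
    by (intro sum.cong refl card_image) (auto simp: inj_on_def)
  finally have "real (card (words_at n)) * p ^ n = (\<Sum>i\<in>?I. real (card (words_at (n - l i))) * p ^ n)"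
    by (simp add: sum_distrib_right)
  also have "\<dots> = (\<Sum>i\<in>?I. p ^ l i * (real (card (words_at (n - l i))) * p ^ (n - l i)))"
    by (intro sum.cong refl) (auto simp: power_add[symmetric])
  also have "\<dots> = (\<Sum>i<N. if l i \<le> n then p ^ l i * (real (card (words_at (n - l i))) * p ^ (n - l i)) else 0)"
    by (simp add: sum.If_cases Int_def conj_commute)
  finally show "real (card (words_at n)) * p ^ n =
    (\<Sum>i<N. if l i \<le> n then p ^ l i * (real (card (words_at (n - l i))) * p ^ (n - l i)) else 0)" .
qed

text \<open>Splitting off the last letter of a cut word leaves an arbitrary word of length below
  \<open>k\<close>. The condition \<open>M \<le> k\<close> keeps \<open>k + j - l i\<close> from
  being truncated.\<close>

lemma cnt_words_at:
  assumes k: "M \<le> k" "0 < k"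
  shows "cnt k j = (\<Sum>i\<in>{i. i < N \<and> j < l i}. card (words_at (k + j - l i)))"
proof -
  let ?I = "{i. i < N \<and> j < l i}"
  have le: "l i \<le> k" if "i < N" for i using l_le_M[OF that] k by simp
  have "{w\<in>W k. lv w = k + j} = (\<Union>i\<in>?I. (\<lambda>w. w @ [i]) ` words_at (k + j - l i))"
  proof (intro equalityI subsetI)
    fix w assume w: "w \<in> {w\<in>W k. lv w = k + j}"
    show "w \<in> (\<Union>i\<in>?I. (\<lambda>w. w @ [i]) ` words_at (k + j - l i))"
    proof (cases w rule: rev_cases)
      case Nil
      then show ?thesis using w k by (simp add: W_def)
    next
      case (snoc v i)
      then have "valid v" "i < N" "lv v < k" "lv v + l i = k + j" using w by (auto simp: W_def)
      then have "i \<in> ?I" "v \<in> words_at (k + j - l i)" by (auto simp: words_at_def)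
      then show ?thesis using snoc by blast
    qed
  next
    fix w assume "w \<in> (\<Union>i\<in>?I. (\<lambda>w. w @ [i]) ` words_at (k + j - l i))"
    then obtain i v where *: "i < N" "j < l i" "valid v" "lv v = k + j - l i" "w = v @ [i]"
      by (auto simp: words_at_def)
    then show "w \<in> {w\<in>W k. lv w = k + j}" using le[of i] by (auto simp: W_def)
  qed
  then have "cnt k j = card (\<Union>i\<in>?I. (\<lambda>w. w @ [i]) ` words_at (k + j - l i))" by (simp add: cnt_def)
  also have "\<dots> = (\<Sum>i\<in>?I. card ((\<lambda>w. w @ [i]) ` words_at (k + j - l i)))"
    by (rule card_UN_disjoint) auto
  also have "\<dots> = (\<Sum>i\<in>?I. card (words_at (k + j - l i)))"
    by (intro sum.cong refl card_image) (auto simp: inj_on_def)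
  finally show ?thesis .
qed

lemma cnt_limit:
  assumes j: "j < M"
  shows "\<exists>L>0. (\<lambda>k. real (cnt k j) * p ^ k) \<longlonglongrightarrow> L"
proof -
  obtain L where L: "0 < L" "(\<lambda>n. real (card (words_at n)) * p ^ n) \<longlonglongrightarrow> L" using card_words_at_limit by blast
  let ?I = "{i. i < N \<and> j < l i}"
  have lim: "(\<lambda>k. p ^ (l i - j) * (real (card (words_at (k + j - l i))) * p ^ (k + j - l i))) \<longlonglongrightarrow> p ^ (l i - j) * L"
    if "i \<in> ?I" for i
  proof (rule tendsto_mult[OF tendsto_const])
    have "filterlim (\<lambda>k. k - (l i - j)) sequentially sequentially" by (rule filterlim_minus_const_nat_at_top)
    from filterlim_compose[OF L(2) this]
    have "(\<lambda>k. real (card (words_at (k - (l i - j)))) * p ^ (k - (l i - j))) \<longlonglongrightarrow> L" .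
    moreover have "k - (l i - j) = k + j - l i" for k using that by auto
    ultimately show "(\<lambda>k. real (card (words_at (k + j - l i))) * p ^ (k + j - l i)) \<longlonglongrightarrow> L" by simp
  qed
  have "(\<lambda>k. \<Sum>i\<in>?I. p ^ (l i - j) * (real (card (words_at (k + j - l i))) * p ^ (k + j - l i)))
      \<longlonglongrightarrow> (\<Sum>i\<in>?I. p ^ (l i - j) * L)"
    by (rule tendsto_sum) (rule lim)
  moreover have "eventually (\<lambda>k. (\<Sum>i\<in>?I. p ^ (l i - j) * (real (card (words_at (k + j - l i))) * p ^ (k + j - l i))) =
      real (cnt k j) * p ^ k) sequentially"
    using eventually_ge_at_top[of "M + 1"]
  proof eventually_elim
    case (elim k)
    have "p ^ (l i - j) * p ^ (k + j - l i) = p ^ k" if "i \<in> ?I" for i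
      using that l_le_M[of i] elim by (auto simp: power_add[symmetric])
    then have "(\<Sum>i\<in>?I. p ^ (l i - j) * (real (card (words_at (k + j - l i))) * p ^ (k + j - l i))) =
        (\<Sum>i\<in>?I. real (card (words_at (k + j - l i))) * p ^ k)"
      by (intro sum.cong refl) (simp add: mult.left_commute)
    also have "\<dots> = real (cnt k j) * p ^ k" using elim by (simp add: cnt_words_at sum_distrib_right)
    finally show ?case .
  qed
  ultimately have "(\<lambda>k. real (cnt k j) * p ^ k) \<longlonglongrightarrow> (\<Sum>i\<in>?I. p ^ (l i - j) * L)"
    by (rule Lim_transform_eventually)
  moreover have "0 < (\<Sum>i\<in>?I. p ^ (l i - j) * L)"
    using M_attained j L(1) p by (intro sum_pos) auto
  ultimately show ?thesis by blast
qed

lemma sum_cnt: "(\<Sum>j<M. real (cnt k j) * p ^ (k + j)) = 1"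
proof -
  have "(\<Sum>w\<in>W k. p ^ lv w) = (\<Sum>j<M. \<Sum>w\<in>{w\<in>W k. lv w - k = j}. p ^ lv w)"
    by (rule sum.group[symmetric]) (use W_lv_less W_lv_ge in fastforce)+
  also have "\<dots> = (\<Sum>j<M. real (cnt k j) * p ^ (k + j))"
  proof (rule sum.cong[OF refl])
    fix j
    have "{w\<in>W k. lv w - k = j} = {w\<in>W k. lv w = k + j}" using W_lv_ge by fastforce
    then show "(\<Sum>w\<in>{w\<in>W k. lv w - k = j}. p ^ lv w) = real (cnt k j) * p ^ (k + j)"
      by (simp add: cnt_def)
  qed
  finally show ?thesis using sum_weights_W by simp
qed

text \<open>Since the weights of \<open>W (n - i)\<close> add up to 1, each \<open>p ^ i\<close> can
  be replaced by a sum of powers \<open>p ^ (n + j)\<close>; the integers here are the resulting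
  coefficients (\<open>sum_counts_eq\<close>). Multiplied by \<open>p ^ n\<close> they tend to the
  value of the polynomial at \<open>p\<close> times the positive limit from
  \<open>cnt_limit\<close>, so a positive value makes all of them nonnegative, although
  \<open>q\<close> itself may have negative coefficients.\<close>

lemma eventually_nonneg_counts:
  fixes q :: "nat \<Rightarrow> int"
  assumes pos: "0 < (\<Sum>i<d. of_int (q i) * p ^ i)"
  shows "\<exists>n0. \<forall>n\<ge>n0. \<forall>j<M. 0 \<le> (\<Sum>i<d. q i * int (cnt (n - i) j))"
proof -
  have "eventually (\<lambda>n. 0 \<le> (\<Sum>i<d. q i * int (cnt (n - i) j))) sequentially" if j: "j < M" for j
  proof -
    obtain L where L: "0 < L" "(\<lambda>k. real (cnt k j) * p ^ k) \<longlonglongrightarrow> L" using cnt_limit[OF j] by blast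
    have "(\<lambda>n. \<Sum>i<d. of_int (q i) * p ^ i * (real (cnt (n - i) j) * p ^ (n - i))) \<longlonglongrightarrow> (\<Sum>i<d. of_int (q i) * p ^ i * L)"
      by (intro tendsto_sum tendsto_mult tendsto_const filterlim_compose[OF L(2)] filterlim_minus_const_nat_at_top)
    moreover have "0 < (\<Sum>i<d. of_int (q i) * p ^ i * L)" using pos L(1) by (simp add: sum_distrib_right[symmetric])
    ultimately have "eventually (\<lambda>n. 0 < (\<Sum>i<d. of_int (q i) * p ^ i * (real (cnt (n - i) j) * p ^ (n - i)))) sequentially"
      by (rule order_tendstoD(1))
    then show ?thesis using eventually_ge_at_top[of d]
    proof eventually_elim
      case (elim n)
      have "(\<Sum>i<d. of_int (q i) * p ^ i * (real (cnt (n - i) j) * p ^ (n - i))) =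
          (\<Sum>i<d. of_int (q i) * real (cnt (n - i) j) * p ^ n)"
        using elim by (intro sum.cong refl) (simp add: power_add[symmetric] ac_simps)
      also have "\<dots> = of_int (\<Sum>i<d. q i * int (cnt (n - i) j)) * p ^ n" by (simp add: sum_distrib_right)
      finally have "0 < real_of_int (\<Sum>i<d. q i * int (cnt (n - i) j)) * p ^ n" using elim by simp
      moreover have "0 < p ^ n" using p by simp
      ultimately have "0 < real_of_int (\<Sum>i<d. q i * int (cnt (n - i) j))" using zero_less_mult_pos2 by blast
      then show ?case unfolding of_int_0_less_iff by simp
    qed
  qed
  then have "eventually (\<lambda>n. \<forall>j\<in>{..<M}. 0 \<le> (\<Sum>i<d. q i * int (cnt (n - i) j))) sequentially"
    by (intro eventually_ball_finite) auto
  then show ?thesis unfolding eventually_sequentially by auto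
qed

lemma sum_counts_eq:
  fixes q :: "nat \<Rightarrow> int"
  assumes "d \<le> n"
  shows "(\<Sum>j<M. of_int (\<Sum>i<d. q i * int (cnt (n - i) j)) * p ^ (n + j)) = (\<Sum>i<d. of_int (q i) * p ^ i)"
proof -
  have "(\<Sum>j<M. of_int (\<Sum>i<d. q i * int (cnt (n - i) j)) * p ^ (n + j)) =
      (\<Sum>j<M. \<Sum>i<d. of_int (q i) * p ^ i * (real (cnt (n - i) j) * p ^ (n - i + j)))"
  proof (rule sum.cong[OF refl])
    fix j
    have "p ^ (n + j) = p ^ i * p ^ (n - i + j)" if "i < d" for i using that assms by (simp add: power_add[symmetric])
    then show "of_int (\<Sum>i<d. q i * int (cnt (n - i) j)) * p ^ (n + j) =
      (\<Sum>i<d. of_int (q i) * p ^ i * (real (cnt (n - i) j) * p ^ (n - i + j)))"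
      by (auto simp: sum_distrib_right intro!: sum.cong)
  qed
  also have "\<dots> = (\<Sum>i<d. of_int (q i) * p ^ i * (\<Sum>j<M. real (cnt (n - i) j) * p ^ (n - i + j)))"
    by (subst sum.swap) (simp add: sum_distrib_left)
  also have "\<dots> = (\<Sum>i<d. of_int (q i) * p ^ i)" by (simp add: sum_cnt)
  finally show ?thesis .
qed

end

subsection \<open>Cylinders and Hausdorff dimension\<close>

lemma separated_set_card_bound:
  fixes B :: "'a::heine_borel set"
  assumes B: "bounded B" and s: "0 < s"
  shows "\<exists>n. \<forall>A\<subseteq>B. finite A \<longrightarrow> (\<forall>x\<in>A. \<forall>y\<in>A. x \<noteq> y \<longrightarrow> s \<le> dist x y) \<longrightarrow> card A \<le> n"
proof -
  have "compact (closure B)" using B by simp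
  then obtain K where K: "finite K" "closure B \<subseteq> (\<Union>x\<in>K. ball x (s / 2))"
    using s unfolding compact_eq_totally_bounded by (meson half_gt_zero)
  have "card A \<le> card K"
    if A: "A \<subseteq> B" "finite A" and sep: "\<forall>x\<in>A. \<forall>y\<in>A. x \<noteq> y \<longrightarrow> s \<le> dist x y" for A
  proof -
    have "\<forall>x\<in>A. \<exists>k\<in>K. dist k x < s / 2" using A K(2) closure_subset[of B] by fastforce
    then obtain g where g: "\<And>x. x \<in> A \<Longrightarrow> g x \<in> K \<and> dist (g x) x < s / 2" by metis
    have "inj_on g A"
    proof (rule inj_onI, rule ccontr)
      fix x y assume xy: "x \<in> A" "y \<in> A" "g x = g y" "x \<noteq> y"
      have "dist x y \<le> dist (g x) x + dist (g x) y" by (metis dist_commute dist_triangle)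
      also have "\<dots> < s" using g[OF xy(1)] g[OF xy(2)] xy(3) by simp
      finally show False using sep xy by fastforce
    qed
    then show ?thesis using g K(1) by (intro card_inj_on_le[of g]) auto
  qed
  then show ?thesis by blast
qed

lemma sum_UNION_le:
  fixes f :: "'b \<Rightarrow> real"
  assumes "finite I" "\<And>i. i \<in> I \<Longrightarrow> finite (A i)" "\<And>x. 0 \<le> f x"
  shows "sum f (\<Union>i\<in>I. A i) \<le> (\<Sum>i\<in>I. sum f (A i))"
  using assms
proof (induction I)
  case (insert j I)
  have "sum f (A j \<union> (\<Union>i\<in>I. A i)) \<le> sum f (A j) + sum f (\<Union>i\<in>I. A i)"
    using insert.prems insert.hyps sum.union_inter[of "A j" "\<Union>i\<in>I. A i" f]
      sum_nonneg[of "A j \<inter> (\<Union>i\<in>I. A i)" f] by simp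
  then show ?case using insert by fastforce
qed simp

text \<open>After translation and rescaling the map is an isometry fixing 0, hence linear and
  injective, and finite dimension makes it onto. Surjectivity is what lets images of balls contain
  balls (\<open>sw_ball\<close>).\<close>

lemma scaled_isometry_surj:
  fixes g :: "'a::euclidean_space \<Rightarrow> 'a"
  assumes c: "0 < c" and g: "\<And>x y. dist (g x) (g y) = c * dist x y"
  shows "surj g"
proof -
  define h where "h x = (1 / c) *\<^sub>R (g x - g 0)" for x
  have h0: "h 0 = 0" by (simp add: h_def)
  have hd: "dist (h x) (h y) = dist x y" for x y
  proof -
    have "h x - h y = (1 / c) *\<^sub>R (g x - g y)" by (simp add: h_def algebra_simps)
    then have "dist (h x) (h y) = (1 / c) * dist (g x) (g y)" using c by (simp add: dist_norm)
    then show ?thesis using g c by simp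
  qed
  have "linear h" using isometry_linear[of h] h0 hd by simp
  moreover have "inj h" by (rule injI) (metis hd dist_eq_0_iff)
  ultimately have "surj h" using linear_injective_imp_surjective[of h] by auto
  show ?thesis
    unfolding surj_def
  proof
    fix y
    obtain x where "(1 / c) *\<^sub>R (y - g 0) = h x" using \<open>surj h\<close> by (rule surjE)
    then have "(1 / c) *\<^sub>R (y - g 0) = (1 / c) *\<^sub>R (g x - g 0)" by (simp only: h_def)
    then have "y = g x" using c by simp
    then show "\<exists>x. y = g x" ..
  qed
qed

locale ifs_attractor = weighted_alphabet +
  fixes f :: "nat \<Rightarrow> 'a::euclidean_space \<Rightarrow> 'a" and r :: real and E V :: "'a set"
  assumes r: "0 < r" "r < 1"
    and sim: "\<And>i x y. i < N \<Longrightarrow> dist (f i x) (f i y) = r ^ l i * dist x y"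
    and compact_E: "compact E" and E_ne: "E \<noteq> {}" and E_fix: "E = (\<Union>i<N. f i ` E)"
    and V_ne: "V \<noteq> {}" and V_bounded: "bounded V" and V_open: "open V"
    and V_sub: "\<And>i. i < N \<Longrightarrow> f i ` V \<subseteq> V"
    and V_disj: "\<And>i j. i < N \<Longrightarrow> j < N \<Longrightarrow> i \<noteq> j \<Longrightarrow> f i ` V \<inter> f j ` V = {}"
begin

definition sw :: "nat list \<Rightarrow> 'a \<Rightarrow> 'a" where "sw w = foldr f w"

abbreviation cyl :: "nat list \<Rightarrow> 'a set" where "cyl w \<equiv> sw w ` E"

lemma sw_simps [simp]: "sw [] x = x" "sw (i # w) x = f i (sw w x)" "sw (v @ w) x = sw v (sw w x)"
  by (auto simp: sw_def)

lemma sw_append_image: "sw (v @ w) ` A = sw v ` (sw w ` A)"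
  by (auto simp: image_image)

lemma sw_dist: "valid w \<Longrightarrow> dist (sw w x) (sw w y) = r ^ lv w * dist x y"
  by (induction w) (auto simp: sim power_add)

lemma r_pow: "0 < r ^ n" "r ^ n \<le> 1" "r ^ n \<noteq> 0"
  using r by (auto intro: power_le_one)

lemma p_pow: "0 < p ^ n" "p ^ n \<le> 1" "p ^ n \<noteq> 0"
  using p by (auto intro: power_le_one)

lemma sw_inj: "valid w \<Longrightarrow> inj (sw w)"
  by (rule injI) (metis sw_dist dist_eq_0_iff mult_eq_0_iff r_pow(3))

lemma sw_surj: "valid w \<Longrightarrow> surj (sw w)"
  by (rule scaled_isometry_surj[of "r ^ lv w"]) (auto simp: sw_dist r)

lemma sw_ball: "valid w \<Longrightarrow> ball (sw w x) (r ^ lv w * a) \<subseteq> sw w ` ball x a"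
proof
  fix y assume w: "valid w" and y: "y \<in> ball (sw w x) (r ^ lv w * a)"
  obtain z where z: "y = sw w z" using sw_surj[OF w] by (metis surjD)
  then have "dist x z < a" using y sw_dist[OF w, of x z] r_pow(1)[of "lv w"] by simp
  then show "y \<in> sw w ` ball x a" using z by simp
qed

lemma cyl_sub: "valid w \<Longrightarrow> cyl w \<subseteq> E"
proof (induction w)
  case (Cons i w)
  then have "f i ` cyl w \<subseteq> f i ` E" by auto
  also have "\<dots> \<subseteq> E" using Cons.prems E_fix by auto
  finally show ?case by (simp add: image_image)
qed auto

lemma cyl_prefix: "prefix v w \<Longrightarrow> valid w \<Longrightarrow> cyl w \<subseteq> cyl v"
proof -
  assume "prefix v w" "valid w"
  then obtain z where z: "w = v @ z" "valid z" by (auto simp: prefix_def)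
  then show ?thesis using image_mono[OF cyl_sub[OF z(2)], of "sw v"] by (simp add: image_image)
qed

lemma cyl_split: "cyl w = (\<Union>i<N. cyl (w @ [i]))"
proof -
  have "cyl w = sw w ` (\<Union>i<N. f i ` E)" using E_fix by simp
  also have "\<dots> = (\<Union>i<N. cyl (w @ [i]))" by (simp add: image_UN image_image)
  finally show ?thesis .
qed

lemma E_W: "(\<Union>w\<in>W k. cyl w) = E"
proof (induction k)
  case 0
  then show ?case by (simp add: W_0)
next
  case (Suc k)
  have "(\<Union>w\<in>W (Suc k). cyl w) = (\<Union>w\<in>{w\<in>W k. k < lv w}. cyl w) \<union> (\<Union>w\<in>{w\<in>W k. lv w = k}. \<Union>i<N. cyl (w @ [i]))"
    unfolding W_Suc UN_Un by auto
  also have "(\<Union>w\<in>{w\<in>W k. lv w = k}. \<Union>i<N. cyl (w @ [i])) = (\<Union>w\<in>{w\<in>W k. lv w = k}. cyl w)"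
    by (intro SUP_cong refl cyl_split[symmetric])
  also have "(\<Union>w\<in>{w\<in>W k. k < lv w}. cyl w) \<union> (\<Union>w\<in>{w\<in>W k. lv w = k}. cyl w) =
      (\<Union>w\<in>{w\<in>W k. k < lv w} \<union> {w\<in>W k. lv w = k}. cyl w)" by (rule UN_Un[symmetric])
  also have "{w\<in>W k. k < lv w} \<union> {w\<in>W k. lv w = k} = W k" using W_lv_ge by fastforce
  finally show ?case using Suc by simp
qed

lemma parallel_V: "valid v \<Longrightarrow> valid w \<Longrightarrow> v \<parallel> w \<Longrightarrow> sw v ` V \<inter> sw w ` V = {}"
proof -
  assume v: "valid v" and w: "valid w" and "v \<parallel> w"
  have sub: "sw u ` V \<subseteq> V" if "valid u" for u
    using that
  proof (induction u)
    case (Cons i u)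
    then have "f i ` (sw u ` V) \<subseteq> f i ` V" by auto
    then show ?case using V_sub[of i] Cons.prems by (auto simp: image_image)
  qed auto
  obtain a b x c y where abc: "v = a @ b # x" "w = a @ c # y" "b \<noteq> c"
    using parallel_decomp[OF \<open>v \<parallel> w\<close>] by blast
  have va: "valid a" "b < N" "c < N" "valid x" "valid y" using v w abc by auto
  have "f b ` sw x ` V \<inter> f c ` sw y ` V = {}"
    using V_disj[OF va(2,3) abc(3)] sub[OF va(4)] sub[OF va(5)] by blast
  moreover have "sw v ` V = sw a ` (f b ` sw x ` V)" "sw w ` V = sw a ` (f c ` sw y ` V)"
    using abc by (simp_all add: image_image)
  ultimately show ?thesis using sw_inj[OF va(1)] by (simp add: image_Int[symmetric])
qed

lemma W_parallel: "v \<in> W k \<Longrightarrow> w \<in> W k \<Longrightarrow> v \<noteq> w \<Longrightarrow> v \<parallel> w"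
  using W_prefix_eq[of v k w] W_prefix_eq[of w k v] unfolding parallel_def by blast

definition dm :: real where "dm = diameter E + 1"

lemma dm_pos: "0 < dm"
  unfolding dm_def using diameter_ge_0[OF compact_imp_bounded[OF compact_E]] by simp

lemma dist_E: "x \<in> E \<Longrightarrow> y \<in> E \<Longrightarrow> dist x y \<le> dm"
  unfolding dm_def using diameter_bounded_bound[OF compact_imp_bounded[OF compact_E], of x y] by simp

lemma dist_cyl: "valid w \<Longrightarrow> x \<in> cyl w \<Longrightarrow> y \<in> cyl w \<Longrightarrow> dist x y \<le> r ^ lv w * dm"
  using sw_dist dist_E r_pow(1)[of "lv w"] by (auto simp: mult_left_mono)

lemma dist_cyl_W: "w \<in> W k \<Longrightarrow> x \<in> cyl w \<Longrightarrow> y \<in> cyl w \<Longrightarrow> dist x y \<le> r ^ k * dm"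
proof -
  assume w: "w \<in> W k" "x \<in> cyl w" "y \<in> cyl w"
  have "r ^ lv w \<le> r ^ k" using W_lv_ge[OF w(1)] r by (intro power_decreasing) auto
  then show ?thesis using dist_cyl[OF W_valid[OF w(1)] w(2,3)] dm_pos by (meson mult_right_mono less_imp_le order_trans)
qed

text \<open>Cylinders may overlap, so the packing argument uses balls from the open set: for the
  words of \<open>W k\<close> the images of the ball around \<open>y0\<close> are disjoint and have
  radius at least \<open>a * r ^ M * r ^ k\<close>. After rescaling by \<open>1 / r ^ k\<close>
  around \<open>x\<close> their centres are separated points of a fixed ball, where \<open>D\<close>
  accounts for the distance from \<open>y0\<close> to \<open>E\<close>.\<close>

lemma cylinders_near_bound:
  "\<exists>n. \<forall>k x. card {w\<in>W k. \<exists>y\<in>cyl w. dist x y \<le> R * r ^ k} \<le> n"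
proof -
  obtain y0 where y0: "y0 \<in> V" using V_ne by blast
  obtain a where a: "0 < a" "ball y0 a \<subseteq> V" using V_open y0 openE by blast
  obtain D where D: "\<And>e. e \<in> E \<Longrightarrow> dist y0 e \<le> D"
    using compact_imp_bounded[OF compact_E] by (metis bounded_any_center)
  define s where "s = a * r ^ M"
  have s: "0 < s" using a r by (simp add: s_def)
  obtain n where n: "\<And>A. A \<subseteq> cball (0::'a) (R + D) \<Longrightarrow> finite A \<Longrightarrow>
      (\<forall>x\<in>A. \<forall>y\<in>A. x \<noteq> y \<longrightarrow> s \<le> dist x y) \<Longrightarrow> card A \<le> n"
    using separated_set_card_bound[OF bounded_cball s] by metis
  have "card {w\<in>W k. \<exists>y\<in>cyl w. dist x y \<le> R * r ^ k} \<le> n" for k x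
  proof -
    let ?Q = "{w\<in>W k. \<exists>y\<in>cyl w. dist x y \<le> R * r ^ k}"
    define z where "z w = (1 / r ^ k) *\<^sub>R (sw w y0 - x)" for w
    have rk: "0 < r ^ k" using r by simp
    have zd: "dist (z v) (z w) = dist (sw v y0) (sw w y0) / r ^ k" for v w
    proof -
      have "z v - z w = (1 / r ^ k) *\<^sub>R (sw v y0 - sw w y0)" by (simp add: z_def algebra_simps)
      then show ?thesis using rk by (simp add: dist_norm)
    qed
    have sep: "s \<le> dist (z v) (z w)" if vw: "v \<in> W k" "w \<in> W k" "v \<noteq> w" for v w
    proof (rule ccontr)
      assume "\<not> s \<le> dist (z v) (z w)"
      then have "dist (sw v y0) (sw w y0) < a * r ^ M * r ^ k" using rk by (simp add: zd s_def field_simps)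
      also have "\<dots> = r ^ (k + M) * a" by (simp add: power_add)
      also have "\<dots> \<le> r ^ lv v * a"
        using W_lv_less[OF vw(1)] r a by (intro mult_right_mono power_decreasing) auto
      finally have "sw w y0 \<in> sw v ` ball y0 a" using sw_ball[OF W_valid[OF vw(1)], of y0 a] by auto
      then have "sw w y0 \<in> sw v ` V \<inter> sw w ` V" using a(2) y0 by blast
      then show False using parallel_V[OF W_valid[OF vw(1)] W_valid[OF vw(2)] W_parallel[OF vw]] by blast
    qed
    have inj: "inj_on z ?Q"
    proof (rule inj_onI, rule ccontr)
      fix v w assume "v \<in> ?Q" "w \<in> ?Q" "z v = z w" "v \<noteq> w"
      then show False using sep[of v w] s by simp
    qed
    have "card (z ` ?Q) \<le> n"
    proof (rule n)
      show "z ` ?Q \<subseteq> cball 0 (R + D)"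
      proof clarify
        fix w e assume w: "w \<in> W k" "e \<in> E" "dist x (sw w e) \<le> R * r ^ k"
        have "dist (sw w y0) (sw w e) = r ^ lv w * dist y0 e" using sw_dist W_valid w(1) by blast
        also have "\<dots> \<le> r ^ k * D" using D[OF w(2)] W_lv_ge[OF w(1)] r by (intro mult_mono power_decreasing) auto
        finally have "dist (sw w y0) x \<le> (R + D) * r ^ k"
          using dist_triangle[of "sw w y0" x "sw w e"] w(3) by (simp add: dist_commute algebra_simps)
        then have "dist (sw w y0) x / r ^ k \<le> R + D" using rk by (simp add: field_simps)
        moreover have "norm (z w) = dist (sw w y0) x / r ^ k" using rk by (simp add: z_def dist_norm)
        ultimately show "z w \<in> cball 0 (R + D)" by simp
      qed
      show "\<forall>x\<in>z ` ?Q. \<forall>y\<in>z ` ?Q. x \<noteq> y \<longrightarrow> s \<le> dist x y" using sep by auto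
    qed simp
    then show ?thesis using card_image[OF inj] by simp
  qed
  then show ?thesis by blast
qed

section \<open>Hausdorff dimension of the attractor\<close>

lemma sum_extensions_le: "valid v \<Longrightarrow> (\<Sum>w\<in>{w\<in>W k. prefix v w}. p ^ lv w) \<le> p ^ lv v"
proof (cases "lv v \<le> k")
  case True
  assume v: "valid v"
  have "{w\<in>W k. prefix v w} = (@) v ` W (k - lv v)" using W_extensions[OF v, of "k - lv v"] True by simp
  then have "(\<Sum>w\<in>{w\<in>W k. prefix v w}. p ^ lv w) = (\<Sum>w\<in>W (k - lv v). p ^ lv v * p ^ lv w)"
    by (simp add: sum.reindex inj_on_def power_add)
  also have "\<dots> = p ^ lv v" by (simp add: sum_distrib_left[symmetric] sum_weights_W)
  finally show ?thesis by simp
next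
  case False
  assume v: "valid v"
  have "{w\<in>W k. prefix v w} \<subseteq> {v}"
  proof clarify
    fix w assume w: "w \<in> W k" "prefix v w"
    have "k \<le> lv v" using False by simp
    then obtain u where u: "u \<in> W k" "prefix u v" using W_prefix_ex[OF v] by blast
    then have "u = w" using W_prefix_eq w by (meson prefix_order.order_trans)
    then show "w = v" using u w by (simp add: prefix_order.antisym)
  qed
  then have "(\<Sum>w\<in>{w\<in>W k. prefix v w}. p ^ lv w) \<le> (\<Sum>w\<in>{v}. p ^ lv w)"
    using p by (intro sum_mono2) auto
  then show ?thesis by simp
qed

text \<open>The mass distribution principle without a measure: the weights \<open>p ^ lv w\<close>
  of one fine cut set \<open>W K\<close> serve as the mass. Each member of the cover meets at most
  \<open>nb\<close> cylinders of its own scale \<open>kf n\<close>, each of mass at most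
  \<open>p ^ kf n\<close>.\<close>

lemma mass_distribution:
  assumes nb: "\<And>k x. card {w\<in>W k. \<exists>y\<in>cyl w. dist x y \<le> 3 * r ^ k} \<le> nb"
    and F: "finite F" and cov: "E \<subseteq> (\<Union>n\<in>F. O' n)"
    and d: "\<And>n. n \<in> F \<Longrightarrow> 0 < d n \<and> d n \<le> 3" and diam: "\<And>n x y. n \<in> F \<Longrightarrow> x \<in> O' n \<Longrightarrow> y \<in> O' n \<Longrightarrow> dist x y \<le> d n"
    and t: "0 < t" "r powr t \<ge> p"
  shows "1 \<le> real nb * (\<Sum>n\<in>F. (d n / r) powr t)"
proof -
  \<comment> \<open>The scale of a set of size \<open>d n\<close>: the last power of
    \<open>r\<close> above \<open>d n\<close>. For \<open>d n \<ge> 1\<close> there is none and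
    \<open>k = 0\<close> has to serve, which the factor 3 permits.\<close>
  have ex: "\<exists>k. d n \<le> 3 * r ^ k \<and> r ^ k \<le> d n / r" if n: "n \<in> F" for n
  proof (cases "d n \<ge> 1")
    case True
    then show ?thesis using d[OF n] r by (intro exI[of _ 0]) (simp add: field_simps)
  next
    case False
    obtain m where m: "r ^ m < d n" using real_arch_pow_inv[of "d n" r] d[OF n] r by blast
    define k where "k = (LEAST k. r ^ k \<le> d n)"
    have k: "r ^ k \<le> d n" unfolding k_def using m by (rule LeastI[of "\<lambda>k. r ^ k \<le> d n" m, OF less_imp_le])
    have "k \<noteq> 0" using k False by (metis power_0)
    then obtain j where j: "k = Suc j" by (cases k) auto
    have "\<not> r ^ j \<le> d n" using not_less_Least[of j "\<lambda>k. r ^ k \<le> d n"] j unfolding k_def by simp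
    then show ?thesis using k j d[OF n] r_pow(1)[of j] r by (intro exI[of _ j]) (auto simp: field_simps)
  qed
  define kf where "kf n = (SOME k. d n \<le> 3 * r ^ k \<and> r ^ k \<le> d n / r)" for n
  have kf: "d n \<le> 3 * r ^ kf n" "r ^ kf n \<le> d n / r" if "n \<in> F" for n
    using someI_ex[OF ex[OF that]] unfolding kf_def by auto
  define K where "K = Max (insert 0 (kf ` F))"
  have K: "kf n \<le> K" if "n \<in> F" for n unfolding K_def using F that by auto
  define Q where "Q n = {v\<in>W (kf n). cyl v \<inter> O' n \<noteq> {}}" for n
  have cardQ: "card (Q n) \<le> nb" if n: "n \<in> F" for n
  proof (cases "Q n = {}")
    case False
    then obtain x where x: "x \<in> O' n" unfolding Q_def by blast
    have near: "dist x y \<le> 3 * r ^ kf n" if "y \<in> O' n" for y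
      using diam[OF n x that] kf(1)[OF n] by linarith
    have "Q n \<subseteq> {w\<in>W (kf n). \<exists>y\<in>cyl w. dist x y \<le> 3 * r ^ kf n}"
      using near unfolding Q_def by blast
    then have "card (Q n) \<le> card {w\<in>W (kf n). \<exists>y\<in>cyl w. dist x y \<le> 3 * r ^ kf n}" by (intro card_mono) auto
    also have "\<dots> \<le> nb" by (rule nb)
    finally show ?thesis .
  qed simp
  have fQ: "finite (Q n)" for n unfolding Q_def by simp
  have sub: "W K \<subseteq> (\<Union>n\<in>F. \<Union>v\<in>Q n. {w\<in>W K. prefix v w})"
  proof
    fix w assume w: "w \<in> W K"
    have vw: "valid w" using W_valid[OF w] .
    obtain y where y: "y \<in> cyl w" using E_ne by blast
    then have "y \<in> E" using cyl_sub[OF vw] by blast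
    then obtain n where n: "n \<in> F" "y \<in> O' n" using cov by blast
    have "kf n \<le> lv w" using K[OF n(1)] W_lv_ge[OF w] by simp
    then obtain v where v: "v \<in> W (kf n)" "prefix v w" using W_prefix_ex[OF vw] by blast
    then have "v \<in> Q n" using cyl_prefix[OF v(2) vw] y n unfolding Q_def by blast
    then show "w \<in> (\<Union>n\<in>F. \<Union>v\<in>Q n. {w\<in>W K. prefix v w})" using n v w by blast
  qed
  have "1 = (\<Sum>w\<in>W K. p ^ lv w)" by (simp add: sum_weights_W)
  also have "\<dots> \<le> (\<Sum>w\<in>(\<Union>n\<in>F. \<Union>v\<in>Q n. {w\<in>W K. prefix v w}). p ^ lv w)"
    using sub F fQ p by (intro sum_mono2) auto
  also have "\<dots> \<le> (\<Sum>n\<in>F. \<Sum>w\<in>(\<Union>v\<in>Q n. {w\<in>W K. prefix v w}). p ^ lv w)"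
    using F fQ p by (intro sum_UNION_le) auto
  also have "\<dots> \<le> (\<Sum>n\<in>F. \<Sum>v\<in>Q n. \<Sum>w\<in>{w\<in>W K. prefix v w}. p ^ lv w)"
    using F fQ p by (intro sum_mono sum_UNION_le) auto
  also have "\<dots> \<le> (\<Sum>n\<in>F. \<Sum>v\<in>Q n. p ^ kf n)"
  proof (intro sum_mono)
    fix n v assume "n \<in> F" "v \<in> Q n"
    then have v: "v \<in> W (kf n)" by (simp add: Q_def)
    have "(\<Sum>w\<in>{w\<in>W K. prefix v w}. p ^ lv w) \<le> p ^ lv v" using sum_extensions_le[OF W_valid[OF v]] .
    also have "\<dots> \<le> p ^ kf n" using W_lv_ge[OF v] p by (intro power_decreasing) auto
    finally show "(\<Sum>w\<in>{w\<in>W K. prefix v w}. p ^ lv w) \<le> p ^ kf n" .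
  qed
  also have "\<dots> \<le> (\<Sum>n\<in>F. real nb * (d n / r) powr t)"
  proof (intro sum_mono)
    fix n assume n: "n \<in> F"
    have "p ^ kf n \<le> (r powr t) ^ kf n" using t p by (intro power_mono) auto
    also have "\<dots> = (r ^ kf n) powr t" using r by (simp add: powr_power powr_realpow[symmetric] powr_powr mult.commute)
    also have "\<dots> \<le> (d n / r) powr t" using kf(2)[OF n] t r by (intro powr_mono2) auto
    finally have "p ^ kf n \<le> (d n / r) powr t" .
    then have "real (card (Q n)) * p ^ kf n \<le> real nb * (d n / r) powr t"
      using cardQ[OF n] p by (intro mult_mono) auto
    then show "(\<Sum>v\<in>Q n. p ^ kf n) \<le> real nb * (d n / r) powr t" by simp
  qed
  also have "\<dots> = real nb * (\<Sum>n\<in>F. (d n / r) powr t)" by (simp add: sum_distrib_left)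
  finally show ?thesis .
qed

text \<open>Covering by the cylinders of \<open>W n\<close> costs at most a constant times
  \<open>(r powr t / p) ^ n\<close>, because the weights \<open>p ^ lv w\<close> add up to
  1.\<close>

lemma hausdorff_measure_zero:
  assumes t: "0 < t" "r powr t < p"
  shows "hausdorff_measure t E = 0"
proof -
  have rt: "0 < r powr t" using r by simp
  have small: "hausdorff_premeasure t \<delta> E \<le> ennreal (dm powr t * (r powr t / p) ^ n)"
    if n: "r ^ n * dm \<le> \<delta>" for \<delta> n
  proof -
    obtain e where e: "bij_betw e {..<card (W n)} (W n)"
      using ex_bij_betw_nat_finite[OF finite_W, of n] by (auto simp: atLeast0LessThan)
    define U where "U i = (if i < card (W n) then cyl (e i) else {})" for i
    have eW: "e i \<in> W n" if "i < card (W n)" for i using e that unfolding bij_betw_def by blast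
    have d\<delta>: "0 \<le> \<delta>" using n dm_pos r by (smt (verit) mult_nonneg_nonneg r_pow(1))
    have dc: "diameter (cyl w) \<le> r ^ lv w * dm" if "valid w" for w
      using dist_cyl[OF that] dm_pos r_pow(1)[of "lv w"] by (intro diameter_le) (auto simp: dist_norm)
    have bc: "bounded (cyl w)" if "valid w" for w
      using bounded_subset[OF compact_imp_bounded[OF compact_E] cyl_sub[OF that]] .
    have mem: "U \<in> {U. E \<subseteq> (\<Union>n. U n) \<and> (\<forall>n. bounded (U n) \<and> diameter (U n) \<le> \<delta>)}"
    proof (intro CollectI conjI allI)
      show "E \<subseteq> (\<Union>i. U i)"
      proof
        fix x assume "x \<in> E"
        then obtain w where w: "w \<in> W n" "x \<in> cyl w" using E_W[of n] by blast
        then obtain i where "i < card (W n)" "e i = w" using e unfolding bij_betw_def by (metis imageE lessThan_iff)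
        then show "x \<in> (\<Union>i. U i)" using w unfolding U_def by force
      qed
      fix i
      show "bounded (U i)" unfolding U_def using bc W_valid eW by auto
      show "diameter (U i) \<le> \<delta>"
      proof (cases "i < card (W n)")
        case True
        have "diameter (cyl (e i)) \<le> r ^ lv (e i) * dm" using dc W_valid eW True by blast
        also have "\<dots> \<le> r ^ n * dm" using W_lv_ge[OF eW[OF True]] r dm_pos by (intro mult_right_mono power_decreasing) auto
        finally show ?thesis using True n unfolding U_def by simp
      qed (use d\<delta> in \<open>simp add: U_def\<close>)
    qed
    have "hausdorff_premeasure t \<delta> E \<le> (\<Sum>i. ennreal (diameter (U i) powr t))"
      unfolding hausdorff_premeasure_def by (rule INF_lower[OF mem])
    also have "\<dots> = (\<Sum>i<card (W n). ennreal (diameter (U i) powr t))"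
      by (rule suminf_finite) (auto simp: U_def)
    also have "\<dots> = ennreal (\<Sum>i<card (W n). diameter (U i) powr t)" by simp
    also have "(\<Sum>i<card (W n). diameter (U i) powr t) = (\<Sum>w\<in>W n. diameter (cyl w) powr t)"
      by (subst sum.reindex_bij_betw[OF e, symmetric]) (simp add: U_def)
    also have "ennreal \<dots> \<le> ennreal (dm powr t * (r powr t / p) ^ n)"
    proof (rule ennreal_leI)
      have "(\<Sum>w\<in>W n. diameter (cyl w) powr t) \<le> (\<Sum>w\<in>W n. dm powr t * (r powr t / p) ^ n * p ^ lv w)"
      proof (rule sum_mono)
        fix w assume w: "w \<in> W n"
        have "diameter (cyl w) powr t \<le> (r ^ lv w * dm) powr t"
          using dc[OF W_valid[OF w]] t diameter_ge_0[OF bc[OF W_valid[OF w]]] by (intro powr_mono2) auto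
        also have "\<dots> = (r powr t) ^ lv w * dm powr t"
          using r dm_pos by (simp add: powr_mult powr_power powr_realpow[symmetric] powr_powr mult.commute)
        also have "(r powr t) ^ lv w = (r powr t / p) ^ lv w * p ^ lv w" using p by (simp add: power_divide)
        finally have "diameter (cyl w) powr t \<le> (r powr t / p) ^ lv w * (p ^ lv w * dm powr t)" by (simp only: mult.assoc)
        also have "(r powr t / p) ^ lv w * (p ^ lv w * dm powr t) \<le> (r powr t / p) ^ n * (p ^ lv w * dm powr t)"
          using W_lv_ge[OF w] t rt p by (intro mult_right_mono power_decreasing) auto
        finally show "diameter (cyl w) powr t \<le> dm powr t * (r powr t / p) ^ n * p ^ lv w"
          by (simp only: ac_simps)
      qed
      also have "\<dots> = dm powr t * (r powr t / p) ^ n" by (simp add: sum_distrib_left[symmetric] sum_weights_W)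
      finally show "(\<Sum>w\<in>W n. diameter (cyl w) powr t) \<le> dm powr t * (r powr t / p) ^ n" .
    qed
    finally show ?thesis .
  qed
  have "hausdorff_premeasure t \<delta> E = 0" if d: "0 < \<delta>" for \<delta>
  proof -
    have "(\<lambda>n. dm powr t * (r powr t / p) ^ n) \<longlonglongrightarrow> dm powr t * 0"
      using t rt p by (intro tendsto_mult tendsto_const LIMSEQ_power_zero) auto
    then have "(\<lambda>n. ennreal (dm powr t * (r powr t / p) ^ n)) \<longlonglongrightarrow> ennreal 0"
      by (intro tendsto_ennrealI) simp
    moreover have "eventually (\<lambda>n. hausdorff_premeasure t \<delta> E \<le> ennreal (dm powr t * (r powr t / p) ^ n)) sequentially"
    proof -
      have "(\<lambda>n. r ^ n * dm) \<longlonglongrightarrow> 0 * dm" using r by (intro tendsto_mult tendsto_const LIMSEQ_power_zero) auto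
      then have "eventually (\<lambda>n. r ^ n * dm < \<delta>) sequentially" using d by (intro order_tendstoD(2)) auto
      then show ?thesis by eventually_elim (use small in auto)
    qed
    ultimately have "hausdorff_premeasure t \<delta> E \<le> ennreal 0"
      by (intro tendsto_lowerbound[of _ _ sequentially]) auto
    then show ?thesis by simp
  qed
  then show ?thesis unfolding hausdorff_measure_def by simp
qed

text \<open>A cheap cover is fattened to an open one, so that finitely many members suffice for
  \<open>mass_distribution\<close>; the fattening of the n-th member may add at most
  \<open>c / 2 * (1/2) ^ Suc n\<close>. Equality in \<open>p \<le> r powr t\<close> covers the
  critical exponent.\<close>

lemma hausdorff_measure_pos:
  assumes t: "0 < t" "p \<le> r powr t"
  shows "hausdorff_measure t E \<noteq> 0"
proof
  assume zero: "hausdorff_measure t E = 0"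
  obtain nb where nb: "\<And>k x. card {w\<in>W k. \<exists>y\<in>cyl w. dist x y \<le> 3 * r ^ k} \<le> nb"
    using cylinders_near_bound[of 3] by blast
  define c where "c = r powr t / (real nb + 1)"
  have c: "0 < c" using r by (simp add: c_def)
  have "hausdorff_premeasure t 1 E \<le> hausdorff_measure t E"
    unfolding hausdorff_measure_def by (rule SUP_upper) simp
  then have "hausdorff_premeasure t 1 E < ennreal (c / 2)" using zero c by simp
  then obtain U where U: "E \<subseteq> (\<Union>n. U n)" "\<And>n. bounded (U n)" "\<And>n. diameter (U n) \<le> 1"
    and sU: "(\<Sum>n. ennreal (diameter (U n) powr t)) < ennreal (c / 2)"
    unfolding hausdorff_premeasure_def INF_less_iff by blast
  define g where "g n = diameter (U n)" for n
  have g: "0 \<le> g n" "g n \<le> 1" for n using diameter_ge_0[OF U(2)] U(3) by (auto simp: g_def)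
  have "\<exists>e>0. e \<le> 1 \<and> (g n + 2 * e) powr t < g n powr t + c / 2 * (1/2) ^ Suc n" for n
  proof -
    have "((\<lambda>e. (g n + 2 * e) powr t) \<longlongrightarrow> (g n + 2 * 0) powr t) (at_right 0)"
    proof (rule tendsto_powr')
      show "((\<lambda>e. g n + 2 * e) \<longlongrightarrow> g n + 2 * 0) (at_right 0)" by (intro tendsto_intros)
      have "eventually (\<lambda>e. 0 \<le> g n + 2 * e) (at_right 0)"
        using eventually_at_right_less[of "0::real"] by eventually_elim (use g in simp)
      then show "g n + 2 * 0 \<noteq> 0 \<or> 0 < t \<and> eventually (\<lambda>e. 0 \<le> g n + 2 * e) (at_right 0)" using t by blast
    qed (rule tendsto_const)
    then have "eventually (\<lambda>e. (g n + 2 * e) powr t < g n powr t + c / 2 * (1/2) ^ Suc n) (at_right 0)"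
      using c by (intro order_tendstoD(2)) auto
    then have "eventually (\<lambda>e. 0 < e \<and> e < 1 \<and> (g n + 2 * e) powr t < g n powr t + c / 2 * (1/2) ^ Suc n) (at_right 0)"
      using eventually_at_right_less[of "0::real"] eventually_at_rightI[of "0::real" 1 "\<lambda>e. e < 1"]
      by (auto elim: eventually_elim2 intro: eventually_conj)
    then obtain e where "0 < e \<and> e < 1 \<and> (g n + 2 * e) powr t < g n powr t + c / 2 * (1/2) ^ Suc n"
      using eventually_happens[of _ "at_right (0::real)"] trivial_limit_at_right_real by blast
    then show ?thesis by (intro exI[of _ e]) auto
  qed
  then obtain e where e: "\<And>n. 0 < e n" "\<And>n. e n \<le> 1"
    "\<And>n. (g n + 2 * e n) powr t < g n powr t + c / 2 * (1/2) ^ Suc n" by metis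
  define O' where "O' n = (\<Union>x\<in>U n. ball x (e n))" for n
  define d where "d n = g n + 2 * e n" for n
  have "U n \<subseteq> O' n" for n
  proof
    fix x assume "x \<in> U n"
    moreover have "x \<in> ball x (e n)" using e(1)[of n] by simp
    ultimately show "x \<in> O' n" unfolding O'_def by blast
  qed
  then have "E \<subseteq> (\<Union>n. O' n)" using U(1) by (meson UN_mono order_refl order_trans)
  moreover have "open (O' n)" for n unfolding O'_def by auto
  ultimately obtain F where F: "finite F" "E \<subseteq> (\<Union>n\<in>F. O' n)"
    using compactE_image[OF compact_E, of UNIV O'] by (metis UNIV_I)
  have defect: "0 < d n \<and> d n \<le> 3" for n using g[of n] e(1,2)[of n] by (simp add: d_def)
  have diam: "dist x y \<le> d n" if xy: "x \<in> O' n" "y \<in> O' n" for n x y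
  proof -
    obtain x' y' where xy': "x' \<in> U n" "dist x' x < e n" "y' \<in> U n" "dist y' y < e n"
      using xy unfolding O'_def by auto
    have "dist x' y' \<le> g n" using diameter_bounded_bound[OF U(2) xy'(1,3)] by (simp add: g_def)
    moreover have "dist x y \<le> dist x' x + dist x' y' + dist y' y"
      by (metis add.commute add_left_mono dist_commute dist_triangle dist_triangle2 order_trans)
    ultimately show ?thesis using xy' by (simp add: d_def)
  qed
  have "1 \<le> real nb * (\<Sum>n\<in>F. (d n / r) powr t)"
    by (rule mass_distribution[OF nb F _ _ t]) (use defect diam in auto)
  also have "(\<Sum>n\<in>F. (d n / r) powr t) = (\<Sum>n\<in>F. d n powr t) / r powr t"
    using defect r by (simp add: powr_divide less_imp_le sum_divide_distrib)
  finally have 1: "r powr t \<le> real nb * (\<Sum>n\<in>F. d n powr t)" using r by (simp add: field_simps)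
  have "(\<Sum>n\<in>F. d n powr t) \<le> (\<Sum>n\<in>F. g n powr t + c / 2 * (1/2) ^ Suc n)"
    using e(3) unfolding d_def by (intro sum_mono less_imp_le)
  also have "\<dots> = (\<Sum>n\<in>F. g n powr t) + c / 2 * (\<Sum>n\<in>F. (1/2) ^ Suc n)"
    by (simp add: sum.distrib sum_distrib_left)
  also have "(\<Sum>n\<in>F. g n powr t) < c / 2"
  proof -
    have "ennreal (\<Sum>n\<in>F. g n powr t) = (\<Sum>n\<in>F. ennreal (g n powr t))" by simp
    also have "\<dots> \<le> (\<Sum>n. ennreal (g n powr t))" by (rule sum_le_suminf) (use F in auto)
    also have "\<dots> < ennreal (c / 2)" using sU by (simp add: g_def)
    finally show ?thesis using c by (simp add: ennreal_less_iff sum_nonneg)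
  qed
  also have "(\<Sum>n\<in>F. (1/2) ^ Suc n) \<le> (1::real)"
  proof -
    have "(\<Sum>n\<in>F. (1/2) ^ Suc n) \<le> (\<Sum>n. (1/2::real) ^ Suc n)"
      by (rule sum_le_suminf) (use F power_half_series sums_summable in auto)
    then show ?thesis using power_half_series sums_unique by fastforce
  qed
  finally have "(\<Sum>n\<in>F. d n powr t) < c" using c by simp
  then have "real nb * (\<Sum>n\<in>F. d n powr t) < (real nb + 1) * c"
    using c by (smt (verit) mult_left_mono mult_strict_right_mono of_nat_0_le_iff)
  also have "\<dots> = r powr t" by (simp add: c_def)
  finally show False using 1 by simp
qed

text \<open>In this locale \<open>p\<close> is only a solution of the Moran equation; the lemma
  identifies it with the measure root.\<close>

lemma r_powr_hausdorff_dim: "r powr hausdorff_dim E = p"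
proof -
  define s where "s = ln p / ln r"
  have lnr: "ln r < 0" and lnp: "ln p < 0" using r p by auto
  have s: "0 < s" using lnr lnp by (simp add: s_def divide_neg_neg)
  have rs: "r powr s = p" using r p lnr by (simp add: powr_def s_def)
  have gt: "hausdorff_measure t E = 0" if "s < t" for t
  proof (rule hausdorff_measure_zero)
    show "r powr t < p" using that r rs powr_less_mono'[of r s t] by simp
  qed (use s that in simp)
  have lt: "hausdorff_measure t E \<noteq> 0" if "0 < t" "t \<le> s" for t
  proof (rule hausdorff_measure_pos[OF that(1)])
    show "p \<le> r powr t" using that r rs powr_mono'[of t s r] by simp
  qed
  have "hausdorff_dim E = s"
    unfolding hausdorff_dim_def
  proof (rule cInf_eq_non_empty)
    show "{t. 0 < t \<and> hausdorff_measure t E = 0} \<noteq> {}" using gt[of "s + 1"] s by (auto intro!: exI[of _ "s + 1"])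
    show "s \<le> t" if "t \<in> {t. 0 < t \<and> hausdorff_measure t E = 0}" for t using lt[of t] that by force
    fix y assume y: "\<And>t. t \<in> {t. 0 < t \<and> hausdorff_measure t E = 0} \<Longrightarrow> y \<le> t"
    show "y \<le> s"
    proof (rule dense_ge)
      fix t assume "s < t"
      then show "y \<le> t" using gt s by (intro y) auto
    qed
  qed
  then show ?thesis using rs by simp
qed

end

subsection \<open>Uniform disconnectedness\<close>

definition link :: "'a::metric_space set \<Rightarrow> real \<Rightarrow> ('a \<times> 'a) set" where
  "link A e = {(a, b). a \<in> A \<and> b \<in> A \<and> dist a b \<le> e}"

text \<open>A quantitative form of total disconnectedness that, unlike the topological one, keeps
  track of constants under similarities and finite unions.\<close>

definition chains_bounded :: "'a::metric_space set \<Rightarrow> real \<Rightarrow> real \<Rightarrow> bool" where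
  "chains_bounded A e d \<longleftrightarrow> (\<forall>x\<in>A. \<forall>y. (x, y) \<in> (link A e)\<^sup>* \<longrightarrow> dist x y \<le> d)"

lemma chains_boundedD: "chains_bounded A e d \<Longrightarrow> x \<in> A \<Longrightarrow> (x, y) \<in> (link A e)\<^sup>* \<Longrightarrow> dist x y \<le> d"
  by (simp add: chains_bounded_def)

lemma link_mono: "A \<subseteq> B \<Longrightarrow> e \<le> e' \<Longrightarrow> link A e \<subseteq> link B e'"
  by (auto simp: link_def)

lemma link_rtrancl_in: "(x, y) \<in> (link A e)\<^sup>* \<Longrightarrow> x \<in> A \<Longrightarrow> y \<in> A"
  by (induction rule: rtrancl_induct) (auto simp: link_def)

lemma link_rtrancl_sym: "(x, y) \<in> (link A e)\<^sup>* \<Longrightarrow> (y, x) \<in> (link A e)\<^sup>*"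
proof -
  have "sym (link A e)" by (auto simp: sym_def link_def dist_commute)
  then show "(x, y) \<in> (link A e)\<^sup>* \<Longrightarrow> (y, x) \<in> (link A e)\<^sup>*" using sym_rtrancl by (meson symD)
qed

lemma chains_bounded_mono:
  assumes "chains_bounded A e d" "e' \<le> e" "d \<le> d'"
  shows "chains_bounded A e' d'"
  unfolding chains_bounded_def
proof (intro ballI allI impI)
  fix x y assume x: "x \<in> A" and "(x, y) \<in> (link A e')\<^sup>*"
  then have "(x, y) \<in> (link A e)\<^sup>*" using rtrancl_mono[OF link_mono[OF order_refl assms(2)]] by blast
  then show "dist x y \<le> d'" using chains_boundedD[OF assms(1) x] assms(3) by fastforce
qed

text \<open>A chain in the union makes excursions into \<open>B\<close> of diameter at most \<open>d2\<close>, so the points it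
  visits in \<open>A\<close> form a chain with steps at most \<open>h\<close>.\<close>

lemma chains_bounded_Un:
  assumes A: "chains_bounded A h d1" and B: "chains_bounded B e d2"
    and h: "2 * e + d2 \<le> h" and e: "0 \<le> e" and d: "0 \<le> d1" "0 \<le> d2"
  shows "chains_bounded (A \<union> B) e (d1 + 2 * d2 + 2 * e)"
proof -
  define St where "St a0 y \<longleftrightarrow> (\<exists>a. (a0, a) \<in> (link A h)\<^sup>* \<and>
      (y = a \<or> (\<exists>b\<in>B. dist a b \<le> e \<and> (b, y) \<in> (link B e)\<^sup>*)))" for a0 y
  have St_step: "St a0 z" if a0: "a0 \<in> A" and St: "St a0 y" and yz: "(y, z) \<in> link (A \<union> B) e" for a0 y z
  proof -
    have yz': "dist y z \<le> e" "z \<in> A \<union> B" using yz by (auto simp: link_def)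
    obtain a where a: "(a0, a) \<in> (link A h)\<^sup>*" "y = a \<or> (\<exists>b\<in>B. dist a b \<le> e \<and> (b, y) \<in> (link B e)\<^sup>*)"
      using St unfolding St_def by blast
    have aA: "a \<in> A" using link_rtrancl_in[OF a(1) a0] .
    show ?thesis
    proof (cases "z \<in> A")
      case True
      have "dist a z \<le> h"
      proof (cases "y = a")
        case True
        then show ?thesis using yz' h e d by simp
      next
        case False
        then obtain b where b: "b \<in> B" "dist a b \<le> e" "(b, y) \<in> (link B e)\<^sup>*" using a(2) by blast
        have "dist b y \<le> d2" using chains_boundedD[OF B b(1,3)] .
        moreover have "dist a z \<le> dist a b + dist b y + dist y z"
          using dist_triangle[of a z b] dist_triangle[of b z y] by linarith
        ultimately show ?thesis using b yz' h by linarith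
      qed
      then have "(a, z) \<in> link A h" using aA True by (simp add: link_def)
      then have "(a0, z) \<in> (link A h)\<^sup>*" using a(1) by (rule rtrancl_into_rtrancl[rotated])
      then show ?thesis unfolding St_def by blast
    next
      case False
      then have zB: "z \<in> B" using yz' by blast
      show ?thesis
      proof (cases "y = a")
        case True
        then show ?thesis using a(1) zB yz' unfolding St_def by blast
      next
        case False
        then obtain b where b: "b \<in> B" "dist a b \<le> e" "(b, y) \<in> (link B e)\<^sup>*" using a(2) by blast
        have "y \<in> B" using link_rtrancl_in[OF b(3,1)] .
        then have "(y, z) \<in> link B e" using zB yz' by (simp add: link_def)
        then have "(b, z) \<in> (link B e)\<^sup>*" using b(3) by (rule rtrancl_into_rtrancl[rotated])
        then show ?thesis using a(1) b unfolding St_def by blast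
      qed
    qed
  qed
  have St_dist: "dist a0 y \<le> d1 + e + d2" if a0: "a0 \<in> A" and St: "St a0 y" for a0 y
  proof -
    obtain a where a: "(a0, a) \<in> (link A h)\<^sup>*" "y = a \<or> (\<exists>b\<in>B. dist a b \<le> e \<and> (b, y) \<in> (link B e)\<^sup>*)"
      using St unfolding St_def by blast
    have 1: "dist a0 a \<le> d1" using chains_boundedD[OF A a0 a(1)] .
    show ?thesis
    proof (cases "y = a")
      case True
      then show ?thesis using 1 e d by simp
    next
      case False
      then obtain b where b: "b \<in> B" "dist a b \<le> e" "(b, y) \<in> (link B e)\<^sup>*" using a(2) by blast
      have "dist b y \<le> d2" using chains_boundedD[OF B b(1,3)] .
      then show ?thesis using 1 b dist_triangle[of a0 y a] dist_triangle[of a y b] by linarith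
    qed
  qed
  have St0: "St a0 a0" for a0 unfolding St_def by blast
  show ?thesis
    unfolding chains_bounded_def
  proof (intro ballI allI impI)
    fix x y assume x: "x \<in> A \<union> B" and xy: "(x, y) \<in> (link (A \<union> B) e)\<^sup>*"
    show "dist x y \<le> d1 + 2 * d2 + 2 * e"
    proof (cases "x \<in> A")
      case True
      have "St x y" using xy
        by (induction rule: rtrancl_induct) (auto intro: St0 St_step[OF True])
      then show ?thesis using St_dist[OF True] d e by fastforce
    next
      case False
      then have xB: "x \<in> B" using x by blast
      have "(x, y) \<in> (link B e)\<^sup>* \<or> (\<exists>b a0. (x, b) \<in> (link B e)\<^sup>* \<and> a0 \<in> A \<and> dist b a0 \<le> e \<and> St a0 y)"
        using xy
      proof (induction rule: rtrancl_induct)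
        case (step y z)
        show ?case
        proof (cases "(x, y) \<in> (link B e)\<^sup>*")
          case True
          have yB: "y \<in> B" using link_rtrancl_in[OF True xB] .
          have yz: "dist y z \<le> e" "z \<in> A \<union> B" using step(2) by (auto simp: link_def)
          show ?thesis
          proof (cases "z \<in> B")
            case zB: True
            then have "(y, z) \<in> link B e" using yB yz by (simp add: link_def)
            then show ?thesis using True by (meson rtrancl_into_rtrancl)
          next
            case False
            then show ?thesis using True yz St0 by blast
          qed
        next
          case False
          then show ?thesis using step St_step by blast
        qed
      qed simp
      then show ?thesis
      proof (elim disjE exE conjE)
        assume "(x, y) \<in> (link B e)\<^sup>*"
        then show ?thesis using chains_boundedD[OF B xB] d e by fastforce
      next
        fix b a0 assume *: "(x, b) \<in> (link B e)\<^sup>*" "a0 \<in> A" "dist b a0 \<le> e" "St a0 y"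
        have "dist x b \<le> d2" using chains_boundedD[OF B xB *(1)] .
        then show ?thesis
          using *(3) St_dist[OF *(2,4)] dist_triangle[of x y b] dist_triangle[of b y a0] by linarith
      qed
    qed
  qed
qed

text \<open>The components of \<open>E\<close> are points, so the Sura-Bura theorem gives every
  point a relatively clopen neighbourhood in a small ball. Finitely many of these cover
  \<open>E\<close>, and a chain with steps shorter than all their gaps cannot leave the one in which
  it starts.\<close>

lemma totally_disconnected_chains_bounded:
  fixes E :: "'a::euclidean_space set"
  assumes cpt: "compact E" and td: "totally_disconnected E" and d: "0 < d"
  shows "\<exists>e>0. chains_bounded E e d"
proof -
  have "\<exists>U. open U \<and> x \<in> U \<and> E \<inter> U \<subseteq> ball x (d / 2) \<and> compact (E \<inter> U)" if x: "x \<in> E" for x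
  proof -
    have "connected_component_set E x \<subseteq> E" "connected (connected_component_set E x)"
      by (simp_all add: connected_component_subset)
    then obtain a where "connected_component_set E x \<subseteq> {a}" using td unfolding totally_disconnected_def by blast
    moreover have "x \<in> connected_component_set E x" using x by simp
    ultimately have eq: "connected_component_set E x = {x}" by blast
    have comp: "{x} \<in> components E" unfolding eq[symmetric] using x by (rule componentsI)
    have "locally compact E" using cpt by (simp add: closed_imp_locally_compact compact_imp_closed)
    moreover have "open (ball x (d / 2))" "{x} \<subseteq> ball x (d / 2)" using d by auto
    ultimately obtain K where K: "openin (top_of_set E) K" "compact K" "{x} \<subseteq> K" "K \<subseteq> ball x (d / 2)"
      using Sura_Bura_clopen_subset[of E "{x}" "ball x (d / 2)"] comp by (metis compact_sing)
    obtain U where "open U" "K = E \<inter> U" using K(1) unfolding openin_open by blast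
    then show ?thesis using K by blast
  qed
  then obtain U where U: "\<And>x. x \<in> E \<Longrightarrow> open (U x)" "\<And>x. x \<in> E \<Longrightarrow> x \<in> U x"
    "\<And>x. x \<in> E \<Longrightarrow> E \<inter> U x \<subseteq> ball x (d / 2)" "\<And>x. x \<in> E \<Longrightarrow> compact (E \<inter> U x)" by metis
  have "E \<subseteq> (\<Union>x\<in>E. U x)" using U(2) by blast
  then obtain F where F: "F \<subseteq> E" "finite F" "E \<subseteq> (\<Union>x\<in>F. U x)"
    using compactE_image[OF cpt, of E U] U(1) by blast
  have "\<exists>g>0. \<forall>a\<in>E \<inter> U x. \<forall>b\<in>E - U x. g \<le> dist a b" if x: "x \<in> E" for x
  proof (rule separate_compact_closed)
    show "compact (E \<inter> U x)" using U(4)[OF x] .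
    show "closed (E - U x)" using compact_diff[OF cpt U(1)[OF x]] by (rule compact_imp_closed)
    show "E \<inter> U x \<inter> (E - U x) = {}" by blast
  qed
  then obtain g where g: "\<And>x. x \<in> E \<Longrightarrow> 0 < g x" "\<And>x a b. x \<in> E \<Longrightarrow> a \<in> E \<inter> U x \<Longrightarrow> b \<in> E - U x \<Longrightarrow> g x \<le> dist a b"
    by metis
  define e where "e = Min (insert 1 (g ` F)) / 2"
  have fin: "finite (insert 1 (g ` F))" using F by simp
  have "0 < Min (insert 1 (g ` F))" using F g(1) by (subst Min_gr_iff[OF fin]) auto
  then have e: "0 < e" by (simp add: e_def)
  have eg: "e < g x" if x: "x \<in> F" for x
  proof -
    have "Min (insert 1 (g ` F)) \<le> g x" using fin x by (intro Min_le) auto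
    then show ?thesis using e by (simp add: e_def)
  qed
  have "chains_bounded E e d"
    unfolding chains_bounded_def
  proof (intro ballI allI impI)
    fix x y assume x: "x \<in> E" and xy: "(x, y) \<in> (link E e)\<^sup>*"
    obtain z where z: "z \<in> F" "x \<in> U z" using F(3) x by blast
    then have zE: "z \<in> E" using F(1) by blast
    have "y \<in> E \<inter> U z"
      using xy
    proof (induction rule: rtrancl_induct)
      case base
      then show ?case using x z by blast
    next
      case (step y w)
      have w: "w \<in> E" "dist y w \<le> e" using step(2) by (auto simp: link_def)
      show ?case
      proof (rule ccontr)
        assume "w \<notin> E \<inter> U z"
        then have "g z \<le> dist y w" using g(2)[OF zE step.IH] w by blast
        then show False using w eg[OF z(1)] by linarith
      qed
    qed
    then have "dist z y < d / 2" "dist z x < d / 2" using U(3)[OF zE] x z by auto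
    then show "dist x y \<le> d" using dist_triangle3[of x y z] by linarith
  qed
  then show ?thesis using e by blast
qed

locale tdc_attractor = ifs_attractor +
  assumes tdc: "totally_disconnected E"
begin

lemma cyl_chains_bounded:
  assumes d: "0 < d"
  shows "\<exists>e>0. \<forall>k. \<forall>w\<in>W k. chains_bounded (cyl w) (e * r ^ k) (d * r ^ k)"
proof -
  obtain e where e: "0 < e" "chains_bounded E e d"
    using totally_disconnected_chains_bounded[OF compact_E tdc d] by blast
  \<comment> \<open>The factor \<open>r ^ M\<close> pays for the words of \<open>W k\<close> that
    overshoot the level \<open>k\<close>.\<close>
  have "chains_bounded (cyl w) (e * r ^ M * r ^ k) (d * r ^ k)" if w: "w \<in> W k" for k w
    unfolding chains_bounded_def
  proof (intro ballI allI impI)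
    note vw = W_valid[OF w]
    fix x y assume "x \<in> cyl w" and xy: "(x, y) \<in> (link (cyl w) (e * r ^ M * r ^ k))\<^sup>*"
    then obtain x' where x': "x' \<in> E" "x = sw w x'" by blast
    have "\<exists>y'. y = sw w y' \<and> (x', y') \<in> (link E e)\<^sup>*"
      using xy
    proof (induction rule: rtrancl_induct)
      case base
      then show ?case using x' by blast
    next
      case (step y z)
      then obtain y' where y': "y = sw w y'" "(x', y') \<in> (link E e)\<^sup>*" by blast
      have yE: "y' \<in> E" using link_rtrancl_in[OF y'(2) x'(1)] .
      obtain z' where z': "z' \<in> E" "z = sw w z'" using step(2) by (auto simp: link_def)
      have "r ^ lv w * dist y' z' = dist y z" using sw_dist[OF vw] y' z' by simp
      also have "\<dots> \<le> e * r ^ M * r ^ k" using step(2) by (simp add: link_def)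
      also have "\<dots> = r ^ (k + M) * e" by (simp add: power_add)
      also have "\<dots> \<le> r ^ lv w * e" using W_lv_less[OF w] r e by (intro mult_right_mono power_decreasing) auto
      finally have "dist y' z' \<le> e" using r_pow(1)[of "lv w"] by simp
      then have "(y', z') \<in> link E e" using yE z' by (simp add: link_def)
      with y'(2) have "(x', z') \<in> (link E e)\<^sup>*" by (rule rtrancl_into_rtrancl)
      then show ?case using z' by blast
    qed
    then obtain y' where y': "y = sw w y'" "(x', y') \<in> (link E e)\<^sup>*" by blast
    have "dist x' y' \<le> d" using chains_boundedD[OF e(2) x'(1) y'(2)] .
    then have "r ^ lv w * dist x' y' \<le> r ^ k * d"
      using W_lv_ge[OF w] r d by (intro mult_mono power_decreasing) auto
    then show "dist x y \<le> d * r ^ k" using sw_dist[OF vw] x' y' by (simp add: mult.commute)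
  qed
  then show ?thesis using e r_pow(1)[of M] by (intro exI[of _ "e * r ^ M"]) auto
qed

text \<open>Cylinders may touch, so their bounds are combined by \<open>chains_bounded_Un\<close>.
  Each added cylinder costs a smaller step length, hence the bound \<open>n\<close> on their
  number.\<close>

lemma cyls_chains_bounded:
  "0 < d \<Longrightarrow> \<exists>e>0. \<forall>k. \<forall>Q\<subseteq>W k. card Q \<le> n \<longrightarrow> chains_bounded (\<Union>w\<in>Q. cyl w) (e * r ^ k) (d * r ^ k)"
proof (induction n arbitrary: d)
  case 0
  show ?case
  proof (intro exI[of _ 1] conjI allI impI)
    fix k Q assume "Q \<subseteq> W k" "card Q \<le> 0"
    then have "Q = {}" using finite_subset[OF _ finite_W] by auto
    then show "chains_bounded (\<Union>w\<in>Q. cyl w) (1 * r ^ k) (d * r ^ k)" by (simp add: chains_bounded_def)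
  qed simp
next
  case (Suc n)
  obtain h where h: "0 < h" "\<And>k Q. Q \<subseteq> W k \<Longrightarrow> card Q \<le> n \<Longrightarrow> chains_bounded (\<Union>w\<in>Q. cyl w) (h * r ^ k) (d / 2 * r ^ k)"
    using Suc.IH[of "d / 2"] Suc.prems by auto
  \<comment> \<open>With \<open>e \<le> d2\<close> the union lemma needs
    \<open>3 * d2 \<le> h\<close> for the steps and \<open>4 * d2 \<le> d / 2\<close> for the
    diameter.\<close>
  define d2 where "d2 = min (h / 4) (d / 8)"
  have d2: "0 < d2" using h Suc.prems by (simp add: d2_def)
  obtain e0 where e0: "0 < e0" "\<And>k w. w \<in> W k \<Longrightarrow> chains_bounded (cyl w) (e0 * r ^ k) (d2 * r ^ k)"
    using cyl_chains_bounded[OF d2] by blast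
  define e where "e = min e0 d2"
  have e: "0 < e" "e \<le> e0" "e \<le> d2" using e0 d2 by (auto simp: e_def)
  have "chains_bounded (\<Union>w\<in>Q. cyl w) (e * r ^ k) (d * r ^ k)" if Q: "Q \<subseteq> W k" "card Q \<le> Suc n" for k Q
  proof (cases "Q = {}")
    case True
    then show ?thesis by (simp add: chains_bounded_def)
  next
    case False
    then obtain w where w: "w \<in> Q" by blast
    have rk: "0 < r ^ k" by (rule r_pow)
    have fQ: "finite Q" using Q finite_subset[OF _ finite_W] by blast
    have cQ: "card (Q - {w}) \<le> n" using Q(2) w fQ by simp
    have A: "chains_bounded (\<Union>v\<in>Q - {w}. cyl v) (h * r ^ k) (d / 2 * r ^ k)" using h(2)[of "Q - {w}" k] Q cQ by blast
    have B: "chains_bounded (cyl w) (e * r ^ k) (d2 * r ^ k)"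
    proof (rule chains_bounded_mono)
      show "chains_bounded (cyl w) (e0 * r ^ k) (d2 * r ^ k)" using e0(2)[of w k] Q w by blast
    qed (use e rk in auto)
    have le: "2 * e + d2 \<le> h" "d / 2 + 2 * d2 + 2 * e \<le> d"
      using e by (auto simp: d2_def)
    have "chains_bounded ((\<Union>v\<in>Q - {w}. cyl v) \<union> cyl w) (e * r ^ k) (d / 2 * r ^ k + 2 * (d2 * r ^ k) + 2 * (e * r ^ k))"
    proof (rule chains_bounded_Un[OF A B])
      have "(2 * e + d2) * r ^ k \<le> h * r ^ k" using le(1) rk by (intro mult_right_mono) auto
      then show "2 * (e * r ^ k) + d2 * r ^ k \<le> h * r ^ k" by (simp add: algebra_simps)
    qed (use e d2 rk Suc.prems in auto)
    moreover have eq: "(\<Union>v\<in>Q - {w}. cyl v) \<union> cyl w = (\<Union>v\<in>Q. cyl v)" using w by blast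
    ultimately have m1: "chains_bounded (\<Union>v\<in>Q. cyl v) (e * r ^ k) (d / 2 * r ^ k + 2 * (d2 * r ^ k) + 2 * (e * r ^ k))"
      by (simp only: eq)
    have m2: "d / 2 * r ^ k + 2 * (d2 * r ^ k) + 2 * (e * r ^ k) \<le> d * r ^ k"
      using mult_right_mono[OF le(2), of "r ^ k"] rk by (simp add: algebra_simps)
    show ?thesis using chains_bounded_mono[OF m1 order_refl m2] .
  qed
  then show ?case using e(1) by blast
qed

text \<open>As long as a chain from \<open>x\<close> stays within \<open>r ^ k\<close>, its next
  point is within \<open>2 * r ^ k\<close> and lies in one of boundedly many cylinders near
  \<open>x\<close>. The bound for the union of these cylinders then keeps that point within
  \<open>r ^ k\<close> again, so the chain never escapes.\<close>

lemma uniformly_disconnected: "\<exists>c>0. \<forall>k. chains_bounded E (c * r ^ k) (r ^ k)"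
proof -
  obtain n where n: "\<And>k x. card {w\<in>W k. \<exists>y\<in>cyl w. dist x y \<le> 2 * r ^ k} \<le> n"
    using cylinders_near_bound[of 2] by blast
  obtain e where e: "0 < e" "\<And>k Q. Q \<subseteq> W k \<Longrightarrow> card Q \<le> n \<Longrightarrow> chains_bounded (\<Union>w\<in>Q. cyl w) (e * r ^ k) (1 * r ^ k)"
    using cyls_chains_bounded[of 1 n] by auto
  define c where "c = min e 1"
  have c: "0 < c" "c \<le> e" "c \<le> 1" using e by (auto simp: c_def)
  have "chains_bounded E (c * r ^ k) (r ^ k)" for k
    unfolding chains_bounded_def
  proof (intro ballI allI impI)
    fix x y assume x: "x \<in> E" and xy: "(x, y) \<in> (link E (c * r ^ k))\<^sup>*"
    have rk: "0 < r ^ k" by (rule r_pow)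
    let ?Q = "{w\<in>W k. \<exists>y\<in>cyl w. dist x y \<le> 2 * r ^ k}"
    let ?A = "\<Union>w\<in>?Q. cyl w"
    have A: "chains_bounded ?A (c * r ^ k) (r ^ k)"
    proof (rule chains_bounded_mono)
      show "chains_bounded ?A (e * r ^ k) (1 * r ^ k)" using e(2)[of ?Q k] n[of k x] by blast
    qed (use c rk in auto)
    have inA: "z \<in> ?A" if z: "z \<in> E" "dist x z \<le> 2 * r ^ k" for z
    proof -
      obtain w where "w \<in> W k" "z \<in> cyl w" using E_W[of k] z(1) by blast
      then show ?thesis using z(2) by blast
    qed
    have xA: "x \<in> ?A" using inA[OF x] rk by simp
    have "(x, y) \<in> (link ?A (c * r ^ k))\<^sup>*"
      using xy
    proof (induction rule: rtrancl_induct)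
      case (step y z)
      have yA: "y \<in> ?A" using link_rtrancl_in[OF step.IH xA] .
      have d: "dist x y \<le> r ^ k" using chains_boundedD[OF A xA step.IH] .
      have z: "z \<in> E" "dist y z \<le> c * r ^ k" using step(2) by (auto simp: link_def)
      have "c * r ^ k \<le> r ^ k" using c rk by simp
      then have "dist x z \<le> 2 * r ^ k" using d z dist_triangle[of x z y] by linarith
      then have "z \<in> ?A" using inA[OF z(1)] by blast
      then have "(y, z) \<in> link ?A (c * r ^ k)" using yA z by (simp add: link_def)
      then show ?case using step.IH by (meson rtrancl_into_rtrancl)
    qed simp
    then show "dist x y \<le> r ^ k" using chains_boundedD[OF A xA] by blast
  qed
  then show ?thesis using c by blast
qed

section \<open>Chain components as pieces\<close>

definition gp :: real where "gp = (SOME c. c > 0 \<and> (\<forall>k. chains_bounded E (c * r ^ k) (r ^ k)))"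

lemma gp: "0 < gp" "chains_bounded E (gp * r ^ k) (r ^ k)"
  using someI_ex[OF uniformly_disconnected] unfolding gp_def by auto

definition cmp :: "nat \<Rightarrow> 'a \<Rightarrow> 'a set" where "cmp k x = {y. (x, y) \<in> (link E (gp * r ^ k))\<^sup>*}"

definition Pk :: "nat \<Rightarrow> 'a set set" where "Pk k = cmp k ` E"

definition sep :: "real \<Rightarrow> 'a set \<Rightarrow> bool" where
  "sep h B \<longleftrightarrow> B \<subseteq> E \<and> (\<forall>x\<in>B. \<forall>y\<in>E - B. h \<le> dist x y)"

lemma cmp_self: "x \<in> cmp k x"
  by (simp add: cmp_def)

lemma cmp_sub_E: "x \<in> E \<Longrightarrow> cmp k x \<subseteq> E"
  using link_rtrancl_in by (auto simp: cmp_def)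

lemma cmp_eq: "y \<in> cmp k x \<Longrightarrow> cmp k y = cmp k x"
proof -
  assume "y \<in> cmp k x"
  then have xy: "(x, y) \<in> (link E (gp * r ^ k))\<^sup>*" by (simp add: cmp_def)
  note yx = link_rtrancl_sym[OF xy]
  show ?thesis unfolding cmp_def using rtrancl_trans[OF xy] rtrancl_trans[OF yx] by blast
qed

lemma Pk_cover: "\<Union>(Pk k) = E"
  using cmp_self cmp_sub_E unfolding Pk_def by blast

lemma Pk_ne: "A \<in> Pk k \<Longrightarrow> A \<noteq> {}"
  using cmp_self by (auto simp: Pk_def)

lemma Pk_sub_E: "A \<in> Pk k \<Longrightarrow> A \<subseteq> E"
  using Pk_cover by blast

lemma Pk_eq_cmp: "A \<in> Pk k \<Longrightarrow> x \<in> A \<Longrightarrow> A = cmp k x"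
  using cmp_eq by (auto simp: Pk_def)

lemma Pk_eqI: "A \<in> Pk k \<Longrightarrow> B \<in> Pk k \<Longrightarrow> x \<in> A \<Longrightarrow> x \<in> B \<Longrightarrow> A = B"
  using Pk_eq_cmp by metis

lemma Pk_diam: "A \<in> Pk k \<Longrightarrow> x \<in> A \<Longrightarrow> y \<in> A \<Longrightarrow> dist x y \<le> r ^ k"
  using Pk_eq_cmp[of A k x] Pk_sub_E[of A k] chains_boundedD[OF gp(2)] by (auto simp: cmp_def)

lemma Pk_gap: "A \<in> Pk k \<Longrightarrow> x \<in> A \<Longrightarrow> y \<in> E \<Longrightarrow> y \<notin> A \<Longrightarrow> gp * r ^ k < dist x y"
proof (rule ccontr)
  assume A: "A \<in> Pk k" "x \<in> A" "y \<in> E" "y \<notin> A" and "\<not> gp * r ^ k < dist x y"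
  then have "(x, y) \<in> link E (gp * r ^ k)" using Pk_sub_E by (auto simp: link_def)
  then have "y \<in> cmp k x" by (auto simp: cmp_def)
  then show False using Pk_eq_cmp[OF A(1,2)] A(4) by blast
qed

lemma sep_Pk: "A \<in> Pk k \<Longrightarrow> sep (gp * r ^ k) A"
  unfolding sep_def
proof (intro conjI ballI)
  show "A \<subseteq> E" if "A \<in> Pk k" using Pk_sub_E that .
  show "gp * r ^ k \<le> dist x y" if "A \<in> Pk k" "x \<in> A" "y \<in> E - A" for x y
    using Pk_gap[OF that(1,2), of y] that(3) by simp
qed

lemma cmp_antimono: "k \<le> k' \<Longrightarrow> cmp k' x \<subseteq> cmp k x"
proof -
  assume "k \<le> k'"
  then have "gp * r ^ k' \<le> gp * r ^ k" using gp(1) r by (intro mult_left_mono power_decreasing) auto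
  then have "link E (gp * r ^ k') \<subseteq> link E (gp * r ^ k)" by (intro link_mono) auto
  then show ?thesis unfolding cmp_def using rtrancl_mono by blast
qed

lemma Pk_refine: "k \<le> k' \<Longrightarrow> B \<in> Pk k' \<Longrightarrow> \<exists>A\<in>Pk k. B \<subseteq> A"
  unfolding Pk_def using cmp_antimono by blast

text \<open>A chain with steps shorter than \<open>h\<close> cannot cross the border of
  \<open>B\<close>. This is how every separated set becomes a union of pieces of a fine enough
  level.\<close>

lemma sep_Pk_dichotomy:
  assumes B: "sep h B" and h: "gp * r ^ k < h" and A: "A \<in> Pk k"
  shows "A \<subseteq> B \<or> A \<inter> B = {}"
proof (rule ccontr)
  assume "\<not> ?thesis"
  then obtain x y where xy: "x \<in> A" "x \<in> B" "y \<in> A" "y \<notin> B" by blast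
  then have "(x, y) \<in> (link E (gp * r ^ k))\<^sup>*" using Pk_eq_cmp[OF A xy(1)] by (auto simp: cmp_def)
  then have "y \<in> B"
  proof (induction rule: rtrancl_induct)
    case base
    then show ?case using xy by blast
  next
    case (step y z)
    have z: "z \<in> E" "dist y z \<le> gp * r ^ k" using step(2) by (auto simp: link_def)
    show ?case
    proof (rule ccontr)
      assume "z \<notin> B"
      then have "h \<le> dist y z" using B step.IH z unfolding sep_def by blast
      then show False using z h by linarith
    qed
  qed
  then show False using xy by blast
qed

lemma ex_level: "0 < a \<Longrightarrow> \<exists>j. r ^ j * b < a"
proof -
  assume a: "0 < a"
  have "(\<lambda>j. r ^ j * b) \<longlonglongrightarrow> 0 * b" using r by (intro tendsto_mult tendsto_const LIMSEQ_power_zero) auto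
  then have "eventually (\<lambda>j. r ^ j * b < a) sequentially" using a by (intro order_tendstoD(2)) auto
  then show ?thesis by (auto simp: eventually_sequentially)
qed

text \<open>The shift of level after which a cylinder is smaller than the chain step of a piece and
  therefore lies in a single piece.\<close>

definition j0 :: nat where "j0 = (SOME j. r ^ j * dm < gp)"

lemma j0: "r ^ j0 * dm < gp"
  unfolding j0_def by (rule someI_ex[OF ex_level[OF gp(1)]])

lemma cyl_in_Pk:
  assumes w: "w \<in> W (k + j0)"
  shows "\<exists>A\<in>Pk k. cyl w \<subseteq> A"
proof -
  obtain x where x: "x \<in> cyl w" using E_ne by blast
  have cE: "cyl w \<subseteq> E" using cyl_sub[OF W_valid[OF w]] .
  have "cyl w \<subseteq> cmp k x"
  proof
    fix y assume y: "y \<in> cyl w"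
    have "dist x y \<le> r ^ k * (r ^ j0 * dm)" using dist_cyl_W[OF w x y] by (simp add: power_add mult.assoc)
    also have "\<dots> \<le> r ^ k * gp" using j0 r_pow(1)[of k] by (intro mult_left_mono) auto
    finally have "(x, y) \<in> link E (gp * r ^ k)" using x y cE by (auto simp: link_def mult.commute)
    then show "y \<in> cmp k x" by (auto simp: cmp_def)
  qed
  then show ?thesis using x cE unfolding Pk_def by blast
qed

lemma Pk_contains_cyl:
  assumes A: "A \<in> Pk k"
  shows "\<exists>w\<in>W (k + j0). cyl w \<subseteq> A"
proof -
  obtain x where x: "x \<in> A" using Pk_ne[OF A] by blast
  then have "x \<in> E" using Pk_sub_E[OF A] by blast
  then obtain w where w: "w \<in> W (k + j0)" "x \<in> cyl w" using E_W[of "k + j0"] by blast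
  obtain A' where "A' \<in> Pk k" "cyl w \<subseteq> A'" using cyl_in_Pk[OF w(1)] by blast
  then show ?thesis using Pk_eqI[OF A, of A' x] x w by blast
qed

lemma finite_Pk: "finite (Pk k)"
proof -
  obtain g where g: "\<And>A. A \<in> Pk k \<Longrightarrow> g A \<in> W (k + j0) \<and> cyl (g A) \<subseteq> A"
    using bchoice[of "Pk k" "\<lambda>A w. w \<in> W (k + j0) \<and> cyl w \<subseteq> A"] Pk_contains_cyl by blast
  have "inj_on g (Pk k)"
  proof (rule inj_onI)
    fix A B assume AB: "A \<in> Pk k" "B \<in> Pk k" "g A = g B"
    obtain x where "x \<in> cyl (g A)" using E_ne by blast
    then show "A = B" using g[OF AB(1)] g[OF AB(2)] AB Pk_eqI[of A k B x] by auto
  qed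
  then show ?thesis using g finite_imageD[of g "Pk k"] finite_subset[OF _ finite_W[of "k + j0"], of "g ` Pk k"] by blast
qed

end

section \<open>Clopen sets, their self-similar measure, and insulated sets\<close>

context tdc_attractor
begin

lemma sepD: "sep h B \<Longrightarrow> x \<in> B \<Longrightarrow> y \<in> E \<Longrightarrow> y \<notin> B \<Longrightarrow> h \<le> dist x y"
  by (simp add: sep_def)

lemma sep_sub: "sep h B \<Longrightarrow> B \<subseteq> E"
  by (simp add: sep_def)

lemma sep_mono: "sep h B \<Longrightarrow> h' \<le> h \<Longrightarrow> sep h' B"
  by (auto simp: sep_def intro: order_trans)

lemma sep_E: "sep h E" and sep_empty: "sep h {}"
  by (auto simp: sep_def)

lemma sep_Un: "sep h A \<Longrightarrow> sep h B \<Longrightarrow> sep h (A \<union> B)"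
  by (auto simp: sep_def)

lemma sep_compl: "sep h A \<Longrightarrow> sep h (E - A)"
proof -
  assume A: "sep h A"
  show ?thesis
    unfolding sep_def
  proof (intro conjI ballI)
    fix x y assume "x \<in> E - A" "y \<in> E - (E - A)"
    then show "h \<le> dist x y" using sepD[OF A, of y x] by (simp add: dist_commute)
  qed blast
qed

lemma sep_Int: "sep h A \<Longrightarrow> sep h B \<Longrightarrow> sep h (A \<inter> B)"
  unfolding sep_def by blast

lemma sep_Diff: "sep h A \<Longrightarrow> sep h B \<Longrightarrow> sep h (A - B)"
proof -
  assume A: "sep h A" and B: "sep h B"
  have "A - B = A \<inter> (E - B)" using sep_sub[OF A] by blast
  then show ?thesis using sep_Int[OF A sep_compl[OF B]] by simp
qed

definition clopen :: "'a set \<Rightarrow> bool" where "clopen B \<longleftrightarrow> (\<exists>h>0. sep h B)"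

lemma clp2:
  assumes "clopen A" "clopen B"
  obtains h where "0 < h" "sep h A" "sep h B"
proof -
  obtain a b where "0 < a" "sep a A" "0 < b" "sep b B" using assms by (auto simp: clopen_def)
  then show ?thesis using that[of "min a b"] sep_mono[of a A "min a b"] sep_mono[of b B "min a b"] by simp
qed

lemma clopen_E: "clopen E" and clopen_empty: "clopen {}"
  unfolding clopen_def using sep_E[of 1] sep_empty[of 1] zero_less_one by blast+

lemma clopen_Un: "clopen A \<Longrightarrow> clopen B \<Longrightarrow> clopen (A \<union> B)"
  by (erule (1) clp2) (use sep_Un clopen_def in blast)

lemma clopen_Int: "clopen A \<Longrightarrow> clopen B \<Longrightarrow> clopen (A \<inter> B)"
  by (erule (1) clp2) (use sep_Int clopen_def in blast)

lemma clopen_Diff: "clopen A \<Longrightarrow> clopen B \<Longrightarrow> clopen (A - B)"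
  by (erule (1) clp2) (use sep_Diff clopen_def in blast)

lemma clopen_sub: "clopen A \<Longrightarrow> A \<subseteq> E"
  using sep_sub by (auto simp: clopen_def)

lemma clopen_UN: "finite I \<Longrightarrow> (\<And>i. i \<in> I \<Longrightarrow> clopen (A i)) \<Longrightarrow> clopen (\<Union>i\<in>I. A i)"
  by (induction I rule: finite_induct) (auto simp: clopen_empty intro: clopen_Un)

lemma clopen_Pk: "A \<in> Pk k \<Longrightarrow> clopen A"
  unfolding clopen_def using sep_Pk gp(1) r_pow(1) by (intro exI[of _ "gp * r ^ k"]) auto

lemma cyl_dichotomy:
  assumes B: "sep h B" and n: "r ^ n * dm < h" and w: "w \<in> W n"
  shows "cyl w \<subseteq> B \<or> cyl w \<inter> B = {}"
proof (rule ccontr)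
  assume "\<not> ?thesis"
  then obtain x y where xy: "x \<in> cyl w" "x \<in> B" "y \<in> cyl w" "y \<notin> B" by blast
  have "y \<in> E" using xy cyl_sub[OF W_valid[OF w]] by blast
  then have "h \<le> dist x y" using sepD[OF B xy(2) _ xy(4)] by blast
  then show False using dist_cyl_W[OF w xy(1,3)] n by linarith
qed

definition mun :: "nat \<Rightarrow> 'a set \<Rightarrow> real" where
  "mun n B = (\<Sum>w\<in>{w\<in>W n. cyl w \<subseteq> B}. p ^ lv w)"

text \<open>Meaningful for clopen \<open>B\<close> only, where the sums are eventually constant.\<close>

definition mu :: "'a set \<Rightarrow> real" where "mu B = lim (\<lambda>n. mun n B)"

lemma mun_if: "mun n B = (\<Sum>w\<in>W n. if cyl w \<subseteq> B then p ^ lv w else 0)"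
  unfolding mun_def by (rule sum.inter_filter) simp

text \<open>At this level no cylinder straddles the border of \<open>B\<close>, so a word is counted
  exactly when all its one-letter extensions are.\<close>

lemma mun_Suc:
  assumes B: "sep h B" and n: "r ^ n * dm < h"
  shows "mun (Suc n) B = mun n B"
proof -
  let ?phi = "\<lambda>w. if cyl w \<subseteq> B then p ^ lv w else 0"
  have "(\<Sum>i<N. ?phi (w @ [i])) = ?phi w" if w: "w \<in> W n" for w
  proof -
    have sub: "cyl (w @ [i]) \<subseteq> cyl w" if "i < N" for i
      using cyl_prefix[of w "w @ [i]"] W_valid[OF w] that by simp
    show ?thesis
    proof (cases "cyl w \<subseteq> B")
      case True
      have "?phi (w @ [i]) = p ^ lv w * p ^ l i" if "i < N" for i
      proof -
        have "cyl (w @ [i]) \<subseteq> B" using sub[OF that] True by (rule order_trans)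
        then show ?thesis by (simp add: power_add)
      qed
      then have "(\<Sum>i<N. ?phi (w @ [i])) = (\<Sum>i<N. p ^ lv w * p ^ l i)" by (intro sum.cong) auto
      also have "\<dots> = p ^ lv w" using sum_p by (simp add: sum_distrib_left[symmetric])
      finally show ?thesis using True by simp
    next
      case False
      then have dis: "cyl w \<inter> B = {}" using cyl_dichotomy[OF B n w] by blast
      have "\<not> cyl (w @ [i]) \<subseteq> B" if "i < N" for i
      proof
        assume "cyl (w @ [i]) \<subseteq> B"
        then have "cyl (w @ [i]) = {}" using sub[OF that] dis by blast
        then show False using E_ne by blast
      qed
      then have "(\<Sum>i<N. ?phi (w @ [i])) = 0" by (intro sum.neutral) auto
      then show ?thesis using False by simp
    qed
  qed
  then have "(\<Sum>w\<in>{w\<in>W n. lv w = n}. \<Sum>i<N. ?phi (w @ [i])) = (\<Sum>w\<in>{w\<in>W n. lv w = n}. ?phi w)"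
    by (intro sum.cong refl) blast
  then show ?thesis unfolding mun_if sum_W_Suc sum_W_split[of _ n] by (rule arg_cong)
qed

lemma level_mono: "r ^ n * dm < h \<Longrightarrow> n \<le> m \<Longrightarrow> r ^ m * dm < h"
proof -
  assume h: "r ^ n * dm < h" and nm: "n \<le> m"
  have "r ^ m * dm \<le> r ^ n * dm" using nm r dm_pos by (intro mult_right_mono power_decreasing) auto
  then show ?thesis using h by linarith
qed

lemma mu_eq:
  assumes B: "sep h B" and n: "r ^ n * dm < h"
  shows "mu B = mun n B"
proof -
  have "mun m B = mun n B" if "n \<le> m" for m
    using that
  proof (induction m)
    case (Suc m)
    show ?case
    proof (cases "n = Suc m")
      case False
      then have nm: "n \<le> m" using Suc.prems by simp
      then show ?thesis using Suc.IH mun_Suc[OF B level_mono[OF n nm]] by simp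
    qed simp
  qed simp
  then have "eventually (\<lambda>m. mun m B = mun n B) sequentially"
    unfolding eventually_sequentially by blast
  then have "(\<lambda>m. mun m B) \<longlonglongrightarrow> mun n B" by (rule tendsto_eventually)
  then show ?thesis unfolding mu_def by (rule limI)
qed

lemma clopen_level:
  assumes "clopen A" "clopen B"
  obtains h n where "0 < h" "sep h A" "sep h B" "r ^ n * dm < h"
  using clp2[OF assms] ex_level by metis

lemma mu_empty [simp]: "mu {} = 0"
proof -
  obtain n where "r ^ n * dm < 1" using ex_level[of 1] by auto
  from mu_eq[OF sep_empty this] show ?thesis using E_ne by (simp add: mun_def)
qed

lemma mu_E: "mu E = 1"
proof -
  obtain n where "r ^ n * dm < 1" using ex_level[of 1] by auto
  from mu_eq[OF sep_E this] have "mu E = mun n E" .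
  also have "{w\<in>W n. cyl w \<subseteq> E} = W n" using cyl_sub W_valid by blast
  then have "mun n E = 1" by (simp add: mun_def sum_weights_W)
  finally show ?thesis .
qed

lemma mu_Un:
  assumes A: "clopen A" and B: "clopen B" and dis: "A \<inter> B = {}"
  shows "mu (A \<union> B) = mu A + mu B"
proof -
  obtain h n where h: "0 < h" "sep h A" "sep h B" "r ^ n * dm < h" using clopen_level[OF A B] .
  have "{w\<in>W n. cyl w \<subseteq> A \<union> B} = {w\<in>W n. cyl w \<subseteq> A} \<union> {w\<in>W n. cyl w \<subseteq> B}"
    using cyl_dichotomy[OF h(2,4)] by blast
  moreover have "{w\<in>W n. cyl w \<subseteq> A} \<inter> {w\<in>W n. cyl w \<subseteq> B} = {}" using dis E_ne by blast
  ultimately have "mun n (A \<union> B) = mun n A + mun n B" unfolding mun_def by (simp add: sum.union_disjoint)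
  then show ?thesis using mu_eq[OF h(2,4)] mu_eq[OF h(3,4)] mu_eq[OF sep_Un[OF h(2,3)] h(4)] by simp
qed

lemma mu_UN:
  "finite I \<Longrightarrow> (\<And>i. i \<in> I \<Longrightarrow> clopen (A i)) \<Longrightarrow> disjoint_family_on A I \<Longrightarrow> mu (\<Union>i\<in>I. A i) = (\<Sum>i\<in>I. mu (A i))"
proof (induction I rule: finite_induct)
  case (insert j I)
  have "A j \<inter> A i = {}" if "i \<in> I" for i
    using insert.prems(2) insert.hyps(2) that unfolding disjoint_family_on_def by auto
  then have "A j \<inter> (\<Union>i\<in>I. A i) = {}" by blast
  then have "mu (A j \<union> (\<Union>i\<in>I. A i)) = mu (A j) + mu (\<Union>i\<in>I. A i)"
    using insert by (intro mu_Un clopen_UN) auto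
  moreover have "disjoint_family_on A I" using insert.prems(2) by (auto simp: disjoint_family_on_def)
  ultimately show ?case using insert by simp
qed simp

lemma mu_Diff: "clopen A \<Longrightarrow> clopen B \<Longrightarrow> B \<subseteq> A \<Longrightarrow> mu (A - B) = mu A - mu B"
  using mu_Un[of "A - B" B] clopen_Diff[of A B] by (simp add: Un_absorb2 Int_commute)

lemma mu_nonneg: "clopen B \<Longrightarrow> 0 \<le> mu B"
proof -
  assume B: "clopen B"
  obtain h n where h: "0 < h" "sep h B" "sep h B" "r ^ n * dm < h" using clopen_level[OF B B] .
  have "0 \<le> mun n B" unfolding mun_def using p by (intro sum_nonneg) auto
  then show ?thesis using mu_eq[OF h(2,4)] by simp
qed

lemma mu_pos: "clopen B \<Longrightarrow> B \<noteq> {} \<Longrightarrow> 0 < mu B"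
proof -
  assume B: "clopen B" "B \<noteq> {}"
  obtain h n where h: "0 < h" "sep h B" "sep h B" "r ^ n * dm < h" using clopen_level[OF B(1) B(1)] .
  obtain x where x: "x \<in> B" using B by blast
  then have "x \<in> E" using clopen_sub[OF B(1)] by blast
  then obtain w where w: "w \<in> W n" "x \<in> cyl w" using E_W[of n] by blast
  then have "cyl w \<subseteq> B" using cyl_dichotomy[OF h(2,4) w(1)] x by blast
  then have "0 < mun n B" unfolding mun_def using w(1) p by (intro sum_pos) auto
  then show ?thesis using mu_eq[OF h(2,4)] by simp
qed

text \<open>With gap and diameter both comparable to \<open>r ^ k\<close>, the set is a union of
  boundedly many cylinders of level \<open>k + j\<close>, and each of them contributes
  \<open>p ^ k\<close> times one of finitely many powers of \<open>p\<close>. The value 0 belongs to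
  the empty set.\<close>

lemma finite_types:
  assumes C: "0 < C"
  shows "\<exists>Phi. finite Phi \<and> (\<forall>k B. sep (r ^ k / C) B \<longrightarrow> (\<forall>x\<in>B. \<forall>y\<in>B. dist x y \<le> C * r ^ k) \<longrightarrow> mu B / p ^ k \<in> Phi)"
proof -
  obtain j where j: "r ^ j * dm < 1 / C" using ex_level[of "1 / C"] C by auto
  obtain nb where nb: "\<And>k x. card {w\<in>W k. \<exists>y\<in>cyl w. dist x y \<le> C / r ^ j * r ^ k} \<le> nb"
    using cylinders_near_bound[of "C / r ^ j"] by blast
  define Phi where "Phi = insert 0 (bounded_sums ((\<lambda>i. p ^ (j + i)) ` {..M}) nb)"
  have "mu B / p ^ k \<in> Phi" if B: "sep (r ^ k / C) B" and d: "\<forall>x\<in>B. \<forall>y\<in>B. dist x y \<le> C * r ^ k" for k B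
  proof (cases "B = {}")
    case False
    then obtain x where x: "x \<in> B" by blast
    have "r ^ k * (r ^ j * dm) < r ^ k * (1 / C)" using j r_pow(1)[of k] by (intro mult_strict_left_mono) auto
    then have "mu B = mun (k + j) B" by (intro mu_eq[OF B]) (simp add: power_add mult.assoc)
    also have "\<dots> = p ^ k * (\<Sum>w\<in>{w\<in>W (k + j). cyl w \<subseteq> B}. p ^ (lv w - k))"
      unfolding mun_def sum_distrib_left
    proof (rule sum.cong[OF refl])
      fix w assume "w \<in> {w\<in>W (k + j). cyl w \<subseteq> B}"
      then have "k \<le> lv w" using W_lv_ge[of w "k + j"] by simp
      then show "p ^ lv w = p ^ k * p ^ (lv w - k)" by (simp add: power_add[symmetric])
    qed
    finally have eq: "mu B / p ^ k = (\<Sum>w\<in>{w\<in>W (k + j). cyl w \<subseteq> B}. p ^ (lv w - k))" using p_pow by simp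
    have "(\<Sum>w\<in>{w\<in>W (k + j). cyl w \<subseteq> B}. p ^ (lv w - k)) \<in> bounded_sums ((\<lambda>i. p ^ (j + i)) ` {..M}) nb"
    proof (rule sum_in_bounded_sums)
      have "{w\<in>W (k + j). cyl w \<subseteq> B} \<subseteq> {w\<in>W (k + j). \<exists>y\<in>cyl w. dist x y \<le> C / r ^ j * r ^ (k + j)}"
      proof clarify
        fix w assume "w \<in> W (k + j)" and sub: "cyl w \<subseteq> B"
        obtain y where y: "y \<in> cyl w" using E_ne by blast
        then have "dist x y \<le> C * r ^ k" using d x sub by blast
        also have "\<dots> = C / r ^ j * r ^ (k + j)" using r by (simp add: power_add)
        finally show "\<exists>y\<in>cyl w. dist x y \<le> C / r ^ j * r ^ (k + j)" using y by blast
      qed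
      then have "card {w\<in>W (k + j). cyl w \<subseteq> B} \<le> card {w\<in>W (k + j). \<exists>y\<in>cyl w. dist x y \<le> C / r ^ j * r ^ (k + j)}"
        by (intro card_mono) auto
      then show "card {w\<in>W (k + j). cyl w \<subseteq> B} \<le> nb" using nb[of "k + j" x] by linarith
      show "(\<lambda>w. p ^ (lv w - k)) ` {w\<in>W (k + j). cyl w \<subseteq> B} \<subseteq> (\<lambda>i. p ^ (j + i)) ` {..M}"
      proof clarify
        fix w assume w: "w \<in> W (k + j)"
        have "lv w - k = j + (lv w - (k + j))" "lv w - (k + j) \<le> M" using W_lv_ge[OF w] W_lv_less[OF w] by auto
        then show "p ^ (lv w - k) \<in> (\<lambda>i. p ^ (j + i)) ` {..M}" by (intro image_eqI[of _ _ "lv w - (k + j)"]) auto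
      qed
    qed simp
    then show ?thesis unfolding eq Phi_def by blast
  qed (simp add: Phi_def)
  moreover have "finite Phi" unfolding Phi_def using finite_bounded_sums by simp
  ultimately show ?thesis by blast
qed

text \<open>No copy of \<open>F\<close> in a cylinder comes closer to the disjoint cylinders than in proportion to its size, so copies of \<open>F\<close>
  stay clopen in \<open>E\<close> although cylinders need not be.\<close>

definition insul :: "real \<Rightarrow> 'a set \<Rightarrow> bool" where
  "insul h F \<longleftrightarrow> sep h F \<and>
     (\<forall>x v. valid x \<longrightarrow> valid v \<longrightarrow> x \<parallel> v \<longrightarrow> (\<forall>a\<in>F. \<forall>b\<in>cyl v. h * r ^ lv x \<le> dist (sw x a) b))"

lemma insulD: "insul h F \<Longrightarrow> valid x \<Longrightarrow> valid v \<Longrightarrow> x \<parallel> v \<Longrightarrow> a \<in> F \<Longrightarrow> b \<in> cyl v \<Longrightarrow> h * r ^ lv x \<le> dist (sw x a) b"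
  unfolding insul_def by blast

lemma insul_sep: "insul h F \<Longrightarrow> sep h F"
  by (simp add: insul_def)

lemma insul_subset:
  assumes F: "insul h F" and B: "sep h' B" "B \<subseteq> F" and e: "e \<le> h" "e \<le> h'"
  shows "insul e B"
  unfolding insul_def
proof (intro conjI allI impI ballI)
  show "sep e B" using sep_mono[OF B(1) e(2)] .
  fix x v a b assume xv: "valid x" "valid v" "x \<parallel> v" and ab: "a \<in> B" "b \<in> cyl v"
  have "e * r ^ lv x \<le> h * r ^ lv x" using e(1) r_pow(1)[of "lv x"] by (intro mult_right_mono) auto
  also have "\<dots> \<le> dist (sw x a) b" using insulD[OF F xv _ ab(2)] ab(1) B(2) by blast
  finally show "e * r ^ lv x \<le> dist (sw x a) b" .
qed

lemma insul_Un: "insul h A \<Longrightarrow> insul h B \<Longrightarrow> insul h (A \<union> B)"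
proof -
  assume A: "insul h A" and B: "insul h B"
  show ?thesis
    unfolding insul_def
  proof (intro conjI allI impI ballI)
    show "sep h (A \<union> B)" using sep_Un[OF insul_sep[OF A] insul_sep[OF B]] .
    fix x v a b assume "valid x" "valid v" "x \<parallel> v" "a \<in> A \<union> B" "b \<in> cyl v"
    then show "h * r ^ lv x \<le> dist (sw x a) b" using insulD[OF A, of x v a b] insulD[OF B, of x v a b] by auto
  qed
qed

lemma insul_empty: "insul h {}"
  by (simp add: insul_def sep_empty)

text \<open>A copy under \<open>x\<close> of the copy under \<open>u\<close> is the copy under
  \<open>x @ u\<close>, and \<open>x @ u\<close> inherits from \<open>x\<close> that it is
  incomparable with \<open>v\<close>; stability under copying is why \<open>insul\<close> quantifies
  over all \<open>x\<close>. For the gap inside \<open>E\<close>, points are located by the cut set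
  \<open>W (lv u)\<close>, which contains \<open>u\<close>.\<close>

lemma insul_sw:
  assumes F: "insul h F" and u: "valid u"
  shows "insul (h * r ^ lv u) (sw u ` F)"
  unfolding insul_def
proof (intro conjI allI impI ballI)
  show "sep (h * r ^ lv u) (sw u ` F)"
    unfolding sep_def
  proof (intro conjI ballI)
    show "sw u ` F \<subseteq> E" using sep_sub[OF insul_sep[OF F]] cyl_sub[OF u] by blast
    fix x y assume x: "x \<in> sw u ` F" and y: "y \<in> E - sw u ` F"
    obtain a where a: "a \<in> F" "x = sw u a" using x by blast
    have "u \<in> W (lv u)" using W_append[OF u, of "[]" 0] by (simp add: W_0)
    obtain w where w: "w \<in> W (lv u)" "y \<in> cyl w" using y E_W[of "lv u"] by blast
    show "h * r ^ lv u \<le> dist x y"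
    proof (cases "w = u")
      case True
      then obtain b where b: "b \<in> E" "y = sw u b" using w by blast
      then have "b \<notin> F" using y by blast
      then have "h \<le> dist a b" using sepD[OF insul_sep[OF F] a(1) b(1)] by blast
      then show ?thesis using sw_dist[OF u, of a b] a b r_pow(1)[of "lv u"] by (simp add: mult.commute)
    next
      case False
      then have "u \<parallel> w" using W_parallel[OF \<open>u \<in> W (lv u)\<close> w(1)] by blast
      then show ?thesis using insulD[OF F u W_valid[OF w(1)] _ a(1) w(2)] a by blast
    qed
  qed
  fix x v a b assume xv: "valid x" "valid v" "x \<parallel> v" and ab: "a \<in> sw u ` F" "b \<in> cyl v"
  obtain a' where a': "a' \<in> F" "a = sw u a'" using ab by blast
  have "x @ u \<parallel> v"
    using xv(3) append_prefixD[of x u v] prefix_same_cases[of x "x @ u" v] unfolding parallel_def by auto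
  then have "h * r ^ lv (x @ u) \<le> dist (sw (x @ u) a') b"
    using insulD[OF F, of "x @ u" v a' b] xv(1,2) u a'(1) ab(2) by simp
  then show "h * r ^ lv u * r ^ lv x \<le> dist (sw x a) b" using a' by (simp add: power_add ac_simps)
qed

text \<open>Insulation keeps the cylinders of incomparable words away from the copy, so the fine
  cylinders inside it are exactly the \<open>u\<close>-copies of those inside
  \<open>F\<close>.\<close>

lemma mu_sw:
  assumes F: "insul h F" and h: "0 < h" and u: "valid u"
  shows "mu (sw u ` F) = p ^ lv u * mu F"
proof -
  obtain n0 where n0: "r ^ n0 * dm < h" using ex_level[OF h] by blast
  \<comment> \<open>\<open>Suc\<close> makes every word of \<open>W (lv u + n)\<close> longer than
    \<open>u\<close> in the sense of \<open>lv\<close>, which rules out prefixes of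
    \<open>u\<close>, including \<open>u\<close> itself.\<close>
  define n where "n = Suc n0"
  have n: "r ^ n * dm < h" using level_mono[OF n0, of n] by (simp add: n_def)
  have "r ^ (lv u + n) * dm < h * r ^ lv u"
    using mult_strict_right_mono[OF n r_pow(1)[of "lv u"]] by (simp add: power_add ac_simps)
  then have "mu (sw u ` F) = mun (lv u + n) (sw u ` F)" by (rule mu_eq[OF insul_sep[OF insul_sw[OF F u]]])
  also have "{w\<in>W (lv u + n). cyl w \<subseteq> sw u ` F} = (@) u ` {v\<in>W n. cyl v \<subseteq> F}"
  proof (intro equalityI subsetI)
    fix w assume "w \<in> {w\<in>W (lv u + n). cyl w \<subseteq> sw u ` F}"
    then have w: "w \<in> W (lv u + n)" "cyl w \<subseteq> sw u ` F" by auto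
    have "\<not> u \<parallel> w"
    proof
      assume "u \<parallel> w"
      obtain b where b: "b \<in> cyl w" using E_ne by blast
      then obtain a where a: "a \<in> F" "b = sw u a" using w(2) by blast
      then have "h * r ^ lv u \<le> dist (sw u a) b" using insulD[OF F u W_valid[OF w(1)] \<open>u \<parallel> w\<close> a(1) b] by blast
      then show False using a h r_pow(1)[of "lv u"] by (simp add: mult_le_0_iff)
    qed
    moreover have "\<not> prefix w u"
    proof
      assume "prefix w u"
      then have "lv w \<le> lv u" by (rule lv_prefix)
      then show False using W_lv_ge[OF w(1)] by (simp add: n_def)
    qed
    ultimately have "prefix u w" unfolding parallel_def by blast
    then obtain v where v: "w = u @ v" by (auto simp: prefix_def)
    then have "v \<in> W n" using W_append[OF u] w(1) by simp
    moreover have "cyl v \<subseteq> F"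
      using w(2) sw_inj[OF u] unfolding v sw_append_image by (simp add: inj_image_subset_iff)
    ultimately show "w \<in> (@) u ` {v\<in>W n. cyl v \<subseteq> F}" using v by blast
  next
    fix w assume "w \<in> (@) u ` {v\<in>W n. cyl v \<subseteq> F}"
    then obtain v where "v \<in> W n" "cyl v \<subseteq> F" "w = u @ v" by blast
    then show "w \<in> {w\<in>W (lv u + n). cyl w \<subseteq> sw u ` F}"
      using W_append[OF u, of v n] image_mono[of "cyl v" F "sw u"] by (simp add: image_image)
  qed
  then have "mun (lv u + n) (sw u ` F) = (\<Sum>w\<in>(@) u ` {v\<in>W n. cyl v \<subseteq> F}. p ^ lv w)" by (simp add: mun_def)
  also have "\<dots> = (\<Sum>v\<in>{v\<in>W n. cyl v \<subseteq> F}. p ^ lv u * p ^ lv v)"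
    by (subst sum.reindex) (auto simp: inj_on_def power_add)
  also have "\<dots> = p ^ lv u * mu F" using mu_eq[OF insul_sep[OF F] n] by (simp add: mun_def sum_distrib_left)
  finally show ?thesis .
qed

text \<open>Bandt and Graf's maximality argument: a cylinder with the largest possible number of neighbours of its
  own size keeps all its neighbours inside \<open>cyl x\<close> when it is copied into \<open>cyl x\<close>.\<close>

lemma insulated_exists: "\<exists>h F. 0 < h \<and> insul h F \<and> F \<noteq> {}"
proof -
  define nbr where "nbr w = {v\<in>W (lv w). v \<noteq> w \<and> (\<exists>a\<in>cyl v. \<exists>b\<in>cyl w. dist a b < r ^ lv w)}" for w
  have fin: "finite (nbr w)" for w unfolding nbr_def by simp
  obtain nb where nb: "\<And>k x. card {w\<in>W k. \<exists>y\<in>cyl w. dist x y \<le> (1 + dm) * r ^ k} \<le> nb"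
    using cylinders_near_bound[of "1 + dm"] by blast
  have bound: "card (nbr w) \<le> nb" if w: "valid w" for w
  proof -
    obtain x where x: "x \<in> cyl w" using E_ne by blast
    have "nbr w \<subseteq> {v\<in>W (lv w). \<exists>y\<in>cyl v. dist x y \<le> (1 + dm) * r ^ lv w}"
    proof
      fix v assume "v \<in> nbr w"
      then obtain a b where v: "v \<in> W (lv w)" "a \<in> cyl v" "b \<in> cyl w" "dist a b < r ^ lv w" by (auto simp: nbr_def)
      have "dist x a \<le> dist x b + dist a b" by (metis dist_commute dist_triangle)
      also have "\<dots> \<le> (1 + dm) * r ^ lv w" using dist_cyl[OF w x v(3)] v(4) by (simp add: algebra_simps)
      finally show "v \<in> {v\<in>W (lv w). \<exists>y\<in>cyl v. dist x y \<le> (1 + dm) * r ^ lv w}" using v by blast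
    qed
    then have "card (nbr w) \<le> card {v\<in>W (lv w). \<exists>y\<in>cyl v. dist x y \<le> (1 + dm) * r ^ lv w}" by (intro card_mono) auto
    then show ?thesis using nb[of "lv w" x] by linarith
  qed
  have "\<exists>w. valid w \<and> (\<forall>v. valid v \<longrightarrow> card (nbr v) \<le> card (nbr w))"
    by (rule ex_has_greatest_nat[of valid "[]" _ "Suc nb"]) (use bound in \<open>auto simp: less_Suc_eq_le\<close>)
  then obtain w where w: "valid w" "\<And>v. valid v \<Longrightarrow> card (nbr v) \<le> card (nbr w)" by blast
  \<comment> \<open>Copying always sends neighbours to neighbours, which is one inclusion; the
    maximal cardinality of \<open>nbr w\<close> forces equality.\<close>
  have nbr_app: "nbr (x @ w) = (@) x ` nbr w" if x: "valid x" for x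
  proof -
    have "(@) x ` nbr w \<subseteq> nbr (x @ w)"
    proof
      fix u assume "u \<in> (@) x ` nbr w"
      then obtain v where v: "u = x @ v" "v \<in> nbr w" by blast
      then obtain a b where ab: "v \<in> W (lv w)" "v \<noteq> w" "a \<in> cyl v" "b \<in> cyl w" "dist a b < r ^ lv w" by (auto simp: nbr_def)
      have "u \<in> W (lv (x @ w))" using W_append[OF x] ab(1) v(1) by simp
      moreover have "sw x a \<in> cyl u" "sw x b \<in> cyl (x @ w)" using ab v(1) by (auto simp: sw_append_image)
      moreover have "dist (sw x a) (sw x b) < r ^ lv (x @ w)"
        using ab(5) sw_dist[OF x] r_pow(1)[of "lv x"] by (simp add: power_add)
      ultimately show "u \<in> nbr (x @ w)" using v(1) ab(2) unfolding nbr_def by blast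
    qed
    moreover have "card (nbr (x @ w)) \<le> card ((@) x ` nbr w)"
      using w(2)[of "x @ w"] x w(1) by (simp add: card_image inj_on_def)
    ultimately show ?thesis using card_seteq[OF fin] by metis
  qed
  obtain e0 where e0: "e0 \<in> E" using E_ne by blast
  define a0 where "a0 = sw w e0"
  have a0: "a0 \<in> cyl w" "a0 \<in> E" using e0 cyl_sub[OF w(1)] by (auto simp: a0_def)
  obtain k where k: "r ^ k * 2 < r ^ lv w" using ex_level[OF r_pow(1)] by blast
  define F where "F = cmp k a0"
  have F: "F \<in> Pk k" "a0 \<in> F" using a0(2) cmp_self unfolding F_def Pk_def by auto
  define h where "h = min (gp * r ^ k) (r ^ lv w / 2)"
  have h: "0 < h" using gp(1) r_pow(1) by (simp add: h_def)
  have "insul h F"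
    unfolding insul_def
  proof (intro conjI allI impI ballI)
    show "sep h F" using sep_mono[OF sep_Pk[OF F(1)]] by (simp add: h_def)
    fix x v a b assume x: "valid x" and v: "valid v" and xv: "x \<parallel> v" and a: "a \<in> F" and b: "b \<in> cyl v"
    let ?K = "lv (x @ w)"
    have vx: "valid (x @ w)" using x w(1) by simp
    \<comment> \<open>\<open>v\<close> may be shorter or longer than \<open>x @ w\<close>, so it is
      extended or cut back to the level of \<open>x @ w\<close>. The result does not extend
      \<open>x\<close>, hence is not a copy of a neighbour of \<open>w\<close>, and by
      \<open>nbr_app\<close> its cylinder is far from that of \<open>x @ w\<close>.\<close>
    have "\<exists>v'\<in>W ?K. b \<in> cyl v' \<and> \<not> prefix x v'"
    proof (cases "?K \<le> lv v")
      case True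
      obtain v' where v': "v' \<in> W ?K" "prefix v' v" using W_prefix_ex[OF v True] by blast
      have "\<not> prefix x v'" using v'(2) xv by (meson parallel_def prefix_order.order_trans)
      then show ?thesis using v' cyl_prefix[OF v'(2) v] b by blast
    next
      case False
      obtain e where e: "e \<in> E" "b = sw v e" using b by blast
      obtain u where u: "u \<in> W (?K - lv v)" "e \<in> cyl u" using e(1) E_W[of "?K - lv v"] by blast
      have "v @ u \<in> W ?K" using W_append[OF v, of u "?K - lv v"] u False by simp
      moreover have "b \<in> cyl (v @ u)" using e u by (auto simp: sw_append_image)
      moreover have "\<not> prefix x (v @ u)"
      proof
        assume "prefix x (v @ u)"
        moreover have "prefix v (v @ u)" by simp
        ultimately show False using prefix_same_cases xv unfolding parallel_def by blast
      qed
      ultimately show ?thesis by blast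
    qed
    then obtain v' where v': "v' \<in> W ?K" "b \<in> cyl v'" "\<not> prefix x v'" by blast
    then have "v' \<notin> nbr (x @ w)" "v' \<noteq> x @ w" using nbr_app[OF x] by auto
    moreover have "sw x a0 \<in> cyl (x @ w)" using a0(1) by (auto simp: sw_append_image)
    ultimately have "r ^ ?K \<le> dist b (sw x a0)" using v'(1,2) unfolding nbr_def by (auto simp: not_less)
    moreover have "dist (sw x a) (sw x a0) \<le> r ^ lv x * (r ^ lv w / 2)"
    proof -
      have "dist a a0 \<le> r ^ lv w / 2" using Pk_diam[OF F(1) a F(2)] k by simp
      then show ?thesis using sw_dist[OF x] r_pow(1)[of "lv x"] by simp
    qed
    moreover have "dist b (sw x a0) \<le> dist (sw x a) b + dist (sw x a) (sw x a0)" by (metis dist_commute dist_triangle)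
    ultimately have "r ^ lv w / 2 * r ^ lv x \<le> dist (sw x a) b" by (simp add: power_add algebra_simps)
    moreover have "h * r ^ lv x \<le> r ^ lv w / 2 * r ^ lv x" using r_pow(1)[of "lv x"] by (intro mult_right_mono) (auto simp: h_def)
    ultimately show "h * r ^ lv x \<le> dist (sw x a) b" by linarith
  qed
  then show ?thesis using h F(2) by blast
qed

end

subsection \<open>The ideal of measures of insulated sets\<close>

text \<open>The ring Z[p] as explicit integer polynomials; \<open>generate_ring_eq_zpolys\<close>
  links it to the generated ring of the statement.\<close>

definition zpolys :: "real \<Rightarrow> real set" where
  "zpolys p = {z. \<exists>d (q :: nat \<Rightarrow> int). z = (\<Sum>i<d. of_int (q i) * p ^ i)}"

lemma zpolysI: "z = (\<Sum>i<d. of_int (q i) * p ^ i) \<Longrightarrow> z \<in> zpolys p"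
  unfolding zpolys_def by (intro CollectI exI)

text \<open>Padding with zero coefficients: the number of coefficients can be made to exceed any
  given \<open>n\<close>, so two representations get a common length.\<close>

lemma zpolysE:
  assumes "z \<in> zpolys p"
  obtains d and q :: "nat \<Rightarrow> int" where "n < d" "z = (\<Sum>i<d. of_int (q i) * p ^ i)"
proof -
  obtain d0 and q :: "nat \<Rightarrow> int" where z: "z = (\<Sum>i<d0. of_int (q i) * p ^ i)" using assms by (auto simp: zpolys_def)
  let ?q = "\<lambda>i. if i < d0 then q i else 0"
  have "z = (\<Sum>i<d0. of_int (?q i) * p ^ i)" unfolding z by (rule sum.cong) auto
  also have "\<dots> = (\<Sum>i<d0 + Suc n. of_int (?q i) * p ^ i)"
    by (rule sum.mono_neutral_left) auto
  finally show ?thesis using that[of "d0 + Suc n" ?q] by simp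
qed

lemma zpolys_0: "0 \<in> zpolys p"
  unfolding zpolys_def by (intro CollectI exI[of _ 0]) simp

lemma zpolys_add: "x \<in> zpolys p \<Longrightarrow> y \<in> zpolys p \<Longrightarrow> x + y \<in> zpolys p"
proof -
  assume x: "x \<in> zpolys p" and y: "y \<in> zpolys p"
  obtain d and q :: "nat \<Rightarrow> int" where q: "x = (\<Sum>i<d. of_int (q i) * p ^ i)" using x by (auto simp: zpolys_def)
  obtain d' and q' :: "nat \<Rightarrow> int" where q': "d < d'" "y = (\<Sum>i<d'. of_int (q' i) * p ^ i)" using zpolysE[OF y, of d] .
  let ?q = "\<lambda>i. if i < d then q i else 0"
  have "x = (\<Sum>i<d. of_int (?q i) * p ^ i)" unfolding q by (rule sum.cong) auto
  also have "\<dots> = (\<Sum>i<d'. of_int (?q i) * p ^ i)"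
    using q'(1) by (intro sum.mono_neutral_left) auto
  finally have "x + y = (\<Sum>i<d'. of_int (?q i + q' i) * p ^ i)"
    unfolding q'(2) by (simp only: sum.distrib[symmetric] of_int_add distrib_right)
  then show ?thesis by (rule zpolysI)
qed

lemma zpolys_minus: "x \<in> zpolys p \<Longrightarrow> - x \<in> zpolys p"
proof -
  assume "x \<in> zpolys p"
  then obtain d and q :: "nat \<Rightarrow> int" where "x = (\<Sum>i<d. of_int (q i) * p ^ i)" by (auto simp: zpolys_def)
  then have "- x = (\<Sum>i<d. of_int (- q i) * p ^ i)" by (simp add: sum_negf)
  then show ?thesis by (rule zpolysI)
qed

lemma zpolys_diff: "x \<in> zpolys p \<Longrightarrow> y \<in> zpolys p \<Longrightarrow> x - y \<in> zpolys p"
  using zpolys_add[of x p "- y"] zpolys_minus[of y p] by simp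

lemma zpolys_sum: "(\<And>i. i \<in> I \<Longrightarrow> f i \<in> zpolys p) \<Longrightarrow> sum f I \<in> zpolys p"
  by (induction I rule: infinite_finite_induct) (auto simp: zpolys_0 zpolys_add)

lemma zpolys_monom: "of_int a * p ^ n \<in> zpolys p"
proof -
  have "of_int a * p ^ n = (\<Sum>i<Suc n. of_int (if i = n then a else 0) * p ^ i)" by simp
  then show ?thesis by (rule zpolysI)
qed

lemma zpolys_power: "p ^ n \<in> zpolys p"
  using zpolys_monom[of 1 p n] by simp

lemma zpolys_1: "1 \<in> zpolys p"
  using zpolys_power[of p 0] by simp

lemma zpolys_p: "p \<in> zpolys p"
  using zpolys_power[of p 1] by simp

lemma zpolys_mult: "x \<in> zpolys p \<Longrightarrow> y \<in> zpolys p \<Longrightarrow> x * y \<in> zpolys p"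
proof -
  assume x: "x \<in> zpolys p" and y: "y \<in> zpolys p"
  obtain d and q :: "nat \<Rightarrow> int" where q: "x = (\<Sum>i<d. of_int (q i) * p ^ i)" using x by (auto simp: zpolys_def)
  obtain d' and q' :: "nat \<Rightarrow> int" where q': "y = (\<Sum>i<d'. of_int (q' i) * p ^ i)" using y by (auto simp: zpolys_def)
  have "x * y = (\<Sum>i<d. \<Sum>j<d'. of_int (q i * q' j) * p ^ (i + j))"
    unfolding q q' sum_product by (simp add: power_add ac_simps)
  also have "\<dots> \<in> zpolys p" by (intro zpolys_sum zpolys_monom)
  finally show ?thesis .
qed

text \<open>The integer multiples of a small power \<open>p ^ n\<close> form a grid of mesh less
  than \<open>b - a\<close>.\<close>

lemma zpolys_dense:
  assumes p: "0 < p" "p < 1" and ab: "a < b"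
  shows "\<exists>y\<in>zpolys p. a < y \<and> y < b"
proof -
  obtain n where n: "p ^ n < b - a" using real_arch_pow_inv[of "b - a" p] p ab by auto
  have pn: "0 < p ^ n" using p by simp
  define k where "k = \<lfloor>a / p ^ n\<rfloor> + 1"
  have "a / p ^ n < of_int k" "of_int k \<le> a / p ^ n + 1" unfolding k_def by linarith+
  then have "a < of_int k * p ^ n" "of_int k * p ^ n \<le> (a / p ^ n + 1) * p ^ n"
    using pn by (simp add: field_simps, intro mult_right_mono) auto
  then have "a < of_int k * p ^ n" "of_int k * p ^ n \<le> a + p ^ n" using pn p by (simp_all add: distrib_right)
  then show ?thesis using n by (intro bexI[OF _ zpolys_monom[of k p n]]) auto
qed

text \<open>An item is taken only while it is smaller than the remainder, so the remainder stays
  positive; the process stops at an item that is at least the remainder, hence with remainder at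
  most \<open>s\<close>.\<close>

lemma greedy_subset:
  fixes a :: "'i \<Rightarrow> real"
  assumes "finite Q" "\<And>i. i \<in> Q \<Longrightarrow> a i \<le> s" "0 < y" "y \<le> sum a Q"
  shows "\<exists>Q'\<subseteq>Q. 0 < y - sum a Q' \<and> y - sum a Q' \<le> s"
  using assms
proof (induction Q arbitrary: y rule: finite_induct)
  case (insert i Q)
  show ?case
  proof (cases "y \<le> a i")
    case True
    then show ?thesis using insert.prems by (intro exI[of _ "{}"]) (auto intro: order_trans)
  next
    case False
    then obtain Q' where Q': "Q' \<subseteq> Q" "0 < y - a i - sum a Q'" "y - a i - sum a Q' \<le> s"
      using insert.IH[of "y - a i"] insert.prems insert.hyps by auto
    have "i \<notin> Q'" "finite Q'" using Q'(1) insert.hyps finite_subset by auto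
    then show ?thesis using Q' by (intro exI[of _ "insert i Q'"]) auto
  qed
qed simp

context weighted_alphabet
begin

text \<open>This is the Moran equation divided by \<open>p\<close>, where all exponents
  \<open>l i - 1\<close> remain nonnegative.\<close>

lemma zpolys_inv_p: "1 / p \<in> zpolys p"
proof -
  have "1 / p = (\<Sum>i<N. p ^ (l i - 1))"
  proof -
    have "p ^ (l i - 1) = p ^ l i / p" if "i < N" for i
      using l_pos[OF that] p by (cases "l i") auto
    then have "(\<Sum>i<N. p ^ (l i - 1)) = (\<Sum>i<N. p ^ l i) / p" by (simp add: sum_divide_distrib)
    then show ?thesis using sum_p by simp
  qed
  then show ?thesis using zpolys_sum[of "{..<N}" "\<lambda>i. p ^ (l i - 1)" p] zpolys_power by simp
qed

lemma zpolys_div_power: "x \<in> zpolys p \<Longrightarrow> x / p ^ n \<in> zpolys p"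
proof (induction n)
  case (Suc n)
  then have "x / p ^ n * (1 / p) \<in> zpolys p" using zpolys_mult zpolys_inv_p by blast
  then show ?case by (simp add: mult.commute)
qed simp

lemma positive_zpoly:
  assumes "z \<in> zpolys p" "0 < z"
  shows "\<exists>n (c :: nat \<Rightarrow> nat). z = (\<Sum>j<M. real (c j) * p ^ (n + j))"
proof -
  obtain d and q :: "nat \<Rightarrow> int" where q: "z = (\<Sum>i<d. of_int (q i) * p ^ i)" using assms(1) by (auto simp: zpolys_def)
  then obtain n0 where n0: "\<And>n j. n0 \<le> n \<Longrightarrow> j < M \<Longrightarrow> 0 \<le> (\<Sum>i<d. q i * int (cnt (n - i) j))"
    using eventually_nonneg_counts[of q d] assms(2) by auto
  define n where "n = max n0 d"
  define c where "c j = nat (\<Sum>i<d. q i * int (cnt (n - i) j))" for j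
  have "real (c j) = of_int (\<Sum>i<d. q i * int (cnt (n - i) j))" if "j < M" for j
    using n0[of n j] that by (simp add: c_def n_def)
  then have "z = (\<Sum>j<M. real (c j) * p ^ (n + j))"
    using sum_counts_eq[of d n q] q by (simp add: n_def)
  then show ?thesis by blast
qed

text \<open>If \<open>0 < z < p\<^sup>m\<close>, the words representing \<open>z\<close> can be chosen among those that represent \<open>p\<^sup>m\<close>.\<close>

lemma zpoly_antichain:
  assumes z: "z \<in> zpolys p" "0 < z" "z < p ^ m"
  shows "\<exists>n T. T \<subseteq> W n \<and> (\<Sum>u\<in>T. p ^ (m + lv u)) = z"
proof -
  obtain d and q :: "nat \<Rightarrow> int" where d: "m < d" and q: "z = (\<Sum>i<d. of_int (q i) * p ^ i)"
    using zpolysE[OF z(1), of m] .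
  \<comment> \<open>These are the coefficients of \<open>p ^ m\<close>. Nonnegativity of the counts
    for \<open>p ^ m - z\<close> says that \<open>c j \<le> cnt (n - m) j\<close>, that is,
    \<open>W (n - m)\<close> has enough words of each length to choose from.\<close>
  let ?e = "\<lambda>i. (if i = m then 1 else 0) :: int"
  have em: "(\<Sum>i<d. of_int (?e i) * p ^ i) = p ^ m" using d by (simp add: if_distrib[of "\<lambda>x. x * _"] if_distrib[of of_int] cong: if_cong)
  have "(\<Sum>i<d. of_int (?e i - q i) * p ^ i) = p ^ m - z"
    unfolding q em[symmetric] by (simp only: sum_subtractf[symmetric] of_int_diff left_diff_distrib)
  then have pos: "0 < (\<Sum>i<d. of_int (?e i - q i) * p ^ i)" using z(3) by simp
  obtain n1 where n1: "\<And>n j. n1 \<le> n \<Longrightarrow> j < M \<Longrightarrow> 0 \<le> (\<Sum>i<d. q i * int (cnt (n - i) j))"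
    using eventually_nonneg_counts[of q d] z(2) q by auto
  obtain n2 where n2: "\<And>n j. n2 \<le> n \<Longrightarrow> j < M \<Longrightarrow> 0 \<le> (\<Sum>i<d. (?e i - q i) * int (cnt (n - i) j))"
    using eventually_nonneg_counts[OF pos] by blast
  define n where "n = max (max n1 n2) d"
  have nle: "n1 \<le> n" "n2 \<le> n" "d \<le> n" by (auto simp: n_def)
  define c where "c j = nat (\<Sum>i<d. q i * int (cnt (n - i) j))" for j
  have cj: "int (c j) = (\<Sum>i<d. q i * int (cnt (n - i) j))" "c j \<le> cnt (n - m) j" if j: "j < M" for j
  proof -
    show 1: "int (c j) = (\<Sum>i<d. q i * int (cnt (n - i) j))" using n1[OF nle(1) j] by (simp add: c_def)
    have "(\<Sum>i<d. (?e i - q i) * int (cnt (n - i) j)) = (\<Sum>i<d. ?e i * int (cnt (n - i) j)) - (\<Sum>i<d. q i * int (cnt (n - i) j))"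
      by (simp only: sum_subtractf[symmetric] left_diff_distrib)
    also have "(\<Sum>i<d. ?e i * int (cnt (n - i) j)) = int (cnt (n - m) j)"
      using d by (simp add: if_distrib[of "\<lambda>x. x * _"] cong: if_cong)
    finally have "0 \<le> int (cnt (n - m) j) - int (c j)" using n2[OF nle(2) j] 1 by linarith
    then show "c j \<le> cnt (n - m) j" by simp
  qed
  have "\<exists>T. T \<subseteq> {u\<in>W (n - m). lv u = n - m + j} \<and> card T = c j" if j: "j < M" for j
    by (rule obtain_subset_with_card_n[OF cj(2)[OF j, unfolded cnt_def]]) blast
  then have "\<forall>j\<in>{..<M}. \<exists>T. T \<subseteq> {u\<in>W (n - m). lv u = n - m + j} \<and> card T = c j" by blast
  from bchoice[OF this] obtain T where T: "\<And>j. j < M \<Longrightarrow> T j \<subseteq> {u\<in>W (n - m). lv u = n - m + j}" "\<And>j. j < M \<Longrightarrow> card (T j) = c j"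
    by auto
  let ?T = "\<Union>j<M. T j"
  have TW: "T j \<subseteq> W (n - m)" if "j < M" for j using T(1)[OF that] by blast
  have fT: "finite (T j)" if "j < M" for j using finite_subset[OF TW[OF that] finite_W] .
  have lvT: "lv u = n - m + j" if "j < M" "u \<in> T j" for u j using T(1)[OF that(1)] that(2) by blast
  have "(\<Sum>u\<in>?T. p ^ (m + lv u)) = (\<Sum>j<M. \<Sum>u\<in>T j. p ^ (m + lv u))"
  proof (rule sum.UNION_disjoint)
    show "\<forall>i\<in>{..<M}. \<forall>j\<in>{..<M}. i \<noteq> j \<longrightarrow> T i \<inter> T j = {}"
    proof (intro ballI impI)
      fix i j assume ij: "i \<in> {..<M}" "j \<in> {..<M}" "i \<noteq> j"
      show "T i \<inter> T j = {}"
      proof (rule ccontr)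
        assume "T i \<inter> T j \<noteq> {}"
        then obtain u where "u \<in> T i" "u \<in> T j" by blast
        then show False using lvT[of i u] lvT[of j u] ij by simp
      qed
    qed
  qed (use fT in auto)
  also have "\<dots> = (\<Sum>j<M. real (c j) * p ^ (n + j))"
  proof (rule sum.cong[OF refl])
    fix j assume j: "j \<in> {..<M}"
    have "m \<le> n" using d by (simp add: n_def)
    then have "p ^ (m + lv u) = p ^ (n + j)" if "u \<in> T j" for u using lvT[of j u] j that by (simp add: add.assoc[symmetric])
    then show "(\<Sum>u\<in>T j. p ^ (m + lv u)) = real (c j) * p ^ (n + j)" using T(2)[of j] j by simp
  qed
  also have "\<dots> = (\<Sum>j<M. of_int (\<Sum>i<d. q i * int (cnt (n - i) j)) * p ^ (n + j))"
    by (rule sum.cong[OF refl]) (metis cj(1) lessThan_iff of_int_of_nat_eq)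
  also have "\<dots> = z" using sum_counts_eq[of d n q] q by (simp add: n_def)
  finally have "(\<Sum>u\<in>?T. p ^ (m + lv u)) = z" .
  moreover have "?T \<subseteq> W (n - m)" using TW by blast
  ultimately show ?thesis by blast
qed

end

text \<open>The principal ideal property is stated elementwise on \<open>zpolys p\<close>, so that
  the measure arguments do not have to handle ring structures.\<close>

locale pid_attractor = tdc_attractor +
  assumes pid: "\<And>J. J \<subseteq> zpolys p \<Longrightarrow> 0 \<in> J \<Longrightarrow> (\<And>x y. x \<in> J \<Longrightarrow> y \<in> J \<Longrightarrow> x + y \<in> J) \<Longrightarrow> (\<And>x. x \<in> J \<Longrightarrow> - x \<in> J) \<Longrightarrow>
      (\<And>z x. z \<in> zpolys p \<Longrightarrow> x \<in> J \<Longrightarrow> z * x \<in> J) \<Longrightarrow> \<exists>g\<in>J. \<forall>x\<in>J. \<exists>z\<in>zpolys p. x = z * g"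
begin

lemma mu_zpolys: "clopen B \<Longrightarrow> mu B \<in> zpolys p"
proof -
  assume B: "clopen B"
  obtain h n where h: "0 < h" "sep h B" "sep h B" "r ^ n * dm < h" using clopen_level[OF B B] .
  have "mun n B \<in> zpolys p" unfolding mun_def by (intro zpolys_sum zpolys_power)
  then show ?thesis using mu_eq[OF h(2,4)] by simp
qed

definition insulated :: "'a set \<Rightarrow> bool" where "insulated F \<longleftrightarrow> (\<exists>h>0. insul h F)"

lemma insulated_clopen: "insulated F \<Longrightarrow> clopen F"
  unfolding insulated_def clopen_def using insul_sep by blast

lemma insulated_subset: "insulated F \<Longrightarrow> clopen B \<Longrightarrow> B \<subseteq> F \<Longrightarrow> insulated B"
proof -
  assume "insulated F" "clopen B" and B: "B \<subseteq> F"
  then obtain h h' where h: "0 < h" "insul h F" "0 < h'" "sep h' B" unfolding insulated_def clopen_def by blast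
  then have "insul (min h h') B" using insul_subset[OF h(2,4) B] by simp
  then show ?thesis unfolding insulated_def using h by (intro exI[of _ "min h h'"]) simp
qed

lemma insulated_Un: "insulated A \<Longrightarrow> insulated B \<Longrightarrow> insulated (A \<union> B)"
proof -
  assume A: "insulated A" and B: "insulated B"
  then obtain h h' where h: "0 < h" "insul h A" "0 < h'" "insul h' B" unfolding insulated_def by blast
  have "insul (min h h') A" "insul (min h h') B"
    using insul_subset[OF h(2) insul_sep[OF h(2)]] insul_subset[OF h(4) insul_sep[OF h(4)]] by auto
  then show ?thesis unfolding insulated_def using insul_Un h by (intro exI[of _ "min h h'"]) auto
qed

lemma insulated_empty: "insulated {}"
  unfolding insulated_def using insul_empty zero_less_one by blast

lemma insulated_sw: "insulated F \<Longrightarrow> valid u \<Longrightarrow> insulated (sw u ` F)"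
  unfolding insulated_def using insul_sw r_pow(1) by (metis mult_pos_pos)

lemma mu_insulated_sw: "insulated F \<Longrightarrow> valid u \<Longrightarrow> mu (sw u ` F) = p ^ lv u * mu F"
  unfolding insulated_def using mu_sw by blast

lemma insulated_sub_E: "insulated F \<Longrightarrow> F \<subseteq> E"
  using clopen_sub insulated_clopen by blast

lemma insulated_parallel:
  assumes F: "insulated F" and G: "G \<subseteq> E" and uv: "valid u" "valid v" "u \<parallel> v"
  shows "sw u ` F \<inter> sw v ` G = {}"
proof (rule ccontr)
  assume "\<not> ?thesis"
  then obtain a b where ab: "a \<in> F" "b \<in> G" "sw u a = sw v b" by blast
  obtain h where h: "0 < h" "insul h F" using F unfolding insulated_def by blast
  have "sw v b \<in> cyl v" using ab G by blast
  then have "h * r ^ lv u \<le> dist (sw u a) (sw v b)" using insulD[OF h(2) uv ab(1)] by blast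
  then show False using ab(3) h(1) r_pow(1)[of "lv u"] by (simp add: mult_le_0_iff)
qed

text \<open>The nonnegative part of an ideal of \<open>\<int>[p]\<close>; the factor \<open>p ^ K\<close> makes room for disjoint copies.\<close>

definition eventual_values :: "real set" where
  "eventual_values = {y. \<exists>K0. \<forall>K\<ge>K0. \<exists>F. insulated F \<and> mu F = p ^ K * y}"

text \<open>Words of every sufficiently large length exist, because their normalised number has a
  positive limit.\<close>

lemma eventual_values_mu: "insulated F \<Longrightarrow> mu F \<in> eventual_values"
proof -
  assume F: "insulated F"
  obtain L where L: "0 < L" "(\<lambda>n. real (card (words_at n)) * p ^ n) \<longlonglongrightarrow> L" using card_words_at_limit by blast
  have "eventually (\<lambda>n. 0 < real (card (words_at n)) * p ^ n) sequentially" using order_tendstoD(1)[OF L(2,1)] .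
  then obtain K0 where K0: "\<And>K. K0 \<le> K \<Longrightarrow> 0 < real (card (words_at K)) * p ^ K" unfolding eventually_sequentially by blast
  have "\<exists>F'. insulated F' \<and> mu F' = p ^ K * mu F" if "K0 \<le> K" for K
  proof -
    have "words_at K \<noteq> {}" using K0[OF that] by auto
    then obtain u where "valid u" "lv u = K" by (auto simp: words_at_def)
    then show ?thesis using insulated_sw[OF F] mu_insulated_sw[OF F] by blast
  qed
  then show ?thesis unfolding eventual_values_def by blast
qed

text \<open>Disjointness is achieved by moving the two sets into the first-level cylinders 0 and 1;
  this uses up \<open>l 0\<close> and \<open>l 1\<close> of the factors \<open>p\<close>.\<close>

lemma eventual_values_add: "x \<in> eventual_values \<Longrightarrow> y \<in> eventual_values \<Longrightarrow> x + y \<in> eventual_values"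
proof -
  assume x: "x \<in> eventual_values" and y: "y \<in> eventual_values"
  obtain K0 where K0: "\<And>K. K0 \<le> K \<Longrightarrow> \<exists>F. insulated F \<and> mu F = p ^ K * x" using x unfolding eventual_values_def by blast
  obtain K1 where K1: "\<And>K. K1 \<le> K \<Longrightarrow> \<exists>F. insulated F \<and> mu F = p ^ K * y" using y unfolding eventual_values_def by blast
  have v01: "valid [0]" "valid [1]" "[0] \<parallel> [1::nat]" using N by (auto simp: parallel_def)
  have "\<exists>F. insulated F \<and> mu F = p ^ K * (x + y)" if K: "K0 + K1 + l 0 + l 1 \<le> K" for K
  proof -
    have "K0 \<le> K - l 0" "K1 \<le> K - l 1" using K by linarith+
    then obtain A B where A: "insulated A" "mu A = p ^ (K - l 0) * x" and B: "insulated B" "mu B = p ^ (K - l 1) * y"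
      using K0 K1 by meson
    have i: "insulated (sw [0] ` A)" "insulated (sw [1] ` B)" using A B insulated_sw v01 by blast+
    have "sw [0] ` A \<inter> sw [1] ` B = {}" using insulated_parallel[OF A(1) insulated_sub_E[OF B(1)] v01] .
    then have "mu (sw [0] ` A \<union> sw [1] ` B) = mu (sw [0] ` A) + mu (sw [1] ` B)"
      using mu_Un insulated_clopen i by blast
    also have "mu (sw [0] ` A) = p ^ l 0 * (p ^ (K - l 0) * x)" using mu_insulated_sw[OF A(1) v01(1)] A(2) by simp
    also have "\<dots> = p ^ K * x" using K by (simp add: mult.assoc[symmetric] power_add[symmetric])
    also have "mu (sw [1] ` B) = p ^ l 1 * (p ^ (K - l 1) * y)" using mu_insulated_sw[OF B(1) v01(2)] B(2) by simp
    also have "\<dots> = p ^ K * y" using K by (simp add: mult.assoc[symmetric] power_add[symmetric])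
    finally show ?thesis using insulated_Un[OF i] by (auto simp: distrib_left)
  qed
  then show ?thesis unfolding eventual_values_def by blast
qed

lemma eventual_values_0: "0 \<in> eventual_values"
  using eventual_values_mu[OF insulated_empty] by simp

lemma eventual_values_power: "y \<in> eventual_values \<Longrightarrow> p ^ n * y \<in> eventual_values"
proof -
  assume "y \<in> eventual_values"
  then obtain K0 where K0: "\<And>K. K0 \<le> K \<Longrightarrow> \<exists>F. insulated F \<and> mu F = p ^ K * y" unfolding eventual_values_def by blast
  have "\<exists>F. insulated F \<and> mu F = p ^ K * (p ^ n * y)" if "K0 \<le> K" for K
    using K0[of "K + n"] that by (simp add: power_add mult.assoc)
  then show ?thesis unfolding eventual_values_def by blast
qed

lemma eventual_values_nat: "y \<in> eventual_values \<Longrightarrow> real n * y \<in> eventual_values"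
  by (induction n) (auto simp: eventual_values_0 distrib_right intro: eventual_values_add)

lemma eventual_values_sum: "(\<And>i. i \<in> I \<Longrightarrow> a i \<in> eventual_values) \<Longrightarrow> sum a I \<in> eventual_values"
  by (induction I rule: infinite_finite_induct) (auto simp: eventual_values_0 eventual_values_add)

lemma eventual_values_nonneg: "y \<in> eventual_values \<Longrightarrow> 0 \<le> y"
proof -
  assume "y \<in> eventual_values"
  then obtain K F where "insulated F" "mu F = p ^ K * y" unfolding eventual_values_def by blast
  then show ?thesis using mu_nonneg[OF insulated_clopen, of F] p_pow(1)[of K] by (simp add: zero_le_mult_iff)
qed

lemma eventual_values_zpolys: "y \<in> eventual_values \<Longrightarrow> y \<in> zpolys p"
proof -
  assume "y \<in> eventual_values"
  then obtain K F where F: "insulated F" "mu F = p ^ K * y" unfolding eventual_values_def by blast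
  have "mu F / p ^ K \<in> zpolys p" using zpolys_div_power mu_zpolys insulated_clopen F(1) by blast
  moreover have "mu F / p ^ K = y" unfolding F(2) by (rule nonzero_mult_div_cancel_left[OF p_pow(3)])
  ultimately show ?thesis by simp
qed

text \<open>Eventual values are nonnegative, so an integer polynomial with coefficients of both
  signs cannot act term by term. \<open>positive_zpoly\<close> first rewrites \<open>z\<close> with
  natural coefficients.\<close>

lemma eventual_values_pos_mult: "y \<in> eventual_values \<Longrightarrow> z \<in> zpolys p \<Longrightarrow> 0 < z \<Longrightarrow> z * y \<in> eventual_values"
proof -
  assume y: "y \<in> eventual_values" and z: "z \<in> zpolys p" "0 < z"
  obtain n and c :: "nat \<Rightarrow> nat" where c: "z = (\<Sum>j<M. real (c j) * p ^ (n + j))" using positive_zpoly[OF z] by blast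
  have "z * y = (\<Sum>j<M. real (c j) * (p ^ (n + j) * y))" unfolding c by (simp add: sum_distrib_right mult.assoc)
  also have "\<dots> \<in> eventual_values" by (intro eventual_values_sum eventual_values_nat eventual_values_power y)
  finally show ?thesis .
qed

text \<open>Writing \<open>a - b = (1 - y b) a + (y a - 1) b\<close> with \<open>1 / a < y < 1 / b\<close> removes the negative coefficient.\<close>

lemma eventual_values_diff:
  assumes a: "a \<in> eventual_values" and b: "b \<in> eventual_values" and ab: "b < a"
  shows "a - b \<in> eventual_values"
proof (cases "b = 0")
  case True
  then show ?thesis using a by simp
next
  case False
  then have b0: "0 < b" using eventual_values_nonneg[OF b] by simp
  have "1 / a < 1 / b" using ab b0 by (simp add: field_simps)
  then obtain y where y: "y \<in> zpolys p" "1 / a < y" "y < 1 / b" using zpolys_dense[OF p] by blast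
  have "0 < 1 - y * b" "0 < y * a - 1" using y(2,3) b0 ab by (simp_all add: field_simps)
  moreover have "1 - y * b \<in> zpolys p" "y * a - 1 \<in> zpolys p"
    using zpolys_diff zpolys_mult zpolys_1 y(1) eventual_values_zpolys[OF a] eventual_values_zpolys[OF b] by blast+
  ultimately have "(1 - y * b) * a + (y * a - 1) * b \<in> eventual_values" using eventual_values_add eventual_values_pos_mult a b by blast
  moreover have "(1 - y * b) * a + (y * a - 1) * b = a - b" by (simp add: algebra_simps)
  ultimately show ?thesis by simp
qed

text \<open>The differences of eventual values form an ideal. Its generator is a priori only a
  difference, but \<open>eventual_values_diff\<close> makes its absolute value an eventual value, so
  some power of \<open>p\<close> times it is the measure of an actual insulated set. That power does
  not affect divisibility.\<close>

lemma generator_exists: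
  "\<exists>G. insulated G \<and> 0 < mu G \<and> (\<forall>F. insulated F \<longrightarrow> mu F / mu G \<in> zpolys p)"
proof -
  define J where "J = {x. \<exists>a\<in>eventual_values. \<exists>b\<in>eventual_values. x = a - b}"
  have J_mono: "of_int c * p ^ n * x \<in> J" if x: "x \<in> J" for x c n
  proof -
    obtain a b where ab: "a \<in> eventual_values" "b \<in> eventual_values" "x = a - b" using x unfolding J_def by blast
    have m: "real k * (p ^ n * a) \<in> eventual_values" "real k * (p ^ n * b) \<in> eventual_values" for k
      using eventual_values_nat[OF eventual_values_power[OF ab(1)]] eventual_values_nat[OF eventual_values_power[OF ab(2)]] by auto
    show ?thesis
    proof (cases "0 \<le> c")
      case True
      then have "of_int c * p ^ n * x = real (nat c) * (p ^ n * a) - real (nat c) * (p ^ n * b)"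
        unfolding ab(3) by (simp add: algebra_simps)
      then show ?thesis unfolding J_def using m by blast
    next
      case False
      then have "real (nat (- c)) = - of_int c" by simp
      then have "of_int c * p ^ n * x = real (nat (- c)) * (p ^ n * b) - real (nat (- c)) * (p ^ n * a)"
        unfolding ab(3) by (simp add: algebra_simps)
      then show ?thesis unfolding J_def using m by blast
    qed
  qed
  have J_add: "x + y \<in> J" if xy: "x \<in> J" "y \<in> J" for x y
  proof -
    obtain a b a' b' where ab: "a \<in> eventual_values" "b \<in> eventual_values" "x = a - b" "a' \<in> eventual_values" "b' \<in> eventual_values" "y = a' - b'"
      using xy unfolding J_def by blast
    have "x + y = (a + a') - (b + b')" using ab by simp
    then show ?thesis unfolding J_def using eventual_values_add ab by blast
  qed
  have J_0: "0 \<in> J" unfolding J_def using eventual_values_0 by force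
  have J_sum: "sum a I \<in> J" if "\<And>i. i \<in> I \<Longrightarrow> a i \<in> J" for a and I :: "nat set"
    using that by (induction I rule: infinite_finite_induct) (auto simp: J_0 J_add)
  have "\<exists>g\<in>J. \<forall>x\<in>J. \<exists>z\<in>zpolys p. x = z * g"
  proof (rule pid)
    show "J \<subseteq> zpolys p" unfolding J_def using eventual_values_zpolys zpolys_diff by blast
    show "- x \<in> J" if "x \<in> J" for x using J_mono[OF that, of "- 1" 0] by simp
    show "z * x \<in> J" if z: "z \<in> zpolys p" and x: "x \<in> J" for z x
    proof -
      obtain d and q :: "nat \<Rightarrow> int" where q: "z = (\<Sum>i<d. of_int (q i) * p ^ i)" using z unfolding zpolys_def by blast
      show ?thesis unfolding q sum_distrib_right by (intro J_sum J_mono x)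
    qed
  qed (use J_0 J_add in auto)
  then obtain g where g: "g \<in> J" "\<And>x. x \<in> J \<Longrightarrow> \<exists>z\<in>zpolys p. x = z * g" by blast
  have muJ: "mu F \<in> J" if "insulated F" for F unfolding J_def using eventual_values_mu[OF that] eventual_values_0 by force
  obtain h F0 where F0: "0 < h" "insul h F0" "F0 \<noteq> {}" using insulated_exists by blast
  have iF0: "insulated F0" using F0 by (auto simp: insulated_def)
  have "0 < mu F0" using mu_pos[OF insulated_clopen[OF iF0] F0(3)] .
  then have g0: "g \<noteq> 0" using g(2)[OF muJ[OF iF0]] by auto
  obtain a b where ab: "a \<in> eventual_values" "b \<in> eventual_values" "g = a - b" using g(1) unfolding J_def by blast
  have "\<bar>g\<bar> \<in> eventual_values"
  proof (cases "0 < g")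
    case True
    then show ?thesis using eventual_values_diff[OF ab(1,2)] ab(3) by simp
  next
    case False
    then show ?thesis using eventual_values_diff[OF ab(2,1)] ab(3) g0 by simp
  qed
  then obtain K G where G: "insulated G" "mu G = p ^ K * \<bar>g\<bar>" unfolding eventual_values_def by blast
  have "mu F / mu G \<in> zpolys p" if F: "insulated F" for F
  proof -
    obtain z where z: "z \<in> zpolys p" "mu F = z * g" using g(2)[OF muJ[OF F]] by blast
    have defect_size: "z / p ^ K \<in> zpolys p" using zpolys_div_power[OF z(1)] .
    have "mu F / mu G = (if 0 < g then z / p ^ K else - (z / p ^ K))"
      using g0 z(2) G(2) by (auto simp: abs_if field_simps)
    then show ?thesis using defect_size zpolys_minus[OF defect_size] by auto
  qed
  moreover have "0 < mu G" using G(2) g0 p_pow(1) by simp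
  ultimately show ?thesis using G(1) by blast
qed

definition G where "G = (SOME G. insulated G \<and> 0 < mu G \<and> (\<forall>F. insulated F \<longrightarrow> mu F / mu G \<in> zpolys p))"

text \<open>Normalised so that \<open>G\<close> has mass 1. The measure \<open>mu\<close> of every
  clopen set lies in Z[p], but after division by \<open>mu G\<close> this is guaranteed for
  insulated sets only.\<close>

definition nm :: "'a set \<Rightarrow> real" where "nm A = mu A / mu G"

lemma G: "insulated G" "0 < mu G" "insulated F \<Longrightarrow> nm F \<in> zpolys p"
  using someI_ex[OF generator_exists] unfolding G_def[symmetric] nm_def by auto

lemma nm_Un: "clopen A \<Longrightarrow> clopen B \<Longrightarrow> A \<inter> B = {} \<Longrightarrow> nm (A \<union> B) = nm A + nm B"
  unfolding nm_def by (simp add: mu_Un add_divide_distrib)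

lemma nm_Diff: "clopen A \<Longrightarrow> clopen B \<Longrightarrow> B \<subseteq> A \<Longrightarrow> nm (A - B) = nm A - nm B"
  unfolding nm_def by (simp add: mu_Diff diff_divide_distrib)

lemma nm_UN: "finite I \<Longrightarrow> (\<And>i. i \<in> I \<Longrightarrow> clopen (A i)) \<Longrightarrow> disjoint_family_on A I \<Longrightarrow> nm (\<Union>i\<in>I. A i) = (\<Sum>i\<in>I. nm (A i))"
  unfolding nm_def by (simp add: mu_UN sum_divide_distrib)

lemma nm_pos: "clopen A \<Longrightarrow> A \<noteq> {} \<Longrightarrow> 0 < nm A"
  unfolding nm_def using mu_pos G(2) by simp

lemma nm_nonneg: "clopen A \<Longrightarrow> 0 \<le> nm A"
  unfolding nm_def using mu_nonneg G(2) by simp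

lemma nm_empty [simp]: "nm {} = 0"
  by (simp add: nm_def)

lemma nm_sw: "insulated F \<Longrightarrow> valid u \<Longrightarrow> nm (sw u ` F) = p ^ lv u * nm F"
  unfolding nm_def by (simp add: mu_insulated_sw)

lemma nm_G: "nm G = 1"
  unfolding nm_def using G(2) by simp

lemma G_ne: "G \<noteq> {}"
  using G(2) by auto

section \<open>Exact subdivision of insulated sets\<close>

lemma contains_cyl:
  assumes B: "sep h B" "B \<noteq> {}" and n: "r ^ n * dm < h"
  shows "\<exists>w\<in>W n. cyl w \<subseteq> B"
proof -
  obtain x where x: "x \<in> B" using B(2) by blast
  then obtain w where w: "w \<in> W n" "x \<in> cyl w" using E_W[of n] sep_sub[OF B(1)] by blast
  then show ?thesis using cyl_dichotomy[OF B(1) n w(1)] x by blast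
qed

lemma Pk_types:
  "\<exists>Phi. finite Phi \<and> (\<forall>k A. A \<in> Pk k \<longrightarrow> nm A / p ^ k \<in> Phi)"
proof -
  define C where "C = max 1 (1 / gp)"
  have C: "0 < C" "1 \<le> C" "1 / C \<le> gp"
    using gp(1) by (auto simp: C_def field_simps max_def)
  obtain Phi where Phi: "finite Phi" "\<And>k B. sep (r ^ k / C) B \<Longrightarrow> (\<forall>x\<in>B. \<forall>y\<in>B. dist x y \<le> C * r ^ k) \<Longrightarrow> mu B / p ^ k \<in> Phi"
    using finite_types[OF C(1)] by blast
  have "nm A / p ^ k \<in> (\<lambda>x. x / mu G) ` Phi" if A: "A \<in> Pk k" for k A
  proof -
    have "sep (r ^ k / C) A"
      using mult_right_mono[OF C(3), of "r ^ k"] r_pow(1)[of k] by (intro sep_mono[OF sep_Pk[OF A]]) simp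
    moreover have "dist x y \<le> C * r ^ k" if "x \<in> A" "y \<in> A" for x y
    proof -
      have "1 * r ^ k \<le> C * r ^ k" using C(2) r_pow(1)[of k] by (intro mult_right_mono) auto
      then show ?thesis using Pk_diam[OF A that] by linarith
    qed
    ultimately have "mu A / p ^ k \<in> Phi" using Phi(2) by blast
    moreover have "nm A / p ^ k = (mu A / p ^ k) / mu G" by (simp add: nm_def)
    ultimately show ?thesis by blast
  qed
  then show ?thesis using Phi(1) by (intro exI[of _ "(\<lambda>x. x / mu G) ` Phi"]) auto
qed

lemma sep_pieces:
  assumes B: "sep h B" and k: "gp * r ^ k < h"
  shows "\<Union>{A\<in>Pk k. A \<subseteq> B} = B"
proof
  show "B \<subseteq> \<Union>{A\<in>Pk k. A \<subseteq> B}"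
  proof
    fix x assume x: "x \<in> B"
    then obtain A where A: "A \<in> Pk k" "x \<in> A" using Pk_cover[of k] sep_sub[OF B] by blast
    then show "x \<in> \<Union>{A\<in>Pk k. A \<subseteq> B}" using sep_Pk_dichotomy[OF B k A(1)] x by blast
  qed
qed blast

lemma Pk_disjoint_family: "Q \<subseteq> Pk k \<Longrightarrow> disjoint_family_on (\<lambda>A. A) Q"
  unfolding disjoint_family_on_def using Pk_eqI by blast

lemma nm_pieces: "Q \<subseteq> Pk k \<Longrightarrow> nm (\<Union>Q) = (\<Sum>A\<in>Q. nm A)"
  using nm_UN[of Q "\<lambda>A. A"] finite_subset[OF _ finite_Pk] clopen_Pk Pk_disjoint_family by (metis UN_ball_bex_simps(3) image_ident subsetD)

text \<open>A copy \<open>R\<close> of \<open>G\<close> with at most half the mass of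
  \<open>F\<close> is set aside. \<open>F - R\<close> is used up greedily by pieces so fine that the
  remainder falls below \<open>p ^ m\<close>, the mass of a smaller copy of \<open>G\<close> inside
  \<open>R\<close>. The remainder lies in Z[p], and \<open>zpoly_antichain\<close> realises it
  exactly by disjoint copies of \<open>G\<close> inside \<open>R\<close>.\<close>

lemma split_small:
  assumes F: "insulated F" and y: "y \<in> zpolys p" "0 < y" "2 * y \<le> nm F"
  shows "\<exists>H\<subseteq>F. clopen H \<and> nm H = y"
proof -
  have Fne: "F \<noteq> {}" using y by auto
  have cF: "clopen F" using insulated_clopen[OF F] .
  obtain h where h: "0 < h" "sep h F" using cF by (auto simp: clopen_def)
  obtain hG where hG: "0 < hG" "sep hG G" using insulated_clopen[OF G(1)] by (auto simp: clopen_def)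
  obtain n1 where n1: "r ^ n1 * dm < h" using ex_level[OF h(1)] by blast
  obtain n2 where n2: "p ^ n2 < nm F / 2" using real_arch_pow_inv[of "nm F / 2" p] nm_pos[OF cF Fne] p by auto
  define n where "n = max n1 n2"
  obtain v where v: "v \<in> W n" "cyl v \<subseteq> F"
    using contains_cyl[OF h(2) Fne level_mono[OF n1, of n]] by (auto simp: n_def)
  have vv: "valid v" using W_valid[OF v(1)] .
  obtain n3 where n3: "r ^ n3 * dm < hG" using ex_level[OF hG(1)] by blast
  \<comment> \<open>\<open>cyl v\<close> contains \<open>R\<close> but may be larger. With
    \<open>cyl v' \<subseteq> G\<close> the whole cylinder of \<open>v @ v'\<close> lies in
    \<open>R\<close>, so all copies placed there avoid \<open>F - R\<close>.\<close>
  obtain v' where v': "v' \<in> W n3" "cyl v' \<subseteq> G" using contains_cyl[OF hG(2) G_ne n3] by blast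
  have vv': "valid v'" using W_valid[OF v'(1)] .
  define R where "R = sw v ` G"
  have R: "insulated R" "R \<subseteq> F" using insulated_sw[OF G(1) vv] v(2) insulated_sub_E[OF G(1)] by (auto simp: R_def)
  have "nm R = p ^ lv v" unfolding R_def using nm_sw[OF G(1) vv] nm_G by simp
  also have "\<dots> \<le> p ^ n2" using W_lv_ge[OF v(1)] p by (intro power_decreasing) (auto simp: n_def)
  finally have nR: "nm R \<le> nm F / 2" using n2 by simp
  define m where "m = lv (v @ v')"
  have cylR: "cyl (v @ v') \<subseteq> R" unfolding R_def sw_append_image using v'(2) by blast
  obtain Phi where Phi: "finite Phi" "\<And>k A. A \<in> Pk k \<Longrightarrow> nm A / p ^ k \<in> Phi" using Pk_types by blast
  define B where "B = Max (insert 1 Phi)"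
  have B: "0 < B" "\<And>x. x \<in> Phi \<Longrightarrow> x \<le> B"
  proof -
    have "1 \<le> B" unfolding B_def using Phi(1) by (intro Max_ge) auto
    then show "0 < B" by simp
    show "x \<le> B" if "x \<in> Phi" for x unfolding B_def using Phi(1) that by (intro Max_ge) auto
  qed
  have cFR: "clopen (F - R)" using clopen_Diff[OF cF insulated_clopen[OF R(1)]] .
  then obtain h' where h': "0 < h'" "sep h' (F - R)" by (auto simp: clopen_def)
  obtain k1 where k1: "r ^ k1 * gp < h'" using ex_level[OF h'(1)] by blast
  obtain k2 where k2: "p ^ k2 < p ^ m / B" using real_arch_pow_inv[of "p ^ m / B" p] p_pow(1)[of m] B p by auto
  define k where "k = max k1 k2"
  have kgp: "gp * r ^ k < h'"
  proof -
    have "gp * r ^ k \<le> gp * r ^ k1" using gp(1) r by (intro mult_left_mono power_decreasing) (auto simp: k_def)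
    then show ?thesis using k1 by (simp add: mult.commute)
  qed
  define Q where "Q = {A\<in>Pk k. A \<subseteq> F - R}"
  have UQ: "\<Union>Q = F - R" unfolding Q_def by (rule sep_pieces[OF h'(2) kgp])
  have QP: "Q \<subseteq> Pk k" by (auto simp: Q_def)
  have fQ: "finite Q" using finite_subset[OF QP finite_Pk] .
  have small: "nm A \<le> B * p ^ k" if "A \<in> Q" for A
    using B(2)[OF Phi(2)[of A k]] that QP p_pow(1)[of k] by (auto simp: field_simps)
  have Bk: "B * p ^ k < p ^ m"
  proof -
    have "B * p ^ k \<le> B * p ^ k2" using B(1) p by (intro mult_left_mono power_decreasing) (auto simp: k_def)
    also have "\<dots> < p ^ m" using k2 B(1) by (simp add: field_simps)
    finally show ?thesis .
  qed
  have "(\<Sum>A\<in>Q. nm A) = nm F - nm R" using nm_pieces[OF QP] UQ nm_Diff[OF cF insulated_clopen[OF R(1)] R(2)] by simp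
  then have "y \<le> (\<Sum>A\<in>Q. nm A)" using y(3) nR by linarith
  then obtain Q' where Q': "Q' \<subseteq> Q" "0 < y - sum nm Q'" "y - sum nm Q' \<le> B * p ^ k"
    using greedy_subset[of Q nm "B * p ^ k" y] fQ small y(2) by blast
  define z where "z = y - sum nm Q'"
  \<comment> \<open>The chosen pieces lie in \<open>F\<close> and inherit its insulation; this is
    what puts their masses, and hence the remainder \<open>z\<close>, into Z[p].\<close>
  have insQ: "insulated A" if "A \<in> Q'" for A
    using insulated_subset[OF F clopen_Pk[of A k]] that Q'(1) by (auto simp: Q_def)
  have "z \<in> zpolys p" unfolding z_def using y(1) G(3) insQ by (intro zpolys_diff zpolys_sum) auto
  moreover have "0 < z" "z < p ^ m" using Q'(2,3) Bk by (auto simp: z_def)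
  ultimately obtain n' T where T: "T \<subseteq> W n'" "(\<Sum>u\<in>T. p ^ (m + lv u)) = z" using zpoly_antichain by blast
  have fT: "finite T" using finite_subset[OF T(1) finite_W] .
  define H' where "H' = (\<Union>u\<in>T. sw (v @ v' @ u) ` G)"
  have val: "valid (v @ v' @ u)" if "u \<in> T" for u using vv vv' T(1) W_valid that by auto
  have iH: "insulated (sw (v @ v' @ u) ` G)" if "u \<in> T" for u using insulated_sw[OF G(1) val[OF that]] .
  have disj: "disjoint_family_on (\<lambda>u. sw (v @ v' @ u) ` G) T"
    unfolding disjoint_family_on_def
  proof (intro ballI impI)
    fix u u' assume u: "u \<in> T" "u' \<in> T" "u \<noteq> u'"
    then have "u \<parallel> u'" using W_parallel T(1) by blast
    then have "v @ v' @ u \<parallel> v @ v' @ u'" by (auto simp: parallel_def)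
    then show "sw (v @ v' @ u) ` G \<inter> sw (v @ v' @ u') ` G = {}"
      using insulated_parallel[OF G(1) insulated_sub_E[OF G(1)] val[OF u(1)] val[OF u(2)]] by blast
  qed
  have cH': "clopen H'" unfolding H'_def by (rule clopen_UN[OF fT insulated_clopen[OF iH]])
  have "nm H' = (\<Sum>u\<in>T. nm (sw (v @ v' @ u) ` G))"
    unfolding H'_def by (rule nm_UN[OF fT insulated_clopen[OF iH] disj])
  also have "\<dots> = (\<Sum>u\<in>T. p ^ (m + lv u))"
    using nm_sw[OF G(1) val] nm_G by (intro sum.cong) (auto simp: m_def add.assoc)
  finally have nH': "nm H' = z" using T(2) by simp
  have "H' \<subseteq> cyl (v @ v')"
  proof -
    have "sw (v @ v' @ u) ` G \<subseteq> cyl (v @ v')" if "u \<in> T" for u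
    proof -
      have "valid u" using W_valid T(1) that by blast
      then have "sw u ` G \<subseteq> E" using cyl_sub[of u] image_mono[OF insulated_sub_E[OF G(1)], of "sw u"] by simp
      then have "sw (v @ v') ` (sw u ` G) \<subseteq> cyl (v @ v')" by (rule image_mono)
      then show ?thesis by (simp add: image_image)
    qed
    then show ?thesis unfolding H'_def by blast
  qed
  then have H'R: "H' \<subseteq> R" using cylR by blast
  have Q'P: "Q' \<subseteq> Pk k" using Q'(1) QP by blast
  have cQ: "clopen (\<Union>Q')" using clopen_UN[of Q' "\<lambda>A. A"] clopen_Pk Q'P finite_subset[OF Q'(1) fQ] by auto
  have QFR: "\<Union>Q' \<subseteq> F - R" using Q'(1) UQ by blast
  have "nm (\<Union>Q' \<union> H') = nm (\<Union>Q') + nm H'" using QFR H'R by (intro nm_Un cQ cH') blast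
  also have "\<dots> = y" using nm_pieces[OF Q'P] nH' by (simp add: z_def)
  finally show ?thesis using clopen_Un[OF cQ cH'] QFR H'R R(2) by (intro exI[of _ "\<Union>Q' \<union> H'"]) blast
qed

lemma split_exact:
  assumes F: "insulated F" and y: "y \<in> zpolys p" "0 < y" "y < nm F"
  shows "\<exists>H\<subseteq>F. clopen H \<and> nm H = y"
proof (cases "2 * y \<le> nm F")
  case True
  then show ?thesis using split_small[OF F y(1,2)] by blast
next
  case False
  have "nm F - y \<in> zpolys p" using zpolys_diff G(3)[OF F] y(1) by blast
  then obtain H where H: "H \<subseteq> F" "clopen H" "nm H = nm F - y"
    using split_small[OF F, of "nm F - y"] y(3) False by auto
  have cF: "clopen F" using insulated_clopen[OF F] .
  have "nm (F - H) = y" using nm_Diff[OF cF H(2,1)] H(3) by simp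
  then show ?thesis using clopen_Diff[OF cF H(2)] by blast
qed

end

subsection \<open>Fake measures\<close>

text \<open>Every piece outside the regions reserved so far gets the weight \<open>nh\<close> of its (rescaled) measure, a value close to the
  \<open>kap\<close>-fold measure. Inside each such piece a copy of \<open>H0\<close> is reserved, whose weight can be chosen so that the weights add
  up. Divisibility of \<open>nh\<close> by \<open>1 - p ^ ee\<close> keeps the required split of the copy in \<open>\<int>[p]\<close>, and \<open>nh\<close> and \<open>ee\<close> do
  not depend on the attractor, so two attractors can be given the same total \<open>nh 1\<close>.\<close>

locale fake_measure = pid_attractor +
  fixes m ee :: nat and kap eps :: real and nh :: "real \<Rightarrow> real" and H0 :: "'a set" and h0 amin amax :: real
  assumes m: "0 < m" and ee: "p ^ ee \<le> 1 / 2"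
    and kap: "2 / mu G \<le> kap" and eps: "0 < eps"
    and nh_lower: "\<And>a. 0 < a \<Longrightarrow> kap * a \<le> nh a" and nh_upper: "\<And>a. 0 < a \<Longrightarrow> nh a \<le> kap * a + eps"
    and nh_mult: "\<And>a. \<exists>z\<in>zpolys p. nh a = (1 - p ^ ee) * z"
    and amin: "0 < amin" and amin_E: "amin \<le> 1" and amax_E: "1 \<le> amax"
    and types: "\<And>k A. A \<in> Pk k \<Longrightarrow> amin * p ^ k \<le> mu A \<and> mu A \<le> amax * p ^ k"
    and H0: "H0 \<subseteq> G" "insul h0 H0" "0 < h0" "nm H0 = 1 - p ^ ee"
    and m_large: "gp * r ^ m < h0 * r ^ (j0 + M)"
    and eps_small: "eps * (amax / amin) < p ^ (j0 + M) / 2"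
    and ee_large: "(kap * amax + eps) * p ^ ee < p ^ (j0 + M) / 4"
begin

text \<open>Level 0 is the whole attractor, since a tree needs one root and \<open>Pk 0\<close> may
  consist of several pieces.\<close>

definition P :: "nat \<Rightarrow> 'a set set" where "P t = (if t = 0 then {E} else Pk (t * m))"

lemma P_0: "P 0 = {E}" and P_Suc: "P (Suc t) = Pk (Suc t * m)"
  by (simp_all add: P_def)

lemma P_cover: "\<Union>(P t) = E"
  by (simp add: P_def Pk_cover)

lemma P_sub: "A \<in> P t \<Longrightarrow> A \<subseteq> E"
  using P_cover by blast

lemma P_ne: "A \<in> P t \<Longrightarrow> A \<noteq> {}"
  using Pk_ne E_ne by (auto simp: P_def split: if_splits)

lemma P_sep: "A \<in> P t \<Longrightarrow> sep (gp * r ^ (t * m)) A"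
  using sep_Pk sep_E by (auto simp: P_def split: if_splits)

lemma P_clopen: "A \<in> P t \<Longrightarrow> clopen A"
  using clopen_Pk clopen_E by (auto simp: P_def split: if_splits)

lemma P_eqI: "A \<in> P t \<Longrightarrow> B \<in> P t \<Longrightarrow> x \<in> A \<Longrightarrow> x \<in> B \<Longrightarrow> A = B"
  using Pk_eqI by (auto simp: P_def split: if_splits)

lemma P_finite: "finite (P t)"
  by (simp add: P_def finite_Pk)

lemma P_refine: "t \<le> s \<Longrightarrow> B \<in> P s \<Longrightarrow> \<exists>A\<in>P t. B \<subseteq> A"
proof (cases "t = 0")
  case True
  assume "B \<in> P s"
  then show ?thesis using True P_sub P_0 by blast
next
  case False
  assume "t \<le> s" "B \<in> P s"
  then show ?thesis using False Pk_refine[of "t * m" "s * m" B] by (simp add: P_def split: if_splits)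
qed

lemma P_diam: "A \<in> P t \<Longrightarrow> x \<in> A \<Longrightarrow> y \<in> A \<Longrightarrow> dist x y \<le> max 1 dm * r ^ (t * m)"
proof (cases "t = 0")
  case True
  assume "A \<in> P t" "x \<in> A" "y \<in> A"
  then show ?thesis using True dist_E[of x y] by (simp add: P_def)
next
  case False
  assume "A \<in> P t" "x \<in> A" "y \<in> A"
  then have "dist x y \<le> 1 * r ^ (t * m)" using False Pk_diam[of A "t * m" x y] by (simp add: P_def)
  also have "\<dots> \<le> max 1 dm * r ^ (t * m)" using r_pow(1)[of "t * m"] by (intro mult_right_mono) auto
  finally show ?thesis .
qed

lemma P_types: "A \<in> P t \<Longrightarrow> amin * p ^ (t * m) \<le> mu A \<and> mu A \<le> amax * p ^ (t * m)"
  using types mu_E amin_E amax_E by (auto simp: P_def split: if_splits)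

lemma P_dichotomy: "sep h B \<Longrightarrow> gp * r ^ (t * m) < h \<Longrightarrow> 0 < t \<Longrightarrow> A \<in> P t \<Longrightarrow> A \<subseteq> B \<or> A \<inter> B = {}"
  using sep_Pk_dichotomy[of h B "t * m" A] by (simp add: P_def)

lemma P_contains_cyl: "A \<in> P t \<Longrightarrow> \<exists>w\<in>W (t * m + j0). cyl w \<subseteq> A"
proof (cases "t = 0")
  case True
  assume "A \<in> P t"
  obtain x where "x \<in> E" using E_ne by blast
  then obtain w where "w \<in> W j0" using E_W[of j0] by blast
  then show ?thesis using True \<open>A \<in> P t\<close> cyl_sub[OF W_valid] by (auto simp: P_def)
next
  case False
  assume "A \<in> P t"
  then show ?thesis using False Pk_contains_cyl[of A "t * m"] by (simp add: P_def)
qed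

definition wd :: "nat \<Rightarrow> 'a set \<Rightarrow> nat list" where "wd t A = (SOME w. w \<in> W (t * m + j0) \<and> cyl w \<subseteq> A)"

lemma wd: "A \<in> P t \<Longrightarrow> wd t A \<in> W (t * m + j0)" "A \<in> P t \<Longrightarrow> cyl (wd t A) \<subseteq> A"
  using someI_ex[of "\<lambda>w. w \<in> W (t * m + j0) \<and> cyl w \<subseteq> A"] P_contains_cyl[of A t] unfolding wd_def by auto

lemma wd_valid: "A \<in> P t \<Longrightarrow> valid (wd t A)"
  using wd(1) W_valid by blast

lemma lv_wd: "A \<in> P t \<Longrightarrow> t * m + j0 \<le> lv (wd t A)" "A \<in> P t \<Longrightarrow> lv (wd t A) < t * m + j0 + M"
  using wd(1) W_lv_ge W_lv_less by blast+

definition R :: "nat \<Rightarrow> 'a set \<Rightarrow> 'a set" where "R t A = sw (wd t A) ` H0"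

lemma H0_insulated: "insulated H0"
  unfolding insulated_def using H0 by blast

lemma R_sub: "A \<in> P t \<Longrightarrow> R t A \<subseteq> A"
  using wd(2)[of A t] H0(1) insulated_sub_E[OF G(1)] unfolding R_def by blast

lemma R_insulated: "A \<in> P t \<Longrightarrow> insulated (R t A)"
  unfolding R_def using insulated_sw[OF H0_insulated wd_valid] .

lemma nm_R: "A \<in> P t \<Longrightarrow> nm (R t A) = (1 - p ^ ee) * p ^ lv (wd t A)"
  unfolding R_def using nm_sw[OF H0_insulated wd_valid] H0(4) by simp

lemma r_lv_wd: "A \<in> P t \<Longrightarrow> r ^ (j0 + M) * r ^ (t * m) \<le> r ^ lv (wd t A)"
proof -
  assume A: "A \<in> P t"
  have "r ^ (j0 + M + t * m) \<le> r ^ lv (wd t A)" using lv_wd(2)[OF A] r by (intro power_decreasing) auto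
  then show ?thesis by (simp add: power_add)
qed

lemma p_lv_wd: "A \<in> P t \<Longrightarrow> p ^ (j0 + M) * p ^ (t * m) \<le> p ^ lv (wd t A)"
proof -
  assume A: "A \<in> P t"
  have "p ^ (j0 + M + t * m) \<le> p ^ lv (wd t A)" using lv_wd(2)[OF A] p by (intro power_decreasing) auto
  then show ?thesis by (simp add: power_add)
qed

text \<open>This is the purpose of \<open>m_large\<close>: one step of the tree is finer than the
  gap around a reserved region, so the region is a union of pieces of the next level.\<close>

lemma R_dichotomy: "A \<in> P t \<Longrightarrow> B \<in> P (Suc t) \<Longrightarrow> B \<subseteq> R t A \<or> B \<inter> R t A = {}"
proof -
  assume A: "A \<in> P t" and B: "B \<in> P (Suc t)"
  have "sep (h0 * r ^ lv (wd t A)) (R t A)"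
    unfolding R_def using insul_sep[OF insul_sw[OF H0(2) wd_valid[OF A]]] .
  moreover have "gp * r ^ (Suc t * m) < h0 * r ^ lv (wd t A)"
  proof -
    have "gp * r ^ (Suc t * m) = gp * r ^ m * r ^ (t * m)" by (simp add: power_add)
    also have "\<dots> < h0 * r ^ (j0 + M) * r ^ (t * m)" using m_large r_pow(1) by (intro mult_strict_right_mono) auto
    also have "\<dots> \<le> h0 * r ^ lv (wd t A)" using r_lv_wd[OF A] H0(3) by (simp add: mult.assoc)
    finally show ?thesis .
  qed
  ultimately show ?thesis using P_dichotomy[OF _ _ _ B] by blast
qed

definition ch :: "nat \<Rightarrow> 'a set \<Rightarrow> 'a set set" where "ch t A = {B\<in>P (Suc t). B \<subseteq> A - R t A}"

lemma ch_finite: "finite (ch t A)"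
  unfolding ch_def using P_finite by simp

lemma ch_P: "B \<in> ch t A \<Longrightarrow> B \<in> P (Suc t)"
  by (simp add: ch_def)

lemma P_disjoint_family: "Q \<subseteq> P t \<Longrightarrow> disjoint_family_on (\<lambda>A. A) Q"
  unfolding disjoint_family_on_def using P_eqI by blast

lemma Union_ch: "A \<in> P t \<Longrightarrow> \<Union>(ch t A) = A - R t A"
proof
  assume A: "A \<in> P t"
  show "A - R t A \<subseteq> \<Union>(ch t A)"
  proof
    fix x assume x: "x \<in> A - R t A"
    then obtain B where B: "B \<in> P (Suc t)" "x \<in> B" using P_cover[of "Suc t"] P_sub[OF A] by blast
    obtain A' where "A' \<in> P t" "B \<subseteq> A'" using P_refine[OF _ B(1), of t] by auto
    then have "B \<subseteq> A" using P_eqI[OF A, of A' x] x B(2) by blast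
    moreover have "B \<inter> R t A = {}" using R_dichotomy[OF A B(1)] x B(2) by blast
    ultimately show "x \<in> \<Union>(ch t A)" using B unfolding ch_def by blast
  qed
qed (auto simp: ch_def)

lemma sum_mu_ch: "A \<in> P t \<Longrightarrow> (\<Sum>B\<in>ch t A. mu B) = mu A - mu (R t A)"
proof -
  assume A: "A \<in> P t"
  have sub: "ch t A \<subseteq> P (Suc t)" using ch_P by blast
  have "mu (\<Union>B\<in>ch t A. B) = (\<Sum>B\<in>ch t A. mu B)"
    using mu_UN[OF ch_finite P_clopen[OF ch_P] P_disjoint_family[OF sub]] .
  then have "(\<Sum>B\<in>ch t A. mu B) = mu (A - R t A)" using Union_ch[OF A] by simp
  also have "\<dots> = mu A - mu (R t A)" using mu_Diff[OF P_clopen[OF A] insulated_clopen[OF R_insulated[OF A]] R_sub[OF A]] .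
  finally show ?thesis .
qed

definition nominal :: "nat \<Rightarrow> 'a set \<Rightarrow> real" where "nominal t A = p ^ (t * m) * nh (mu A / p ^ (t * m))"

lemma mu_P_pos: "A \<in> P t \<Longrightarrow> 0 < mu A"
  using mu_pos P_clopen P_ne by blast

lemma kap_pos: "0 < kap"
  using kap G(2) by (smt (verit) divide_pos_pos)

lemma nominal_lower: "A \<in> P t \<Longrightarrow> kap * mu A \<le> nominal t A"
proof -
  assume A: "A \<in> P t"
  have "kap * (mu A / p ^ (t * m)) \<le> nh (mu A / p ^ (t * m))"
    using mu_P_pos[OF A] p_pow(1)[of "t * m"] by (intro nh_lower) simp
  then have "p ^ (t * m) * (kap * (mu A / p ^ (t * m))) \<le> nominal t A"
    unfolding nominal_def using p_pow(1)[of "t * m"] by (intro mult_left_mono) auto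
  then show ?thesis using p by simp
qed

lemma nominal_upper: "A \<in> P t \<Longrightarrow> nominal t A \<le> kap * mu A + eps * p ^ (t * m)"
proof -
  assume A: "A \<in> P t"
  have "nh (mu A / p ^ (t * m)) \<le> kap * (mu A / p ^ (t * m)) + eps"
    using mu_P_pos[OF A] p_pow(1)[of "t * m"] by (intro nh_upper) simp
  then have "nominal t A \<le> p ^ (t * m) * (kap * (mu A / p ^ (t * m)) + eps)"
    unfolding nominal_def using p_pow(1)[of "t * m"] by (intro mult_left_mono) auto
  then show ?thesis using p by (simp add: distrib_left mult.commute)
qed

lemma nominal_pos: "A \<in> P t \<Longrightarrow> 0 < nominal t A"
  using nominal_lower[of A t] mult_pos_pos[OF kap_pos mu_P_pos[of A t]] by linarith

definition defect :: "nat \<Rightarrow> 'a set \<Rightarrow> real" where "defect t A = nominal t A - (\<Sum>B\<in>ch t A. nominal (Suc t) B) - nm (R t A)"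

text \<open>Within \<open>nominal t A\<close> the reserved region accounts for
  \<open>kap * mu (R t A)\<close>, at least twice its mass \<open>nm (R t A)\<close> by the choice
  of \<open>kap\<close>. Assigning it only \<open>nm (R t A)\<close> leaves a surplus of at least
  that mass, and \<open>eps_small\<close> makes this exceed the rounding errors of the boundedly
  many children.\<close>

lemma defect_pos: "A \<in> P t \<Longrightarrow> 0 < defect t A"
proof -
  assume A: "A \<in> P t"
  have muR: "0 \<le> mu (R t A)" using mu_nonneg[OF insulated_clopen[OF R_insulated[OF A]]] .
  have card: "real (card (ch t A)) * p ^ (Suc t * m) \<le> amax / amin * p ^ (t * m)"
  proof -
    have "real (card (ch t A)) * (amin * p ^ (Suc t * m)) = (\<Sum>B\<in>ch t A. amin * p ^ (Suc t * m))" by simp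
    also have "\<dots> \<le> (\<Sum>B\<in>ch t A. mu B)" using P_types[OF ch_P] by (intro sum_mono) blast
    also have "\<dots> \<le> amax * p ^ (t * m)" using sum_mu_ch[OF A] muR P_types[OF A] by linarith
    finally show ?thesis using amin by (simp add: field_simps)
  qed
  have "(\<Sum>B\<in>ch t A. nominal (Suc t) B) \<le> (\<Sum>B\<in>ch t A. kap * mu B + eps * p ^ (Suc t * m))"
    using nominal_upper[OF ch_P] by (intro sum_mono) blast
  also have "\<dots> = kap * (mu A - mu (R t A)) + eps * (real (card (ch t A)) * p ^ (Suc t * m))"
    using sum_mu_ch[OF A] by (simp add: sum.distrib sum_distrib_left[symmetric])
  also have "\<dots> \<le> kap * (mu A - mu (R t A)) + eps * (amax / amin * p ^ (t * m))"
    using card eps by (intro add_left_mono mult_left_mono) auto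
  also have "\<dots> = kap * mu A - kap * mu (R t A) + eps * (amax / amin) * p ^ (t * m)" by (simp add: algebra_simps)
  also have "\<dots> < kap * mu A - kap * mu (R t A) + p ^ (j0 + M) / 2 * p ^ (t * m)"
    using eps_small p_pow(1)[of "t * m"] by (intro add_strict_left_mono mult_strict_right_mono) auto
  finally have s: "(\<Sum>B\<in>ch t A. nominal (Suc t) B) < kap * mu A - kap * mu (R t A) + p ^ (j0 + M) / 2 * p ^ (t * m)" .
  have "2 * nm (R t A) \<le> kap * mu (R t A)"
    using mult_right_mono[OF kap muR] by (simp add: nm_def)
  moreover have "p ^ (j0 + M) / 2 * p ^ (t * m) \<le> nm (R t A)"
  proof -
    have "1 / 2 * (p ^ (j0 + M) * p ^ (t * m)) \<le> (1 - p ^ ee) * p ^ lv (wd t A)"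
      using p_lv_wd[OF A] ee p_pow(1) by (intro mult_mono) (auto simp: less_imp_le)
    then show ?thesis using nm_R[OF A] by simp
  qed
  ultimately show ?thesis using s nominal_lower[OF A] unfolding defect_def by linarith
qed

text \<open>The weight on \<open>V1\<close> is \<open>nm\<close> divided by \<open>p ^ ee\<close>, a
  gain of \<open>nm V1 * (1 / p ^ ee - 1)\<close>. Equating this gain with the defect determines
  \<open>nm V1\<close>, and dividing by \<open>p ^ lv (wd t A)\<close> transports it back to
  \<open>H0\<close>.\<close>

definition defect_size :: "nat \<Rightarrow> 'a set \<Rightarrow> real" where
  "defect_size t A = defect t A * p ^ ee / (1 - p ^ ee) / p ^ lv (wd t A)"

lemma one_minus: "1 / 2 \<le> 1 - p ^ ee" "0 < 1 - p ^ ee"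
  using ee by auto

lemma defect_size_pos: "A \<in> P t \<Longrightarrow> 0 < defect_size t A"
  unfolding defect_size_def using defect_pos one_minus p_pow(1) by simp

text \<open>The larger the amplification \<open>1 / p ^ ee\<close>, the smaller the part
  \<open>V1\<close> that absorbs the defect; by \<open>ee_large\<close> it fits into the reserved
  region.\<close>

lemma defect_size_less: "A \<in> P t \<Longrightarrow> defect_size t A < nm H0"
proof -
  assume A: "A \<in> P t"
  have "defect t A \<le> nominal t A"
    unfolding defect_def using nm_nonneg[OF insulated_clopen[OF R_insulated[OF A]]] nominal_pos[OF ch_P]
    by (smt (verit) less_imp_le sum_nonneg)
  also have "\<dots> \<le> kap * (amax * p ^ (t * m)) + eps * p ^ (t * m)"
    using nominal_upper[OF A] P_types[OF A] kap_pos by (smt (verit) mult_left_mono)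
  also have "\<dots> = (kap * amax + eps) * p ^ (t * m)" by (simp add: algebra_simps)
  finally have "defect t A * p ^ ee \<le> (kap * amax + eps) * p ^ ee * p ^ (t * m)"
    using mult_right_mono[of "defect t A" "(kap * amax + eps) * p ^ (t * m)" "p ^ ee"] p_pow(1)[of ee] by (simp add: ac_simps)
  also have "\<dots> < p ^ (j0 + M) / 4 * p ^ (t * m)"
    using ee_large p_pow(1)[of "t * m"] by (intro mult_strict_right_mono) auto
  also have "\<dots> \<le> 1 / 4 * p ^ lv (wd t A)" using p_lv_wd[OF A] by simp
  also have "\<dots> \<le> ((1 - p ^ ee) * (1 - p ^ ee)) * p ^ lv (wd t A)"
  proof (rule mult_right_mono)
    have "1 / 2 * (1 / 2) \<le> (1 - p ^ ee) * (1 - p ^ ee)" using one_minus by (intro mult_mono) auto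
    then show "1 / 4 \<le> (1 - p ^ ee) * (1 - p ^ ee)" by simp
  qed (use p_pow(1) less_imp_le in blast)
  finally have "defect t A * p ^ ee < (1 - p ^ ee) * (1 - p ^ ee) * p ^ lv (wd t A)" .
  then have "defect t A * p ^ ee / (1 - p ^ ee) < (1 - p ^ ee) * p ^ lv (wd t A)"
    using one_minus(2) by (simp add: pos_divide_less_eq ac_simps)
  then show ?thesis unfolding defect_size_def H0(4) by (simp only: pos_divide_less_eq[OF p_pow(1)])
qed

lemma nominal_mult: "\<exists>z\<in>zpolys p. nominal t A = (1 - p ^ ee) * z"
proof -
  obtain z where z: "z \<in> zpolys p" "nh (mu A / p ^ (t * m)) = (1 - p ^ ee) * z" using nh_mult by blast
  have "nominal t A = (1 - p ^ ee) * (p ^ (t * m) * z)" unfolding nominal_def z(2) by simp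
  then show ?thesis using zpolys_mult[OF zpolys_power z(1)] by blast
qed

text \<open>The denominator \<open>1 - p ^ ee\<close> cancels because every term of the defect is
  divisible by it: the nominal weights by \<open>nh_mult\<close>, and \<open>nm (R t A)\<close>
  because \<open>H0\<close> was chosen with mass \<open>1 - p ^ ee\<close>.\<close>

lemma defect_size_zpolys: "A \<in> P t \<Longrightarrow> defect_size t A \<in> zpolys p"
proof -
  assume A: "A \<in> P t"
  have "\<forall>B. \<exists>z. z \<in> zpolys p \<and> nominal (Suc t) B = (1 - p ^ ee) * z" using nominal_mult by blast
  then obtain z where z: "\<And>B. z B \<in> zpolys p" "\<And>B. nominal (Suc t) B = (1 - p ^ ee) * z B" by metis
  obtain z0 where z0: "z0 \<in> zpolys p" "nominal t A = (1 - p ^ ee) * z0" using nominal_mult by blast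
  define y where "y = z0 - (\<Sum>B\<in>ch t A. z B) - p ^ lv (wd t A)"
  have y: "y \<in> zpolys p" unfolding y_def using z z0 zpolys_sum[of "ch t A" z p]
    by (intro zpolys_diff zpolys_power) auto
  have "defect t A = (1 - p ^ ee) * y"
    unfolding defect_def y_def z0(2) nm_R[OF A] z(2) by (simp add: right_diff_distrib sum_distrib_left)
  then have "defect_size t A = y * p ^ ee / p ^ lv (wd t A)" unfolding defect_size_def using one_minus(2) by simp
  then show ?thesis using zpolys_div_power[OF zpolys_mult[OF y zpolys_power]] by simp
qed

definition H1 :: "real \<Rightarrow> 'a set" where "H1 z = (SOME H. H \<subseteq> H0 \<and> clopen H \<and> nm H = z)"

lemma H1: "z \<in> zpolys p \<Longrightarrow> 0 < z \<Longrightarrow> z < nm H0 \<Longrightarrow> H1 z \<subseteq> H0 \<and> clopen (H1 z) \<and> nm (H1 z) = z"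
  unfolding H1_def by (rule someI_ex) (use split_exact[OF H0_insulated] in blast)

definition V1 :: "nat \<Rightarrow> 'a set \<Rightarrow> 'a set" where "V1 t A = sw (wd t A) ` H1 (defect_size t A)"
definition V0 :: "nat \<Rightarrow> 'a set \<Rightarrow> 'a set" where "V0 t A = sw (wd t A) ` (H0 - H1 (defect_size t A))"

lemma H1_defect_size:
  assumes A: "A \<in> P t"
  shows "H1 (defect_size t A) \<subseteq> H0" "insulated (H1 (defect_size t A))" "insulated (H0 - H1 (defect_size t A))" "nm (H1 (defect_size t A)) = defect_size t A"
    "H0 - H1 (defect_size t A) \<noteq> {}"
proof -
  note H = H1[OF defect_size_zpolys[OF A] defect_size_pos[OF A] defect_size_less[OF A]]
  show "H1 (defect_size t A) \<subseteq> H0" "nm (H1 (defect_size t A)) = defect_size t A" using H by auto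
  show "insulated (H1 (defect_size t A))" using insulated_subset[OF H0_insulated] H by blast
  show "insulated (H0 - H1 (defect_size t A))" using insulated_subset[OF H0_insulated] clopen_Diff insulated_clopen[OF H0_insulated] H by blast
  show "H0 - H1 (defect_size t A) \<noteq> {}"
  proof
    assume "H0 - H1 (defect_size t A) = {}"
    then have "H1 (defect_size t A) = H0" using H by blast
    then show False using H defect_size_less[OF A] by simp
  qed
qed

lemma V_Un: "A \<in> P t \<Longrightarrow> V0 t A \<union> V1 t A = R t A"
  unfolding V0_def V1_def R_def using H1_defect_size(1)[of A t] by blast

lemma V_Int: "A \<in> P t \<Longrightarrow> V0 t A \<inter> V1 t A = {}"
  unfolding V0_def V1_def using sw_inj[OF wd_valid[of A t]] by (auto simp: inj_def)

lemma V_insulated: "A \<in> P t \<Longrightarrow> insulated (V0 t A)" "A \<in> P t \<Longrightarrow> insulated (V1 t A)"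
  unfolding V0_def V1_def using insulated_sw wd_valid H1_defect_size by blast+

lemma nm_V:
  assumes A: "A \<in> P t"
  shows "nm (V0 t A) + nm (V1 t A) / p ^ ee = nm (R t A) + defect t A"
proof -
  have v1: "nm (V1 t A) = defect t A * p ^ ee / (1 - p ^ ee)"
    unfolding V1_def using nm_sw[OF H1_defect_size(2)[OF A] wd_valid[OF A]] H1_defect_size(4)[OF A] p_pow(3)[of "lv (wd t A)"]
    by (simp add: defect_size_def)
  have "nm (V0 t A) + nm (V1 t A) = nm (R t A)"
    using nm_Un[OF insulated_clopen[OF V_insulated(1)[OF A]] insulated_clopen[OF V_insulated(2)[OF A]] V_Int[OF A]] V_Un[OF A] by simp
  moreover have "nm (V1 t A) / p ^ ee = defect t A / (1 - p ^ ee)" unfolding v1 using p_pow(3)[of ee] by simp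
  moreover have "defect t A / (1 - p ^ ee) - defect t A * p ^ ee / (1 - p ^ ee) = defect t A"
    using one_minus(2) by (simp add: diff_divide_distrib[symmetric] field_simps)
  ultimately show ?thesis using v1 by linarith
qed

section \<open>The weight on free and on reserved pieces\<close>

primrec active :: "nat \<Rightarrow> 'a set set" where
  "active 0 = {E}"
| "active (Suc t) = (\<Union>A\<in>active t. ch t A)"

lemma active_P: "A \<in> active t \<Longrightarrow> A \<in> P t"
  by (induction t arbitrary: A) (auto simp: P_0 ch_P)

lemma active_R_disjoint: "B \<in> active t \<Longrightarrow> s < t \<Longrightarrow> A \<in> active s \<Longrightarrow> B \<inter> R s A = {}"
proof (induction t arbitrary: B)
  case (Suc t)
  obtain A0 where A0: "A0 \<in> active t" "B \<in> ch t A0" using Suc.prems(1) by auto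
  have B: "B \<subseteq> A0 - R t A0" using A0(2) by (simp add: ch_def)
  show ?case
  proof (cases "s = t")
    case True
    show ?thesis
    proof (cases "A = A0")
      case True
      then show ?thesis using B \<open>s = t\<close> by blast
    next
      case False
      then have "A \<inter> A0 = {}" using P_eqI[OF active_P[OF Suc.prems(3)], of A0] active_P[OF A0(1)] \<open>s = t\<close> by blast
      then show ?thesis using B R_sub[OF active_P[OF Suc.prems(3)]] by blast
    qed
  next
    case False
    then have "A0 \<inter> R s A = {}" using Suc.IH[OF A0(1) _ Suc.prems(3)] Suc.prems(2) by simp
    then show ?thesis using B by blast
  qed
qed simp

lemma active_or_owned: "B \<in> P t \<Longrightarrow> B \<in> active t \<or> (\<exists>s<t. \<exists>A\<in>active s. B \<subseteq> R s A)"
proof (induction t arbitrary: B)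
  case 0
  then show ?case by (simp add: P_0)
next
  case (Suc t)
  obtain B' where B': "B' \<in> P t" "B \<subseteq> B'" using P_refine[OF _ Suc.prems, of t] by auto
  from Suc.IH[OF B'(1)] show ?case
  proof
    assume a: "B' \<in> active t"
    show ?thesis
    proof (cases "B \<subseteq> R t B'")
      case True
      then show ?thesis using a by blast
    next
      case False
      then have "B \<in> ch t B'" using R_dichotomy[OF B'(1) Suc.prems] B'(2) Suc.prems unfolding ch_def by blast
      then show ?thesis using a by auto
    qed
  next
    assume "\<exists>s<t. \<exists>A\<in>active s. B' \<subseteq> R s A"
    then show ?thesis using B'(2) less_Suc_eq by blast
  qed
qed

lemma R_disjoint: "A \<in> active s \<Longrightarrow> A' \<in> active s' \<Longrightarrow> x \<in> R s A \<Longrightarrow> x \<in> R s' A' \<Longrightarrow> s = s' \<and> A = A'"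
proof -
  assume A: "A \<in> active s" and A': "A' \<in> active s'" and x: "x \<in> R s A" "x \<in> R s' A'"
  have xA: "x \<in> A" "x \<in> A'" using R_sub active_P A A' x by blast+
  have "s = s'"
  proof (rule linorder_cases[of s s'])
    assume "s < s'"
    then show ?thesis using active_R_disjoint[OF A' _ A] x xA by blast
  next
    assume "s' < s"
    then show ?thesis using active_R_disjoint[OF A _ A'] x xA by blast
  qed simp
  then show ?thesis using P_eqI[OF active_P[OF A], of A' x] active_P[OF A'] xA by blast
qed

text \<open>Unspecified unless \<open>B\<close> is a nonempty subset of a reserved region.\<close>

definition own :: "'a set \<Rightarrow> nat \<times> 'a set" where
  "own B = (THE sA. snd sA \<in> active (fst sA) \<and> B \<subseteq> R (fst sA) (snd sA))"

lemma own_eq: "A \<in> active s \<Longrightarrow> B \<subseteq> R s A \<Longrightarrow> B \<noteq> {} \<Longrightarrow> own B = (s, A)"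
  unfolding own_def
proof (rule the_equality)
  assume A: "A \<in> active s" "B \<subseteq> R s A" "B \<noteq> {}"
  then show "snd (s, A) \<in> active (fst (s, A)) \<and> B \<subseteq> R (fst (s, A)) (snd (s, A))" by simp
  fix sA assume sA: "snd sA \<in> active (fst sA) \<and> B \<subseteq> R (fst sA) (snd sA)"
  obtain x where "x \<in> B" using A by blast
  then have "fst sA = s \<and> snd sA = A" using R_disjoint[of "snd sA" "fst sA" A s x] A sA by blast
  then show "sA = (s, A)" by (cases sA) simp
qed

text \<open>The split of a reserved region into \<open>V0\<close> and \<open>V1\<close> makes up for the error that \<open>nh\<close> causes on the free children.\<close>

definition nu :: "nat \<Rightarrow> 'a set \<Rightarrow> real" where
  "nu t B = (if B \<in> active t then nominal t B
     else nm (B \<inter> V0 (fst (own B)) (snd (own B))) + nm (B \<inter> V1 (fst (own B)) (snd (own B))) / p ^ ee)"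

lemma nu_owned:
  assumes A: "A \<in> active s" and B: "B \<in> P t" "B \<subseteq> R s A" and st: "s < t"
  shows "nu t B = nm (B \<inter> V0 s A) + nm (B \<inter> V1 s A) / p ^ ee"
proof -
  have "B \<notin> active t" using active_R_disjoint[OF _ st A, of B] B P_ne[OF B(1)] by blast
  then show ?thesis using own_eq[OF A B(2) P_ne[OF B(1)]] by (simp add: nu_def)
qed

lemma sum_nm_Int:
  assumes Q: "Q \<subseteq> P t" and Y: "clopen Y"
  shows "(\<Sum>B\<in>Q. nm (B \<inter> Y)) = nm (\<Union>Q \<inter> Y)"
proof -
  have "disjoint_family_on (\<lambda>B. B \<inter> Y) Q" using P_disjoint_family[OF Q] unfolding disjoint_family_on_def by blast
  then have "nm (\<Union>B\<in>Q. B \<inter> Y) = (\<Sum>B\<in>Q. nm (B \<inter> Y))"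
    using finite_subset[OF Q P_finite] P_clopen Q Y by (intro nm_UN clopen_Int) auto
  moreover have "(\<Union>B\<in>Q. B \<inter> Y) = \<Union>Q \<inter> Y" by blast
  ultimately show ?thesis by simp
qed

lemma sum_nu_owned:
  assumes A: "A \<in> active s" and Q: "Q \<subseteq> P t" "\<Union>Q \<subseteq> R s A" and st: "s < t"
  shows "(\<Sum>B\<in>Q. nu t B) = nm (\<Union>Q \<inter> V0 s A) + nm (\<Union>Q \<inter> V1 s A) / p ^ ee"
proof -
  have "(\<Sum>B\<in>Q. nu t B) = (\<Sum>B\<in>Q. nm (B \<inter> V0 s A) + nm (B \<inter> V1 s A) / p ^ ee)"
    using Q by (intro sum.cong refl nu_owned[OF A _ _ st]) auto
  also have "\<dots> = nm (\<Union>Q \<inter> V0 s A) + nm (\<Union>Q \<inter> V1 s A) / p ^ ee"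
    using sum_nm_Int[OF Q(1) insulated_clopen[OF V_insulated(1)[OF active_P[OF A]]]]
      sum_nm_Int[OF Q(1) insulated_clopen[OF V_insulated(2)[OF active_P[OF A]]]]
    by (simp add: sum.distrib sum_divide_distrib[symmetric])
  finally show ?thesis .
qed

lemma Union_children: "A \<in> P t \<Longrightarrow> \<Union>{B\<in>P (Suc t). B \<subseteq> A} = A"
proof
  assume A: "A \<in> P t"
  show "A \<subseteq> \<Union>{B\<in>P (Suc t). B \<subseteq> A}"
  proof
    fix x assume x: "x \<in> A"
    then obtain B where B: "B \<in> P (Suc t)" "x \<in> B" using P_cover[of "Suc t"] P_sub[OF A] by blast
    obtain A' where "A' \<in> P t" "B \<subseteq> A'" using P_refine[OF _ B(1), of t] by auto
    then have "B \<subseteq> A" using P_eqI[OF A, of A' x] x B(2) by blast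
    then show "x \<in> \<Union>{B\<in>P (Suc t). B \<subseteq> A}" using B by blast
  qed
qed blast

text \<open>For a free piece additivity is the definition of the defect together with
  \<open>nm_V\<close>. For a piece inside a reserved region \<open>nu\<close> is a fixed multiple of
  \<open>nm\<close> on each of \<open>V0\<close> and \<open>V1\<close>, hence additive.\<close>

lemma nu_split: "A \<in> P t \<Longrightarrow> nu t A = (\<Sum>B\<in>{B\<in>P (Suc t). B \<subseteq> A}. nu (Suc t) B)"
proof -
  assume A: "A \<in> P t"
  let ?Q = "{B\<in>P (Suc t). B \<subseteq> A}"
  show ?thesis
  proof (cases "A \<in> active t")
    case True
    let ?Q' = "{B\<in>P (Suc t). B \<subseteq> R t A}"
    have Q: "?Q = ch t A \<union> ?Q'" using R_dichotomy[OF A] R_sub[OF A] unfolding ch_def by blast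
    have dis: "ch t A \<inter> ?Q' = {}" using P_ne unfolding ch_def by blast
    have fin: "finite (ch t A)" "finite ?Q'" using ch_finite P_finite by auto
    have UQ': "\<Union>?Q' = R t A"
    proof -
      have "R t A \<subseteq> \<Union>?Q'"
      proof
        fix x assume x: "x \<in> R t A"
        then have "x \<in> \<Union>?Q" using R_sub[OF A] unfolding Union_children[OF A] by blast
        then obtain B where "B \<in> P (Suc t)" "x \<in> B" by blast
        then show "x \<in> \<Union>?Q'" using R_dichotomy[OF A, of B] x by blast
      qed
      then show ?thesis by blast
    qed
    have "(\<Sum>B\<in>?Q'. nu (Suc t) B) = nm (\<Union>?Q' \<inter> V0 t A) + nm (\<Union>?Q' \<inter> V1 t A) / p ^ ee"
      using UQ' by (intro sum_nu_owned[OF True]) auto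
    also have "\<dots> = nm (V0 t A) + nm (V1 t A) / p ^ ee"
    proof -
      have "R t A \<inter> V0 t A = V0 t A" "R t A \<inter> V1 t A = V1 t A" using V_Un[OF A] by blast+
      then show ?thesis unfolding UQ' by simp
    qed
    also have "\<dots> = nm (R t A) + defect t A" by (rule nm_V[OF A])
    finally have 1: "(\<Sum>B\<in>?Q'. nu (Suc t) B) = nominal t A - (\<Sum>B\<in>ch t A. nominal (Suc t) B)" by (simp add: defect_def)
    have "nu (Suc t) B = nominal (Suc t) B" if "B \<in> ch t A" for B
      using that True by (auto simp: nu_def)
    then have "(\<Sum>B\<in>ch t A. nu (Suc t) B) = (\<Sum>B\<in>ch t A. nominal (Suc t) B)" by (intro sum.cong) auto
    then have "(\<Sum>B\<in>?Q. nu (Suc t) B) = nominal t A" unfolding Q sum.union_disjoint[OF fin dis] using 1 by simp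
    then show ?thesis using True by (simp add: nu_def)
  next
    case False
    then obtain s A0 where s: "s < t" "A0 \<in> active s" "A \<subseteq> R s A0" using active_or_owned[OF A] by blast
    have "(\<Sum>B\<in>?Q. nu (Suc t) B) = nm (\<Union>?Q \<inter> V0 s A0) + nm (\<Union>?Q \<inter> V1 s A0) / p ^ ee"
      using s Union_children[OF A] by (intro sum_nu_owned[OF s(2)]) auto
    also have "\<dots> = nu t A" using nu_owned[OF s(2) A s(3,1)] Union_children[OF A] by simp
    finally show ?thesis by simp
  qed
qed

text \<open>Finitely many sizes mean finitely many splits \<open>H1\<close>, and therefore one
  insulation constant \<open>hV\<close> for all of them. The size is determined by the type of the
  piece, a sum of boundedly many child types, and the overshoot of \<open>wd t A\<close>, and each
  of these takes finitely many values.\<close>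

lemma defect_size_finite: "\<exists>Z. finite Z \<and> (\<forall>t. \<forall>A\<in>P t. defect_size t A \<in> Z)"
proof -
  obtain Phi where Phi: "finite Phi" "\<And>k A. A \<in> Pk k \<Longrightarrow> nm A / p ^ k \<in> Phi" using Pk_types by blast
  define T where "T = insert 1 ((\<lambda>x. x * mu G) ` Phi)"
  have T: "mu A / p ^ (t * m) \<in> T" if A: "A \<in> P t" for t A
  proof (cases "t = 0")
    case True
    then show ?thesis using A mu_E by (simp add: P_def T_def)
  next
    case False
    have "mu A / p ^ (t * m) = (nm A / p ^ (t * m)) * mu G" using G(2) by (simp add: nm_def)
    then show ?thesis using Phi(2)[of A "t * m"] A False unfolding T_def P_def by (metis image_eqI insertI2)
  qed
  define K where "K = (\<lambda>x. p ^ m * nh x) ` T"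
  define n where "n = nat \<lceil>amax / (amin * p ^ m)\<rceil>"
  define D where "D = (\<lambda>(x, y, j). (nh x - y - (1 - p ^ ee) * p ^ j) * p ^ ee / (1 - p ^ ee) / p ^ j) ` (T \<times> bounded_sums K n \<times> {..j0 + M})"
  have "finite D" unfolding D_def K_def T_def using Phi(1) by (intro finite_imageI finite_cartesian_product finite_bounded_sums) auto
  moreover have "defect_size t A \<in> D" if A: "A \<in> P t" for t A
  proof -
    define j where "j = lv (wd t A) - t * m"
    have lvj: "lv (wd t A) = t * m + j" "j \<le> j0 + M" using lv_wd[OF A] by (auto simp: j_def)
    define y where "y = (\<Sum>B\<in>ch t A. p ^ m * nh (mu B / p ^ (Suc t * m)))"
    have card: "card (ch t A) \<le> n"
    proof -
      have "real (card (ch t A)) * (amin * p ^ (Suc t * m)) = (\<Sum>B\<in>ch t A. amin * p ^ (Suc t * m))" by simp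
      also have "\<dots> \<le> (\<Sum>B\<in>ch t A. mu B)" using P_types[OF ch_P] by (intro sum_mono) blast
      also have "\<dots> \<le> amax * p ^ (t * m)"
        using sum_mu_ch[OF A] mu_nonneg[OF insulated_clopen[OF R_insulated[OF A]]] P_types[OF A] by linarith
      finally have "(real (card (ch t A)) * (amin * p ^ m)) * p ^ (t * m) \<le> amax * p ^ (t * m)" by (simp add: power_add ac_simps)
      then have "real (card (ch t A)) * (amin * p ^ m) \<le> amax" using p_pow(1)[of "t * m"] by (rule mult_right_le_imp_le)
      then have "real (card (ch t A)) \<le> amax / (amin * p ^ m)" using amin p_pow(1)[of m] by (simp add: pos_le_divide_eq)
      then show ?thesis unfolding n_def by linarith
    qed
    have y: "y \<in> bounded_sums K n"
      unfolding y_def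
    proof (rule sum_in_bounded_sums[OF ch_finite card])
      show "(\<lambda>B. p ^ m * nh (mu B / p ^ (Suc t * m))) ` ch t A \<subseteq> K" using T[OF ch_P] unfolding K_def by blast
    qed
    have "defect t A = p ^ (t * m) * (nh (mu A / p ^ (t * m)) - y - (1 - p ^ ee) * p ^ j)"
    proof -
      have sumeq: "(\<Sum>B\<in>ch t A. nominal (Suc t) B) = p ^ (t * m) * y"
        unfolding y_def nominal_def sum_distrib_left by (intro sum.cong refl) (simp add: power_add ac_simps)
      have "defect t A = nominal t A - p ^ (t * m) * y - (1 - p ^ ee) * p ^ (t * m + j)"
        unfolding defect_def nm_R[OF A] sumeq lvj(1) ..
      also have "nominal t A = p ^ (t * m) * nh (mu A / p ^ (t * m))" by (rule nominal_def)
      also have "p ^ (t * m) * nh (mu A / p ^ (t * m)) - p ^ (t * m) * y - (1 - p ^ ee) * p ^ (t * m + j) =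
          p ^ (t * m) * (nh (mu A / p ^ (t * m)) - y - (1 - p ^ ee) * p ^ j)"
        by (simp add: power_add algebra_simps)
      finally show ?thesis .
    qed
    then have "defect_size t A = (nh (mu A / p ^ (t * m)) - y - (1 - p ^ ee) * p ^ j) * p ^ ee / (1 - p ^ ee) / p ^ j"
      unfolding defect_size_def lvj(1) power_add using p by simp
    then show ?thesis unfolding D_def using T[OF A] y lvj(2)
      by (intro image_eqI[of _ _ "(mu A / p ^ (t * m), y, j)"]) auto
  qed
  ultimately show ?thesis by blast
qed

lemma V_insul: "\<exists>h>0. \<forall>t. \<forall>A\<in>P t. insul h (H1 (defect_size t A)) \<and> insul h (H0 - H1 (defect_size t A))"
proof -
  obtain Z where Z: "finite Z" "\<And>t A. A \<in> P t \<Longrightarrow> defect_size t A \<in> Z" using defect_size_finite by blast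
  define Y where "Y = {z\<in>Z. \<exists>t. \<exists>A\<in>P t. z = defect_size t A}"
  have fY: "finite Y" using Z(1) by (simp add: Y_def)
  have "\<forall>z\<in>Y. \<exists>h>0. insul h (H1 z) \<and> insul h (H0 - H1 z)"
  proof
    fix z assume "z \<in> Y"
    then obtain t A where tA: "A \<in> P t" "z = defect_size t A" by (auto simp: Y_def)
    obtain a b where ab: "0 < a" "insul a (H1 z)" "0 < b" "insul b (H0 - H1 z)"
      using H1_defect_size(2,3)[OF tA(1)] tA(2) unfolding insulated_def by blast
    show "\<exists>h>0. insul h (H1 z) \<and> insul h (H0 - H1 z)"
      using ab insul_subset[OF ab(2) insul_sep[OF ab(2)], of "min a b"] insul_subset[OF ab(4) insul_sep[OF ab(4)], of "min a b"]
      by (intro exI[of _ "min a b"]) auto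
  qed
  then obtain g where g: "\<And>z. z \<in> Y \<Longrightarrow> 0 < g z \<and> insul (g z) (H1 z) \<and> insul (g z) (H0 - H1 z)" by metis
  define h where "h = Min (insert 1 (g ` Y))"
  have h: "0 < h" unfolding h_def using fY g by (subst Min_gr_iff) auto
  have hg: "h \<le> g z" if "z \<in> Y" for z unfolding h_def using fY that by (intro Min_le) auto
  have "insul h (H1 (defect_size t A)) \<and> insul h (H0 - H1 (defect_size t A))" if "A \<in> P t" for t A
  proof -
    have "defect_size t A \<in> Y" using Z(2)[OF that] that by (auto simp: Y_def)
    then show ?thesis using g hg insul_subset[OF _ insul_sep] by (meson order_refl)
  qed
  then show ?thesis using h by blast
qed

definition hV :: real where "hV = (SOME h. h > 0 \<and> (\<forall>t. \<forall>A\<in>P t. insul h (H1 (defect_size t A)) \<and> insul h (H0 - H1 (defect_size t A))))"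

lemma hV: "0 < hV" "A \<in> P t \<Longrightarrow> insul hV (H1 (defect_size t A))" "A \<in> P t \<Longrightarrow> insul hV (H0 - H1 (defect_size t A))"
  using someI_ex[OF V_insul] unfolding hV_def by blast+

lemma V_sep:
  assumes A: "A \<in> P t"
  shows "sep (hV * r ^ (j0 + M) * r ^ (t * m)) (V0 t A)" "sep (hV * r ^ (j0 + M) * r ^ (t * m)) (V1 t A)"
proof -
  have le: "hV * r ^ (j0 + M) * r ^ (t * m) \<le> hV * r ^ lv (wd t A)"
    using r_lv_wd[OF A] hV(1) by (simp add: mult.assoc)
  show "sep (hV * r ^ (j0 + M) * r ^ (t * m)) (V0 t A)"
    unfolding V0_def by (rule sep_mono[OF insul_sep[OF insul_sw[OF hV(3)[OF A] wd_valid[OF A]]] le])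
  show "sep (hV * r ^ (j0 + M) * r ^ (t * m)) (V1 t A)"
    unfolding V1_def by (rule sep_mono[OF insul_sep[OF insul_sw[OF hV(2)[OF A] wd_valid[OF A]]] le])
qed

text \<open>The sets \<open>V0\<close> and \<open>V1\<close> that cut an owned piece of level
  \<open>t\<close> were separated at the coarser level \<open>s < t\<close> of the owner. So the
  intersections still have gaps and diameters comparable to \<open>r ^ (t * m)\<close>, and
  \<open>finite_types\<close> applies to them.\<close>

lemma nu_types:
  "\<exists>Phi. finite Phi \<and> Phi \<subseteq> zpolys p \<and> (\<forall>y\<in>Phi. 0 < y) \<and> (\<forall>t. \<forall>A\<in>P t. nu t A / (p ^ m) ^ t \<in> Phi)"
proof -
  define cc where "cc = min gp (hV * r ^ (j0 + M))"
  have cc: "0 < cc" using gp(1) hV(1) r_pow(1) by (simp add: cc_def)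
  define C where "C = max (max 1 dm) (1 / cc)"
  have C: "0 < C" "max 1 dm \<le> C" "1 / C \<le> cc"
  proof -
    show c: "max 1 dm \<le> C" by (simp add: C_def)
    then show c0: "0 < C" by linarith
    have "1 / cc \<le> C" by (simp add: C_def)
    then show "1 / C \<le> cc" using cc c0 by (simp add: field_simps)
  qed
  obtain Q where Q: "finite Q" "\<And>k B. sep (r ^ k / C) B \<Longrightarrow> (\<forall>x\<in>B. \<forall>y\<in>B. dist x y \<le> C * r ^ k) \<Longrightarrow> mu B / p ^ k \<in> Q"
    using finite_types[OF C(1)] by blast
  have ptm: "(p ^ m) ^ t = p ^ (t * m)" for t by (simp add: power_mult[symmetric] mult.commute)
  have cC: "r ^ (t * m) / C \<le> cc * r ^ (t * m)" for t
    using mult_right_mono[OF C(3), of "r ^ (t * m)"] r_pow(1)[of "t * m"] by simp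
  have diam: "dist x y \<le> C * r ^ (t * m)" if "A \<in> P t" "x \<in> A" "y \<in> A" for x y t A
  proof -
    have "max 1 dm * r ^ (t * m) \<le> C * r ^ (t * m)" using C(2) r_pow(1)[of "t * m"] by (intro mult_right_mono) auto
    then show ?thesis using P_diam[OF that] by linarith
  qed
  have sepA: "sep (cc * r ^ (t * m)) A" if "A \<in> P t" for t A
    using r_pow(1)[of "t * m"] by (intro sep_mono[OF P_sep[OF that]] mult_right_mono) (auto simp: cc_def)
  define F where "F = {nu t A / (p ^ m) ^ t | t A. A \<in> P t}"
  have "F \<subseteq> nh ` Q \<union> (\<lambda>(x, y). x / mu G + y / mu G / p ^ ee) ` (Q \<times> Q)"
  proof
    fix z assume "z \<in> F"
    then obtain t A where tA: "A \<in> P t" "z = nu t A / (p ^ m) ^ t" by (auto simp: F_def)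
    show "z \<in> nh ` Q \<union> (\<lambda>(x, y). x / mu G + y / mu G / p ^ ee) ` (Q \<times> Q)"
    proof (cases "A \<in> active t")
      case True
      then have "z = nh (mu A / p ^ (t * m))" using tA(2) p by (simp add: nu_def nominal_def ptm)
      moreover have "mu A / p ^ (t * m) \<in> Q"
        using diam[OF tA(1)] by (intro Q(2) sep_mono[OF sepA[OF tA(1)] cC]) blast
      ultimately show ?thesis by blast
    next
      case False
      then obtain s A0 where s: "s < t" "A0 \<in> active s" "A \<subseteq> R s A0" using active_or_owned[OF tA(1)] by blast
      have inQ: "mu (A \<inter> V) / p ^ (t * m) \<in> Q" if V: "sep (hV * r ^ (j0 + M) * r ^ (s * m)) V" for V
      proof (rule Q(2))
        have "hV * r ^ (j0 + M) * r ^ (t * m) \<le> hV * r ^ (j0 + M) * r ^ (s * m)"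
          using s(1) r hV(1) by (intro mult_left_mono power_decreasing) auto
        moreover have "cc * r ^ (t * m) \<le> hV * r ^ (j0 + M) * r ^ (t * m)"
          using r_pow(1)[of "t * m"] by (intro mult_right_mono) (auto simp: cc_def)
        ultimately have "cc * r ^ (t * m) \<le> hV * r ^ (j0 + M) * r ^ (s * m)" by linarith
        then have "sep (cc * r ^ (t * m)) V" by (rule sep_mono[OF V])
        then show "sep (r ^ (t * m) / C) (A \<inter> V)" using sep_mono[OF sep_Int[OF sepA[OF tA(1)]] cC] by blast
        show "\<forall>x\<in>A \<inter> V. \<forall>y\<in>A \<inter> V. dist x y \<le> C * r ^ (t * m)" using diam[OF tA(1)] by blast
      qed
      have "z = mu (A \<inter> V0 s A0) / p ^ (t * m) / mu G + mu (A \<inter> V1 s A0) / p ^ (t * m) / mu G / p ^ ee"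
        unfolding tA(2) nu_owned[OF s(2) tA(1) s(3,1)] nm_def ptm by (simp add: add_divide_distrib ac_simps)
      then have "z \<in> (\<lambda>(x, y). x / mu G + y / mu G / p ^ ee) ` (Q \<times> Q)"
        using inQ[OF V_sep(1)[OF active_P[OF s(2)]]] inQ[OF V_sep(2)[OF active_P[OF s(2)]]]
        by (intro image_eqI[of _ _ "(mu (A \<inter> V0 s A0) / p ^ (t * m), mu (A \<inter> V1 s A0) / p ^ (t * m))"]) simp_all
      then show ?thesis by (rule UnI2)
    qed
  qed
  then have "finite F" by (rule finite_subset) (use Q(1) in auto)
  moreover have "F \<subseteq> zpolys p \<and> (\<forall>y\<in>F. 0 < y)"
  proof -
    have "z \<in> zpolys p \<and> 0 < z" if "z \<in> F" for z
    proof -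
      obtain t A where tA: "A \<in> P t" "z = nu t A / (p ^ m) ^ t" using \<open>z \<in> F\<close> by (auto simp: F_def)
      have "nu t A \<in> zpolys p \<and> 0 < nu t A"
      proof (cases "A \<in> active t")
        case True
        obtain y where y: "y \<in> zpolys p" "nominal t A = (1 - p ^ ee) * y" using nominal_mult by blast
        then have "nominal t A \<in> zpolys p" using zpolys_mult[OF zpolys_diff[OF zpolys_1 zpolys_power]] by simp
        then show ?thesis using True nominal_pos[OF tA(1)] by (simp add: nu_def)
      next
        case False
        then obtain s A0 where s: "s < t" "A0 \<in> active s" "A \<subseteq> R s A0" using active_or_owned[OF tA(1)] by blast
        note A0 = active_P[OF s(2)]
        have c: "clopen (A \<inter> V0 s A0)" "clopen (A \<inter> V1 s A0)"
          using clopen_Int[OF P_clopen[OF tA(1)]] insulated_clopen V_insulated[OF A0] by blast+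
        have i: "insulated (A \<inter> V0 s A0)" "insulated (A \<inter> V1 s A0)"
          using insulated_subset[OF V_insulated(1)[OF A0] c(1)] insulated_subset[OF V_insulated(2)[OF A0] c(2)] by auto
        have "A \<inter> V0 s A0 \<noteq> {} \<or> A \<inter> V1 s A0 \<noteq> {}" using s(3) V_Un[OF A0] P_ne[OF tA(1)] by blast
        then have "0 < nm (A \<inter> V0 s A0) + nm (A \<inter> V1 s A0) / p ^ ee"
          using nm_pos[OF c(1)] nm_pos[OF c(2)] nm_nonneg[OF c(1)] nm_nonneg[OF c(2)] p_pow(1)[of ee]
          by (metis add_nonneg_pos add_pos_nonneg divide_nonneg_pos divide_pos_pos)
        then show ?thesis unfolding nu_owned[OF s(2) tA(1) s(3,1)]
          using zpolys_add[OF G(3)[OF i(1)] zpolys_div_power[OF G(3)[OF i(2)]]] by blast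
      qed
      then show ?thesis unfolding tA(2) ptm using zpolys_div_power p_pow(1)[of "t * m"] by simp
    qed
    then show ?thesis by blast
  qed
  ultimately show ?thesis by (intro exI[of _ F]) (auto simp: F_def)
qed

lemma piece_tree_nu:
  assumes C: "max 1 dm \<le> C" "1 / gp \<le> C"
  shows "\<exists>Phi. piece_tree E P nu (r ^ m) (p ^ m) C (zpolys p) Phi"
proof -
  obtain Phi where Phi: "finite Phi" "Phi \<subseteq> zpolys p" "\<And>y. y \<in> Phi \<Longrightarrow> 0 < y"
    "\<And>t A. A \<in> P t \<Longrightarrow> nu t A / (p ^ m) ^ t \<in> Phi" using nu_types by blast
  have rtm: "(r ^ m) ^ t = r ^ (t * m)" for t by (simp add: power_mult[symmetric] mult.commute)
  have "piece_tree E P nu (r ^ m) (p ^ m) C (zpolys p) Phi"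
  proof
    show "0 < r ^ m" "0 < p ^ m" using r_pow(1) p_pow(1) by auto
    show "r ^ m < 1" "p ^ m < 1" using r p m by (auto simp: power_less_one_iff)
    show "1 \<le> C" using C(1) by simp
    show "1 / p ^ m \<in> zpolys p" using zpolys_div_power[OF zpolys_1] .
    show "(r ^ m) ^ t \<le> C * dist x y" if AB: "A \<in> P t" "B \<in> P t" "A \<noteq> B" "x \<in> A" "y \<in> B" for t A B x y
    proof -
      have "y \<notin> A" using P_eqI[OF AB(1,2) _ AB(5)] AB(3) by blast
      moreover have "y \<in> E" using P_sub[OF AB(2)] AB(5) by blast
      ultimately have "gp * r ^ (t * m) \<le> dist x y" using sepD[OF P_sep[OF AB(1)] AB(4)] by blast
      moreover have "1 \<le> C * gp" using C(2) gp(1) by (simp add: field_simps)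
      moreover have "0 \<le> C" using C(1) by simp
      ultimately have "C * (gp * r ^ (t * m)) \<le> C * dist x y" "1 * r ^ (t * m) \<le> C * gp * r ^ (t * m)"
        using r_pow(1)[of "t * m"] by (auto intro: mult_left_mono mult_right_mono)
      then have "r ^ (t * m) \<le> C * dist x y" by (simp only: mult.assoc mult_1)
      then show ?thesis by (simp add: rtm)
    qed
    show "dist x y \<le> C * (r ^ m) ^ t" if A: "A \<in> P t" "x \<in> A" "y \<in> A" for t A x y
    proof -
      have "max 1 dm * r ^ (t * m) \<le> C * r ^ (t * m)" using C(1) r_pow(1)[of "t * m"] by (intro mult_right_mono) auto
      then show ?thesis using P_diam[OF A] by (simp add: rtm)
    qed
    show "\<exists>A\<in>P t. B \<subseteq> A" if "B \<in> P (Suc t)" for t B using P_refine[OF _ that, of t] by simp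
    show "nu t A = (\<Sum>B\<in>{B\<in>P (Suc t). B \<subseteq> A}. nu (Suc t) B)" if "A \<in> P t" for t A by (rule nu_split[OF that])
    show "nu t A / (p ^ m) ^ t \<in> Phi" if "A \<in> P t" for t A by (rule Phi(4)[OF that])
    show "0 < y" if "y \<in> Phi" for y by (rule Phi(3)[OF that])
    show "A \<noteq> {}" if "A \<in> P t" for t A by (rule P_ne[OF that])
    show "x + y \<in> zpolys p" if "x \<in> zpolys p" "y \<in> zpolys p" for x y by (rule zpolys_add[OF that])
    show "x * y \<in> zpolys p" if "x \<in> zpolys p" "y \<in> zpolys p" for x y by (rule zpolys_mult[OF that])
  qed (rule zpolys_0 zpolys_1 zpolys_power compact_E E_ne P_0 P_finite P_cover Phi(1) Phi(2))+
  then show ?thesis by blast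
qed

end

section \<open>Carving subsets of prescribed weight\<close>

context fake_measure
begin

lemma nu_on_V:
  assumes A: "A \<in> active s" and B: "B \<in> P t" "s < t"
  shows "B \<subseteq> V0 s A \<Longrightarrow> nu t B = nm B / p ^ 0" "B \<subseteq> V1 s A \<Longrightarrow> nu t B = nm B / p ^ ee"
proof -
  note Un = V_Un[OF active_P[OF A]] and Int = V_Int[OF active_P[OF A]]
  show "nu t B = nm B / p ^ 0" if "B \<subseteq> V0 s A"
  proof -
    have "B \<subseteq> R s A" "B \<inter> V0 s A = B" "B \<inter> V1 s A = {}" using that Un Int by auto
    then show ?thesis using nu_owned[OF A B(1) _ B(2)] by simp
  qed
  show "nu t B = nm B / p ^ ee" if "B \<subseteq> V1 s A"
  proof -
    have "B \<subseteq> R s A" "B \<inter> V1 s A = B" "B \<inter> V0 s A = {}" using that Un Int by auto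
    then show ?thesis using nu_owned[OF A B(1) _ B(2)] by simp
  qed
qed

text \<open>A free piece has such a copy in the \<open>V0\<close> of its own reserved region. A
  piece inside a reserved region contains a cylinder too small to meet both \<open>V0\<close> and
  \<open>V1\<close>. Only levels \<open>t' > t\<close> are claimed, because a region reserved at
  level \<open>t\<close> owns pieces from the next level on.\<close>

lemma faithful_copy:
  "\<exists>j. \<forall>t. \<forall>A\<in>P t. \<exists>u e. valid u \<and> t * m \<le> lv u \<and> lv u \<le> t * m + j \<and> e \<in> {0, ee} \<and> sw u ` G \<subseteq> A \<and>
     (\<forall>t'>t. \<forall>B\<in>P t'. B \<subseteq> sw u ` G \<longrightarrow> nu t' B = nm B / p ^ e)"
proof -
  obtain n1 where n1: "r ^ n1 * dm < hV" using ex_level[OF hV(1)] by blast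
  define hh where "hh = min gp (hV * r ^ (j0 + M))"
  have hh: "0 < hh" using gp(1) hV(1) r_pow(1) by (simp add: hh_def)
  obtain n2 where n2: "r ^ n2 * dm < hh" using ex_level[OF hh] by blast
  define j where "j = j0 + M + n1 + M + n2"
  have "\<exists>u e. valid u \<and> t * m \<le> lv u \<and> lv u \<le> t * m + j \<and> e \<in> {0, ee} \<and> sw u ` G \<subseteq> A \<and>
     (\<forall>t'>t. \<forall>B\<in>P t'. B \<subseteq> sw u ` G \<longrightarrow> nu t' B = nm B / p ^ e)" if A: "A \<in> P t" for t A
  proof (cases "A \<in> active t")
    case True
    obtain v where v: "v \<in> W n1" "cyl v \<subseteq> H0 - H1 (defect_size t A)"
      using contains_cyl[OF insul_sep[OF hV(3)[OF A]] H1_defect_size(5)[OF A] n1] by blast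
    define u where "u = wd t A @ v"
    have u: "valid u" using wd_valid[OF A] W_valid[OF v(1)] by (simp add: u_def)
    have "sw v ` G \<subseteq> cyl v" using insulated_sub_E[OF G(1)] by (rule image_mono)
    then have "sw v ` G \<subseteq> H0 - H1 (defect_size t A)" using v(2) by (rule order_trans)
    then have GV: "sw u ` G \<subseteq> V0 t A" unfolding u_def sw_append_image V0_def by (rule image_mono)
    have "V0 t A \<subseteq> A" using V_Un[OF A] R_sub[OF A] by blast
    moreover have "nu t' B = nm B / p ^ 0" if "t < t'" "B \<in> P t'" "B \<subseteq> sw u ` G" for t' B
      using nu_on_V(1)[OF True that(2,1)] that(3) GV by (meson order_trans)
    moreover have "t * m \<le> lv u" "lv u \<le> t * m + j"
      using lv_wd[OF A] W_lv_less[OF v(1)] by (auto simp: u_def j_def)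
    ultimately show ?thesis using u GV by (intro exI[of _ u] exI[of _ 0] conjI; blast)
  next
    case False
    then obtain s A0 where s: "s < t" "A0 \<in> active s" "A \<subseteq> R s A0" using active_or_owned[OF A] by blast
    note A0 = active_P[OF s(2)]
    have sepA: "sep (hh * r ^ (t * m)) A"
      using r_pow(1)[of "t * m"] by (intro sep_mono[OF P_sep[OF A]] mult_right_mono) (auto simp: hh_def)
    have sepV: "sep (hh * r ^ (t * m)) (V0 s A0)"
    proof (rule sep_mono[OF V_sep(1)[OF A0]])
      have "hh * r ^ (t * m) \<le> hV * r ^ (j0 + M) * r ^ (t * m)"
        using r_pow(1)[of "t * m"] by (intro mult_right_mono) (auto simp: hh_def)
      also have "\<dots> \<le> hV * r ^ (j0 + M) * r ^ (s * m)"
        using s(1) r hV(1) by (intro mult_left_mono power_decreasing) auto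
      finally show "hh * r ^ (t * m) \<le> hV * r ^ (j0 + M) * r ^ (s * m)" .
    qed
    have lev: "r ^ (t * m + n2) * dm < hh * r ^ (t * m)"
      using mult_strict_right_mono[OF n2 r_pow(1)[of "t * m"]] by (simp add: power_add ac_simps)
    obtain u where u: "u \<in> W (t * m + n2)" "cyl u \<subseteq> A" using contains_cyl[OF sepA P_ne[OF A] lev] by blast
    have GE: "sw u ` G \<subseteq> cyl u" using insulated_sub_E[OF G(1)] by (rule image_mono)
    have lvu: "t * m \<le> lv u" "lv u \<le> t * m + j" using W_lv_ge[OF u(1)] W_lv_less[OF u(1)] by (auto simp: j_def)
    have subA: "sw u ` G \<subseteq> A" using GE u(2) by (rule order_trans)
    have "cyl u \<subseteq> V0 s A0 \<or> cyl u \<subseteq> V1 s A0"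
      using cyl_dichotomy[OF sepV lev u(1)] u(2) s(3) V_Un[OF A0] by blast
    then show ?thesis
    proof
      assume "cyl u \<subseteq> V0 s A0"
      then have "sw u ` G \<subseteq> V0 s A0" using GE by (rule order_trans[rotated])
      then have "nu t' B = nm B / p ^ 0" if "t < t'" "B \<in> P t'" "B \<subseteq> sw u ` G" for t' B
        using nu_on_V(1)[OF s(2) that(2)] that(1,3) s(1) by (meson order_trans less_trans)
      then show ?thesis using W_valid[OF u(1)] lvu subA by (intro exI[of _ u] exI[of _ 0]) simp
    next
      assume "cyl u \<subseteq> V1 s A0"
      then have "sw u ` G \<subseteq> V1 s A0" using GE by (rule order_trans[rotated])
      then have "nu t' B = nm B / p ^ ee" if "t < t'" "B \<in> P t'" "B \<subseteq> sw u ` G" for t' B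
        using nu_on_V(2)[OF s(2) that(2)] that(1,3) s(1) by (meson order_trans less_trans)
      then show ?thesis using W_valid[OF u(1)] lvu subA by (intro exI[of _ u] exI[of _ ee]) simp
    qed
  qed
  then show ?thesis by blast
qed

text \<open>The choice depends on the mass alone, so finitely many masses share one insulation
  constant.\<close>

definition H2 :: "real \<Rightarrow> 'a set" where "H2 x = (SOME H. H \<subseteq> G \<and> clopen H \<and> nm H = x)"

lemma H2: "x \<in> zpolys p \<Longrightarrow> 0 < x \<Longrightarrow> x < 1 \<Longrightarrow> H2 x \<subseteq> G \<and> insulated (H2 x) \<and> nm (H2 x) = x"
proof -
  assume x: "x \<in> zpolys p" "0 < x" "x < 1"
  have "H2 x \<subseteq> G \<and> clopen (H2 x) \<and> nm (H2 x) = x"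
    unfolding H2_def by (rule someI_ex) (use split_exact[OF G(1) x(1,2)] x(3) nm_G in auto)
  then show ?thesis using insulated_subset[OF G(1)] by blast
qed

lemma level_m:
  assumes a: "0 < a"
  shows "\<exists>n. b * r ^ (n * m) < a" "\<exists>n. b * p ^ (n * m) < a"
proof -
  have "(\<lambda>n. b * (r ^ m) ^ n) \<longlonglongrightarrow> b * 0" "(\<lambda>n. b * (p ^ m) ^ n) \<longlonglongrightarrow> b * 0"
    using r p m by (intro tendsto_mult tendsto_const LIMSEQ_power_zero; simp add: power_less_one_iff)+
  then have "eventually (\<lambda>n. b * (r ^ m) ^ n < a) sequentially" "eventually (\<lambda>n. b * (p ^ m) ^ n < a) sequentially"
    using a by (auto intro: order_tendstoD(2))
  then show "\<exists>n. b * r ^ (n * m) < a" "\<exists>n. b * p ^ (n * m) < a"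
    by (auto simp: eventually_sequentially power_mult[symmetric] mult.commute[of m])
qed

text \<open>The scheme of \<open>split_small\<close> with \<open>nu\<close> in place of
  \<open>nm\<close>: pieces outside a faithful copy \<open>S\<close> of \<open>G\<close> are taken
  greedily, and the remainder is cut exactly out of \<open>S\<close>, where \<open>nu\<close> is
  proportional to \<open>nm\<close>. The relative sizes of the remainder form the finite set
  \<open>Xs\<close>, so the sets \<open>H2 x\<close> have a common gap and the depth
  \<open>k\<close> depends on neither \<open>t\<close> nor \<open>U\<close>.\<close>

lemma carve_one:
  assumes PT: "piece_tree E P nu (r ^ m) (p ^ m) C (zpolys p) Phi"
    and b: "b \<in> zpolys p" "b' \<in> zpolys p" "0 < b" "0 < b'"
  shows "\<exists>k. \<forall>t U. U \<in> piece_tree.PS E P t \<longrightarrow> piece_tree.vs P nu t U = (p ^ m) ^ t * (b + b') \<longrightarrow>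
        (\<exists>Y\<in>piece_tree.PS E P (t + k). Y \<subseteq> U \<and> piece_tree.vs P nu (t + k) Y = (p ^ m) ^ t * b)"
proof -
  interpret PT: piece_tree E P nu "r ^ m" "p ^ m" C "zpolys p" Phi by (rule PT)
  have ptm: "(p ^ m) ^ t = p ^ (t * m)" for t by (simp add: power_mult[symmetric] mult.commute)
  obtain j where j': "\<forall>t. \<forall>A\<in>P t. \<exists>u e. valid u \<and> t * m \<le> lv u \<and> lv u \<le> t * m + j \<and> e \<in> {0, ee} \<and> sw u ` G \<subseteq> A \<and>
     (\<forall>t'>t. \<forall>B\<in>P t'. B \<subseteq> sw u ` G \<longrightarrow> nu t' B = nm B / p ^ e)" using faithful_copy by (elim exE) (rule that)
  note j = j'[rule_format]
  have PS_I: "B \<in> PT.PS t" if B: "sep h B" "gp * r ^ (t * m) < h" "0 < t" for h B t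
    unfolding PT.PS_def mem_Collect_eq using sep_sub[OF B(1)] P_dichotomy[OF B] by simp
  obtain hG where hG: "0 < hG" "insul hG G" using G(1) unfolding insulated_def by blast
  have Phi_ne: "Phi \<noteq> {}" using PT.nu_Phi[of E 0] PT.P_0 by blast
  define pmin where "pmin = Min Phi"
  define pmax where "pmax = Max Phi"
  have pmm: "0 < pmin" "\<And>x. x \<in> Phi \<Longrightarrow> pmin \<le> x" "\<And>x. x \<in> Phi \<Longrightarrow> x \<le> pmax"
    using PT.Phi_pos[OF Min_in[OF PT.fin_Phi Phi_ne]] PT.fin_Phi by (auto simp: pmin_def pmax_def)
  \<comment> \<open>Two demands on \<open>n\<close>: at level \<open>t + n\<close> the copy
    \<open>S\<close> is a union of pieces (\<open>n1\<close>), and every piece is lighter than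
    \<open>S\<close> (\<open>n2\<close>), so that a greedy remainder fits into
    \<open>S\<close>.\<close>
  obtain n1 where n1: "gp * r ^ (n1 * m) < hG * r ^ j" using level_m(1)[of "hG * r ^ j" gp] hG(1) r_pow(1) by auto
  obtain n2 where n2: "pmax * p ^ (n2 * m) < p ^ j" using level_m(2)[OF p_pow(1), of pmax j] by blast
  define n where "n = Suc (n1 + n2)"
  have n1': "gp * r ^ (n * m) < hG * r ^ j"
  proof -
    have "gp * r ^ (n * m) \<le> gp * r ^ (n1 * m)" using gp(1) r by (intro mult_left_mono power_decreasing) (auto simp: n_def add_mult_distrib)
    then show ?thesis using n1 by linarith
  qed
  have pmax0: "0 < pmax" using pmm Phi_ne by fastforce
  have n2': "pmax * p ^ (n * m) < p ^ j"
  proof -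
    have "pmax * p ^ (n * m) \<le> pmax * p ^ (n2 * m)" using pmax0 p by (intro mult_left_mono power_decreasing) (auto simp: n_def add_mult_distrib)
    then show ?thesis using n2 by linarith
  qed
  define N0 where "N0 = nat \<lceil>(b + b') / (pmin * p ^ (n * m))\<rceil>"
  \<comment> \<open>Here \<open>y\<close> stands for the weight of the pieces taken, relative to
    \<open>p ^ (t * m)\<close>, \<open>i\<close> for \<open>lv u - t * m\<close>, and
    \<open>e\<close> for the exponent of the faithful copy.\<close>
  define Xs where "Xs = {x \<in> (\<lambda>(y, i, e). (b - y) * p ^ e / p ^ i) ` (bounded_sums ((\<lambda>x. x * p ^ (n * m)) ` Phi) N0 \<times> {..j} \<times> {0, ee}).
      x \<in> zpolys p \<and> 0 < x \<and> x < 1}"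
  have fXs: "finite Xs" unfolding Xs_def using PT.fin_Phi finite_bounded_sums by simp
  have "\<forall>x\<in>Xs. \<exists>h>0. insul h (H2 x)" using H2 unfolding Xs_def insulated_def by blast
  then obtain g where g: "\<And>x. x \<in> Xs \<Longrightarrow> 0 < g x \<and> insul (g x) (H2 x)" by metis
  define h2 where "h2 = Min (insert 1 (g ` Xs))"
  have h2: "0 < h2" unfolding h2_def using fXs g by (subst Min_gr_iff) auto
  have h2g: "h2 \<le> g x" if "x \<in> Xs" for x unfolding h2_def using fXs that by (intro Min_le) auto
  obtain n3 where n3: "gp * r ^ (n3 * m) < h2 * r ^ j" using level_m(1)[of "h2 * r ^ j" gp] h2 r_pow(1) by auto
  define k where "k = n + n3"
  have n3': "gp * r ^ (k * m) < h2 * r ^ j"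
  proof -
    have "gp * r ^ (k * m) \<le> gp * r ^ (n3 * m)" using gp(1) r by (intro mult_left_mono power_decreasing) (auto simp: k_def add_mult_distrib)
    then show ?thesis using n3 by linarith
  qed
  have "\<exists>Y\<in>PT.PS (t + k). Y \<subseteq> U \<and> PT.vs (t + k) Y = (p ^ m) ^ t * b"
    if U: "U \<in> PT.PS t" and vU: "PT.vs t U = (p ^ m) ^ t * (b + b')" for t U
  proof -
    have p0: "0 < p ^ (t * m)" by (rule p_pow)
    have "U \<noteq> {}"
    proof
      assume "U = {}"
      then have "PT.vs t U = 0" using P_ne by (force simp: PT.vs_def intro: sum.neutral)
      then show False using vU b p p0 by (simp add: ptm)
    qed
    then obtain x where "x \<in> U" by blast
    then have "x \<in> \<Union>{D\<in>P t. D \<subseteq> U}" using PT.PS_eq_Union[OF U] by simp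
    then obtain A where A: "A \<in> P t" "A \<subseteq> U" by blast
    obtain u e where u: "valid u" "t * m \<le> lv u" "lv u \<le> t * m + j" and e: "e \<in> {0, ee}" and GA: "sw u ` G \<subseteq> A"
      and nuG': "\<forall>t'>t. \<forall>B\<in>P t'. B \<subseteq> sw u ` G \<longrightarrow> nu t' B = nm B / p ^ e"
      using j[OF A(1)] by (elim exE conjE) (rule that; assumption)
    note nuG = nuG'[rule_format]
    have vs_prop: "PT.vs t' B = nm B / p ^ e" if B: "B \<in> PT.PS t'" "B \<subseteq> sw u ` G" "t < t'" for t' B
    proof -
      have "PT.vs t' B = (\<Sum>D\<in>{D\<in>P t'. D \<subseteq> B}. nm D / p ^ e)"
        unfolding PT.vs_def using nuG[OF B(3)] B(2) by (intro sum.cong) auto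
      also have "\<dots> = (\<Sum>D\<in>{D\<in>P t'. D \<subseteq> B}. nm D) / p ^ e" by (simp add: sum_divide_distrib)
      also have "(\<Sum>D\<in>{D\<in>P t'. D \<subseteq> B}. nm D) = nm (\<Union>D\<in>{D\<in>P t'. D \<subseteq> B}. D)"
        using P_finite P_clopen P_disjoint_family[of "{D\<in>P t'. D \<subseteq> B}" t'] by (intro nm_UN[symmetric]) auto
      also have "(\<Union>D\<in>{D\<in>P t'. D \<subseteq> B}. D) = B" using PT.PS_eq_Union[OF B(1)] by simp
      finally show ?thesis .
    qed
    have rl: "r ^ j * r ^ (t * m) \<le> r ^ lv u"
    proof -
      have "r ^ (t * m + j) \<le> r ^ lv u" using u(3) r by (intro power_decreasing) auto
      then show ?thesis by (simp add: power_add mult.commute)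
    qed
    have pl: "p ^ j * p ^ (t * m) \<le> p ^ lv u"
    proof -
      have "p ^ (t * m + j) \<le> p ^ lv u" using u(3) p by (intro power_decreasing) auto
      then show ?thesis by (simp add: power_add mult.commute)
    qed
    define s where "s = t + n"
    have s: "t < s" "t \<le> s" "0 < s" by (auto simp: s_def n_def)
    define S where "S = sw u ` G"
    have S_PS: "S \<in> PT.PS s"
    proof (rule PS_I[OF _ _ s(3)])
      show "sep (hG * r ^ lv u) S" unfolding S_def using insul_sep[OF insul_sw[OF hG(2) u(1)]] .
      have "gp * r ^ (s * m) = gp * r ^ (n * m) * r ^ (t * m)" by (simp add: s_def algebra_simps power_add)
      also have "\<dots> < hG * r ^ j * r ^ (t * m)" using n1' r_pow(1) by (intro mult_strict_right_mono) auto
      also have "\<dots> \<le> hG * r ^ lv u" using rl hG(1) by (simp add: mult.assoc)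
      finally show "gp * r ^ (s * m) < hG * r ^ lv u" .
    qed
    have SU: "S \<subseteq> U" using GA A(2) by (auto simp: S_def)
    have vS: "PT.vs s S = p ^ lv u / p ^ e"
      using vs_prop[OF S_PS _ s(1)] nm_sw[OF G(1) u(1)] nm_G by (simp add: S_def)
    have U_s: "U \<in> PT.PS s" using PT.PS_mono[OF U s(2)] .
    have vU_s: "PT.vs s U = p ^ (t * m) * (b + b')" using PT.vs_mono_level[OF U s(2)] vU by (simp add: ptm)
    define Q where "Q = {D\<in>P s. D \<subseteq> U - S}"
    have fQ: "finite Q" "Q \<subseteq> P s" using P_finite by (auto simp: Q_def)
    have US_PS: "U - S \<in> PT.PS s" using PT.PS_Diff[OF U_s S_PS] .
    have sumQ: "sum (nu s) Q = p ^ (t * m) * (b + b') - PT.vs s S"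
      using PT.vs_Diff[OF U_s S_PS SU] vU_s unfolding PT.vs_def[of s "U - S"] Q_def by simp
    have sm: "p ^ (s * m) = p ^ (n * m) * p ^ (t * m)" by (simp add: s_def algebra_simps power_add)
    have nu_bd: "pmin * p ^ (s * m) \<le> nu s D" "nu s D \<le> pmax * p ^ (s * m)" if "D \<in> Q" for D
      using pmm(2,3)[OF PT.nu_Phi[of D s]] that fQ(2) p_pow(1)[of "s * m"] by (auto simp: ptm field_simps)
    have step: "pmax * p ^ (s * m) < PT.vs s S"
    proof -
      have "pmax * p ^ (s * m) = pmax * p ^ (n * m) * p ^ (t * m)" by (simp add: sm)
      also have "\<dots> < p ^ j * p ^ (t * m)" using n2' p0 by (intro mult_strict_right_mono) auto
      also have "\<dots> \<le> p ^ lv u" by (rule pl)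
      also have "\<dots> \<le> p ^ lv u / p ^ e" using p_pow(1)[of "lv u"] p_pow(1,2)[of e] by (simp add: le_divide_eq_1 pos_le_divide_eq mult_left_le)
      finally show ?thesis using vS by simp
    qed
    have y0: "0 < p ^ (t * m) * b" using p0 b by simp
    have "\<exists>Q'\<subseteq>Q. 0 < p ^ (t * m) * b - sum (nu s) Q' \<and> p ^ (t * m) * b - sum (nu s) Q' < PT.vs s S"
    proof (cases "p ^ (t * m) * b \<le> sum (nu s) Q")
      case True
      from greedy_subset[OF fQ(1) nu_bd(2) y0 True] obtain Q' where
        "Q' \<subseteq> Q" "0 < p ^ (t * m) * b - sum (nu s) Q'" "p ^ (t * m) * b - sum (nu s) Q' \<le> pmax * p ^ (s * m)" by blast
      then show ?thesis using step by (intro exI[of _ Q']) linarith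
    next
      case False
      \<comment> \<open>All pieces outside \<open>S\<close> together are too light. What is missing
        is the weight of \<open>S\<close> less \<open>p ^ (t * m) * b'\<close>, which stays below
        the weight of \<open>S\<close> because \<open>b'\<close> is positive.\<close>
      have "p ^ (t * m) * b - sum (nu s) Q = PT.vs s S - p ^ (t * m) * b'" using sumQ by (simp add: algebra_simps)
      moreover have "0 < p ^ (t * m) * b'" using p0 b by simp
      ultimately show ?thesis using False by (intro exI[of _ Q]) simp
    qed
    then obtain Q' where Q': "Q' \<subseteq> Q" "0 < p ^ (t * m) * b - sum (nu s) Q'" "p ^ (t * m) * b - sum (nu s) Q' < PT.vs s S" by blast
    have Q'P: "Q' \<subseteq> P s" using Q'(1) fQ(2) by blast
    have fQ': "finite Q'" using finite_subset[OF Q'(1) fQ(1)] .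
    define x where "x = (p ^ (t * m) * b - sum (nu s) Q') * p ^ e / p ^ lv u"
    have x01: "0 < x" "x < 1"
    proof -
      show "0 < x" unfolding x_def using Q'(2) p_pow(1) by simp
      have "(p ^ (t * m) * b - sum (nu s) Q') * p ^ e < p ^ lv u"
        using Q'(3) vS p_pow(1)[of e] by (simp add: pos_less_divide_eq)
      then show "x < 1" unfolding x_def using p_pow(1)[of "lv u"] by simp
    qed
    have nuZ: "nu s D \<in> zpolys p" if "D \<in> P s" for D
    proof -
      have "nu s D / (p ^ m) ^ s \<in> zpolys p" using PT.nu_Phi[OF that] PT.Phi_Z by blast
      then have "nu s D / (p ^ m) ^ s * p ^ (s * m) \<in> zpolys p" using zpolys_mult zpolys_power by blast
      then show ?thesis using p p_pow(3)[of "s * m"] by (simp add: ptm)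
    qed
    have "p ^ (t * m) * b - sum (nu s) Q' \<in> zpolys p"
      using Q'P nuZ by (intro zpolys_diff zpolys_mult zpolys_power zpolys_sum b(1)) auto
    then have xZ: "x \<in> zpolys p" unfolding x_def using zpolys_div_power zpolys_mult zpolys_power by blast
    have "x \<in> (\<lambda>(y, i, e). (b - y) * p ^ e / p ^ i) ` (bounded_sums ((\<lambda>x. x * p ^ (n * m)) ` Phi) N0 \<times> {..j} \<times> {0, ee})"
    proof (rule image_eqI)
      let ?y = "\<Sum>D\<in>Q'. nu s D / p ^ (t * m)"
      have lvu: "lv u = t * m + (lv u - t * m)" using u(2) by simp
      have "p ^ (t * m) * b - sum (nu s) Q' = p ^ (t * m) * (b - ?y)"
        using p p_pow(3)[of "t * m"] by (simp add: right_diff_distrib sum_divide_distrib[symmetric])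
      then have "x = p ^ (t * m) * (b - ?y) * p ^ e / (p ^ (t * m) * p ^ (lv u - t * m))"
        unfolding x_def power_add[symmetric] using lvu by simp
      then show "x = (case (?y, lv u - t * m, e) of (y, i, e) \<Rightarrow> (b - y) * p ^ e / p ^ i)"
        using p p_pow(3)[of "t * m"] by simp
      have card: "card Q' \<le> N0"
      proof -
        have "real (card Q') * (pmin * p ^ (s * m)) = (\<Sum>D\<in>Q'. pmin * p ^ (s * m))" by simp
        also have "\<dots> \<le> sum (nu s) Q'" using nu_bd(1) Q'(1) by (intro sum_mono) blast
        also have "\<dots> \<le> p ^ (t * m) * (b + b')"
        proof -
          have "0 < p ^ (t * m) * b'" using p0 b by simp
          then show ?thesis using Q'(2) by (simp add: distrib_left)
        qed
        finally have "(real (card Q') * (pmin * p ^ (n * m))) * p ^ (t * m) \<le> (b + b') * p ^ (t * m)"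
          unfolding sm by (simp only: ac_simps)
        then have "real (card Q') * (pmin * p ^ (n * m)) \<le> b + b'" using p0 by (rule mult_right_le_imp_le)
        then have "real (card Q') \<le> (b + b') / (pmin * p ^ (n * m))"
          using pmm(1) p_pow(1)[of "n * m"] by (simp add: pos_le_divide_eq)
        then show ?thesis unfolding N0_def by linarith
      qed
      have "?y \<in> bounded_sums ((\<lambda>x. x * p ^ (n * m)) ` Phi) N0"
      proof (rule sum_in_bounded_sums[OF fQ' card])
        show "(\<lambda>D. nu s D / p ^ (t * m)) ` Q' \<subseteq> (\<lambda>x. x * p ^ (n * m)) ` Phi"
        proof
          fix y assume "y \<in> (\<lambda>D. nu s D / p ^ (t * m)) ` Q'"
          then obtain D where D: "D \<in> P s" "y = nu s D / p ^ (t * m)" using Q'P by blast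
          have "y = nu s D / (p ^ m) ^ s * p ^ (n * m)" unfolding D(2) ptm sm using p p_pow(3)[of "n * m"] by simp
          then show "y \<in> (\<lambda>x. x * p ^ (n * m)) ` Phi" using PT.nu_Phi[OF D(1)] by blast
        qed
      qed
      then show "(?y, lv u - t * m, e) \<in> bounded_sums ((\<lambda>x. x * p ^ (n * m)) ` Phi) N0 \<times> {..j} \<times> {0, ee}"
        using u(3) e by auto
    qed
    then have xX: "x \<in> Xs" unfolding Xs_def using xZ x01 by blast
    define H where "H = sw u ` H2 x"
    note h2x = H2[OF xZ x01]
    have HS: "H \<subseteq> S" unfolding H_def S_def using h2x by blast
    have sk: "s \<le> t + k" "0 < t + k" "t < t + k" by (auto simp: s_def k_def n_def)
    have H_PS: "H \<in> PT.PS (t + k)"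
    proof (rule PS_I[OF _ _ sk(2)])
      have "insul h2 (H2 x)" using insul_subset[OF _ insul_sep] g[OF xX] h2g[OF xX] by (meson order_refl)
      then show "sep (h2 * r ^ lv u) H" unfolding H_def using insul_sep[OF insul_sw[OF _ u(1)]] by blast
      have "gp * r ^ ((t + k) * m) = gp * r ^ (k * m) * r ^ (t * m)" by (simp add: algebra_simps power_add)
      also have "\<dots> < h2 * r ^ j * r ^ (t * m)" using n3' r_pow(1) by (intro mult_strict_right_mono) auto
      also have "\<dots> \<le> h2 * r ^ lv u" using rl h2 by (simp add: mult.assoc)
      finally show "gp * r ^ ((t + k) * m) < h2 * r ^ lv u" .
    qed
    have vH: "PT.vs (t + k) H = p ^ (t * m) * b - sum (nu s) Q'"
    proof -
      have "PT.vs (t + k) H = nm H / p ^ e" using vs_prop[OF H_PS _ sk(3)] HS by (simp add: S_def)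
      also have "nm H = p ^ lv u * x" unfolding H_def using nm_sw[OF _ u(1)] h2x by simp
      finally show ?thesis unfolding x_def using p p_pow(3)[of e] p_pow(3)[of "lv u"] by simp
    qed
    have UQ: "\<Union>Q' \<in> PT.PS s" "PT.vs s (\<Union>Q') = sum (nu s) Q'" using PT.PS_Union[OF Q'P] PT.vs_Union[OF Q'P] by auto
    have UQk: "\<Union>Q' \<in> PT.PS (t + k)" "PT.vs (t + k) (\<Union>Q') = sum (nu s) Q'"
      using PT.PS_mono[OF UQ(1) sk(1)] PT.vs_mono_level[OF UQ(1) sk(1)] UQ(2) by auto
    have QUS: "\<Union>Q' \<subseteq> U - S" using Q'(1) unfolding Q_def by blast
    have "PT.vs (t + k) (\<Union>Q' \<union> H) = PT.vs (t + k) (\<Union>Q') + PT.vs (t + k) H"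
      using QUS HS by (intro PT.vs_Un UQk H_PS) blast
    also have "\<dots> = (p ^ m) ^ t * b" using UQk(2) vH by (simp add: ptm)
    finally show ?thesis using PT.PS_Un[OF UQk(1) H_PS] QUS HS SU by (intro bexI[of _ "\<Union>Q' \<union> H"]) blast
  qed
  then show ?thesis by blast
qed

lemma rich_piece_tree_nu:
  assumes C: "max 1 dm \<le> C" "1 / gp \<le> C"
  shows "\<exists>Phi. rich_piece_tree E P nu (r ^ m) (p ^ m) C (zpolys p) Phi"
proof -
  obtain Phi where PT: "piece_tree E P nu (r ^ m) (p ^ m) C (zpolys p) Phi" using piece_tree_nu[OF C] by blast
  have "rich_piece_tree E P nu (r ^ m) (p ^ m) C (zpolys p) Phi"
    by (rule rich_piece_tree.intro[OF PT]) (unfold_locales, rule carve_one[OF PT])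
  then show ?thesis by blast
qed

lemma nu_total: "nu 0 E = nh 1"
  by (simp add: nu_def nominal_def mu_E)

end

section \<open>Common parameters for two attractors\<close>

definition near_multiple :: "real \<Rightarrow> real \<Rightarrow> nat \<Rightarrow> real \<Rightarrow> (real \<Rightarrow> real) \<Rightarrow> bool" where
  "near_multiple p kap ee eps nh \<longleftrightarrow>
    (\<forall>a>0. kap * a \<le> nh a \<and> nh a \<le> kap * a + eps) \<and> (\<forall>a. \<exists>z\<in>zpolys p. nh a = (1 - p ^ ee) * z)"

definition tree_with_total :: "'a::euclidean_space set \<Rightarrow> real \<Rightarrow> real \<Rightarrow> nat \<Rightarrow> real \<Rightarrow> real \<Rightarrow> bool" where
  "tree_with_total E r p m C T \<longleftrightarrow>
    (\<exists>P nu Phi. rich_piece_tree E P nu (r ^ m) (p ^ m) C (zpolys p) Phi \<and> nu 0 E = T)"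

text \<open>Multiples of \<open>1 - p ^ ee\<close> are dense because Z[p] is. No attractor enters,
  so one \<open>nh\<close> can serve two of them.\<close>

lemma near_multiple_exists:
  assumes p: "0 < p" "p < 1" and ee: "0 < ee" and eps: "0 < eps"
  shows "\<exists>nh. near_multiple p kap ee eps nh"
proof -
  have q: "0 < 1 - p ^ ee" using p ee by (simp add: power_less_one_iff)
  have "\<exists>z\<in>zpolys p. kap * a / (1 - p ^ ee) < z \<and> z < (kap * a + eps) / (1 - p ^ ee)" for a
    using q eps by (intro zpolys_dense[OF p] divide_strict_right_mono) auto
  then obtain z where z: "\<And>a. z a \<in> zpolys p \<and> kap * a / (1 - p ^ ee) < z a \<and> z a < (kap * a + eps) / (1 - p ^ ee)"
    by metis
  have "kap * a < (1 - p ^ ee) * z a \<and> (1 - p ^ ee) * z a < kap * a + eps" for a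
    using z[of a] q by (simp add: pos_divide_less_eq pos_less_divide_eq mult.commute)
  then show ?thesis using z unfolding near_multiple_def
    by (intro exI[of _ "\<lambda>a. (1 - p ^ ee) * z a"]) (auto intro: less_imp_le)
qed

context pid_attractor
begin

lemma type_bounds:
  "\<exists>amin amax. 0 < amin \<and> amin \<le> 1 \<and> 1 \<le> amax \<and> (\<forall>k A. A \<in> Pk k \<longrightarrow> amin * p ^ k \<le> mu A \<and> mu A \<le> amax * p ^ k)"
proof -
  obtain Phi where Phi: "finite Phi" "\<And>k A. A \<in> Pk k \<Longrightarrow> nm A / p ^ k \<in> Phi" using Pk_types by blast
  define Psi where "Psi = insert 1 ((\<lambda>x. x * mu G) ` {x\<in>Phi. 0 < x})"
  have Psi: "finite Psi" "Psi \<noteq> {}" "1 \<in> Psi" "\<And>x. x \<in> Psi \<Longrightarrow> 0 < x" using Phi(1) G(2) by (auto simp: Psi_def)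
  have "Min Psi * p ^ k \<le> mu A \<and> mu A \<le> Max Psi * p ^ k" if A: "A \<in> Pk k" for k A
  proof -
    have "0 < nm A / p ^ k" using nm_pos[OF clopen_Pk[OF A] Pk_ne[OF A]] p_pow(1) by simp
    then have "nm A / p ^ k * mu G \<in> Psi" unfolding Psi_def using Phi(2)[OF A] by blast
    moreover have "nm A / p ^ k * mu G = mu A / p ^ k" using G(2) by (simp add: nm_def)
    ultimately have "mu A / p ^ k \<in> Psi" by (simp only:)
    then have "Min Psi \<le> mu A / p ^ k" "mu A / p ^ k \<le> Max Psi" by (rule Min_le[OF Psi(1)], rule Max_ge[OF Psi(1)])
    then show ?thesis using p_pow(1)[of k] by (simp add: pos_le_divide_eq pos_divide_le_eq)
  qed
  moreover have "0 < Min Psi" "Min Psi \<le> 1" "1 \<le> Max Psi" using Psi by auto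
  ultimately show ?thesis by blast
qed

text \<open>Each parameter is bounded in terms of the preceding ones, by bounds that depend on the
  attractor. The nested filters record this order, so that the statements for two attractors can be
  merged one parameter at a time by \<open>eventually_conj\<close>. The rounding \<open>nh\<close>
  is universally quantified because both attractors must use the same one.\<close>

lemma eventually_tree_with_total:
  "\<forall>\<^sub>F kap in at_top. \<forall>\<^sub>F ee in sequentially. \<forall>\<^sub>F eps in at_right 0. \<forall>\<^sub>F m in sequentially.
    \<forall>nh. near_multiple p kap ee eps nh \<longrightarrow> (\<forall>\<^sub>F C in at_top. tree_with_total E r p m C (nh 1))"
proof -
  obtain amin amax where a: "0 < amin" "amin \<le> 1" "1 \<le> amax"
    and types: "\<And>k A. A \<in> Pk k \<Longrightarrow> amin * p ^ k \<le> mu A \<and> mu A \<le> amax * p ^ k"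
    using type_bounds by blast
  have lev: "\<exists>n. x * b ^ n < y" if "0 < y" "0 < b" "b < 1" for x y b :: real
  proof -
    have "(\<lambda>n. x * b ^ n) \<longlonglongrightarrow> x * 0" using that by (intro tendsto_mult tendsto_const LIMSEQ_power_zero) auto
    then have "eventually (\<lambda>n. x * b ^ n < y) sequentially" using that by (auto intro: order_tendstoD(2))
    then show ?thesis by (auto simp: eventually_sequentially)
  qed
  have pjm: "0 < p ^ (j0 + M)" by (rule p_pow)
  show ?thesis
  proof (rule eventually_at_top_linorderI[of "2 / mu G"])
    fix kap assume kap: "2 / mu G \<le> kap"
    have kap0: "0 < kap" using kap G(2) by (meson divide_pos_pos less_le_trans zero_less_numeral)
    obtain n1 where n1: "1 * p ^ n1 < 1 / 2" using lev[of "1 / 2" p 1] p by auto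
    obtain n2 where n2: "(kap * amax + 1) * p ^ n2 < p ^ (j0 + M) / 4" using lev[of "p ^ (j0 + M) / 4" p] p pjm by auto
    show "\<forall>\<^sub>F ee in sequentially. \<forall>\<^sub>F eps in at_right 0. \<forall>\<^sub>F m in sequentially.
      \<forall>nh. near_multiple p kap ee eps nh \<longrightarrow> (\<forall>\<^sub>F C in at_top. tree_with_total E r p m C (nh 1))"
    proof (rule eventually_sequentiallyI[of "n1 + n2"])
      fix ee assume ee: "n1 + n2 \<le> ee"
      have "p ^ ee \<le> p ^ n1" using ee p by (intro power_decreasing) auto
      then have e1: "p ^ ee \<le> 1 / 2" using n1 by simp
      have "(kap * amax + 1) * p ^ ee \<le> (kap * amax + 1) * p ^ n2"
        using ee p kap0 a by (intro mult_left_mono power_decreasing) auto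
      then have e2: "(kap * amax + 1) * p ^ ee < p ^ (j0 + M) / 4" using n2 by linarith
      have "1 - p ^ ee \<in> zpolys p" "0 < 1 - p ^ ee" "1 - p ^ ee < nm G"
        using zpolys_diff[OF zpolys_1 zpolys_power] e1 p_pow(1)[of ee] by (auto simp: nm_G)
      then obtain H0 where H0: "H0 \<subseteq> G" "clopen H0" "nm H0 = 1 - p ^ ee" using split_exact[OF G(1)] by blast
      obtain h0 where h0: "0 < h0" "insul h0 H0" using insulated_subset[OF G(1) H0(2,1)] unfolding insulated_def by blast
      define eps0 where "eps0 = min 1 (p ^ (j0 + M) / 4 * (amin / amax))"
      have eps0: "0 < eps0" using pjm a by (simp add: eps0_def)
      show "\<forall>\<^sub>F eps in at_right 0. \<forall>\<^sub>F m in sequentially.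
        \<forall>nh. near_multiple p kap ee eps nh \<longrightarrow> (\<forall>\<^sub>F C in at_top. tree_with_total E r p m C (nh 1))"
      proof (rule eventually_at_rightI[OF _ eps0])
        fix eps assume "eps \<in> {0<..<eps0}"
        then have eps: "0 < eps" "eps \<le> eps0" by auto
        have "eps * (amax / amin) \<le> p ^ (j0 + M) / 4 * (amin / amax) * (amax / amin)"
          using eps a by (intro mult_right_mono) (auto simp: eps0_def)
        also have "\<dots> = p ^ (j0 + M) / 4" using a by simp
        finally have eps1: "eps * (amax / amin) < p ^ (j0 + M) / 2" using pjm by linarith
        have "(kap * amax + eps) * p ^ ee \<le> (kap * amax + 1) * p ^ ee"
          using eps p_pow(1)[of ee] by (intro mult_right_mono) (auto simp: eps0_def)
        then have eps2: "(kap * amax + eps) * p ^ ee < p ^ (j0 + M) / 4" using e2 by linarith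
        obtain n3 where n3: "gp * r ^ n3 < h0 * r ^ (j0 + M)" using lev[of "h0 * r ^ (j0 + M)" r gp] r h0(1) by auto
        show "\<forall>\<^sub>F m in sequentially.
          \<forall>nh. near_multiple p kap ee eps nh \<longrightarrow> (\<forall>\<^sub>F C in at_top. tree_with_total E r p m C (nh 1))"
        proof (rule eventually_sequentiallyI[of "Suc n3"], intro allI impI)
          fix m nh
          assume m: "Suc n3 \<le> m" and nh: "near_multiple p kap ee eps nh"
          have "gp * r ^ m \<le> gp * r ^ n3" using m r gp(1) by (intro mult_left_mono power_decreasing) auto
          then have m1: "gp * r ^ m < h0 * r ^ (j0 + M)" using n3 by linarith
          interpret F: fake_measure N l p f r E V m ee kap eps nh H0 h0 amin amax
            by unfold_locales (use m e1 kap eps nh[unfolded near_multiple_def] a types H0 h0 m1 eps1 eps2 in \<open>simp_all\<close>)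
          show "\<forall>\<^sub>F C in at_top. tree_with_total E r p m C (nh 1)"
          proof (rule eventually_at_top_linorderI[of "max (max 1 dm) (1 / gp)"])
            fix C assume "max (max 1 dm) (1 / gp) \<le> C"
            then have "max 1 dm \<le> C" "1 / gp \<le> C" by auto
            from F.rich_piece_tree_nu[OF this] obtain Phi where "rich_piece_tree E F.P F.nu (r ^ m) (p ^ m) C (zpolys p) Phi" ..
            then show "tree_with_total E r p m C (nh 1)"
              unfolding tree_with_total_def using F.nu_total by blast
          qed
        qed
      qed
    qed
  qed
qed

end

lemma pid_attractors_lipschitz_equivalent:
  fixes A :: "'a::euclidean_space set" and B :: "'b::euclidean_space set"
  assumes A: "pid_attractor N l p f r A V" and B: "pid_attractor N' l' p f' r B V'"
  shows "lipschitz_equivalent A B"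
proof -
  interpret A: pid_attractor N l p f r A V by (rule A)
  interpret B: pid_attractor N' l' p f' r B V' by (rule B)
  obtain kap where kap: "\<forall>\<^sub>F ee in sequentially. \<forall>\<^sub>F eps in at_right 0. \<forall>\<^sub>F m in sequentially.
      \<forall>nh. near_multiple p kap ee eps nh \<longrightarrow> (\<forall>\<^sub>F C in at_top. tree_with_total A r p m C (nh 1))"
    "\<forall>\<^sub>F ee in sequentially. \<forall>\<^sub>F eps in at_right 0. \<forall>\<^sub>F m in sequentially.
      \<forall>nh. near_multiple p kap ee eps nh \<longrightarrow> (\<forall>\<^sub>F C in at_top. tree_with_total B r p m C (nh 1))"
    using eventually_happens'[OF _ eventually_conj[OF A.eventually_tree_with_total B.eventually_tree_with_total]] by auto
  obtain ee where ee: "0 < ee" "\<forall>\<^sub>F eps in at_right 0. \<forall>\<^sub>F m in sequentially.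
      \<forall>nh. near_multiple p kap ee eps nh \<longrightarrow> (\<forall>\<^sub>F C in at_top. tree_with_total A r p m C (nh 1))"
    "\<forall>\<^sub>F eps in at_right 0. \<forall>\<^sub>F m in sequentially.
      \<forall>nh. near_multiple p kap ee eps nh \<longrightarrow> (\<forall>\<^sub>F C in at_top. tree_with_total B r p m C (nh 1))"
    using eventually_happens'[OF _ eventually_conj[OF eventually_gt_at_top[of 0] eventually_conj[OF kap]]] by auto
  obtain eps where eps: "0 < eps" "\<forall>\<^sub>F m in sequentially.
      \<forall>nh. near_multiple p kap ee eps nh \<longrightarrow> (\<forall>\<^sub>F C in at_top. tree_with_total A r p m C (nh 1))"
    "\<forall>\<^sub>F m in sequentially.
      \<forall>nh. near_multiple p kap ee eps nh \<longrightarrow> (\<forall>\<^sub>F C in at_top. tree_with_total B r p m C (nh 1))"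
    using eventually_happens'[OF _ eventually_conj[OF eventually_at_right_less[of 0] eventually_conj[OF ee(2,3)]]] by auto
  obtain nh where nh: "near_multiple p kap ee eps nh" using near_multiple_exists[OF A.p ee(1) eps(1)] by blast
  obtain m where m: "\<forall>\<^sub>F C in at_top. tree_with_total A r p m C (nh 1)" "\<forall>\<^sub>F C in at_top. tree_with_total B r p m C (nh 1)"
    using eventually_happens'[OF _ eventually_conj[OF eps(2,3)]] nh by auto
  obtain C where C: "tree_with_total A r p m C (nh 1)" "tree_with_total B r p m C (nh 1)"
    using eventually_happens'[OF _ eventually_conj[OF m]] by auto
  obtain P nu Phi where TA: "rich_piece_tree A P nu (r ^ m) (p ^ m) C (zpolys p) Phi" "nu 0 A = nh 1"
    using C(1) unfolding tree_with_total_def by blast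
  obtain P' nu' Phi' where TB: "rich_piece_tree B P' nu' (r ^ m) (p ^ m) C (zpolys p) Phi'" "nu' 0 B = nh 1"
    using C(2) unfolding tree_with_total_def by blast
  interpret PP: piece_tree_pair A B P nu P' nu' "r ^ m" "p ^ m" C "zpolys p" Phi Phi'
    by (intro piece_tree_pair.intro TA(1) TB(1) piece_tree_pair_axioms.intro) (simp add: TA(2) TB(2))
  obtain g L where L: "1 \<le> L" "bij_betw g A B"
    and g: "\<And>x y. x \<in> A \<Longrightarrow> y \<in> A \<Longrightarrow> dist x y \<le> L * dist (g x) (g y) \<and> dist (g x) (g y) \<le> L * dist x y"
    using PP.bilipschitz_bijection by blast
  have "inverse L * dist x y \<le> dist (g x) (g y)" if "x \<in> A" "y \<in> A" for x y
    using g[OF that] L(1) by (simp add: field_simps)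
  then show ?thesis unfolding lipschitz_equivalent_def using L g by blast
qed

subsection \<open>Attractor, ratio root and measure root\<close>

locale contracting_similarities =
  fixes N :: nat and f :: "nat \<Rightarrow> 'a::euclidean_space \<Rightarrow> 'a" and c :: "nat \<Rightarrow> real"
  assumes N_pos: "0 < N" and c: "\<And>i. i < N \<Longrightarrow> 0 < c i \<and> c i < 1"
    and dist_f: "\<And>i x y. i < N \<Longrightarrow> dist (f i x) (f i y) = c i * dist x y"
begin

lemma continuous_f: "i < N \<Longrightarrow> continuous_on A (f i)"
proof -
  assume i: "i < N"
  have "(c i)-lipschitz_on A (f i)" using c[OF i] dist_f[OF i] by (intro lipschitz_onI) auto
  then show ?thesis by (rule lipschitz_on_continuous_on)
qed

lemma inj_f: "i < N \<Longrightarrow> f i x = f i y \<Longrightarrow> x = y"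
  using dist_f[of i x y] c[of i] by simp

definition F :: "'a set \<Rightarrow> 'a set" where "F A = (\<Union>i<N. f i ` A)"

lemma F_mono: "A \<subseteq> B \<Longrightarrow> F A \<subseteq> F B"
  unfolding F_def by blast

text \<open>A point of \<open>A\<close> farthest from \<open>B\<close> is the image under some
  \<open>f i\<close> of a point of \<open>A\<close>, so its distance is at most
  \<open>c i < 1\<close> times the maximal distance, which must then be 0.\<close>

lemma fixed_subset:
  assumes A: "compact A" "A = F A" and B: "compact B" "B \<noteq> {}" "B = F B"
  shows "A \<subseteq> B"
proof (cases "A = {}")
  case False
  have "continuous_on A (\<lambda>x. infdist x B)" by (intro continuous_intros)
  then obtain x where x: "x \<in> A" "\<And>y. y \<in> A \<Longrightarrow> infdist y B \<le> infdist x B"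
    using continuous_attains_sup[OF A(1) False] by blast
  have "x \<in> F A" using x(1) A(2) by simp
  then obtain i y where i: "i < N" "y \<in> A" "x = f i y" unfolding F_def by blast
  obtain z where z: "z \<in> B" "infdist y B = dist y z"
    using infdist_attains_inf[OF compact_imp_closed[OF B(1)] B(2)] by blast
  have "f i z \<in> F B" unfolding F_def using i(1) z(1) by blast
  then have "infdist x B \<le> dist x (f i z)" using B(3) by (intro infdist_le) simp
  also have "\<dots> = c i * infdist y B" using dist_f[OF i(1)] by (simp add: i(3) z(2))
  also have "\<dots> \<le> c i * infdist x B" using x(2)[OF i(2)] c[OF i(1)] by (intro mult_left_mono) auto
  finally have "(1 - c i) * infdist x B \<le> 0" by (simp add: algebra_simps)
  then have "infdist x B \<le> 0" using c[OF i(1)] by (simp add: mult_le_0_iff)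
  show ?thesis
  proof
    fix y assume "y \<in> A"
    then have "infdist y B = 0" using x(2)[of y] \<open>infdist x B \<le> 0\<close> infdist_nonneg[of y B] by linarith
    then show "y \<in> B" using in_closed_iff_infdist_zero[OF compact_imp_closed[OF B(1)] B(2)] by blast
  qed
qed simp

text \<open>The attractor is the intersection of the iterates of a large ball that is mapped into itself.\<close>

lemma fixed_exists: "\<exists>E. E \<noteq> {} \<and> compact E \<and> E = F E"
proof -
  define R where "R = Max ((\<lambda>i. norm (f i 0) / (1 - c i)) ` {..<N})"
  have R: "norm (f i 0) + c i * R \<le> R" if "i < N" for i
  proof -
    have "norm (f i 0) / (1 - c i) \<le> R" unfolding R_def using that by (intro Max_ge) auto
    then show ?thesis using c[OF that] by (simp add: pos_divide_le_eq algebra_simps)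
  qed
  have R0: "0 \<le> R"
  proof -
    have "0 \<le> norm (f 0 0) / (1 - c 0)" using c[OF N_pos] by simp
    also have "\<dots> \<le> R" unfolding R_def using N_pos by (intro Max_ge) auto
    finally show ?thesis .
  qed
  define K where "K n = (F ^^ n) (cball 0 R)" for n
  have K_Suc: "K (Suc n) = F (K n)" for n by (simp add: K_def)
  have "F (cball 0 R) \<subseteq> cball 0 R"
  proof
    fix y assume "y \<in> F (cball 0 R)"
    then obtain i x where i: "i < N" "x \<in> cball 0 R" "y = f i x" unfolding F_def by blast
    have "norm y \<le> norm (f i 0) + dist (f i x) (f i 0)" using norm_triangle_sub[of "f i x" "f i 0"] by (simp add: i(3) dist_norm)
    also have "\<dots> \<le> norm (f i 0) + c i * R" using i(2) c[OF i(1)] dist_f[OF i(1)] by (simp add: mult_left_mono)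
    also have "\<dots> \<le> R" by (rule R[OF i(1)])
    finally show "y \<in> cball 0 R" by simp
  qed
  then have K_step: "K (Suc n) \<subseteq> K n" for n
  proof (induction n)
    case 0 then show ?case by (simp add: K_def)
  next
    case (Suc n) then show ?case using F_mono by (simp only: K_Suc)
  qed
  have K_mono: "m \<le> n \<Longrightarrow> K n \<subseteq> K m" for m n
    using lift_Suc_antimono_le[of K m n] K_step by blast
  have K_compact: "compact (K n)" for n
  proof (induction n)
    case 0 then show ?case by (simp add: K_def)
  next
    case (Suc n) then show ?case unfolding K_Suc F_def
      by (intro compact_UN finite_lessThan compact_continuous_image continuous_f) auto
  qed
  have K_ne: "K n \<noteq> {}" for n
  proof (induction n)
    case 0 then show ?case using R0 by (simp add: K_def)
  next
    case (Suc n) then show ?case unfolding K_Suc F_def using N_pos by blast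
  qed
  define E where "E = \<Inter>(range K)"
  have E_ne: "E \<noteq> {}" unfolding E_def using compact_nest[OF K_compact K_ne K_mono] .
  have "compact E" unfolding E_def using K_compact by (intro compact_Inter) auto
  moreover have "F E \<subseteq> E"
  proof
    fix x assume x: "x \<in> F E"
    have "x \<in> K n" for n
    proof -
      have "F E \<subseteq> F (K n)" by (rule F_mono) (auto simp: E_def)
      then show ?thesis using x K_Suc[of n] K_step[of n] by blast
    qed
    then show "x \<in> E" by (simp add: E_def)
  qed
  moreover have "E \<subseteq> F E"
  proof
    fix x assume x: "x \<in> E"
    \<comment> \<open>Pigeonhole: there are finitely many maps and the sets \<open>K n\<close>
      decrease, so if every map failed at some stage, all would fail at the largest of these
      stages.\<close>
    have "\<exists>i<N. \<forall>n. x \<in> f i ` K n"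
    proof (rule ccontr)
      assume "\<not> ?thesis"
      then have "\<forall>i. \<exists>n. i < N \<longrightarrow> x \<notin> f i ` K n" by blast
      then obtain g where g: "\<And>i. i < N \<Longrightarrow> x \<notin> f i ` K (g i)" by metis
      define n where "n = Max (g ` {..<N})"
      have "x \<in> F (K n)" using x K_Suc[of n] unfolding E_def by blast
      then obtain i where i: "i < N" "x \<in> f i ` K n" unfolding F_def by blast
      have "g i \<le> n" unfolding n_def using i(1) by (intro Max_ge) auto
      then show False using g[OF i(1)] i(2) K_mono by blast
    qed
    then obtain i where i: "i < N" "\<And>n. x \<in> f i ` K n" by blast
    obtain y where y: "y \<in> K 0" "x = f i y" using i(2)[of 0] by blast
    have "y \<in> K n" for n using i(2)[of n] y(2) inj_f[OF i(1)] by blast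
    then show "x \<in> F E" unfolding F_def using i(1) y(2) by (auto simp: E_def)
  qed
  ultimately show ?thesis using E_ne by blast
qed

lemma fixed_unique: "\<exists>!E. E \<noteq> {} \<and> compact E \<and> E = F E"
proof -
  obtain E where E: "E \<noteq> {} \<and> compact E \<and> E = F E" using fixed_exists by blast
  then show ?thesis
  proof (rule ex1I)
    fix A assume A: "A \<noteq> {} \<and> compact A \<and> A = F A"
    show "A = E" using fixed_subset[of A E] fixed_subset[of E A] A E by blast
  qed
qed

end

lemma attractor_fixed:
  assumes S: "is_ifs S"
  shows "attractor S \<noteq> {} \<and> compact (attractor S) \<and> attractor S = (\<Union>i<length S. (S ! i) ` attractor S)"
proof -
  have "\<forall>i. \<exists>c. i < length S \<longrightarrow> 0 < c \<and> c < 1 \<and> similarity_with_ratio c (S ! i)" using S unfolding is_ifs_def by blast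
  then obtain c where c: "\<And>i. i < length S \<Longrightarrow> 0 < c i \<and> c i < 1 \<and> similarity_with_ratio (c i) (S ! i)" by metis
  interpret contracting_similarities "length S" "\<lambda>i. S ! i" c
    using S c by unfold_locales (auto simp: is_ifs_def similarity_with_ratio_def)
  have "\<exists>!E. E \<noteq> {} \<and> compact E \<and> E = (\<Union>i<length S. (S ! i) ` E)" using fixed_unique unfolding F_def .
  from theI'[OF this] show ?thesis unfolding attractor_def[symmetric] .
qed

lemma similarity_ratio_unique:
  fixes g :: "'a::euclidean_space \<Rightarrow> 'a"
  assumes "similarity_with_ratio a g" "similarity_with_ratio b g"
  shows "a = b"
proof -
  obtain e :: 'a where e: "e \<in> Basis" using nonempty_Basis by blast
  have "a * dist 0 e = b * dist 0 e" using assms unfolding similarity_with_ratio_def by metis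
  then show ?thesis using e by (simp add: dist_norm)
qed

text \<open>Taking logarithms makes the two exponent families proportional; as both have greatest
  common divisor 1, they coincide, and then so do the roots.\<close>

lemma ratio_root_unique:
  assumes S: "0 < length S" and r: "is_ratio_root S r" and r': "is_ratio_root S r'"
  shows "r = r'"
proof -
  obtain l where l: "\<And>i. i < length S \<Longrightarrow> 0 < l i \<and> similarity_with_ratio (r ^ l i) (S ! i)" "Gcd (l ` {..<length S}) = 1"
    and r01: "0 < r" "r < 1" using r unfolding is_ratio_root_def by blast
  obtain l' where l': "\<And>i. i < length S \<Longrightarrow> 0 < l' i \<and> similarity_with_ratio (r' ^ l' i) (S ! i)" "Gcd (l' ` {..<length S}) = 1"
    and r01': "0 < r'" "r' < 1" using r' unfolding is_ratio_root_def by blast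
  have eq: "r ^ l i = r' ^ l' i" if "i < length S" for i using l(1) l'(1) that similarity_ratio_unique by blast
  have ln: "real (l i) * ln r = real (l' i) * ln r'" if "i < length S" for i
    using arg_cong[OF eq[OF that], of ln] r01 r01' by (simp add: ln_realpow)
  have "l' 0 * l i = l 0 * l' i" if i: "i < length S" for i
  proof -
    have "(real (l' 0) * real (l i)) * (ln r * ln r') = (real (l i) * ln r) * (real (l' 0) * ln r')" by simp
    also have "\<dots> = (real (l 0) * real (l' i)) * (ln r * ln r')"
      unfolding ln[OF i] ln[OF S, symmetric] by simp
    finally have "real (l' 0) * real (l i) = real (l 0) * real (l' i)" using r01 r01' by simp
    then show ?thesis by (simp only: of_nat_mult[symmetric] of_nat_eq_iff)
  qed
  then have "(*) (l' 0) ` l ` {..<length S} = (*) (l 0) ` l' ` {..<length S}" unfolding image_image by (intro image_cong) auto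
  then have "l' 0 = l 0" using Gcd_mult[of "l' 0" "l ` {..<length S}"] Gcd_mult[of "l 0" "l' ` {..<length S}"] l(2) l'(2) by simp
  then show ?thesis using eq[OF S] l(1)[OF S] r01 r01' by (intro power_eq_imp_eq_base[of r "l 0" r']) auto
qed

lemma moran_root_exists:
  fixes l :: "nat \<Rightarrow> nat"
  assumes N: "2 \<le> N" and l: "\<And>i. i < N \<Longrightarrow> 0 < l i"
  shows "\<exists>x::real. 0 < x \<and> x < 1 \<and> (\<Sum>i<N. x ^ l i) = 1"
proof -
  have "(\<Sum>i<N. (0::real) ^ l i) = 0" using l by (intro sum.neutral) auto
  moreover have "(\<Sum>i<N. (1::real) ^ l i) = N" by simp
  moreover have "\<exists>x\<ge>0. x \<le> 1 \<and> (\<Sum>i<N. x ^ l i) = (1::real)"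
    by (rule IVT') (use calculation N in \<open>auto intro!: continuous_intros\<close>)
  then obtain x :: real where x: "0 \<le> x" "x \<le> 1" "(\<Sum>i<N. x ^ l i) = 1" by blast
  moreover have "x \<noteq> 0" "x \<noteq> 1" using x(3) calculation(1,2) N by auto
  ultimately show ?thesis by (intro exI[of _ x]) auto
qed

subsection \<open>The ring generated by the measure root\<close>

lemma ring_of_type_algebra_ops [simp]:
  "carrier (ring_of_type_algebra :: real ring) = UNIV"
  "x \<otimes>\<^bsub>ring_of_type_algebra\<^esub> y = x * (y::real)" "\<one>\<^bsub>ring_of_type_algebra\<^esub> = (1::real)"
  "\<zero>\<^bsub>ring_of_type_algebra\<^esub> = (0::real)" "x \<oplus>\<^bsub>ring_of_type_algebra\<^esub> y = x + (y::real)"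
  by (simp_all add: ring_of_type_algebra_def)

lemma ring_of_type_algebra_minus [simp]: "\<ominus>\<^bsub>ring_of_type_algebra\<^esub> x = - (x::real)"
proof -
  interpret ring "ring_of_type_algebra :: real ring" by (rule ring_from_type_algebra)
  show ?thesis by (rule minus_equality) simp_all
qed

lemma generate_ring_eq_zpolys: "generate_ring ring_of_type_algebra {p} = zpolys p"
proof (intro equalityI subsetI)
  fix x assume "x \<in> generate_ring ring_of_type_algebra {p}"
  then show "x \<in> zpolys p"
    by induction (auto intro: zpolys_1 zpolys_p zpolys_minus zpolys_add zpolys_mult)
next
  let ?H = "generate_ring ring_of_type_algebra {p}"
  have one: "1 \<in> ?H" and p: "p \<in> ?H" using generate_ring.one[of ring_of_type_algebra "{p}"] generate_ring.incl[of p "{p}"] by auto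
  have minus: "- x \<in> ?H" if "x \<in> ?H" for x using generate_ring.a_inv[OF that] by simp
  have add: "x + y \<in> ?H" if "x \<in> ?H" "y \<in> ?H" for x y using generate_ring.eng_add[OF that] by simp
  have mult: "x * y \<in> ?H" if "x \<in> ?H" "y \<in> ?H" for x y using generate_ring.eng_mult[OF that] by simp
  have zero: "0 \<in> ?H" using add[OF one minus[OF one]] by simp
  have nat: "real n \<in> ?H" for n by (induction n) (use zero one add in auto)
  have int: "of_int a \<in> ?H" for a :: int
    using nat[of "nat a"] minus[OF nat[of "nat (- a)"]] by (cases "0 \<le> a") auto
  have pow: "p ^ n \<in> ?H" for n by (induction n) (use one p mult in auto)
  have "(\<Sum>i<d. of_int (q i) * p ^ i) \<in> ?H" for q :: "nat \<Rightarrow> int" and d :: nat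
    by (induction d) (use zero add mult[OF int pow] in auto)
  then show "x \<in> ?H" if "x \<in> zpolys p" for x using that unfolding zpolys_def by blast
qed

lemma zpolys_ideal_principal:
  assumes pd: "principal_domain (Z_adjoin p)"
    and J: "J \<subseteq> zpolys p" "0 \<in> J" "\<And>x y. x \<in> J \<Longrightarrow> y \<in> J \<Longrightarrow> x + y \<in> J" "\<And>x. x \<in> J \<Longrightarrow> - x \<in> J"
      "\<And>z x. z \<in> zpolys p \<Longrightarrow> x \<in> J \<Longrightarrow> z * x \<in> J"
  shows "\<exists>g\<in>J. \<forall>x\<in>J. \<exists>z\<in>zpolys p. x = z * g"
proof -
  interpret Z: principal_domain "Z_adjoin p" by (rule pd)
  have ops [simp]: "carrier (Z_adjoin p) = zpolys p" "x \<otimes>\<^bsub>Z_adjoin p\<^esub> y = x * y" "\<one>\<^bsub>Z_adjoin p\<^esub> = 1"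
    "\<zero>\<^bsub>Z_adjoin p\<^esub> = 0" "x \<oplus>\<^bsub>Z_adjoin p\<^esub> y = x + y" for x y
    by (simp_all add: Z_adjoin_def generate_ring_eq_zpolys)
  have inv: "inv\<^bsub>add_monoid (Z_adjoin p)\<^esub> x = - x" if "x \<in> J" for x
    using Z.minus_equality[of "- x" x] that J(1,4) unfolding a_inv_def by auto
  have "subgroup J (add_monoid (Z_adjoin p))"
    by (rule group.subgroupI[OF Z.a_group]) (use J inv in auto)
  moreover have "x * z \<in> J" if "x \<in> J" "z \<in> zpolys p" for x z
    using J(5)[OF that(2,1)] by (subst mult.commute)
  ultimately have "ideal J (Z_adjoin p)"
    using J(5) by (intro idealI Z.ring_axioms) simp_all
  then obtain g where g: "g \<in> zpolys p" "J = PIdl\<^bsub>Z_adjoin p\<^esub> g" using Z.exists_gen by auto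
  then have "J = {x * g | x. x \<in> zpolys p}" by (simp add: cgenideal_def)
  moreover from this have "g \<in> J" using zpolys_1 by force
  ultimately show ?thesis by blast
qed

lemma TDC_OSC1_roots_attractor:
  fixes S :: "('a::euclidean_space \<Rightarrow> 'a) list"
  assumes S: "S \<in> TDC_OSC1_roots p r" and pd: "principal_domain (Z_adjoin p)"
  shows "\<exists>N l f V. pid_attractor N l p f r (attractor S) V"
proof -
  have ifs: "is_ifs S" and osc: "open_set_condition S" and tdc: "totally_disconnected (attractor S)"
    and com: "commensurable_ratios S" and mr: "measure_root S = p" and rr: "ratio_root S = r"
    using S by (auto simp: TDC_OSC1_roots_def TDC_OSC1_def)
  have len: "2 \<le> length S" using ifs by (simp add: is_ifs_def)
  obtain r0 where r0: "is_ratio_root S r0" using com by (auto simp: commensurable_ratios_def)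
  have "is_ratio_root S r" unfolding rr[symmetric] ratio_root_def
    by (rule theI[of "is_ratio_root S", OF r0]) (rule ratio_root_unique[OF _ _ r0], use len in auto)
  then obtain l where l: "\<And>i. i < length S \<Longrightarrow> 0 < l i \<and> similarity_with_ratio (r ^ l i) (S ! i)"
    "Gcd (l ` {..<length S}) = 1" and r: "0 < r" "r < 1" unfolding is_ratio_root_def by blast
  obtain V where V: "V \<noteq> {}" "bounded V" "open V" and V': "\<forall>i<length S. (S ! i) ` V \<subseteq> V"
    "\<forall>i<length S. \<forall>j<length S. i \<noteq> j \<longrightarrow> (S ! i) ` V \<inter> (S ! j) ` V = {}"
    using osc unfolding open_set_condition_def by (elim exE conjE)
  note V'' = V'[rule_format]
  have l_pos: "0 < l i" if "i < length S" for i using l(1)[OF that] ..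
  obtain x :: real where x: "0 < x" "x < 1" "(\<Sum>i<length S. x ^ l i) = 1" using moran_root_exists[OF len, of l, OF l_pos] by blast
  have sim: "dist ((S ! i) y) ((S ! i) z) = r ^ l i * dist y z" if "i < length S" for i y z
    using l(1)[OF that] by (simp add: similarity_with_ratio_def)
  have att: "attractor S \<noteq> {}" "compact (attractor S)" "attractor S = (\<Union>i<length S. (S ! i) ` attractor S)"
    using attractor_fixed[OF ifs] by blast+
  \<comment> \<open>The attractor is first treated with the Moran root \<open>x\<close> in the place
    of \<open>p\<close>; its Hausdorff dimension then shows that \<open>x\<close> is the measure
    root \<open>p\<close>.\<close>
  interpret A: ifs_attractor "length S" l x "\<lambda>i. S ! i" r "attractor S" V
    by unfold_locales (fact len l_pos l(2) x r V att V'' sim)+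
  have xp: "x = p" using A.r_powr_hausdorff_dim mr rr by (simp add: measure_root_def)
  interpret T: tdc_attractor "length S" l p "\<lambda>i. S ! i" r "attractor S" V
    using A.ifs_attractor_axioms tdc unfolding xp by (intro tdc_attractor.intro tdc_attractor_axioms.intro)
  have "pid_attractor (length S) l p (\<lambda>i. S ! i) r (attractor S) V"
    by unfold_locales (rule zpolys_ideal_principal[OF pd])
  then show ?thesis by (intro exI)
qed

theorem theorem1p4:
  fixes p r :: real
    and S :: "('a::euclidean_space \<Rightarrow> 'a) list"
    and T :: "('b::euclidean_space \<Rightarrow> 'b) list"
  assumes "0 < p" and "p < 1" and "0 < r" and "r < 1"
    and "S \<in> TDC_OSC1_roots p r" and "T \<in> TDC_OSC1_roots p r"
    and "principal_domain (Z_adjoin p)"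
  shows "lipschitz_equivalent (attractor S) (attractor T)"
proof -
  obtain N l f V where A: "pid_attractor N l p f r (attractor S) V"
    using TDC_OSC1_roots_attractor[OF assms(5,7)] by (elim exE) (rule that)
  obtain N' l' f' V' where B: "pid_attractor N' l' p f' r (attractor T) V'"
    using TDC_OSC1_roots_attractor[OF assms(6,7)] by (elim exE) (rule that)
  show ?thesis by (rule pid_attractors_lipschitz_equivalent[OF A B])
qed

end
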